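(* Let $k$ be an algebraically closed field of arbitrary characteristic, $R=k[[X_1,\ldots,X_n]]$ with maximal ideal $\mathfrak m$, and let $f\in\mathfrak m$ be such that $\tau(f)<\infty$. The following three statements are equivalent: (i) $\mu(uf)=\widetilde\mu(f)$ for every unit $u\in R$; (ii) $Z(\mathcal N_{T(f)})=Z(Y_0)$; (iii) $f^{\ell}\in\mathfrak m\,T(f)^{\ell}$ for some integer $\ell\geqslant 1$.
   Context: For $h\in R$, $J(h)=\langle h_{X_1},\ldots,h_{X_n}\rangle$ is the ideal generated by the partial derivatives of $h$, $T(h)=\langle h\rangle+J(h)$ is the Tjurina ideal, $\mu(h)=\dim_k R/J(h)\in\mathbb N\cup\{\infty\}$ is the Milnor number, and $\tau(h)=\dim_k R/T(h)$ is the Tjurina number. For $f\in\mathfrak m$ with $\tau(f)<\infty$, $\widetilde\mu(f)=e_0(T(f))$, where $e_0(I)$ denotes the Hilbert–Samuel multiplicity of an $\mathfrak m$-primary ideal $I$; when $f\in\mathfrak m\setminus\mathfrak m^2$ (so that $T(f)=R$), one takes $\widetilde\mu(f)=0$. Null-forms: a homogeneous polynomial $\varphi\in k[Y_0,\ldots,Y_n]$ of some degree $s$ is a null-form for $T(f)$ (with respect to the generators $f,f_{X_1},\ldots,f_{X_n}$) if there exists $F\in R[Y_0,\ldots,Y_n]$ homogeneous of degree $s$ with $F\equiv\varphi\bmod\mathfrak m$ and $F(f,f_{X_1},\ldots,f_{X_n})\in\mathfrak m\,T(f)^s$. $\mathcal N_{T(f)}$ is the homogeneous ideal of $k[Y_0,\ldots,Y_n]$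 generated by all null-forms of $T(f)$. For a homogeneous ideal or a homogeneous polynomial $N$ in $k[Y_0,\ldots,Y_n]$, $Z(N)\subset\mathbb P^n_k$ is its projective zero set.
   Formalization: The implication from (iii) (hence from (i)) to (ii) is claimed only if f lies in m² or n = 1; for f in m \ m² and n ≥ 2 (e.g. f = X_1) (i) and (iii) hold but (ii) always fails, since Z(N_{T(f)}) is a single point. All other implications are unrestricted. *)

theory Defs
  imports
    "HOL-Library.Cardinality"
    "HOL-Library.Poly_Mapping"
    "HOL-Library.Extended_Real"
    "HOL-Computational_Algebra.Polynomial"
begin

section \<open>Formal power series in several variables\<close>

text \<open>
  \<open>('a, 'n) mfps\<close> is the ring of formal power series with coefficients in \<open>'a\<close> in the
  variables indexed by \<open>'n\<close>; for finite \<open>'n\<close> with \<open>CARD('n) = n\<close> this is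
  \<open>k[[X_1, ..., X_n]]\<close>. Exponents are of type \<open>'n \<Rightarrow>\<^sub>0 nat\<close>.
\<close>

typedef ('a, 'n) mfps = "UNIV :: (('n \<Rightarrow>\<^sub>0 nat) \<Rightarrow> 'a) set"
  morphisms mfps_nth Abs_mfps ..

lemma mfps_nth_Abs [simp]: "mfps_nth (Abs_mfps f) = f"
  by (simp add: Abs_mfps_inverse)

lemma mfps_eqI: "(\<And>a. mfps_nth f a = mfps_nth g a) \<Longrightarrow> f = g"
  by (metis ext mfps_nth_inject)

lemma finite_exponent_splits: "finite {(b, c :: 'n \<Rightarrow>\<^sub>0 nat). b + c = a}"
proof -
  let ?K = "Poly_Mapping.keys a"
  let ?N = "Max (insert 0 (Poly_Mapping.lookup a ` ?K))"
  let ?S = "{h. \<forall>i. (i \<in> ?K \<longrightarrow> h i \<in> {..?N}) \<and> (i \<notin> ?K \<longrightarrow> h i = (0::nat))}"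
  let ?B = "{b :: 'n \<Rightarrow>\<^sub>0 nat. \<forall>i. Poly_Mapping.lookup b i \<le> Poly_Mapping.lookup a i}"
  have "Poly_Mapping.lookup b \<in> ?S" if "b \<in> ?B" for b
  proof -
    have le: "Poly_Mapping.lookup b i \<le> Poly_Mapping.lookup a i" for i
      using that by simp
    have "Poly_Mapping.lookup b i \<le> ?N" if "i \<in> ?K" for i
      using that by (intro order.trans[OF le] Max_ge) auto
    moreover have "Poly_Mapping.lookup b i = 0" if "i \<notin> ?K" for i
      using le[of i] that by (simp add: in_keys_iff)
    ultimately show ?thesis by simp
  qed
  then have "Poly_Mapping.lookup ` ?B \<subseteq> ?S"
    by (rule image_subsetI)
  moreover have "finite ?S"
    by (rule finite_set_of_finite_funs) auto
  ultimately have "finite (Poly_Mapping.lookup ` ?B)"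
    by (rule finite_subset)
  then have "finite ?B"
    by (rule finite_imageD) (simp add: inj_on_def)
  moreover have "{(b, c). b + c = a} \<subseteq> ?B \<times> ?B"
    by (auto simp: lookup_add)
  ultimately show ?thesis
    using finite_subset[OF _ finite_cartesian_product[of ?B ?B]] by simp
qed

instantiation mfps :: (comm_ring_1, type) comm_ring_1
begin

definition zero_mfps :: "('a, 'b) mfps" where
  "zero_mfps = Abs_mfps (\<lambda>_. 0)"

definition one_mfps :: "('a, 'b) mfps" where
  "one_mfps = Abs_mfps (\<lambda>a. if a = 0 then 1 else 0)"

definition plus_mfps :: "('a, 'b) mfps \<Rightarrow> ('a, 'b) mfps \<Rightarrow> ('a, 'b) mfps" where
  "f + g = Abs_mfps (\<lambda>a. mfps_nth f a + mfps_nth g a)"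

definition uminus_mfps :: "('a, 'b) mfps \<Rightarrow> ('a, 'b) mfps" where
  "- f = Abs_mfps (\<lambda>a. - mfps_nth f a)"

definition minus_mfps :: "('a, 'b) mfps \<Rightarrow> ('a, 'b) mfps \<Rightarrow> ('a, 'b) mfps" where
  "f - g = Abs_mfps (\<lambda>a. mfps_nth f a - mfps_nth g a)"

definition times_mfps :: "('a, 'b) mfps \<Rightarrow> ('a, 'b) mfps \<Rightarrow> ('a, 'b) mfps" where
  "f * g = Abs_mfps (\<lambda>a. \<Sum>(b, c)\<in>{(b, c). b + c = a}. mfps_nth f b * mfps_nth g c)"

instance
proof
  fix f g h :: "('a, 'b) mfps"
  show "f + g + h = f + (g + h)" "f + g = g + f" "0 + f = f" "- f + f = 0" "f - g = f + - g"
    by (simp_all add: zero_mfps_def plus_mfps_def uminus_mfps_def minus_mfps_def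
        algebra_simps mfps_eqI)
  show "f * g = g * f"
    unfolding times_mfps_def
    by (intro arg_cong[where f = Abs_mfps] ext
        sum.reindex_bij_witness[of _ prod.swap prod.swap]) (auto simp: ac_simps)
  show "(f + g) * h = f * h + g * h"
    by (rule mfps_eqI)
      (simp add: times_mfps_def plus_mfps_def algebra_simps sum.distrib case_prod_unfold)
  show "(0 :: ('a, 'b) mfps) \<noteq> 1"
  proof
    assume "(0 :: ('a, 'b) mfps) = 1"
    then have "mfps_nth (0 :: ('a, 'b) mfps) 0 = mfps_nth 1 0" by simp
    then show False by (simp add: zero_mfps_def one_mfps_def)
  qed
  show "1 * f = f"
  proof (rule mfps_eqI)
    fix a
    have "mfps_nth (1 * f) a =
        (\<Sum>(b, c)\<in>{(b, c). b + c = a}. (if b = 0 then 1 else 0) * mfps_nth f c)"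
      by (simp add: times_mfps_def one_mfps_def)
    also have "\<dots> = (\<Sum>(b, c)\<in>{(0 :: 'b \<Rightarrow>\<^sub>0 nat, a)}. (if b = 0 then 1 else 0) * mfps_nth f c)"
      by (rule sum.mono_neutral_right) (auto simp: finite_exponent_splits split: if_splits)
    finally show "mfps_nth (1 * f) a = mfps_nth f a" by simp
  qed
  show "f * g * h = f * (g * h)"
  proof (rule mfps_eqI)
    fix a
    let ?D = "\<lambda>a. {(b, c :: 'b \<Rightarrow>\<^sub>0 nat). b + c = a}"
    let ?f = "mfps_nth f" and ?g = "mfps_nth g" and ?h = "mfps_nth h"
    have "mfps_nth (f * g * h) a = (\<Sum>p\<in>?D a. \<Sum>q\<in>?D (fst p). ?f (fst q) * ?g (snd q) * ?h (snd p))"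
      by (simp add: times_mfps_def case_prod_unfold sum_distrib_right)
    also have "\<dots> = (\<Sum>(p, q)\<in>(SIGMA p:?D a. ?D (fst p)). ?f (fst q) * ?g (snd q) * ?h (snd p))"
      by (rule sum.Sigma) (auto simp: finite_exponent_splits)
    also have "\<dots> = (\<Sum>(p, q)\<in>(SIGMA p:?D a. ?D (snd p)). ?f (fst p) * (?g (fst q) * ?h (snd q)))"
      by (rule sum.reindex_bij_witness[of _
            "\<lambda>(p, q). ((fst p + fst q, snd q), (fst p, fst q))"
            "\<lambda>(p, q). ((fst q, snd q + snd p), (snd q, snd p))"]) (auto simp: ac_simps)
    also have "\<dots> = (\<Sum>p\<in>?D a. \<Sum>q\<in>?D (snd p). ?f (fst p) * (?g (fst q) * ?h (snd q)))"
      by (rule sum.Sigma[symmetric]) (auto simp: finite_exponent_splits)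
    also have "\<dots> = mfps_nth (f * (g * h)) a"
      by (simp add: times_mfps_def case_prod_unfold sum_distrib_left)
    finally show "mfps_nth (f * g * h) a = mfps_nth (f * (g * h)) a" .
  qed
qed

end

definition mfps_const :: "'a \<Rightarrow> ('a::zero, 'n) mfps" where
  "mfps_const c = Abs_mfps (\<lambda>a. if a = 0 then c else 0)"

definition mfps_deriv :: "'n \<Rightarrow> ('a::comm_ring_1, 'n) mfps \<Rightarrow> ('a, 'n) mfps" where
  "mfps_deriv i h = Abs_mfps (\<lambda>a. of_nat (Poly_Mapping.lookup a i + 1) *
     mfps_nth h (a + Poly_Mapping.single i 1))"

definition max_ideal :: "('a::comm_ring_1, 'n) mfps set" where
  "max_ideal = {h. mfps_nth h 0 = 0}"


section \<open>Ideals\<close>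

text \<open>A commutative ring as a module over itself: its submodules are the ideals.\<close>

lemma module_ring: "module ((*) :: 'a::comm_ring_1 \<Rightarrow> 'a \<Rightarrow> 'a)"
  by unfold_locales (simp_all add: algebra_simps)

definition is_ideal :: "'a::comm_ring_1 set \<Rightarrow> bool" where
  "is_ideal I \<longleftrightarrow> module.subspace (*) I"

definition ideal_gen :: "'a::comm_ring_1 set \<Rightarrow> 'a set" where
  "ideal_gen S = module.span (*) S"

definition ideal_mult :: "'a::comm_ring_1 set \<Rightarrow> 'a set \<Rightarrow> 'a set" where
  "ideal_mult I J = ideal_gen {x * y |x y. x \<in> I \<and> y \<in> J}"

primrec ideal_pow :: "'a::comm_ring_1 set \<Rightarrow> nat \<Rightarrow> 'a set" where
  "ideal_pow I 0 = UNIV"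
| "ideal_pow I (Suc s) = ideal_mult I (ideal_pow I s)"

text \<open>
  The length of the \<open>R\<close>-module \<open>R/I\<close>. Submodules of \<open>R/I\<close> are the \<open>K/I\<close> for ideals
  \<open>K \<supseteq> I\<close>, so this is the supremum of the lengths \<open>m\<close> of chains
  \<open>K 0 \<subset> ... \<subset> K m\<close> of such ideals.
\<close>

definition quot_length :: "'a::comm_ring_1 set \<Rightarrow> enat" where
  "quot_length I = (SUP m \<in> {m. \<exists>K :: nat \<Rightarrow> 'a set.
     (\<forall>j\<le>m. is_ideal (K j) \<and> I \<subseteq> K j) \<and> (\<forall>j<m. K j \<subset> K (Suc j))}. enat m)"

text \<open>
  \<open>quot_basis W B\<close>: the residue classes of the elements of the finite set \<open>B\<close> are pairwise
  distinct and form a \<open>k\<close>-basis of \<open>R/W\<close>.  Then \<open>quot_dim W\<close> is \<open>dim\<^sub>k R/W\<close>; all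
  finite bases have the same cardinality, and the infimum is \<open>\<infinity>\<close> if there is none.
\<close>

definition quot_basis :: "('a::field, 'n) mfps set \<Rightarrow> ('a, 'n) mfps set \<Rightarrow> bool" where
  "quot_basis W B \<longleftrightarrow> finite B \<and>
     (\<forall>c. (\<Sum>b\<in>B. mfps_const (c b) * b) \<in> W \<longrightarrow> (\<forall>b\<in>B. c b = 0)) \<and>
     (\<forall>h. \<exists>c. h - (\<Sum>b\<in>B. mfps_const (c b) * b) \<in> W)"

definition quot_dim :: "('a::field, 'n) mfps set \<Rightarrow> enat" where
  "quot_dim W = (INF B \<in> {B. quot_basis W B}. enat (card B))"

text \<open>
  The Hilbert--Samuel multiplicity, \<open>lim n! \<cdot> length (R/I^s) / s^n\<close> for \<open>s \<rightarrow> \<infinity>\<close>, where \<open>n\<close>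
  is the Krull dimension of \<open>R\<close>. It is only meaningful for \<open>\<mm>\<close>-primary \<open>I\<close>, where all the
  lengths are finite.
\<close>

definition hs_multiplicity :: "('a::field, 'n::finite) mfps set \<Rightarrow> real" where
  "hs_multiplicity I =
     lim (\<lambda>s. fact CARD('n) * real (the_enat (quot_length (ideal_pow I s))) / real s ^ CARD('n))"


section \<open>Milnor and Tjurina numbers\<close>

definition jacobian_ideal :: "('a::comm_ring_1, 'n) mfps \<Rightarrow> ('a, 'n) mfps set" where
  "jacobian_ideal h = ideal_gen (range (\<lambda>i. mfps_deriv i h))"

definition tjurina_ideal :: "('a::comm_ring_1, 'n) mfps \<Rightarrow> ('a, 'n) mfps set" where
  "tjurina_ideal h = {x + y |x y. x \<in> ideal_gen {h} \<and> y \<in> jacobian_ideal h}"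

definition milnor_number :: "('a::field, 'n) mfps \<Rightarrow> enat" where
  "milnor_number h = quot_dim (jacobian_ideal h)"

definition tjurina_number :: "('a::field, 'n) mfps \<Rightarrow> enat" where
  "tjurina_number h = quot_dim (tjurina_ideal h)"

definition milnor_tilde :: "('a::field, 'n::finite) mfps \<Rightarrow> real" where
  "milnor_tilde f =
     (if f \<in> max_ideal - ideal_pow max_ideal 2 then 0 else hs_multiplicity (tjurina_ideal f))"


section \<open>Polynomials, null-forms and projective zero sets\<close>

text \<open>
  Polynomials over \<open>'b\<close> in the variables indexed by \<open>'i\<close> are of type
  \<open>('i \<Rightarrow>\<^sub>0 nat) \<Rightarrow>\<^sub>0 'b\<close>. The \<open>n + 1\<close> variables \<open>Y_0, ..., Y_n\<close> are indexed by \<open>'n option\<close>: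
  \<open>None\<close> stands for \<open>0\<close>.
\<close>

definition poly_eval :: "(('i::finite \<Rightarrow>\<^sub>0 nat) \<Rightarrow>\<^sub>0 'b::comm_ring_1) \<Rightarrow> ('i \<Rightarrow> 'b) \<Rightarrow> 'b" where
  "poly_eval F v = (\<Sum>a\<in>Poly_Mapping.keys F.
     Poly_Mapping.lookup F a * (\<Prod>i\<in>UNIV. v i ^ Poly_Mapping.lookup a i))"

definition homogeneous :: "nat \<Rightarrow> (('i::finite \<Rightarrow>\<^sub>0 nat) \<Rightarrow>\<^sub>0 'b::zero) \<Rightarrow> bool" where
  "homogeneous s F \<longleftrightarrow> (\<forall>a\<in>Poly_Mapping.keys F. (\<Sum>i\<in>UNIV. Poly_Mapping.lookup a i) = s)"

definition tjurina_gens :: "('a::comm_ring_1, 'n) mfps \<Rightarrow> 'n option \<Rightarrow> ('a, 'n) mfps" where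
  "tjurina_gens f j = (case j of None \<Rightarrow> f | Some i \<Rightarrow> mfps_deriv i f)"

definition null_form ::
  "('a::field, 'n::finite) mfps \<Rightarrow> nat \<Rightarrow> (('n option \<Rightarrow>\<^sub>0 nat) \<Rightarrow>\<^sub>0 'a) \<Rightarrow> bool" where
  "null_form f s \<phi> \<longleftrightarrow> homogeneous s \<phi> \<and>
     (\<exists>F :: ('n option \<Rightarrow>\<^sub>0 nat) \<Rightarrow>\<^sub>0 ('a, 'n) mfps.
        homogeneous s F \<and>
        (\<forall>a. Poly_Mapping.lookup F a - mfps_const (Poly_Mapping.lookup \<phi> a) \<in> max_ideal) \<and>
        poly_eval F (tjurina_gens f) \<in> ideal_mult max_ideal (ideal_pow (tjurina_ideal f) s))"

definition null_ideal ::
  "('a::field, 'n::finite) mfps \<Rightarrow> (('n option \<Rightarrow>\<^sub>0 nat) \<Rightarrow>\<^sub>0 'a) set" where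
  "null_ideal f = ideal_gen {\<phi>. \<exists>s. null_form f s \<phi>}"

definition proj_rel :: "(('i \<Rightarrow> 'a::field) \<times> ('i \<Rightarrow> 'a)) set" where
  "proj_rel = {(v, w). v \<noteq> (\<lambda>_. 0) \<and> (\<exists>c. c \<noteq> 0 \<and> w = (\<lambda>i. c * v i))}"

definition proj_space :: "('i \<Rightarrow> 'a::field) set set" where
  "proj_space = {v. v \<noteq> (\<lambda>_. 0)} // proj_rel"

text \<open>
  For a set \<open>N\<close> of polynomials that is a homogeneous ideal or consists of homogeneous
  polynomials, vanishing does not depend on the representative \<open>v\<close> of the point \<open>p\<close>.
\<close>

definition zero_set :: "(('i::finite \<Rightarrow>\<^sub>0 nat) \<Rightarrow>\<^sub>0 'a::field) set \<Rightarrow> ('i \<Rightarrow> 'a) set set" where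
  "zero_set N = {p \<in> proj_space. \<forall>\<phi>\<in>N. \<forall>v\<in>p. poly_eval \<phi> v = 0}"

definition Y0 :: "('n option \<Rightarrow>\<^sub>0 nat) \<Rightarrow>\<^sub>0 'a::field" where
  "Y0 = Poly_Mapping.single (Poly_Mapping.single None 1) 1"

end

theory Submission
  imports Defs
begin

text \<open>
  Write \<open>T = T(f)\<close> and \<open>\<mm>\<close> for the maximal ideal. If \<open>f \<notin> \<mm>\<^sup>2\<close>, then \<open>T = R\<close> and (i), (iii) are immediate.
  Let \<open>f \<in> \<mm>\<^sup>2\<close>. For a unit \<open>u\<close>, the ideal \<open>T\<close> is generated by \<open>f\<close> and the \<open>n\<close> generators \<open>g\<^sub>i\<close> of \<open>J = J(uf)\<close>.
  When \<open>J\<close> is \<open>\<mm>\<close>-primary, the \<open>g\<^sub>i\<close> are quasi-regular (the Koszul complex is acyclic because the powers of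
  the variables form a regular sequence in \<open>J\<close>), so \<open>R/J\<^sup>s\<close> has length \<open>\<mu>(uf)\<close> times the binomial
  coefficient \<open>n + s - 1\<close> over \<open>n\<close>.

  (iii) implies (i): \<open>f\<^sup>l \<in> \<mm> T\<^sup>l\<close> makes every \<open>J(uf)\<close> a reduction of \<open>T\<close> by Nakayama, and comparing the
  lengths of \<open>R/J\<^sup>s\<close> and \<open>R/T\<^sup>s\<close> gives \<open>\<mu>(uf) = e\<^sub>0(T)\<close>.

  (i) implies (iii): some \<open>u = 1 + c\<^sub>1 X\<^sub>1 + \<dots> + c\<^sub>n X\<^sub>n\<close> always yields a reduction, so the limit defining
  \<open>e\<^sub>0(T)\<close> exists. If \<open>f\<close> is not nilpotent in the fiber cone of \<open>T\<close>, the Nullstellensatz gives a common zero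
  \<open>(1, -c)\<close> of all null-forms; for the unit \<open>u\<close> belonging to \<open>c\<close>, the ideal \<open>J(uf)\<close> is not a reduction of \<open>T\<close>.
  Then \<open>\<mu>(uf) > e\<^sub>0(T)\<close>: otherwise the monomials \<open>f\<^sup>j g\<^sup>a\<close> with \<open>j \<ge> 1\<close>, \<open>j + |a| = s\<close> are dependent modulo \<open>J\<^sup>s\<close>
  for some \<open>s\<close>, the top coefficient of a dependency can be cancelled because it is a nonzero form in the
  quasi-regular sequence, and this gives \<open>T\<^sup>s\<^sup>+\<^sup>c \<subseteq> J\<^sup>s\<close> for all \<open>s\<close>. By Hilbert's basis theorem \<open>f\<close> is then integral
  over \<open>J\<close>, a contradiction.

  For (ii), the inclusion \<open>Z(\<N>) \<subseteq> Z(Y\<^sub>0)\<close> is equivalent to (iii) by the Nullstellensatz, and if \<open>J(f)\<close> is a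
  reduction of \<open>T \<subseteq> \<mm>\<close>, no nonzero form in \<open>f\<^sub>X\<^sub>1, \<dots>, f\<^sub>X\<^sub>n\<close> is a null-form modulo \<open>Y\<^sub>0\<close>, again by quasi-regularity.
\<close>

subsection \<open>Ideals\<close>

text \<open>Only the first-order part of \<open>u\<close> matters: modulo m T the i-th derivative of
  u f is u(0) times that of f plus the i-th partial of u at the origin times f. Hence linear units
  represent all choices, and asking whether J(uf) is a reduction of T becomes a question about one
  point of the affine chart Y_0 = 1. No multiplicity theory is presupposed. Lengths are k-dimensions
  because the residue field is k itself; e_0 is obtained by squeezing powers of T between powers of
  an ideal with n generators; a strict drop of multiplicity is exhibited by an explicit independent
  family. The main obstacle is the passage from such asymptotic information to an integral equation
  for f: the Rees algebra of J is not finitely generated over k, so Hilbert's theorem has to act on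
  a finitely generated polynomial model inside it. The characteristic is harmless because
  derivatives enter only through the Leibniz rule, never through Euler or Taylor formulas.\<close>

lemma is_ideal_iff:
  "is_ideal I \<longleftrightarrow> 0 \<in> I \<and> (\<forall>x\<in>I. \<forall>y\<in>I. x + y \<in> I) \<and> (\<forall>c. \<forall>x\<in>I. c * x \<in> I)"
  unfolding is_ideal_def by (rule module.subspace_def[OF module_ring])

lemma is_idealI:
  "0 \<in> I \<Longrightarrow> (\<And>x y. x \<in> I \<Longrightarrow> y \<in> I \<Longrightarrow> x + y \<in> I) \<Longrightarrow> (\<And>c x. x \<in> I \<Longrightarrow> c * x \<in> I) \<Longrightarrow> is_ideal I"
  by (simp add: is_ideal_iff)

lemma ideal_zero: "is_ideal I \<Longrightarrow> 0 \<in> I"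
  and ideal_add: "is_ideal I \<Longrightarrow> x \<in> I \<Longrightarrow> y \<in> I \<Longrightarrow> x + y \<in> I"
  and ideal_mult_l: "is_ideal I \<Longrightarrow> x \<in> I \<Longrightarrow> c * x \<in> I"
  by (auto simp: is_ideal_iff)

lemma ideal_mult_r: "is_ideal I \<Longrightarrow> x \<in> I \<Longrightarrow> x * c \<in> I"
  using ideal_mult_l[of I x c] by (simp add: mult.commute)

lemma ideal_uminus: "is_ideal I \<Longrightarrow> x \<in> I \<Longrightarrow> - x \<in> I"
  using ideal_mult_l[of I x "-1"] by simp

lemma ideal_diff: "is_ideal I \<Longrightarrow> x \<in> I \<Longrightarrow> y \<in> I \<Longrightarrow> x - y \<in> I"
  using ideal_add[of I x "- y"] ideal_uminus[of I y] by simp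

lemma ideal_sum: "is_ideal I \<Longrightarrow> (\<And>i. i \<in> A \<Longrightarrow> f i \<in> I) \<Longrightarrow> sum f A \<in> I"
  by (induction A rule: infinite_finite_induct) (auto intro: ideal_zero ideal_add)

lemma ideal_cong: "is_ideal I \<Longrightarrow> x - y \<in> I \<Longrightarrow> x \<in> I \<longleftrightarrow> y \<in> I"
  using ideal_add[of I "x - y" y] ideal_diff[of I x "x - y"] by auto

lemma is_ideal_UNIV [simp]: "is_ideal UNIV"
  by (simp add: is_ideal_iff)

lemma is_ideal_zero [simp]: "is_ideal {0}"
  by (simp add: is_ideal_iff)

lemma ideal_eq_UNIV: "is_ideal I \<Longrightarrow> x \<in> I \<Longrightarrow> x dvd 1 \<Longrightarrow> I = UNIV"
  by (metis UNIV_eq_I dvdE ideal_mult_l ideal_mult_r mult.left_neutral)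

lemma is_ideal_gen [simp]: "is_ideal (ideal_gen S)"
  unfolding is_ideal_def ideal_gen_def by (rule module.subspace_span[OF module_ring])

lemma ideal_gen_base: "x \<in> S \<Longrightarrow> x \<in> ideal_gen S"
  unfolding ideal_gen_def by (rule module.span_base[OF module_ring])

lemma ideal_gen_least: "S \<subseteq> I \<Longrightarrow> is_ideal I \<Longrightarrow> ideal_gen S \<subseteq> I"
  unfolding is_ideal_def ideal_gen_def by (rule module.span_minimal[OF module_ring])

lemma ideal_gen_mono: "S \<subseteq> S' \<Longrightarrow> ideal_gen S \<subseteq> ideal_gen S'"
  by (rule ideal_gen_least) (auto intro: ideal_gen_base)

lemma ideal_gen_imageE:
  assumes "finite A" "x \<in> ideal_gen (v ` A)"
  obtains c where "x = (\<Sum>i\<in>A. c i * v i)"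
proof -
  let ?I = "{x. \<exists>c. x = (\<Sum>i\<in>A. c i * v i)}"
  have "is_ideal ?I"
  proof (rule is_idealI)
    show "0 \<in> ?I" by (auto intro: exI[of _ "\<lambda>_. 0"])
  next
    fix x y assume "x \<in> ?I" "y \<in> ?I"
    then obtain c d where "x = (\<Sum>i\<in>A. c i * v i)" "y = (\<Sum>i\<in>A. d i * v i)" by auto
    then have "x + y = (\<Sum>i\<in>A. (c i + d i) * v i)"
      by (simp add: algebra_simps sum.distrib)
    then show "x + y \<in> ?I" by (intro CollectI exI)
  next
    fix r x assume "x \<in> ?I"
    then obtain c where "x = (\<Sum>i\<in>A. c i * v i)" by auto
    then have "r * x = (\<Sum>i\<in>A. (r * c i) * v i)"
      by (simp add: algebra_simps sum_distrib_left)
    then show "r * x \<in> ?I" by (intro CollectI exI)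
  qed
  moreover have "v ` A \<subseteq> ?I"
  proof
    fix y assume "y \<in> v ` A"
    then obtain j where j: "j \<in> A" "y = v j" by auto
    then have "y = (\<Sum>i\<in>A. (if i = j then 1 else 0) * v i)"
      using assms(1) by (simp add: if_distrib[of "\<lambda>c. c * _"] cong: if_cong)
    then show "y \<in> ?I" by (intro CollectI exI)
  qed
  ultimately have "ideal_gen (v ` A) \<subseteq> ?I" by (intro ideal_gen_least)
  then show ?thesis using assms(2) that by blast
qed

lemma ideal_gen_rangeE:
  fixes v :: "'i::finite \<Rightarrow> 'a::comm_ring_1"
  assumes "x \<in> ideal_gen (range v)"
  obtains c where "x = (\<Sum>i\<in>UNIV. c i * v i)"
  using ideal_gen_imageE[of UNIV x v] assms by auto

lemma ideal_gen_singleE: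
  assumes "x \<in> ideal_gen {y}"
  obtains c where "x = c * y"
  using ideal_gen_imageE[of "{y}" x "\<lambda>x. x"] assms by auto

definition ideal_plus :: "'a::comm_ring_1 set \<Rightarrow> 'a set \<Rightarrow> 'a set" where
  "ideal_plus I J = {x + y |x y. x \<in> I \<and> y \<in> J}"

lemma ideal_plusI: "x \<in> I \<Longrightarrow> y \<in> J \<Longrightarrow> x + y \<in> ideal_plus I J"
  by (auto simp: ideal_plus_def)

lemma ideal_plusE:
  assumes "z \<in> ideal_plus I J" obtains x y where "z = x + y" "x \<in> I" "y \<in> J"
  using assms by (auto simp: ideal_plus_def)

lemma is_ideal_plus: 
  assumes "is_ideal I" "is_ideal J" shows "is_ideal (ideal_plus I J)"
proof (rule is_idealI)
  show "0 \<in> ideal_plus I J"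
    using ideal_plusI[of 0 I 0 J] assms by (simp add: ideal_zero)
next
  fix x y assume "x \<in> ideal_plus I J" "y \<in> ideal_plus I J"
  then obtain a b c d where "x = a + b" "y = c + d" "a \<in> I" "c \<in> I" "b \<in> J" "d \<in> J"
    by (metis ideal_plusE)
  then show "x + y \<in> ideal_plus I J"
    using ideal_plusI[of "a + c" I "b + d" J] assms by (simp add: ideal_add algebra_simps)
next
  fix c x assume "x \<in> ideal_plus I J"
  then obtain a b where "x = a + b" "a \<in> I" "b \<in> J"
    by (metis ideal_plusE)
  then show "c * x \<in> ideal_plus I J"
    using ideal_plusI[of "c * a" I "c * b" J] assms by (simp add: ideal_mult_l distrib_left)
qed

lemma ideal_plus_l: "is_ideal J \<Longrightarrow> x \<in> I \<Longrightarrow> x \<in> ideal_plus I J"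
  and ideal_plus_r: "is_ideal I \<Longrightarrow> x \<in> J \<Longrightarrow> x \<in> ideal_plus I J"
  using ideal_plusI[of x I 0 J] ideal_plusI[of 0 I x J] by (auto intro: ideal_zero)

lemma ideal_plus_least: "I \<subseteq> K \<Longrightarrow> J \<subseteq> K \<Longrightarrow> is_ideal K \<Longrightarrow> ideal_plus I J \<subseteq> K"
  by (auto simp: ideal_plus_def intro: ideal_add)

lemma is_ideal_mult [simp]: "is_ideal (ideal_mult I J)"
  by (simp add: ideal_mult_def)

lemma ideal_mult_mem: "x \<in> I \<Longrightarrow> y \<in> J \<Longrightarrow> x * y \<in> ideal_mult I J"
  unfolding ideal_mult_def by (rule ideal_gen_base) auto

lemma ideal_mult_least:
  "(\<And>x y. x \<in> I \<Longrightarrow> y \<in> J \<Longrightarrow> x * y \<in> K) \<Longrightarrow> is_ideal K \<Longrightarrow> ideal_mult I J \<subseteq> K"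
  unfolding ideal_mult_def by (rule ideal_gen_least) auto

lemma ideal_mult_mono: "I \<subseteq> I' \<Longrightarrow> J \<subseteq> J' \<Longrightarrow> ideal_mult I J \<subseteq> ideal_mult I' J'"
  by (rule ideal_mult_least) (auto intro: ideal_mult_mem)

lemma ideal_mult_commute: "ideal_mult I J = ideal_mult J I"
proof -
  have *: "x * y \<in> ideal_mult J I" if "x \<in> I" "y \<in> J" for I J :: "'a set" and x y
    using ideal_mult_mem[OF that(2,1)] by (simp only: mult.commute)
  have "ideal_mult I J \<subseteq> ideal_mult J I" for I J :: "'a set"
    by (rule ideal_mult_least) (simp_all add: *)
  then show ?thesis by blast
qed

lemma ideal_mult_subset_r: "is_ideal J \<Longrightarrow> ideal_mult I J \<subseteq> J"
  by (rule ideal_mult_least) (auto intro: ideal_mult_l)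

lemma ideal_mult_subset_l: "is_ideal I \<Longrightarrow> ideal_mult I J \<subseteq> I"
  by (rule ideal_mult_least) (auto intro: ideal_mult_r)

lemma ideal_mult_UNIV [simp]: "is_ideal J \<Longrightarrow> ideal_mult UNIV J = J"
  using ideal_mult_subset_r[of J UNIV] ideal_mult_mem[of 1 UNIV _ J] by auto

lemma ideal_mult_UNIV_r [simp]: "is_ideal J \<Longrightarrow> ideal_mult J UNIV = J"
  using ideal_mult_UNIV[of J] by (simp only: ideal_mult_commute)

lemma ideal_quotient_ideal: "is_ideal I \<Longrightarrow> is_ideal {x. x * y \<in> I}"
  by (rule is_idealI) (auto simp: ideal_zero distrib_right ideal_add mult.assoc ideal_mult_l)

lemma ideal_mult_assoc_le: "ideal_mult (ideal_mult I J) K \<subseteq> ideal_mult I (ideal_mult J K)"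
proof (rule ideal_mult_least)
  fix x y assume "x \<in> ideal_mult I J" and y: "y \<in> K"
  have "ideal_mult I J \<subseteq> {x. x * y \<in> ideal_mult I (ideal_mult J K)}"
    by (rule ideal_mult_least)
      (auto simp: mult.assoc y intro!: ideal_mult_mem ideal_quotient_ideal)
  then show "x * y \<in> ideal_mult I (ideal_mult J K)" using \<open>x \<in> ideal_mult I J\<close> by auto
qed simp

lemma ideal_mult_assoc: "ideal_mult (ideal_mult I J) K = ideal_mult I (ideal_mult J K)"
  using ideal_mult_assoc_le[of I J K] ideal_mult_assoc_le[of K J I]
  by (metis equalityI ideal_mult_commute)

lemma ideal_mult_left_commute: "ideal_mult I (ideal_mult J K) = ideal_mult J (ideal_mult I K)"
  by (metis ideal_mult_assoc ideal_mult_commute)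

lemma ideal_mult_plus_le:
  "ideal_mult I (ideal_plus J K) \<subseteq> ideal_plus (ideal_mult I J) (ideal_mult I K)"
  by (rule ideal_mult_least)
    (auto elim!: ideal_plusE simp: distrib_left is_ideal_plus intro!: ideal_plusI ideal_mult_mem)

lemma is_ideal_pow [simp]: "is_ideal (ideal_pow I s)"
  by (cases s) simp_all

lemma ideal_pow_1: "is_ideal I \<Longrightarrow> ideal_pow I (Suc 0) = I"
  by (simp add: ideal_mult_commute[of I])

lemma ideal_pow_add: "ideal_pow I (a + b) = ideal_mult (ideal_pow I a) (ideal_pow I b)"
  by (induction a) (simp_all add: ideal_mult_assoc)

lemma ideal_pow_mult_mem: "x \<in> ideal_pow I a \<Longrightarrow> y \<in> ideal_pow I b \<Longrightarrow> x * y \<in> ideal_pow I (a + b)"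
  by (simp add: ideal_pow_add ideal_mult_mem)

lemma ideal_pow_mono: "I \<subseteq> J \<Longrightarrow> ideal_pow I s \<subseteq> ideal_pow J s"
  by (induction s) (simp_all add: ideal_mult_mono)

lemma ideal_pow_antimono: "a \<le> b \<Longrightarrow> ideal_pow I b \<subseteq> ideal_pow I a"
  using ideal_pow_add[of I a "b - a"] ideal_mult_subset_l[of "ideal_pow I a"] by simp

lemma ideal_pow_pow: "ideal_pow (ideal_pow I a) b = ideal_pow I (a * b)"
  by (induction b) (simp_all add: ideal_pow_add)

lemma power_in_ideal_pow: "x \<in> I \<Longrightarrow> x ^ s \<in> ideal_pow I s"
  by (induction s) (auto intro: ideal_mult_mem)

lemma ideal_pow_UNIV: "ideal_pow UNIV s = UNIV"
  by (induction s) simp_all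

lemma ideal_pow_mult: "ideal_pow (ideal_mult I J) s = ideal_mult (ideal_pow I s) (ideal_pow J s)"
  by (induction s) (simp_all add: ideal_mult_assoc ideal_mult_left_commute)

text \<open>A product of elements of \<open>T\<close> is a multiple of a pure power of
  \<open>f\<close> plus terms with a factor in \<open>J\<close>. So the single element
  \<open>f ^ Suc s\<close> decides whether \<open>J\<close> is a reduction of
  \<open>T\<close>.\<close>

lemma ideal_pow_plus_single:
  assumes T: "T = ideal_plus (ideal_gen {f}) J" and J: "is_ideal J"
  shows "ideal_pow T (Suc s) = ideal_plus (ideal_gen {f ^ Suc s}) (ideal_mult J (ideal_pow T s))"
    (is "_ = ?r s")
proof
  have I: "is_ideal (?r s)" for s by (simp add: is_ideal_plus)
  have f: "f \<in> T" and JT: "J \<subseteq> T"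
    using T J by (auto intro: ideal_plus_l ideal_plus_r ideal_gen_base)
  show "ideal_pow T (Suc s) \<subseteq> ?r s"
  proof (induction s)
    case 0
    then show ?case using T J by (simp add: is_ideal_plus)
  next
    case (Suc s)
    have "x * y \<in> ?r (Suc s)" if "x \<in> T" "y \<in> ideal_pow T (Suc s)" for x y
    proof -
      from \<open>x \<in> T\<close> obtain c j where x: "x = c * f + j" "j \<in> J"
        unfolding T by (metis ideal_plusE ideal_gen_singleE)
      from that(2) Suc obtain d z where y: "y = d * f ^ Suc s + z" "z \<in> ideal_mult J (ideal_pow T s)"
        by (metis ideal_plusE ideal_gen_singleE subsetD)
      have "x * y = (c * d) * f ^ Suc (Suc s) + (c * (f * z) + j * y)"
        by (simp add: x y algebra_simps)
      moreover have "j * y \<in> ideal_mult J (ideal_pow T (Suc s))"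
        using x that(2) ideal_mult_mem by blast
      moreover have "f * z \<in> ideal_mult J (ideal_pow T (Suc s))"
        using ideal_mult_mem[OF f y(2)] by (simp add: ideal_mult_left_commute)
      ultimately show ?thesis
        by (metis ideal_plusI ideal_add ideal_mult_l ideal_gen_base is_ideal_gen is_ideal_mult singletonI)
    qed
    then show ?case using I[of "Suc s"] by (subst ideal_pow.simps) (rule ideal_mult_least)
  qed
  show "?r s \<subseteq> ideal_pow T (Suc s)"
  proof (rule ideal_plus_least)
    show "ideal_gen {f ^ Suc s} \<subseteq> ideal_pow T (Suc s)"
      by (rule ideal_gen_least) (use power_in_ideal_pow[OF f, of "Suc s"] in auto)
    show "ideal_mult J (ideal_pow T s) \<subseteq> ideal_pow T (Suc s)"
      using JT by (simp add: ideal_mult_mono)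
  qed simp
qed

subsection \<open>Monomials\<close>

definition deg :: "('i::finite \<Rightarrow>\<^sub>0 nat) \<Rightarrow> nat" where
  "deg a = (\<Sum>i\<in>UNIV. Poly_Mapping.lookup a i)"

definition mon :: "('i::finite \<Rightarrow> 'a::comm_monoid_mult) \<Rightarrow> ('i \<Rightarrow>\<^sub>0 nat) \<Rightarrow> 'a" where
  "mon v a = (\<Prod>i\<in>UNIV. v i ^ Poly_Mapping.lookup a i)"

lemma deg_zero [simp]: "deg 0 = 0"
  and deg_add: "deg (a + b) = deg a + deg b"
  by (simp_all add: deg_def lookup_add sum.distrib)

lemma deg_single [simp]: "deg (Poly_Mapping.single i k) = k"
  by (simp add: deg_def lookup_single when_def)

lemma lookup_le_deg: "Poly_Mapping.lookup a i \<le> deg a"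
  unfolding deg_def by (rule member_le_sum) auto

lemma deg_eq_0_iff [simp]: "deg a = 0 \<longleftrightarrow> a = 0"
  by (auto simp: deg_def poly_mapping_eq_iff fun_eq_iff)

lemma mon_zero [simp]: "mon v 0 = 1"
  and mon_add: "mon v (a + b) = mon v a * mon v b"
  by (simp_all add: mon_def lookup_add power_add prod.distrib)

lemma mon_single [simp]: "mon v (Poly_Mapping.single i k) = v i ^ k"
proof -
  have "mon v (Poly_Mapping.single i k) = (\<Prod>j\<in>UNIV. if j = i then v i ^ k else 1)"
    unfolding mon_def by (rule prod.cong) (auto simp: lookup_single when_def)
  then show ?thesis by simp
qed

lemma exponent_split:
  fixes a :: "'i \<Rightarrow>\<^sub>0 nat"
  assumes "Poly_Mapping.lookup a i > 0"
  obtains b where "a = b + Poly_Mapping.single i 1"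
proof
  show "a = (a - Poly_Mapping.single i 1) + Poly_Mapping.single i 1"
    using assms by (intro poly_mapping_eqI) (auto simp: lookup_add lookup_minus lookup_single when_def)
qed

lemma deg_SucE:
  assumes "deg a = Suc s"
  obtains b i where "a = b + Poly_Mapping.single i 1" "deg b = s"
proof -
  from assms have "a \<noteq> 0" by auto
  then obtain i where "Poly_Mapping.lookup a i > 0"
    by (auto simp: poly_mapping_eq_iff fun_eq_iff)
  then obtain b where "a = b + Poly_Mapping.single i 1" by (rule exponent_split)
  with assms that show thesis by (simp add: deg_add)
qed

lemma finite_deg_le: "finite {a :: 'i::finite \<Rightarrow>\<^sub>0 nat. deg a \<le> s}"
proof -
  have "Poly_Mapping.lookup ` {a :: 'i \<Rightarrow>\<^sub>0 nat. deg a \<le> s}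
      \<subseteq> {h. \<forall>i. (i \<in> UNIV \<longrightarrow> h i \<in> {..s}) \<and> (i \<notin> UNIV \<longrightarrow> h i = 0)}"
    using order.trans[OF lookup_le_deg] by auto
  then have "finite (Poly_Mapping.lookup ` {a :: 'i \<Rightarrow>\<^sub>0 nat. deg a \<le> s})"
    by (rule finite_subset) (rule finite_set_of_finite_funs; simp)
  then show ?thesis by (rule finite_imageD) (simp add: inj_on_def)
qed

lemma finite_deg [simp]: "finite {a :: 'i::finite \<Rightarrow>\<^sub>0 nat. deg a = s}"
  and finite_deg_less [simp]: "finite {a :: 'i::finite \<Rightarrow>\<^sub>0 nat. deg a < s}"
  by (auto intro: finite_subset[OF _ finite_deg_le[of s]])

text \<open>Take the largest elements of \<open>A\<close> and \<open>B\<close> in a linear order compatible with addition.\<close>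

lemma exponent_unique_sum:
  fixes A B :: "('i::finite \<Rightarrow>\<^sub>0 nat) set"
  assumes "finite A" "finite B" "A \<noteq> {}" "B \<noteq> {}"
  obtains a b where "a \<in> A" "b \<in> B" "\<And>a' b'. a' \<in> A \<Longrightarrow> b' \<in> B \<Longrightarrow> a' + b' = a + b \<Longrightarrow> a' = a \<and> b' = b"
proof -
  obtain h :: "'i \<Rightarrow> nat" where h: "inj h"
    using finite_imp_inj_to_nat_seg[of "UNIV :: 'i set"] by auto
  \<comment> \<open>Exponents over \<open>nat\<close> carry a linear order compatible with addition;
    \<open>\<phi>\<close> transports the exponents there, injectively and additively.\<close>
  define \<phi> :: "('i \<Rightarrow>\<^sub>0 nat) \<Rightarrow> (nat \<Rightarrow>\<^sub>0 nat)"
    where "\<phi> a = (\<Sum>i\<in>UNIV. Poly_Mapping.single (h i) (Poly_Mapping.lookup a i))" for a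
  have lk: "Poly_Mapping.lookup (\<phi> a) (h i) = Poly_Mapping.lookup a i" for a i
  proof -
    have "Poly_Mapping.lookup (\<phi> a) (h i) = (\<Sum>j\<in>UNIV. if j = i then Poly_Mapping.lookup a i else 0)"
      unfolding \<phi>_def lookup_sum
      by (rule sum.cong) (auto simp: lookup_single when_def inj_eq[OF h])
    then show ?thesis by simp
  qed
  then have inj: "\<phi> a = \<phi> b \<Longrightarrow> a = b" for a b
    by (metis poly_mapping_eqI)
  have add: "\<phi> (a + b) = \<phi> a + \<phi> b" for a b
    by (simp add: \<phi>_def lookup_add single_add sum.distrib)
  have "Max (\<phi> ` A) \<in> \<phi> ` A" "Max (\<phi> ` B) \<in> \<phi> ` B"
    using assms by (intro Max_in; simp)+
  then obtain a b where ab: "a \<in> A" "b \<in> B" "Max (\<phi> ` A) = \<phi> a" "Max (\<phi> ` B) = \<phi> b" by auto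
  have "a' = a \<and> b' = b" if "a' \<in> A" "b' \<in> B" "a' + b' = a + b" for a' b'
  proof -
    have "\<phi> a' \<le> \<phi> a" "\<phi> b' \<le> \<phi> b"
      using ab assms that by (metis Max_ge finite_imageI imageI)+
    moreover have "\<phi> a' + \<phi> b' = \<phi> a + \<phi> b" using that(3) by (metis add)
    ultimately have "\<phi> a' = \<phi> a \<and> \<phi> b' = \<phi> b"
      by (metis add_le_cancel_left add_le_cancel_right order_antisym)
    then show ?thesis using inj by blast
  qed
  with ab that show thesis by blast
qed

lemma mon_in_ideal_pow:
  assumes "\<And>i. v i \<in> I" shows "mon v a \<in> ideal_pow I (deg a)"
proof (induction "deg a" arbitrary: a)
  case (Suc s)
  then obtain b i where b: "a = b + Poly_Mapping.single i 1" "deg b = s" by (metis deg_SucE)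
  then have "v i * mon v b \<in> ideal_pow I (Suc s)"
    using Suc.hyps(1)[of b] assms by (simp add: ideal_mult_mem)
  then show ?case using b by (simp add: mon_add deg_add mult.commute)
qed simp

lemma ideal_pow_expand:
  fixes v :: "'i::finite \<Rightarrow> 'a::comm_ring_1"
  assumes "is_ideal K" and x: "x \<in> ideal_mult K (ideal_pow (ideal_gen (range v)) s)"
  obtains c where "\<And>a. c a \<in> K" "x = (\<Sum>a | deg a = s. c a * mon v a)"
proof -
  define F where "F K s = {x. \<exists>c. (\<forall>a. c a \<in> K) \<and> x = (\<Sum>a | deg a = s. c a * mon v a)}" for K s
  have F: "is_ideal (F K s)" if K: "is_ideal K" for K s
  proof (rule is_idealI)
    show "0 \<in> F K s" using K by (auto simp: F_def ideal_zero intro!: exI[of _ "\<lambda>_. 0"])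
  next
    fix x y assume "x \<in> F K s" "y \<in> F K s"
    then obtain c d where "\<forall>a. c a \<in> K" "\<forall>a. d a \<in> K" "x = (\<Sum>a | deg a = s. c a * mon v a)"
      "y = (\<Sum>a | deg a = s. d a * mon v a)"
      by (auto simp: F_def)
    then show "x + y \<in> F K s"
      using K unfolding F_def
      by (intro CollectI exI[of _ "\<lambda>a. c a + d a"]) (auto simp: distrib_right sum.distrib ideal_add)
  next
    fix r x assume "x \<in> F K s"
    then obtain c where "\<forall>a. c a \<in> K" "x = (\<Sum>a | deg a = s. c a * mon v a)"
      by (auto simp: F_def)
    then show "r * x \<in> F K s"
      using K unfolding F_def
      by (intro CollectI exI[of _ "\<lambda>a. r * c a"]) (auto simp: mult.assoc sum_distrib_left ideal_mult_l)
  qed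
  have mF: "mon v b \<in> F UNIV (deg b)" for b
    unfolding F_def by (auto intro!: exI[of _ "\<lambda>a. if a = b then 1 else 0"] simp: if_distrib[of "\<lambda>c. c * _"] cong: if_cong)
  have pow: "ideal_pow (ideal_gen (range v)) s \<subseteq> F UNIV s" for s
  proof (induction s)
    case 0
    then show ?case using ideal_eq_UNIV[OF F, of UNIV 1 0] mF[of 0] by simp
  next
    case (Suc s)
    have "x * y \<in> F UNIV (Suc s)" if "x \<in> ideal_gen (range v)" "y \<in> ideal_pow (ideal_gen (range v)) s" for x y
    proof -
      from that(2) Suc obtain c where c: "y = (\<Sum>a | deg a = s. c a * mon v a)"
        by (auto simp: F_def)
      have "v i * y \<in> F UNIV (Suc s)" for i
      proof -
        have "v i * y = (\<Sum>a | deg a = s. c a * mon v (a + Poly_Mapping.single i 1))"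
          by (simp add: c sum_distrib_left mon_add mult_ac)
        also have "\<dots> \<in> F UNIV (Suc s)"
        proof (intro ideal_sum ideal_mult_l F is_ideal_UNIV)
          fix a :: "'i \<Rightarrow>\<^sub>0 nat" assume "a \<in> {a. deg a = s}"
          then show "mon v (a + Poly_Mapping.single i 1) \<in> F UNIV (Suc s)"
            using mF[of "a + Poly_Mapping.single i 1"] by (simp add: deg_add)
        qed
        finally show ?thesis .
      qed
      then have "ideal_gen (range v) \<subseteq> {x. x * y \<in> F UNIV (Suc s)}"
        by (intro ideal_gen_least ideal_quotient_ideal F) auto
      then show ?thesis using that(1) by auto
    qed
    then show ?case by (simp add: ideal_mult_least F)
  qed
  have "ideal_mult K (ideal_pow (ideal_gen (range v)) s) \<subseteq> F K s"
  proof (rule ideal_mult_least)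
    fix x y assume x: "x \<in> K" and "y \<in> ideal_pow (ideal_gen (range v)) s"
    then obtain c where c: "y = (\<Sum>a | deg a = s. c a * mon v a)"
      using pow by (auto simp: F_def)
    show "x * y \<in> F K s"
      unfolding F_def c using x assms
      by (intro CollectI exI[of _ "\<lambda>a. x * c a"]) (auto simp: mult.assoc sum_distrib_left intro: ideal_mult_r)
  qed (rule F, fact)
  then show thesis using x that by (auto simp: F_def)
qed

lemma ideal_pow_expand':
  fixes v :: "'i::finite \<Rightarrow> 'a::comm_ring_1"
  assumes "x \<in> ideal_pow (ideal_gen (range v)) s"
  obtains c where "x = (\<Sum>a | deg a = s. c a * mon v a)"
  using ideal_pow_expand[of UNIV x v s] assms by auto

subsection \<open>Formal power series\<close>

lemma mfps_nth_zero [simp]: "mfps_nth 0 a = 0"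
  and mfps_nth_one: "mfps_nth 1 a = (if a = 0 then 1 else 0)"
  and mfps_nth_add [simp]: "mfps_nth (f + g) a = mfps_nth f a + mfps_nth g a"
  and mfps_nth_uminus [simp]: "mfps_nth (- f) a = - mfps_nth f a"
  and mfps_nth_diff [simp]: "mfps_nth (f - g) a = mfps_nth f a - mfps_nth g a"
  and mfps_nth_mult: "mfps_nth (f * g) a = (\<Sum>(b, c)\<in>{(b, c). b + c = a}. mfps_nth f b * mfps_nth g c)"
  and mfps_nth_const: "mfps_nth (mfps_const c) a = (if a = 0 then c else 0)"
  for f g :: "('a::comm_ring_1, 'n) mfps"
  by (simp_all add: zero_mfps_def one_mfps_def plus_mfps_def uminus_mfps_def minus_mfps_def
      times_mfps_def mfps_const_def)

lemma mfps_nth_sum: "mfps_nth (sum f A) a = (\<Sum>i\<in>A. mfps_nth (f i) a)"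
  for f :: "'i \<Rightarrow> ('a::comm_ring_1, 'n) mfps"
  by (induction A rule: infinite_finite_induct) simp_all

lemma exponent_splits_zero: "{(b, c :: 'n \<Rightarrow>\<^sub>0 nat). b + c = 0} = {(0, 0)}"
  by (auto simp: poly_mapping_eq_iff fun_eq_iff lookup_add)

lemma mfps_nth_mult_0: "mfps_nth (f * g) 0 = mfps_nth f 0 * mfps_nth g 0"
  for f g :: "('a::comm_ring_1, 'n) mfps"
  by (simp add: mfps_nth_mult exponent_splits_zero)

definition mfps_monom :: "('n \<Rightarrow>\<^sub>0 nat) \<Rightarrow> ('a::comm_ring_1, 'n) mfps" where
  "mfps_monom b = Abs_mfps (\<lambda>a. if a = b then 1 else 0)"

lemma mfps_nth_monom: "mfps_nth (mfps_monom b) a = (if a = b then 1 else 0)"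
  by (simp add: mfps_monom_def)

lemma mfps_nth_monom_mult [simp]: "mfps_nth (mfps_monom b * h) (b + c) = mfps_nth h c"
proof -
  have "mfps_nth (mfps_monom b * h) (b + c) =
      (\<Sum>(x, y)\<in>{(b, c)}. (if x = b then 1 else 0) * mfps_nth h y)"
    unfolding mfps_nth_mult mfps_nth_monom
    by (rule sum.mono_neutral_right) (auto simp: finite_exponent_splits split: if_splits)
  then show ?thesis by simp
qed

lemma mfps_nth_monom_mult_0: "(\<And>c. a \<noteq> b + c) \<Longrightarrow> mfps_nth (mfps_monom b * h) a = 0"
  unfolding mfps_nth_mult mfps_nth_monom by (rule sum.neutral) auto

lemma mfps_monom_0 [simp]: "mfps_monom 0 = 1"
  by (rule mfps_eqI) (simp add: mfps_nth_monom mfps_nth_one)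

lemma mfps_const_eq_monom: "mfps_nth (mfps_const c * h) a = c * mfps_nth h a"
  for h :: "('a::comm_ring_1, 'n) mfps"
proof -
  have "mfps_nth (mfps_const c * h) a =
      (\<Sum>(x, y)\<in>{(0 :: 'n \<Rightarrow>\<^sub>0 nat, a)}. (if x = 0 then c else 0) * mfps_nth h y)"
    unfolding mfps_nth_mult mfps_nth_const
    by (rule sum.mono_neutral_right) (auto simp: finite_exponent_splits split: if_splits)
  then show ?thesis by simp
qed

lemma mfps_const_0 [simp]: "mfps_const 0 = (0 :: ('a::comm_ring_1, 'n) mfps)"
  and mfps_const_1 [simp]: "mfps_const 1 = (1 :: ('a::comm_ring_1, 'n) mfps)"
  and mfps_const_add: "mfps_const (c + d) = (mfps_const c + mfps_const d :: ('a, 'n) mfps)"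
  and mfps_const_diff: "mfps_const (c - d) = (mfps_const c - mfps_const d :: ('a, 'n) mfps)"
  and mfps_const_uminus: "mfps_const (- c) = (- mfps_const c :: ('a, 'n) mfps)"
  and mfps_const_mult: "mfps_const (c * d) = (mfps_const c * mfps_const d :: ('a, 'n) mfps)"
  for c d :: "'a::comm_ring_1"
  by (rule mfps_eqI, simp add: mfps_nth_const mfps_nth_one mfps_const_eq_monom)+

lemma mfps_const_sum: "mfps_const (sum c A) = (\<Sum>i\<in>A. mfps_const (c i))"
  for c :: "'i \<Rightarrow> 'a::comm_ring_1"
  by (induction A rule: infinite_finite_induct) (simp_all add: mfps_const_add)

abbreviation mfps_var :: "'n \<Rightarrow> ('a::comm_ring_1, 'n) mfps" where
  "mfps_var i \<equiv> mfps_monom (Poly_Mapping.single i 1)"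

text \<open>This is the s-th power of the maximal ideal (\<open>max_ideal_pow\<close>), in a form
  where membership is read off the coefficients.\<close>

definition order_ideal :: "nat \<Rightarrow> ('a::comm_ring_1, 'n::finite) mfps set" where
  "order_ideal s = {h. \<forall>a. deg a < s \<longrightarrow> mfps_nth h a = 0}"

lemma order_ideal_mult_mem:
  assumes "x \<in> order_ideal s" "y \<in> order_ideal t"
  shows "x * y \<in> order_ideal (s + t)"
  unfolding order_ideal_def
proof (intro CollectI allI impI)
  fix a :: "'b \<Rightarrow>\<^sub>0 nat" assume a: "deg a < s + t"
  show "mfps_nth (x * y) a = 0"
    unfolding mfps_nth_mult
  proof (rule sum.neutral, clarify)
    fix b c assume "a = b + c"
    with a have "deg b < s \<or> deg c < t" by (auto simp: deg_add)
    then show "mfps_nth x b * mfps_nth y c = 0"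
      using assms by (auto simp: order_ideal_def)
  qed
qed

lemma is_ideal_order_ideal: "is_ideal (order_ideal s)"
proof (rule is_idealI)
  fix c x :: "('a, 'b) mfps" assume "x \<in> order_ideal s"
  moreover have "c \<in> order_ideal 0" by (simp add: order_ideal_def)
  ultimately show "c * x \<in> order_ideal s" using order_ideal_mult_mem[of c 0 x s] by simp
qed (auto simp: order_ideal_def)

lemma max_ideal_eq_order_ideal: "max_ideal = order_ideal 1"
  by (auto simp: max_ideal_def order_ideal_def)

lemma is_ideal_max_ideal [simp]: "is_ideal (max_ideal :: ('a::comm_ring_1, 'n) mfps set)"
  by (rule is_idealI) (simp_all add: max_ideal_def mfps_nth_mult_0)

lemma mfps_decompose:
  fixes h :: "('a::comm_ring_1, 'n::finite) mfps"
  assumes h: "h \<in> order_ideal (Suc s)"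
  obtains q where "h = (\<Sum>i\<in>UNIV. mfps_var i * q i)" "\<And>i. q i \<in> order_ideal s"
proof -
  \<comment> \<open>Each exponent is charged to one variable \<open>p a\<close> occurring in it, so
    every coefficient of \<open>h\<close> goes into exactly one \<open>q i\<close>.\<close>
  define p :: "('n \<Rightarrow>\<^sub>0 nat) \<Rightarrow> 'n" where "p a = (SOME i. Poly_Mapping.lookup a i > 0)" for a
  have p: "Poly_Mapping.lookup a (p a) > 0" if "a \<noteq> 0" for a
  proof -
    from that obtain i where "Poly_Mapping.lookup a i > 0"
      by (auto simp: poly_mapping_eq_iff fun_eq_iff)
    then show ?thesis unfolding p_def by (rule someI)
  qed
  define q :: "'n \<Rightarrow> ('a, 'n) mfps" where "q i = Abs_mfps (\<lambda>b. if p (Poly_Mapping.single i 1 + b) = i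
    then mfps_nth h (Poly_Mapping.single i 1 + b) else 0)" for i
  have "mfps_nth (mfps_var i * q i) a = (if p a = i then mfps_nth h a else 0)" for i a
  proof (cases "\<exists>b. a = Poly_Mapping.single i 1 + b")
    case True
    then show ?thesis by (auto simp: q_def)
  next
    case False
    then have "mfps_nth (mfps_var i * q i) a = 0" by (intro mfps_nth_monom_mult_0) auto
    moreover have "mfps_nth h a = 0" if "p a = i"
    proof (cases "a = 0")
      case True
      then show ?thesis using h by (simp add: order_ideal_def)
    next
      case False
      with p that \<open>\<nexists>b. _\<close> show ?thesis by (metis add.commute exponent_split)
    qed
    ultimately show ?thesis by simp
  qed
  then have "h = (\<Sum>i\<in>UNIV. mfps_var i * q i)"
    by (intro mfps_eqI) (simp add: mfps_nth_sum)
  moreover have "q i \<in> order_ideal s" for i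
    using h by (auto simp: order_ideal_def q_def deg_add)
  ultimately show thesis using that by blast
qed

lemma mfps_var_in_max_ideal: "mfps_var (i :: 'n) \<in> max_ideal"
proof -
  have "(0 :: 'n \<Rightarrow>\<^sub>0 nat) \<noteq> Poly_Mapping.single i 1"
    by (metis lookup_single_eq lookup_zero zero_neq_one)
  then show ?thesis by (simp add: max_ideal_def mfps_nth_monom)
qed

lemma max_ideal_pow: "ideal_pow max_ideal s = (order_ideal s :: ('a::comm_ring_1, 'n::finite) mfps set)"
proof (induction s)
  case 0
  then show ?case by (simp add: order_ideal_def)
next
  case (Suc s)
  have "ideal_mult max_ideal (order_ideal s) \<subseteq> (order_ideal (Suc s) :: ('a, 'n) mfps set)"
    using order_ideal_mult_mem[where s = 1 and t = s]
    by (intro ideal_mult_least is_ideal_order_ideal) (auto simp: max_ideal_eq_order_ideal)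
  moreover have "h \<in> ideal_mult max_ideal (order_ideal s)"
    if h: "h \<in> order_ideal (Suc s)" for h :: "('a, 'n) mfps"
    using mfps_decompose[OF h] mfps_var_in_max_ideal
    by (metis (no_types, lifting) ideal_mult_mem ideal_sum is_ideal_mult)
  ultimately show ?case using Suc by auto
qed

lemma max_ideal_gen: "max_ideal = ideal_gen (range (mfps_var :: 'n::finite \<Rightarrow> ('a::comm_ring_1, 'n) mfps))"
proof
  show "ideal_gen (range mfps_var) \<subseteq> (max_ideal :: ('a, 'n) mfps set)"
    using mfps_var_in_max_ideal by (intro ideal_gen_least) auto
  show "max_ideal \<subseteq> ideal_gen (range (mfps_var :: 'n \<Rightarrow> ('a, 'n) mfps))"
  proof
    fix h :: "('a, 'n) mfps" assume "h \<in> max_ideal"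
    then obtain q where q: "h = (\<Sum>i\<in>UNIV. mfps_var i * q i)"
      using mfps_decompose[of h 0] by (auto simp: max_ideal_eq_order_ideal)
    show "h \<in> ideal_gen (range mfps_var)"
      unfolding q by (intro ideal_sum ideal_mult_r is_ideal_gen ideal_gen_base) auto
  qed
qed

lemma diff_const_in_max_ideal: "h - mfps_const (mfps_nth h 0) \<in> max_ideal"
  for h :: "('a::comm_ring_1, 'n) mfps"
  by (simp add: max_ideal_def mfps_nth_const)

text \<open>The inverse is the geometric series: \<open>v ^ k\<close> has order at least
  \<open>k\<close>, so each coefficient of the series is a finite sum.\<close>

lemma mfps_one_diff_unit:
  fixes v :: "('a::comm_ring_1, 'n::finite) mfps"
  assumes v: "v \<in> max_ideal"
  shows "1 - v dvd 1"
proof -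
  define w where "w = Abs_mfps (\<lambda>a. mfps_nth (\<Sum>k\<le>deg a. v ^ k) a)"
  have w: "mfps_nth w a = mfps_nth (\<Sum>k\<le>s. v ^ k) a" if "deg a \<le> s" for a s
  proof -
    have "mfps_nth (v ^ k) a = 0" if "deg a < k" for k
      using power_in_ideal_pow[OF v, of k] that by (auto simp: max_ideal_pow order_ideal_def)
    then have "(\<Sum>k\<le>s. mfps_nth (v ^ k) a) = (\<Sum>k\<le>deg a. mfps_nth (v ^ k) a)"
      using that by (intro sum.mono_neutral_right) auto
    then show ?thesis by (simp add: w_def mfps_nth_sum)
  qed
  have "(1 - v) * w = 1"
  proof (rule mfps_eqI)
    fix a :: "'n \<Rightarrow>\<^sub>0 nat"
    have "mfps_nth ((1 - v) * w) a = mfps_nth ((1 - v) * (\<Sum>k\<le>deg a. v ^ k)) a"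
      unfolding mfps_nth_mult
    proof (rule sum.cong, simp, clarify)
      fix b c :: "'n \<Rightarrow>\<^sub>0 nat" assume "a = b + c"
      then show "mfps_nth (1 - v) b * mfps_nth w c =
          mfps_nth (1 - v) b * mfps_nth (\<Sum>k\<le>deg (b + c). v ^ k) c"
        using w[of c "deg (b + c)"] by (simp add: deg_add)
    qed
    also have "(1 - v) * (\<Sum>k\<le>deg a. v ^ k) = 1 - v ^ Suc (deg a)"
      by (rule sum_gp_basic)
    also have "mfps_nth \<dots> a = mfps_nth 1 a"
      using power_in_ideal_pow[OF v, of "Suc (deg a)"]
      unfolding max_ideal_pow by (simp add: order_ideal_def del: power_Suc)
    finally show "mfps_nth ((1 - v) * w) a = mfps_nth 1 a" .
  qed
  then show ?thesis by (metis dvdI)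
qed

lemma mfps_unit_iff: "u dvd 1 \<longleftrightarrow> mfps_nth u 0 \<noteq> 0"
  for u :: "('a::field, 'n::finite) mfps"
proof
  assume "u dvd 1"
  then obtain w where "1 = u * w" by (rule dvdE)
  then have "1 = mfps_nth u 0 * mfps_nth w 0" by (metis mfps_nth_mult_0 mfps_nth_one)
  then show "mfps_nth u 0 \<noteq> 0" by auto
next
  let ?c = "mfps_nth u 0"
  assume c: "?c \<noteq> 0"
  define v where "v = 1 - mfps_const (inverse ?c) * u"
  have "v \<in> max_ideal"
    using c by (simp add: v_def max_ideal_def mfps_nth_one mfps_const_eq_monom)
  then have "1 - v dvd 1" by (rule mfps_one_diff_unit)
  then show "u dvd 1" unfolding v_def by (simp add: dvd_mult_right)
qed

section \<open>Nakayama's lemma and the Leibniz rule\<close>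

lemma ideal_plus_mono: "I \<subseteq> I' \<Longrightarrow> J \<subseteq> J' \<Longrightarrow> ideal_plus I J \<subseteq> ideal_plus I' J'"
  unfolding ideal_plus_def by blast

text \<open>Induction on the generators with varying \<open>K\<close>: modulo \<open>K + (x)\<close>
  the other generators are absorbed, and what remains for \<open>x\<close> is (1 - v) x in
  \<open>K\<close> with v in the maximal ideal. Locality enters only through the invertibility of 1
  - v.\<close>

lemma nakayama:
  fixes F :: "('a::comm_ring_1, 'n::finite) mfps set"
  assumes "finite F" "is_ideal K"
    and "ideal_gen F \<subseteq> ideal_plus K (ideal_mult max_ideal (ideal_gen F))"
  shows "ideal_gen F \<subseteq> K"
proof -
  have "F \<subseteq> K"
    if "finite F" "is_ideal K" "F \<subseteq> ideal_plus K (ideal_mult max_ideal (ideal_gen F))"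
    for K F :: "('a, 'n) mfps set"
    using that
  proof (induction F arbitrary: K rule: finite_induct)
    case (insert x F)
    let ?m = "max_ideal :: ('a, 'n) mfps set"
    define K' where "K' = ideal_plus K (ideal_gen {x})"
    have K': "is_ideal K'" by (simp add: K'_def is_ideal_plus insert)
    have "ideal_mult ?m (ideal_gen (insert x F)) \<subseteq>
        ideal_plus (ideal_mult ?m (ideal_gen {x})) (ideal_mult ?m (ideal_gen F))"
    proof -
      have "ideal_gen (insert x F) \<subseteq> ideal_plus (ideal_gen {x}) (ideal_gen F)"
        by (intro ideal_gen_least is_ideal_plus is_ideal_gen)
          (auto intro: ideal_plus_l ideal_plus_r ideal_gen_base)
      then show ?thesis
        by (rule order.trans[OF ideal_mult_mono[OF order.refl] ideal_mult_plus_le])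
    qed
    then have *: "insert x F \<subseteq> ideal_plus K (ideal_plus (ideal_mult ?m (ideal_gen {x})) (ideal_mult ?m (ideal_gen F)))"
      using insert.prems(2) by (meson ideal_plus_mono order.refl order.trans)
    have "F \<subseteq> ideal_plus K' (ideal_mult ?m (ideal_gen F))"
    proof
      fix y assume "y \<in> F"
      with * have "y \<in> ideal_plus K (ideal_plus (ideal_mult ?m (ideal_gen {x})) (ideal_mult ?m (ideal_gen F)))"
        by auto
      then obtain a b c where y: "y = a + (b + c)" "a \<in> K" "b \<in> ideal_mult ?m (ideal_gen {x})"
        "c \<in> ideal_mult ?m (ideal_gen F)"
        by (elim ideal_plusE) simp
      have "b \<in> ideal_gen {x}" using y(3) ideal_mult_subset_r[of "ideal_gen {x}"] by auto
      then have "a + b \<in> K'" using y(2) unfolding K'_def by (intro ideal_plusI)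
      then show "y \<in> ideal_plus K' (ideal_mult ?m (ideal_gen F))"
        using ideal_plusI[OF _ y(4), of "a + b"] by (simp add: y(1) add.assoc)
    qed
    then have F: "F \<subseteq> K'" using insert.IH[OF K'] by blast
    from * have "x \<in> ideal_plus K (ideal_plus (ideal_mult ?m (ideal_gen {x})) (ideal_mult ?m (ideal_gen F)))"
      by auto
    then obtain a b c where x: "x = a + (b + c)" "a \<in> K" "b \<in> ideal_mult ?m (ideal_gen {x})"
        "c \<in> ideal_mult ?m (ideal_gen F)"
      by (elim ideal_plusE) simp
    have "ideal_mult ?m (ideal_gen F) \<subseteq> ideal_plus K (ideal_mult ?m (ideal_gen {x}))"
    proof -
      have "ideal_gen F \<subseteq> K'" using F K' by (rule ideal_gen_least)
      then have "ideal_mult ?m (ideal_gen F) \<subseteq> ideal_mult ?m K'" by (rule ideal_mult_mono[OF order.refl])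
      also have "\<dots> \<subseteq> ideal_plus (ideal_mult ?m K) (ideal_mult ?m (ideal_gen {x}))"
        unfolding K'_def by (rule ideal_mult_plus_le)
      also have "\<dots> \<subseteq> ideal_plus K (ideal_mult ?m (ideal_gen {x}))"
        by (intro ideal_plus_mono ideal_mult_subset_r insert.prems order.refl)
      finally show ?thesis .
    qed
    then obtain a' b' where c: "c = a' + b'" "a' \<in> K" "b' \<in> ideal_mult ?m (ideal_gen {x})"
      using x(4) by (blast elim: ideal_plusE)
    have "b + b' \<in> ideal_mult ?m (ideal_gen {x})" using x c by (simp add: ideal_add)
    \<comment> \<open>The multiples of \<open>x\<close> by elements of the maximal ideal already
      form an ideal, so \<open>b + b'\<close> is a single product \<open>v * x\<close>.\<close>
    moreover have "ideal_mult ?m (ideal_gen {x}) \<subseteq> {v * x |v. v \<in> ?m}"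
    proof (rule ideal_mult_least)
      fix u v assume "u \<in> ?m" "v \<in> ideal_gen {x}"
      then obtain r where "v = r * x" by (metis ideal_gen_singleE)
      then have "u * v = (u * r) * x" by (simp add: mult.assoc)
      then show "u * v \<in> {v * x |v. v \<in> ?m}"
        using \<open>u \<in> ?m\<close> ideal_mult_r[OF is_ideal_max_ideal] by blast
    next
      show "is_ideal {v * x |v. v \<in> ?m}"
      proof (rule is_idealI)
        show "0 \<in> {v * x |v. v \<in> ?m}" by (auto intro!: exI[of _ 0] ideal_zero)
      next
        fix p q assume "p \<in> {v * x |v. v \<in> ?m}" "q \<in> {v * x |v. v \<in> ?m}"
        then obtain v w where "p = v * x" "q = w * x" "v \<in> ?m" "w \<in> ?m" by blast
        then show "p + q \<in> {v * x |v. v \<in> ?m}"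
          by (auto intro!: exI[of _ "v + w"] ideal_add simp: distrib_right)
      next
        fix c p assume "p \<in> {v * x |v. v \<in> ?m}"
        then obtain v where "p = v * x" "v \<in> ?m" by blast
        then show "c * p \<in> {v * x |v. v \<in> ?m}"
          by (auto intro!: exI[of _ "c * v"] ideal_mult_l simp: mult.assoc)
      qed
    qed
    ultimately obtain v where v: "b + b' = v * x" "v \<in> ?m" by auto
    have "x - (b + b') = a + a'" using x(1) c(1) by (simp add: algebra_simps)
    then have "(1 - v) * x = a + a'" by (simp add: v(1) left_diff_distrib)
    then have "(1 - v) * x \<in> K" using x c insert.prems by (simp add: ideal_add)
    moreover obtain w where w: "1 = (1 - v) * w" using mfps_one_diff_unit[OF v(2)] by (rule dvdE)
    ultimately have "w * ((1 - v) * x) \<in> K" using insert.prems(1) by (simp add: ideal_mult_l)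
    moreover have "w * ((1 - v) * x) = x"
      using w by (metis mult.assoc mult.commute mult.left_neutral)
    ultimately have "x \<in> K" by simp
    moreover from this have "K' \<subseteq> K"
      unfolding K'_def using insert.prems(1) by (intro ideal_plus_least ideal_gen_least) auto
    ultimately show ?case using F by auto
  qed simp
  from this[OF assms(1,2)] assms(3) have "F \<subseteq> K"
    using ideal_gen_base by blast
  then show ?thesis using assms(2) by (rule ideal_gen_least)
qed

text \<open>The factor coming from the exponent of a product monomial splits as a sum over its two
  factors. Shifting the summation by one step in direction \<open>i\<close> loses only terms whose
  integer factor is 0, so the characteristic is irrelevant.\<close>

lemma mfps_deriv_mult:
  "mfps_deriv i (u * f) = mfps_deriv i u * f + u * mfps_deriv i f"
  for f :: "('a::comm_ring_1, 'n) mfps"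
proof (rule mfps_eqI)
  fix a :: "'n \<Rightarrow>\<^sub>0 nat"
  define e :: "'n \<Rightarrow>\<^sub>0 nat" where "e = Poly_Mapping.single i 1"
  let ?D = "\<lambda>a. {(b, c :: 'n \<Rightarrow>\<^sub>0 nat). b + c = a}"
  have shift: "(\<Sum>(b, c)\<in>?D (a + e). of_nat (Poly_Mapping.lookup b i) * F b c)
      = (\<Sum>(b, c)\<in>?D a. of_nat (Poly_Mapping.lookup b i + 1) * F (b + e) c)" for F :: "_ \<Rightarrow> _ \<Rightarrow> 'a"
  proof -
    have "(\<Sum>(b, c)\<in>?D a. of_nat (Poly_Mapping.lookup b i + 1) * F (b + e) c) =
        (\<Sum>(b, c)\<in>(\<lambda>(b, c). (b + e, c)) ` ?D a. of_nat (Poly_Mapping.lookup b i) * F b c)"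
      by (subst sum.reindex) (auto simp: inj_on_def e_def lookup_add intro!: sum.cong)
    also have "\<dots> = (\<Sum>(b, c)\<in>?D (a + e). of_nat (Poly_Mapping.lookup b i) * F b c)"
    proof (rule sum.mono_neutral_left)
      show "\<forall>x\<in>?D (a + e) - (\<lambda>(b, c). (b + e, c)) ` ?D a.
          (case x of (b, c) \<Rightarrow> of_nat (Poly_Mapping.lookup b i) * F b c) = 0"
      proof clarify
        fix b c assume bc: "b + c = a + e" "(b, c) \<notin> (\<lambda>(b, c). (b + e, c)) ` ?D a"
        have "Poly_Mapping.lookup b i = 0"
        proof (rule ccontr)
          assume "Poly_Mapping.lookup b i \<noteq> 0"
          then obtain b' where b: "b = b' + e" unfolding e_def by (metis exponent_split gr0I)
          then have "b' + c = a" using bc(1) by (metis add.assoc add.commute add_right_cancel)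
          then show False using bc(2) b by auto
        qed
        then show "of_nat (Poly_Mapping.lookup b i) * F b c = 0" by simp
      qed
    qed (auto simp: finite_exponent_splits add.assoc add.commute[of e])
    finally show ?thesis by simp
  qed
  have shift': "(\<Sum>(b, c)\<in>?D (a + e). of_nat (Poly_Mapping.lookup c i) * F b c)
      = (\<Sum>(b, c)\<in>?D a. of_nat (Poly_Mapping.lookup c i + 1) * F b (c + e))" for F :: "_ \<Rightarrow> _ \<Rightarrow> 'a"
  proof -
    have sw: "(\<Sum>(b, c)\<in>?D a. G b c) = (\<Sum>(b, c)\<in>?D a. G c b)" for a and G :: "_ \<Rightarrow> _ \<Rightarrow> 'a"
      by (rule sum.reindex_bij_witness[of _ prod.swap prod.swap]) (auto simp: add.commute)
    show ?thesis using shift[of "\<lambda>b c. F c b"] by (subst sw, subst (2) sw) simp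
  qed
  have D1: "mfps_nth (mfps_deriv i u * f) a =
      (\<Sum>(b, c)\<in>?D a. of_nat (Poly_Mapping.lookup b i + 1) * (mfps_nth u (b + e) * mfps_nth f c))"
    unfolding mfps_nth_mult by (simp only: mfps_deriv_def mfps_nth_Abs e_def mult.assoc)
  have D2: "mfps_nth (u * mfps_deriv i f) a =
      (\<Sum>(b, c)\<in>?D a. of_nat (Poly_Mapping.lookup c i + 1) * (mfps_nth u b * mfps_nth f (c + e)))"
    unfolding mfps_nth_mult by (simp only: mfps_deriv_def mfps_nth_Abs e_def mult.left_commute)
  have "mfps_nth (mfps_deriv i (u * f)) a =
      (\<Sum>(b, c)\<in>?D (a + e). of_nat (Poly_Mapping.lookup (a + e) i) * (mfps_nth u b * mfps_nth f c))"
    by (simp add: mfps_deriv_def mfps_nth_mult sum_distrib_left e_def lookup_add case_prod_unfold)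
  also have "\<dots> = (\<Sum>(b, c)\<in>?D (a + e). of_nat (Poly_Mapping.lookup b i) * (mfps_nth u b * mfps_nth f c)
       + of_nat (Poly_Mapping.lookup c i) * (mfps_nth u b * mfps_nth f c))"
  proof (rule sum.cong, simp, clarify)
    fix b c assume bc: "b + c = a + e"
    show "of_nat (Poly_Mapping.lookup (a + e) i) * (mfps_nth u b * mfps_nth f c) =
        of_nat (Poly_Mapping.lookup b i) * (mfps_nth u b * mfps_nth f c)
        + of_nat (Poly_Mapping.lookup c i) * (mfps_nth u b * mfps_nth f c)"
      unfolding bc[symmetric] by (simp only: lookup_add of_nat_add distrib_right)
  qed
  also have "\<dots> = mfps_nth (mfps_deriv i u * f + u * mfps_deriv i f) a"
    using shift[of "\<lambda>b c. mfps_nth u b * mfps_nth f c"] shift'[of "\<lambda>b c. mfps_nth u b * mfps_nth f c"]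
    by (simp add: case_prod_unfold sum.distrib D1 D2)
  finally show "mfps_nth (mfps_deriv i (u * f)) a = mfps_nth (mfps_deriv i u * f + u * mfps_deriv i f) a" .
qed

subsection \<open>Codimension of ideals over the base field\<close>

text \<open>Gaussian elimination: one equation is used to eliminate a pivot unknown
  \<open>r\<close>, whose value \<open>- s\<close> is recovered from that equation at the
  end.\<close>

lemma homogeneous_system:
  fixes A :: "'i \<Rightarrow> 'j \<Rightarrow> 'k::field"
  assumes "finite J" "finite I" "card J < card I"
  obtains c where "\<exists>i\<in>I. c i \<noteq> 0" "\<And>j. j \<in> J \<Longrightarrow> (\<Sum>i\<in>I. c i * A i j) = 0"
proof -
  have "\<exists>c. (\<exists>i\<in>I. c i \<noteq> 0) \<and> (\<forall>j\<in>J. (\<Sum>i\<in>I. c i * A i j) = 0)"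
    using assms
  proof (induction J arbitrary: I A rule: finite_induct)
    case empty
    then have "I \<noteq> {}" by auto
    then show ?case by (auto intro!: exI[of _ "\<lambda>_. 1"])
  next
    case (insert j J)
    show ?case
    proof (cases "\<forall>i\<in>I. A i j = 0")
      case True
      from insert.IH[OF insert.prems(1), of A] insert.prems insert.hyps
      obtain c where "\<exists>i\<in>I. c i \<noteq> 0" "\<forall>j\<in>J. (\<Sum>i\<in>I. c i * A i j) = 0" by auto
      with True show ?thesis by (auto intro!: exI[of _ c])
    next
      case False
      then obtain r where r: "r \<in> I" "A r j \<noteq> 0" by auto
      define A' where "A' i l = A i l - A i j / A r j * A r l" for i l
      have "card J < card (I - {r})" using insert.prems insert.hyps r by auto
      from insert.IH[OF _ this, of A'] insert.prems
      obtain c where c: "\<exists>i\<in>I - {r}. c i \<noteq> 0" "\<forall>l\<in>J. (\<Sum>i\<in>I - {r}. c i * A' i l) = 0" by auto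
      define s where "s = (\<Sum>i\<in>I - {r}. c i * (A i j / A r j))"
      define d where "d i = (if i = r then - s else c i)" for i
      have d: "(\<Sum>i\<in>I. d i * A i l) = (\<Sum>i\<in>I - {r}. c i * A' i l)" for l
      proof -
        have "(\<Sum>i\<in>I. d i * A i l) = - s * A r l + (\<Sum>i\<in>I - {r}. c i * A i l)"
          using r insert.prems by (subst sum.remove[of _ r]) (auto simp: d_def intro!: sum.cong)
        also have "\<dots> = (\<Sum>i\<in>I - {r}. c i * A' i l)"
          by (simp add: A'_def s_def algebra_simps sum_subtractf sum_distrib_right sum_distrib_left sum_negf)
        finally show ?thesis .
      qed
      have "(\<Sum>i\<in>I - {r}. c i * A' i j) = 0" using r by (simp add: A'_def)
      then have "\<forall>l\<in>insert j J. (\<Sum>i\<in>I. d i * A i l) = 0" using c(2) by (simp add: d)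
      moreover have "\<exists>i\<in>I. d i \<noteq> 0" using c(1) by (auto simp: d_def)
      ultimately show ?thesis by blast
    qed
  qed
  then obtain c where "\<exists>i\<in>I. c i \<noteq> 0" "\<forall>j\<in>J. (\<Sum>i\<in>I. c i * A i j) = 0" by blast
  then show thesis by (intro that[of c]) auto
qed

text \<open>Indexed families replace the sets of \<open>quot_basis\<close>: the bases of R/J^s below
  are indexed by pairs of a basis index and an exponent.\<close>

definition lcomb :: "('i \<Rightarrow> 'a::comm_ring_1) \<Rightarrow> ('i \<Rightarrow> ('a, 'n) mfps) \<Rightarrow> 'i set \<Rightarrow> ('a, 'n) mfps" where
  "lcomb c b I = (\<Sum>i\<in>I. mfps_const (c i) * b i)"

definition indep_mod :: "('a::field, 'n) mfps set \<Rightarrow> 'i set \<Rightarrow> ('i \<Rightarrow> ('a, 'n) mfps) \<Rightarrow> bool" where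
  "indep_mod W I b \<longleftrightarrow> finite I \<and> (\<forall>c. lcomb c b I \<in> W \<longrightarrow> (\<forall>i\<in>I. c i = 0))"

definition spans_mod :: "('a::field, 'n) mfps set \<Rightarrow> 'i set \<Rightarrow> ('i \<Rightarrow> ('a, 'n) mfps) \<Rightarrow> bool" where
  "spans_mod W I b \<longleftrightarrow> finite I \<and> (\<forall>h. \<exists>c. h - lcomb c b I \<in> W)"

lemma lcomb_diff: "lcomb (\<lambda>i. c i - d i) b I = lcomb c b I - lcomb d b I"
  and lcomb_scale: "lcomb (\<lambda>i. x * c i) b I = mfps_const x * lcomb c b I"
  by (simp_all add: lcomb_def mfps_const_diff mfps_const_mult distrib_right
      left_diff_distrib sum.distrib sum_subtractf sum_distrib_left mult.assoc)

lemma lcomb_in_ideal: "is_ideal V \<Longrightarrow> (\<And>i. i \<in> I \<Longrightarrow> b i \<in> V) \<Longrightarrow> lcomb c b I \<in> V"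
  unfolding lcomb_def by (intro ideal_sum ideal_mult_l)

lemma indep_mod_le_spans_mod:
  assumes W: "is_ideal W" and I: "indep_mod W I b" and J: "spans_mod W J b'"
  shows "card I \<le> card J"
proof (rule ccontr)
  assume "\<not> card I \<le> card J"
  then have lt: "card J < card I" by simp
  from J have "\<forall>i. \<exists>c. b i - lcomb c b' J \<in> W" by (auto simp: spans_mod_def)
  then obtain A where A: "\<And>i. b i - lcomb (A i) b' J \<in> W" by metis
  have fin: "finite I" "finite J" using I J by (auto simp: indep_mod_def spans_mod_def)
  obtain c where c: "\<exists>i\<in>I. c i \<noteq> 0" "\<And>j. j \<in> J \<Longrightarrow> (\<Sum>i\<in>I. c i * A i j) = 0"
    using homogeneous_system[OF fin(2,1) lt] by blast
  have "(\<Sum>i\<in>I. mfps_const (c i) * lcomb (A i) b' J) = lcomb (\<lambda>j. \<Sum>i\<in>I. c i * A i j) b' J"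
    unfolding lcomb_def mfps_const_sum sum_distrib_left sum_distrib_right mfps_const_mult
    by (subst sum.swap) (simp add: mult.assoc)
  also have "\<dots> = 0" using c(2) by (simp add: lcomb_def)
  finally have "lcomb c b I = (\<Sum>i\<in>I. mfps_const (c i) * (b i - lcomb (A i) b' J))"
    by (simp add: right_diff_distrib sum_subtractf lcomb_def)
  then have "lcomb c b I \<in> W" using A by (simp add: ideal_sum ideal_mult_l W)
  then show False using c(1) I by (auto simp: indep_mod_def)
qed

lemma lcomb_reindex:
  assumes "bij_betw h I' I" shows "lcomb c b I = lcomb (c \<circ> h) (b \<circ> h) I'"
  unfolding lcomb_def by (simp add: sum.reindex_bij_betw[OF assms, symmetric])

lemma spans_mod_reindex:
  assumes h: "bij_betw h I' I" and "spans_mod W I b" shows "spans_mod W I' (b \<circ> h)"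
  using assms(2) unfolding spans_mod_def lcomb_reindex[OF h] by (metis bij_betw_finite h)

definition fincod :: "('a::field, 'n) mfps set \<Rightarrow> bool" where
  "fincod W \<longleftrightarrow> (\<exists>d. \<exists>b :: nat \<Rightarrow> _. spans_mod W {..<d} b)"

text \<open>The k-dimension of R/W as a natural number (\<open>cod_eqI\<close>,
  \<open>quot_dim_eq\<close>); meaningful only together with \<open>fincod W\<close>.\<close>

definition cod :: "('a::field, 'n) mfps set \<Rightarrow> nat" where
  "cod W = (LEAST d. \<exists>b :: nat \<Rightarrow> _. spans_mod W {..<d} b)"

lemma spans_mod_fincod:
  assumes "spans_mod W I b" shows "fincod W" "cod W \<le> card I"
proof -
  have "finite I" using assms by (simp add: spans_mod_def)
  then obtain h where "bij_betw h {..<card I} I"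
    by (metis bij_betw_from_nat_into_finite)
  then have *: "spans_mod W {..<card I} (b \<circ> h)" using assms by (rule spans_mod_reindex)
  then show "fincod W" unfolding fincod_def by blast
  show "cod W \<le> card I" unfolding cod_def by (rule Least_le) (use * in blast)
qed

text \<open>A spanning family of least size is independent: a nontrivial relation would allow one
  member to be dropped.\<close>

lemma fincod_basis:
  assumes W: "is_ideal W" and "fincod W"
  obtains b :: "nat \<Rightarrow> ('a::field, 'n) mfps"
  where "spans_mod W {..<cod W} b" "indep_mod W {..<cod W} b"
proof -
  obtain b :: "nat \<Rightarrow> ('a, 'n) mfps" where b: "spans_mod W {..<cod W} b"
    using LeastI_ex[OF assms(2)[unfolded fincod_def]] unfolding cod_def by blast
  have "indep_mod W {..<cod W} b"
    unfolding indep_mod_def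
  proof (intro conjI allI impI ballI; (rule ccontr)?)
    fix c r assume c: "lcomb c b {..<cod W} \<in> W" and r: "r \<in> {..<cod W}" "c r \<noteq> 0"
    have "spans_mod W ({..<cod W} - {r}) b"
      unfolding spans_mod_def
    proof (intro conjI allI)
      fix h
      from b obtain d where d: "h - lcomb d b {..<cod W} \<in> W" by (auto simp: spans_mod_def)
      define e where "e i = d i - d r / c r * c i" for i
      have "lcomb e b {..<cod W} = lcomb d b {..<cod W} - mfps_const (d r / c r) * lcomb c b {..<cod W}"
        unfolding e_def by (simp only: lcomb_diff lcomb_scale)
      then have "h - lcomb e b {..<cod W} = (h - lcomb d b {..<cod W}) + mfps_const (d r / c r) * lcomb c b {..<cod W}"
        by simp
      also have "\<dots> \<in> W" using d c W by (intro ideal_add ideal_mult_l)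
      finally have "h - lcomb e b {..<cod W} \<in> W" .
      moreover have "e r = 0" using r by (simp add: e_def)
      then have "lcomb e b {..<cod W} = lcomb e b ({..<cod W} - {r})"
        unfolding lcomb_def using r by (subst sum.remove[of _ r]) auto
      ultimately show "\<exists>c. h - lcomb c b ({..<cod W} - {r}) \<in> W" by auto
    qed simp
    then have "cod W \<le> card ({..<cod W} - {r})" by (rule spans_mod_fincod)
    then show False using r by simp
  qed simp
  with b that show thesis by blast
qed

lemma indep_mod_le_cod:
  "is_ideal W \<Longrightarrow> fincod W \<Longrightarrow> indep_mod W I b \<Longrightarrow> card I \<le> cod W"
  by (metis fincod_basis indep_mod_le_spans_mod card_lessThan)

lemma cod_eqI:
  "is_ideal W \<Longrightarrow> indep_mod W I b \<Longrightarrow> spans_mod W I b \<Longrightarrow> cod W = card I"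
  by (meson indep_mod_le_cod order_antisym spans_mod_fincod)

lemma spans_mod_mono: "W \<subseteq> V \<Longrightarrow> spans_mod W I b \<Longrightarrow> spans_mod V I b"
  unfolding spans_mod_def by blast

lemma fincod_mono: "W \<subseteq> V \<Longrightarrow> fincod W \<Longrightarrow> fincod V"
  unfolding fincod_def using spans_mod_mono by blast

lemma cod_mono:
  assumes "is_ideal W" "W \<subseteq> V" "fincod W" shows "cod V \<le> cod W"
proof -
  obtain b :: "nat \<Rightarrow> _" where "spans_mod W {..<cod W} b" using fincod_basis[OF assms(1,3)] .
  then show ?thesis using spans_mod_fincod(2)[OF spans_mod_mono[OF assms(2)]] by fastforce
qed

text \<open>A basis modulo \<open>V\<close> together with a family inside \<open>V\<close> that is
  independent modulo \<open>W\<close> stays independent modulo \<open>W\<close>. This is the source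
  of all lower bounds for codimensions below.\<close>

lemma cod_add_indep:
  assumes W: "is_ideal W" and V: "is_ideal V" and "W \<subseteq> V" "fincod W"
    and x: "\<And>i. i \<in> I \<Longrightarrow> x i \<in> V" "indep_mod W I x"
  shows "cod V + card I \<le> cod W"
proof -
  obtain b :: "nat \<Rightarrow> _" where b: "indep_mod V {..<cod V} b"
    using fincod_basis[OF V fincod_mono[OF assms(3,4)]] .
  have fin: "finite I" using x by (simp add: indep_mod_def)
  have split: "lcomb c (case_sum b x) ({..<cod V} <+> I) = lcomb (c \<circ> Inl) b {..<cod V} + lcomb (c \<circ> Inr) x I" for c
    unfolding lcomb_def using fin by (subst sum.Plus) auto
  have "indep_mod W ({..<cod V} <+> I) (case_sum b x)"
    unfolding indep_mod_def split
  proof (intro conjI allI impI)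
    fix c assume c: "lcomb (c \<circ> Inl) b {..<cod V} + lcomb (c \<circ> Inr) x I \<in> W"
    have xV: "lcomb (c \<circ> Inr) x I \<in> V" using V x by (intro lcomb_in_ideal)
    have "lcomb (c \<circ> Inl) b {..<cod V} \<in> V"
      using ideal_diff[OF V subsetD[OF \<open>W \<subseteq> V\<close> c] xV] by simp
    then have l: "\<forall>i<cod V. c (Inl i) = 0" using b by (auto simp: indep_mod_def)
    then have "lcomb (c \<circ> Inr) x I \<in> W" using c by (simp add: lcomb_def)
    then have "\<forall>i\<in>I. c (Inr i) = 0" using x(2) by (auto simp: indep_mod_def)
    with l show "\<forall>i\<in>{..<cod V} <+> I. c i = 0" by auto
  qed (use fin in auto)
  then have "card ({..<cod V} <+> I) \<le> cod W" using W assms by (intro indep_mod_le_cod)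
  then show ?thesis using fin by (simp add: card_Plus)
qed

lemma cod_strict:
  assumes W: "is_ideal W" and V: "is_ideal V" and "W \<subset> V" "fincod W"
  shows "cod V < cod W"
proof -
  from assms obtain x where x: "x \<in> V" "x \<notin> W" by auto
  have "c = 0" if "mfps_const c * x \<in> W" for c
  proof (rule ccontr)
    assume "c \<noteq> 0"
    then have "mfps_const (inverse c) * (mfps_const c * x) = x"
      unfolding mult.assoc[symmetric] mfps_const_mult[symmetric] by simp
    then show False using ideal_mult_l[OF W that, of "mfps_const (inverse c)"] x(2) by simp
  qed
  then have "indep_mod W {()} (\<lambda>_. x)" by (simp add: indep_mod_def lcomb_def)
  then have "cod V + card {()} \<le> cod W" using assms x by (intro cod_add_indep) auto
  then show ?thesis by simp
qed

lemma cod_UNIV [simp]: "cod UNIV = 0" and fincod_UNIV [simp]: "fincod UNIV"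
  using spans_mod_fincod[of UNIV "{}"] by (auto simp: spans_mod_def)

lemma quot_basis_iff: "quot_basis W B \<longleftrightarrow> indep_mod W B (\<lambda>b. b) \<and> spans_mod W B (\<lambda>b. b)"
  by (auto simp: quot_basis_def indep_mod_def spans_mod_def lcomb_def)

lemma quot_dim_eq:
  fixes W :: "('a::field, 'n) mfps set"
  assumes W: "is_ideal W"
  shows "quot_dim W = (if fincod W then enat (cod W) else \<infinity>)"
proof (cases "fincod W")
  case True
  have card: "card B = cod W" if "quot_basis W B" for B
    using that cod_eqI[OF W, of B "\<lambda>b. b"] by (auto simp: quot_basis_iff)
  obtain b :: "nat \<Rightarrow> ('a, 'n) mfps" where b: "spans_mod W {..<cod W} b" "indep_mod W {..<cod W} b"
    using fincod_basis[OF W True] .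
  have inj: "inj_on b {..<cod W}"
  proof (rule inj_onI, rule ccontr)
    fix i j assume ij: "i \<in> {..<cod W}" "j \<in> {..<cod W}" "b i = b j" "i \<noteq> j"
    define c :: "nat \<Rightarrow> 'a" where "c l = (if l = i then 1 else if l = j then - 1 else 0)" for l
    have "lcomb c b {..<cod W} = (\<Sum>l\<in>{i, j}. mfps_const (c l) * b l)"
      unfolding lcomb_def using ij by (intro sum.mono_neutral_right) (auto simp: c_def)
    also have "\<dots> = 0" using ij by (simp add: c_def mfps_const_uminus)
    finally have "lcomb c b {..<cod W} \<in> W" using W by (simp add: ideal_zero)
    then have "c i = 0" using b(2) ij by (simp add: indep_mod_def)
    then show False by (simp add: c_def)
  qed
  have lc: "lcomb c (\<lambda>b. b) (b ` {..<cod W}) = lcomb (c \<circ> b) b {..<cod W}" for c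
    using lcomb_reindex[OF inj_on_imp_bij_betw[OF inj], of c "\<lambda>b. b"] by (simp add: o_def)
  have "quot_basis W (b ` {..<cod W})"
    unfolding quot_basis_iff indep_mod_def spans_mod_def lc
  proof (intro conjI allI impI)
    fix h
    from b(1) obtain c where c: "h - lcomb c b {..<cod W} \<in> W" by (auto simp: spans_mod_def)
    have "lcomb (c \<circ> the_inv_into {..<cod W} b \<circ> b) b {..<cod W} = lcomb c b {..<cod W}"
      unfolding lcomb_def by (rule sum.cong) (auto simp: the_inv_into_f_f[OF inj])
    with c show "\<exists>c. h - lcomb (c \<circ> b) b {..<cod W} \<in> W" by metis
  qed (use b(2) in \<open>auto simp: indep_mod_def o_def\<close>)
  then have "quot_dim W = enat (cod W)"
    unfolding quot_dim_def using card by (intro antisym INF_greatest INF_lower2) auto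
  then show ?thesis using True by simp
next
  case False
  then have "{B. quot_basis W B} = {}"
    using spans_mod_fincod(1) by (auto simp: quot_basis_iff)
  then show ?thesis using False by (simp add: quot_dim_def top_enat_def)
qed

text \<open>Along a strict chain the codimension drops at every step, which bounds the length.
  Conversely a chain with steps of codimension one exists because R/m = k: ideals are enlarged by
  socle elements.\<close>

lemma quot_length_eq:
  fixes I :: "('a::field, 'n::finite) mfps set"
  assumes "is_ideal I" "fincod I" "ideal_pow max_ideal N \<subseteq> I"
  shows "quot_length I = enat (cod I)"
proof -
  define S where "S I = {m. \<exists>K :: nat \<Rightarrow> ('a, 'n) mfps set.
     (\<forall>j\<le>m. is_ideal (K j) \<and> I \<subseteq> K j) \<and> (\<forall>j<m. K j \<subset> K (Suc j))}" for I
  have le: "m \<le> cod I" if m: "m \<in> S I" for m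
  proof -
    from m obtain K where K: "\<And>j. j \<le> m \<Longrightarrow> is_ideal (K j)" "\<And>j. j \<le> m \<Longrightarrow> I \<subseteq> K j"
      "\<And>j. j < m \<Longrightarrow> K j \<subset> K (Suc j)"
      unfolding S_def by blast
    have fin: "fincod (K j)" if "j \<le> m" for j using fincod_mono[OF K(2)[OF that] assms(2)] .
    have "cod (K j) + j \<le> cod (K 0)" if "j \<le> m" for j
      using that
    proof (induction j)
      case (Suc j)
      have "cod (K (Suc j)) < cod (K j)"
        using Suc.prems K fin by (intro cod_strict) auto
      then show ?case using Suc by simp
    qed simp
    from this[of m] cod_mono[of I "K 0"] K assms show ?thesis by fastforce
  qed
  have "cod I \<in> S I"
    using assms
  proof (induction "cod I" arbitrary: I)
    case 0
    then show ?case unfolding S_def by (auto intro!: exI[of _ "\<lambda>_. I"])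
  next
    case (Suc d)
    have "I \<noteq> UNIV" using Suc.hyps(2) by auto
    \<comment> \<open>An element of m^(t-1) outside \<open>I\<close> is multiplied into
      \<open>I\<close> by all of m, that is, it is a socle element of R/I.\<close>
    define t where "t = (LEAST t. ideal_pow max_ideal t \<subseteq> I)"
    have t: "ideal_pow max_ideal t \<subseteq> I" unfolding t_def by (rule LeastI) (rule Suc.prems(3))
    with \<open>I \<noteq> UNIV\<close> have "t \<noteq> 0" by (intro notI) auto
    then obtain r where r: "t = Suc r" by (metis not0_implies_Suc)
    have "\<not> ideal_pow max_ideal r \<subseteq> I"
      using not_less_Least[of r "\<lambda>t. ideal_pow max_ideal t \<subseteq> I"] r unfolding t_def by simp
    then obtain x where x: "x \<in> ideal_pow max_ideal r" "x \<notin> I" by auto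
    have mx: "v * x \<in> I" if "v \<in> max_ideal" for v
      using ideal_mult_mem[OF that x(1)] t r by auto
    define V where "V = ideal_plus I (ideal_gen {x})"
    have V: "is_ideal V" using Suc.prems by (simp add: V_def is_ideal_plus)
    have IV: "I \<subset> V"
      using Suc.prems x ideal_plus_l[of "ideal_gen {x}" _ I] ideal_plus_r[of I x "ideal_gen {x}"]
      by (auto simp: V_def ideal_gen_base)
    have finV: "fincod V" by (rule fincod_mono[OF _ Suc.prems(2)]) (use IV in blast)
    have lt: "cod V < cod I" using Suc.prems V IV by (intro cod_strict)
    obtain b :: "nat \<Rightarrow> _" where b: "spans_mod V {..<cod V} b" using fincod_basis[OF V finV] .
    have "spans_mod I {..<Suc (cod V)} (b(cod V := x))"
      unfolding spans_mod_def
    proof (intro conjI allI)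
      fix h
      from b obtain c where "h - lcomb c b {..<cod V} \<in> V" by (auto simp: spans_mod_def)
      then obtain y q where y: "h - lcomb c b {..<cod V} = y + q * x" "y \<in> I"
        unfolding V_def by (metis ideal_plusE ideal_gen_singleE)
      \<comment> \<open>Since m \<open>x\<close> lies in \<open>I\<close>, the factor
        \<open>q\<close> matters only through its constant term.\<close>
      define d where "d = c(cod V := mfps_nth q 0)"
      have "lcomb d (b(cod V := x)) {..<Suc (cod V)} = lcomb c b {..<cod V} + mfps_const (mfps_nth q 0) * x"
        by (simp add: lcomb_def d_def)
      then have "h - lcomb d (b(cod V := x)) {..<Suc (cod V)} = y + (q - mfps_const (mfps_nth q 0)) * x"
        using y(1) by (simp add: algebra_simps)
      also have "\<dots> \<in> I"
        using y(2) mx[OF diff_const_in_max_ideal] Suc.prems(1) by (intro ideal_add)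
      finally show "\<exists>c. h - lcomb c (b(cod V := x)) {..<Suc (cod V)} \<in> I" by blast
    qed simp
    then have "cod I \<le> Suc (cod V)" using spans_mod_fincod(2) by fastforce
    with lt Suc.hyps(2) have d: "d = cod V" by simp
    have "ideal_pow max_ideal N \<subseteq> V" using Suc.prems IV by blast
    from Suc.hyps(1)[OF d V finV this] obtain K where
      K: "\<And>j. j \<le> d \<Longrightarrow> is_ideal (K j)" "\<And>j. j \<le> d \<Longrightarrow> V \<subseteq> K j" "\<And>j. j < d \<Longrightarrow> K j \<subset> K (Suc j)"
      unfolding S_def d[symmetric] by blast
    define K' where "K' j = (case j of 0 \<Rightarrow> I | Suc j \<Rightarrow> K j)" for j
    have "is_ideal (K' j) \<and> I \<subseteq> K' j" if "j \<le> Suc d" for j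
      using that K(1) Suc.prems psubset_imp_subset[OF IV] order.trans[OF _ K(2), of I]
      by (cases j) (simp_all add: K'_def)
    moreover have "K' j \<subset> K' (Suc j)" if "j < Suc d" for j
      using that K(3) IV K(2)[of 0] by (cases j) (auto simp: K'_def)
    ultimately show ?case unfolding S_def Suc.hyps(2)[symmetric] by blast
  qed
  with le have "(SUP m\<in>S I. enat m) = enat (cod I)"
    by (intro antisym SUP_least SUP_upper) auto
  then show ?thesis by (simp add: quot_length_def S_def)
qed

subsection \<open>The Koszul complex\<close>

text \<open>\<open>idx\<close> numbers the variables; the sign is that of moving the i-th basis
  vector to its place in the ordered exterior product over \<open>A\<close>.\<close>

definition ksign :: "('n \<Rightarrow> nat) \<Rightarrow> 'n \<Rightarrow> 'n set \<Rightarrow> 'a::comm_ring_1" where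
  "ksign idx i A = (- 1) ^ card {j \<in> A. idx j < idx i}"

text \<open>Chains are families indexed by the subsets \<open>A\<close> of the index set; \<open>\<omega> A\<close> is the coefficient
  of the exterior product of the basis vectors in \<open>A\<close>.\<close>

definition kdiff :: "('n::finite \<Rightarrow> nat) \<Rightarrow> ('n \<Rightarrow> 'a::comm_ring_1) \<Rightarrow> ('n set \<Rightarrow> 'a) \<Rightarrow> 'n set \<Rightarrow> 'a" where
  "kdiff idx g \<omega> A = (\<Sum>i\<in>-A. ksign idx i A * g i * \<omega> (insert i A))"

text \<open>Exterior multiplication by the vector with coordinates \<open>c\<close>; it raises the
  degree by one and serves as a homotopy in \<open>kdiff_khtpy\<close>.\<close>

definition khtpy :: "('n::finite \<Rightarrow> nat) \<Rightarrow> ('n \<Rightarrow> 'a::comm_ring_1) \<Rightarrow> ('n set \<Rightarrow> 'a) \<Rightarrow> 'n set \<Rightarrow> 'a" where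
  "khtpy idx c \<omega> A = (\<Sum>i\<in>A. ksign idx i (A - {i}) * c i * \<omega> (A - {i}))"

lemma ksign_insert:
  assumes "j \<notin> A" "finite A"
  shows "ksign idx i (insert j A) = (if idx j < idx i then - ksign idx i A else ksign idx i A)"
proof (cases "idx j < idx i")
  case True
  have "{l \<in> insert j A. idx l < idx i} = insert j {l \<in> A. idx l < idx i}" using True by auto
  then show ?thesis using True assms by (simp add: ksign_def)
next
  case False
  have "{l \<in> insert j A. idx l < idx i} = {l \<in> A. idx l < idx i}" using False by auto
  then show ?thesis using False by (simp add: ksign_def)
qed

text \<open>The terms are cancelled in pairs. Concluding from S = -S would fail in characteristic
  2.\<close>

lemma sum_antisym_zero:
  fixes t :: "'i \<Rightarrow> 'i \<Rightarrow> 'a::ab_group_add"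
  assumes "finite B" "\<And>i j. i \<in> B \<Longrightarrow> j \<in> B \<Longrightarrow> i \<noteq> j \<Longrightarrow> t i j = - t j i"
  shows "(\<Sum>i\<in>B. \<Sum>j\<in>B - {i}. t i j) = 0"
  using assms
proof (induction B rule: finite_induct)
  case (insert b B)
  have "(\<Sum>i\<in>B. \<Sum>j\<in>insert b B - {i}. t i j) = (\<Sum>i\<in>B. t i b + (\<Sum>j\<in>B - {i}. t i j))"
  proof (rule sum.cong)
    fix i assume "i \<in> B"
    then have "insert b B - {i} = insert b (B - {i})" using insert.hyps by auto
    then show "(\<Sum>j\<in>insert b B - {i}. t i j) = t i b + (\<Sum>j\<in>B - {i}. t i j)"
      using insert.hyps by simp
  qed simp
  also have "\<dots> = (\<Sum>i\<in>B. t i b)"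
  proof -
    have "(\<Sum>i\<in>B. \<Sum>j\<in>B - {i}. t i j) = 0" by (rule insert.IH) (rule insert.prems; simp)
    then show ?thesis by (simp add: sum.distrib)
  qed
  finally have "(\<Sum>i\<in>insert b B. \<Sum>j\<in>insert b B - {i}. t i j) = (\<Sum>i\<in>B. t b i) + (\<Sum>i\<in>B. t i b)"
    using insert.hyps by simp
  also have "\<dots> = (\<Sum>i\<in>B. t b i + t i b)" by (simp add: sum.distrib)
  also have "\<dots> = 0"
  proof (rule sum.neutral, rule ballI)
    fix i assume "i \<in> B"
    then have "t b i = - t i b" using insert.hyps by (intro insert.prems) auto
    then show "t b i + t i b = 0" by simp
  qed
  finally show ?case .
qed simp

lemma kdiff_kdiff:
  assumes idx: "inj idx" shows "kdiff idx g (kdiff idx g \<omega>) A = 0"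
proof -
  define t where "t i j = ksign idx i A * g i * (ksign idx j (insert i A) * g j * \<omega> (insert j (insert i A)))" for i j
  have "kdiff idx g (kdiff idx g \<omega>) A = (\<Sum>i\<in>-A. \<Sum>j\<in>-A - {i}. t i j)"
  proof -
    have "- insert i A = - A - {i}" for i by auto
    then show ?thesis by (simp add: kdiff_def sum_distrib_left t_def)
  qed
  also have "\<dots> = 0"
  proof (rule sum_antisym_zero)
    fix i j assume ij: "i \<in> - A" "j \<in> - A" "i \<noteq> j"
    then have "idx i \<noteq> idx j" using idx by (simp add: inj_eq)
    then have "ksign idx i A * ksign idx j (insert i A) = - (ksign idx j A * ksign idx i (insert j A) :: 'b)"
      using ij by (auto simp: ksign_insert)
    moreover have "t i j = ksign idx i A * ksign idx j (insert i A) * (g i * g j * \<omega> (insert i (insert j A)))"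
      "t j i = ksign idx j A * ksign idx i (insert j A) * (g i * g j * \<omega> (insert i (insert j A)))"
      by (simp_all add: t_def mult_ac insert_commute)
    ultimately show "t i j = - t j i" by simp
  qed simp
  finally show ?thesis .
qed

text \<open>The terms that add and remove the same index sum up to the right-hand side: indices
  outside \<open>A\<close> come from the first composite, indices inside \<open>A\<close> from the
  second. The mixed terms \<open>t\<close> and \<open>t'\<close> cancel by the sign rule.\<close>

lemma kdiff_khtpy:
  assumes idx: "inj idx"
  shows "kdiff idx g (khtpy idx c \<omega>) A + khtpy idx c (kdiff idx g \<omega>) A = (\<Sum>i\<in>UNIV. c i * g i) * \<omega> A"
proof -
  define t where "t i j = ksign idx i A * g i * (ksign idx j (insert i (A - {j})) * c j * \<omega> (insert i (A - {j})))" for i j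
  define t' where "t' i j = ksign idx j (A - {j}) * c j * (ksign idx i (A - {j}) * g i * \<omega> (insert i (A - {j})))" for i j
  have sq: "ksign idx i A * ksign idx i A = (1 :: 'b)" for i A
    by (simp add: ksign_def flip: power_mult_distrib)
  have 1: "kdiff idx g (khtpy idx c \<omega>) A = (\<Sum>i\<in>-A. c i * g i * \<omega> A) + (\<Sum>i\<in>-A. \<Sum>j\<in>A. t i j)"
    unfolding kdiff_def sum.distrib[symmetric]
  proof (rule sum.cong)
    fix i assume i: "i \<in> - A"
    then have "ksign idx i A * g i * khtpy idx c \<omega> (insert i A) =
        ksign idx i A * g i * (ksign idx i A * c i * \<omega> A) + (\<Sum>j\<in>A. t i j)"
      unfolding khtpy_def t_def sum_distrib_left[symmetric] distrib_left[symmetric]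
      by (subst sum.insert) (auto intro!: arg_cong[where f = "\<lambda>x. _ * (_ + x)"] sum.cong simp: insert_Diff_if)
    also have "ksign idx i A * g i * (ksign idx i A * c i * \<omega> A) = (ksign idx i A * ksign idx i A) * (c i * g i * \<omega> A)"
      by (simp only: mult_ac)
    finally show "ksign idx i A * g i * khtpy idx c \<omega> (insert i A) = c i * g i * \<omega> A + (\<Sum>j\<in>A. t i j)"
      by (simp add: sq)
  qed simp
  have 2: "khtpy idx c (kdiff idx g \<omega>) A = (\<Sum>i\<in>A. c i * g i * \<omega> A) + (\<Sum>j\<in>A. \<Sum>i\<in>-A. t' i j)"
    unfolding khtpy_def sum.distrib[symmetric]
  proof (rule sum.cong)
    fix j assume j: "j \<in> A"
    then have "- (A - {j}) = insert j (- A)" "insert j (A - {j}) = A" by auto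
    then have "ksign idx j (A - {j}) * c j * kdiff idx g \<omega> (A - {j}) =
        ksign idx j (A - {j}) * c j * (ksign idx j (A - {j}) * g j * \<omega> A) + (\<Sum>i\<in>-A. t' i j)"
      unfolding kdiff_def t'_def sum_distrib_left[symmetric] distrib_left[symmetric]
      using j by simp
    also have "ksign idx j (A - {j}) * c j * (ksign idx j (A - {j}) * g j * \<omega> A) =
        (ksign idx j (A - {j}) * ksign idx j (A - {j})) * (c j * g j * \<omega> A)"
      by (simp only: mult_ac)
    finally show "ksign idx j (A - {j}) * c j * kdiff idx g \<omega> (A - {j}) = c j * g j * \<omega> A + (\<Sum>i\<in>-A. t' i j)"
      by (simp add: sq)
  qed simp
  have "t i j + t' i j = 0" if ij: "i \<in> - A" "j \<in> A" for i j
  proof -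
    define B where "B = A - {j}"
    have A: "A = insert j B" and B: "j \<notin> B" "i \<notin> B" "i \<noteq> j" using ij by (auto simp: B_def)
    then have "idx i \<noteq> idx j" using idx by (simp add: inj_eq)
    then have "ksign idx i (insert j B) * ksign idx j (insert i B) = - (ksign idx j B * ksign idx i B :: 'b)"
      using B by (auto simp: ksign_insert)
    moreover have "t i j = ksign idx i (insert j B) * ksign idx j (insert i B) * (g i * c j * \<omega> (insert i B))"
      "t' i j = ksign idx j B * ksign idx i B * (g i * c j * \<omega> (insert i B))"
      using B unfolding t_def t'_def A by (simp_all add: mult_ac)
    ultimately show ?thesis by simp
  qed
  then have "(\<Sum>i\<in>-A. \<Sum>j\<in>A. t i j) + (\<Sum>j\<in>A. \<Sum>i\<in>-A. t' i j) = 0"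
    by (subst (2) sum.swap) (simp flip: sum.distrib)
  moreover have "(\<Sum>i\<in>-A. c i * g i * \<omega> A) + (\<Sum>i\<in>A. c i * g i * \<omega> A) = (\<Sum>i\<in>UNIV. c i * g i) * \<omega> A"
    unfolding sum_distrib_right[symmetric] distrib_right[symmetric]
    using sum.union_disjoint[of "- A" A "\<lambda>i. c i * g i"] by (simp add: Compl_partition2)
  ultimately show ?thesis unfolding 1 2 by (simp add: algebra_simps)
qed

lemma kdiff_diff: "kdiff idx g (\<lambda>A. \<omega> A - \<eta> A) A = kdiff idx g \<omega> A - kdiff idx g \<eta> A"
  and kdiff_scale: "kdiff idx g (\<lambda>A. x * \<omega> A) A = x * kdiff idx g \<omega> A"
  by (simp_all add: kdiff_def right_diff_distrib sum_subtractf sum_distrib_left mult_ac)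

lemma khtpy_in: "is_ideal I \<Longrightarrow> (\<And>A. \<omega> A \<in> I) \<Longrightarrow> khtpy idx c \<omega> A \<in> I"
  and kdiff_in: "is_ideal I \<Longrightarrow> (\<And>A. \<omega> A \<in> I) \<Longrightarrow> kdiff idx g \<omega> A \<in> I"
  unfolding kdiff_def khtpy_def by (intro ideal_sum ideal_mult_l; simp)+

text \<open>Depth sensitivity: modulo the first \<open>b\<close> elements of a regular sequence of length \<open>n\<close> contained in
  \<open>(g\<^sub>1, \<dots>, g\<^sub>n)\<close>, Koszul homology vanishes in degrees above \<open>b\<close>. The homotopy shows that
  the next element of the sequence annihilates homology.\<close>

lemma koszul_depth:
  fixes g :: "'n::finite \<Rightarrow> 'a::comm_ring_1" and I :: "nat \<Rightarrow> 'a set" and x :: "nat \<Rightarrow> 'a"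
  assumes idx: "inj idx"
    and I: "\<And>b. is_ideal (I b)" "\<And>b. I b \<subseteq> I (Suc b)"
    and step: "\<And>b z. b < CARD('n) \<Longrightarrow> z \<in> I (Suc b) \<Longrightarrow> \<exists>p\<in>I b. \<exists>q. z = p + x b * q"
    and x: "\<And>b. b < CARD('n) \<Longrightarrow> x b \<in> I (Suc b)" "\<And>b. b < CARD('n) \<Longrightarrow> x b \<in> ideal_gen (range g)"
    and regular: "\<And>b z. b < CARD('n) \<Longrightarrow> x b * z \<in> I b \<Longrightarrow> z \<in> I b"
    and \<omega>: "b \<le> CARD('n)" "\<And>A. card A \<le> b \<Longrightarrow> \<omega> A = 0" "\<And>A. kdiff idx g \<omega> A \<in> I b"
  shows "\<exists>v. (\<forall>A. card A \<le> Suc b \<longrightarrow> v A = 0) \<and> (\<forall>A. \<omega> A - kdiff idx g v A \<in> I b)"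
  using \<omega>
proof (induction b arbitrary: \<omega> rule: inc_induct)
  \<comment> \<open>The induction descends from b = n, where every subset has at most n elements and
    the chain therefore vanishes.\<close>
  case base
  have "card A \<le> CARD('n)" for A :: "'n set" by (simp add: card_mono)
  then have "\<omega> A = 0" for A using base by blast
  then show ?case using I by (intro exI[of _ "\<lambda>_. 0"]) (simp add: kdiff_def ideal_zero)
next
  case (step b)
  obtain c where c: "x b = (\<Sum>i\<in>UNIV. c i * g i)"
    using x(2)[OF step.hyps(2)] by (rule ideal_gen_rangeE)
  \<comment> \<open>Writing \<open>x b\<close> as a combination of the \<open>g i\<close> makes
    multiplication by \<open>x b\<close> null-homotopic: modulo \<open>I b\<close> the boundary of
    \<open>w\<close> is \<open>x b\<close> times the cycle.\<close>
  define w where "w = khtpy idx c \<omega>"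
  have w0: "w A = 0" if "card A \<le> Suc b" for A
    unfolding w_def khtpy_def
  proof (rule sum.neutral, rule ballI)
    fix i assume "i \<in> A"
    then have "card (A - {i}) \<le> b" using that by simp
    then show "ksign idx i (A - {i}) * c i * \<omega> (A - {i}) = 0" using step.prems(1) by simp
  qed
  have dw: "kdiff idx g w A - x b * \<omega> A \<in> I b" for A
  proof -
    have "kdiff idx g w A - x b * \<omega> A = - khtpy idx c (kdiff idx g \<omega>) A"
      using kdiff_khtpy[OF idx, of g c \<omega> A] by (simp add: c w_def algebra_simps)
    also have "\<dots> \<in> I b" by (intro ideal_uminus khtpy_in I step.prems)
    finally show ?thesis .
  qed
  have "kdiff idx g w A \<in> I (Suc b)" for A
    using ideal_add[OF I(1) subsetD[OF I(2) dw[of A]] ideal_mult_r[OF I(1) x(1)[OF step.hyps(2)], of "\<omega> A"]]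
    by simp
  then obtain v where v: "\<And>A. card A \<le> Suc (Suc b) \<Longrightarrow> v A = 0" "\<And>A. w A - kdiff idx g v A \<in> I (Suc b)"
    using step.IH[of w] w0 by blast
  have dv0: "kdiff idx g v A = 0" if "card A \<le> Suc b" for A
    unfolding kdiff_def using that v(1) by (intro sum.neutral) (simp add: card_insert_if)
  \<comment> \<open>Modulo \<open>I b\<close>, the elements of \<open>I (Suc b)\<close> are
    multiples of \<open>x b\<close>. In low degree the quotient is chosen to be 0, so that
    \<open>q\<close> is again a chain of the required kind.\<close>
  have "\<exists>q. (w A - kdiff idx g v A) - x b * q \<in> I b \<and> (card A \<le> Suc b \<longrightarrow> q = 0)" for A
  proof (cases "card A \<le> Suc b")
    case True
    then show ?thesis using w0 dv0 I by (auto simp: ideal_zero)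
  next
    case False
    obtain p q where "p \<in> I b" "w A - kdiff idx g v A = p + x b * q"
      using assms(4)[OF step.hyps(2) v(2)[of A]] by blast
    then show ?thesis using False by (intro exI[of _ q]) simp
  qed
  then obtain q where q: "\<And>A. (w A - kdiff idx g v A) - x b * q A \<in> I b" "\<And>A. card A \<le> Suc b \<Longrightarrow> q A = 0"
    by metis
  \<comment> \<open>Both sides agree after multiplication by \<open>x b\<close>, which is cancelled
    by regularity.\<close>
  have "\<omega> A - kdiff idx g q A \<in> I b" for A
  proof (rule regular[OF step.hyps(2)])
    have "kdiff idx g (\<lambda>A. (w A - kdiff idx g v A) - x b * q A) A \<in> I b"
      using q(1) by (rule kdiff_in[OF I(1)])
    then have "kdiff idx g w A - x b * kdiff idx g q A \<in> I b"
      by (simp add: kdiff_diff kdiff_scale kdiff_kdiff[OF idx])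
    from ideal_diff[OF I(1) this dw[of A]]
    show "x b * (\<omega> A - kdiff idx g q A) \<in> I b" by (simp add: right_diff_distrib)
  qed
  with q(2) show ?case by blast
qed

text \<open>A relation is a 1-cycle of the Koszul complex, hence the boundary of a 2-chain; the
  component of such a boundary at {i} involves only the \<open>g j\<close> with j different from i.
  The regular sequence fed into \<open>koszul_depth\<close> consists of the N-th powers of the
  variables.\<close>

lemma syzygy_coefficient:
  fixes g :: "'n::finite \<Rightarrow> ('a::comm_ring_1, 'n) mfps"
  assumes N: "ideal_pow max_ideal N \<subseteq> ideal_gen (range g)"
    and c: "(\<Sum>i\<in>UNIV. c i * g i) = 0"
  shows "c i \<in> ideal_gen (g ` (UNIV - {i}))"
proof -
  obtain idx where idx: "bij_betw idx (UNIV :: 'n set) {..<CARD('n)}"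
    using ex_bij_betw_finite_nat[of "UNIV :: 'n set"] by (auto simp: atLeast0LessThan)
  then have inj: "inj idx" by (simp add: bij_betw_def)
  define e where "e b = inv_into UNIV idx b" for b
  have e: "idx (e b) = b" if "b < CARD('n)" for b
    using that idx unfolding e_def by (metis bij_betw_inv_into_right lessThan_iff)
  have eo: "idx i = b \<Longrightarrow> e b = i" for i b unfolding e_def using inj by auto
  \<comment> \<open>The ideal generated by the N-th powers of the first \<open>b\<close> variables,
    described by the monomials that may occur.\<close>
  define I :: "nat \<Rightarrow> ('a, 'n) mfps set"
    where "I b = {h. \<forall>a. (\<forall>i. idx i < b \<longrightarrow> Poly_Mapping.lookup a i < N) \<longrightarrow> mfps_nth h a = 0}" for b
  define X where "X b = Poly_Mapping.single (e b) N" for b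
  have lX: "Poly_Mapping.lookup (X b) i = (if i = e b then N else 0)" for b i
    by (simp add: X_def lookup_single when_def)
  have ideal: "is_ideal (I b)" for b
  proof (rule is_idealI)
    fix p h assume h: "h \<in> I b"
    show "p * h \<in> I b"
      unfolding I_def
    proof (intro CollectI allI impI)
      fix a assume a: "\<forall>i. idx i < b \<longrightarrow> Poly_Mapping.lookup a i < N"
      show "mfps_nth (p * h) a = 0"
        unfolding mfps_nth_mult
      proof (rule sum.neutral, clarify)
        fix y z assume "a = y + z"
        then have "\<forall>i. idx i < b \<longrightarrow> Poly_Mapping.lookup z i < N" using a by (simp add: lookup_add)
          (meson add_lessD1 add.commute le_add2 order.strict_trans1)
        then show "mfps_nth p y * mfps_nth h z = 0" using h by (simp add: I_def)
      qed
    qed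
  qed (auto simp: I_def)
  have split: "\<exists>p\<in>I b. \<exists>q. z = p + mfps_monom (X b) * q" if b: "b < CARD('n)" and z: "z \<in> I (Suc b)" for b z
  proof -
    define p :: "('a, 'n) mfps" where "p = Abs_mfps (\<lambda>a. if Poly_Mapping.lookup a (e b) < N then mfps_nth z a else 0)"
    define q :: "('a, 'n) mfps" where "q = Abs_mfps (\<lambda>a. mfps_nth z (X b + a))"
    have "p \<in> I b"
      using z b eo[of _ b] by (auto simp: I_def p_def less_Suc_eq)
    moreover have "z = p + mfps_monom (X b) * q"
    proof (rule mfps_eqI)
      fix a
      show "mfps_nth z a = mfps_nth (p + mfps_monom (X b) * q) a"
      proof (cases "Poly_Mapping.lookup a (e b) < N")
        case True
        then have "mfps_nth (mfps_monom (X b) * q) a = 0"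
          by (intro mfps_nth_monom_mult_0) (auto simp: lookup_add lX)
        then show ?thesis using True by (simp add: p_def)
      next
        case False
        then have "a = X b + (a - X b)"
          by (intro poly_mapping_eqI) (auto simp: lookup_add lookup_minus lX)
        then have "mfps_nth (mfps_monom (X b) * q) a = mfps_nth z a"
          by (metis mfps_nth_monom_mult q_def mfps_nth_Abs)
        then show ?thesis using False by (simp add: p_def)
      qed
    qed
    ultimately show ?thesis by blast
  qed
  have X1: "mfps_monom (X b) \<in> I (Suc b)" if "b < CARD('n)" for b
    using e[OF that] by (fastforce simp: I_def mfps_nth_monom lX)
  have X2: "mfps_monom (X b) \<in> ideal_gen (range g)" if "b < CARD('n)" for b
    using N by (intro subsetD[OF N]) (auto simp: max_ideal_pow order_ideal_def mfps_nth_monom X_def)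
  have reg: "z \<in> I b" if b: "b < CARD('n)" and z: "mfps_monom (X b) * z \<in> I b" for b z
    unfolding I_def
  proof (intro CollectI allI impI)
    fix a assume a: "\<forall>i. idx i < b \<longrightarrow> Poly_Mapping.lookup a i < N"
    then have "\<forall>i. idx i < b \<longrightarrow> Poly_Mapping.lookup (X b + a) i < N"
      using e[OF b] by (auto simp: lookup_add lX)
    then have "mfps_nth (mfps_monom (X b) * z) (X b + a) = 0" using z unfolding I_def by blast
    then show "mfps_nth z a = 0" by simp
  qed
  \<comment> \<open>The coefficients \<open>c\<close> as a chain supported on singletons; the sum
    has at most one term.\<close>
  define \<omega> where "\<omega> A = (\<Sum>i | A = {i}. c i)" for A
  have \<omega>1: "\<omega> {i} = c i" for i by (simp add: \<omega>_def)
  have \<omega>2: "\<omega> A = 0" if "card A \<noteq> 1" for A using that by (auto simp: \<omega>_def intro!: sum.neutral)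
  have "kdiff idx g \<omega> A \<in> I 0" for A
  proof (cases "A = {}")
    case True
    then show ?thesis using c ideal by (simp add: kdiff_def ksign_def \<omega>1 mult.commute ideal_zero)
  next
    case False
    then have "card (insert i A) \<noteq> 1" if "i \<notin> A" for i using that by (auto simp: card_insert_if)
    then show ?thesis using ideal \<omega>2 by (auto simp: kdiff_def ideal_zero)
  qed
  moreover have "I b \<subseteq> I (Suc b)" for b by (auto simp: I_def)
  ultimately have "\<exists>v. (\<forall>A. card A \<le> Suc 0 \<longrightarrow> v A = 0) \<and> (\<forall>A. \<omega> A - kdiff idx g v A \<in> I 0)"
    using koszul_depth[of idx I "\<lambda>b. mfps_monom (X b)" g 0 \<omega>, OF inj ideal _ split X1 X2 reg] \<omega>2
    by simp
  then obtain v where v: "\<And>A. \<omega> A - kdiff idx g v A \<in> I 0" by blast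
  have "I 0 = {0}" by (auto simp: I_def intro: mfps_eqI)
  then have "c i = kdiff idx g v {i}" using v[of "{i}"] by (simp add: \<omega>1)
  also have "\<dots> \<in> ideal_gen (g ` (UNIV - {i}))"
    unfolding kdiff_def
    by (intro ideal_sum ideal_mult_r[OF is_ideal_gen] ideal_mult_l[OF is_ideal_gen] is_ideal_gen)
      (auto intro: ideal_gen_base)
  finally show ?thesis .
qed

subsection \<open>Ideals generated by a system of parameters\<close>

lemma ideal_dvd: "is_ideal I \<Longrightarrow> x \<in> I \<Longrightarrow> x dvd y \<Longrightarrow> y \<in> I"
  by (metis dvdE ideal_mult_r)

lemma mon_dvd: "k \<le> Poly_Mapping.lookup a i \<Longrightarrow> v i ^ k dvd mon v a" for v :: "'i::finite \<Rightarrow> 'a::comm_ring_1"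
proof -
  assume "k \<le> Poly_Mapping.lookup a i"
  then have "v i ^ k dvd v i ^ Poly_Mapping.lookup a i" by (rule le_imp_power_dvd)
  also have "\<dots> dvd mon v a" unfolding mon_def by (rule dvd_prodI) simp_all
  finally show ?thesis .
qed

lemma deg_large_exponent:
  assumes "(\<Sum>i\<in>UNIV. e i) \<le> deg a" shows "\<exists>i. e i \<le> Poly_Mapping.lookup a i"
proof (rule ccontr)
  assume "\<nexists>i. e i \<le> Poly_Mapping.lookup a i"
  then have "deg a < (\<Sum>i\<in>UNIV. e i)"
    unfolding deg_def by (intro sum_strict_mono) (auto simp: not_le)
  with assms show False by simp
qed

text \<open>Pigeonhole: a monomial in \<open>g\<close> of total degree equal to the sum of the
  \<open>e i\<close> is divisible by some \<open>g i ^ e i\<close>.\<close>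

lemma powers_primary:
  fixes g :: "'n::finite \<Rightarrow> ('a::comm_ring_1, 'n) mfps"
  assumes N: "ideal_pow max_ideal N \<subseteq> ideal_gen (range g)"
  shows "\<exists>N'. ideal_pow max_ideal N' \<subseteq> ideal_gen (range (\<lambda>i. g i ^ e i))"
proof -
  let ?S = "\<Sum>i\<in>UNIV. e i"
  have "ideal_pow max_ideal (N * ?S) \<subseteq> ideal_pow (ideal_gen (range g)) ?S"
    using ideal_pow_mono[OF N] by (simp flip: ideal_pow_pow)
  also have "ideal_pow (ideal_gen (range g)) ?S \<subseteq> ideal_gen (range (\<lambda>i. g i ^ e i))"
  proof
    fix x assume "x \<in> ideal_pow (ideal_gen (range g)) ?S"
    then obtain c where c: "x = (\<Sum>a | deg a = ?S. c a * mon g a)" by (rule ideal_pow_expand')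
    show "x \<in> ideal_gen (range (\<lambda>i. g i ^ e i))"
      unfolding c
    proof (intro ideal_sum ideal_mult_l is_ideal_gen)
      fix a :: "'n \<Rightarrow>\<^sub>0 nat" assume "a \<in> {a. deg a = ?S}"
      then obtain i where "e i \<le> Poly_Mapping.lookup a i" using deg_large_exponent[of e a] by auto
      then show "mon g a \<in> ideal_gen (range (\<lambda>i. g i ^ e i))"
        by (intro ideal_dvd[OF is_ideal_gen _ mon_dvd] ideal_gen_base) auto
    qed
  qed
  finally show ?thesis ..
qed

text \<open>The membership is read as a relation among all \<open>g j\<close> in which
  \<open>x\<close> is the coefficient of \<open>g i\<close>.\<close>

lemma colon_parameter:
  fixes g :: "'n::finite \<Rightarrow> ('a::comm_ring_1, 'n) mfps"
  assumes N: "ideal_pow max_ideal N \<subseteq> ideal_gen (range g)"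
    and x: "x * g i \<in> ideal_gen (g ` (UNIV - {i}))"
  shows "x \<in> ideal_gen (g ` (UNIV - {i}))"
proof -
  obtain c where c: "x * g i = (\<Sum>j\<in>UNIV - {i}. c j * g j)"
    using ideal_gen_imageE[OF finite x] by blast
  have "(\<Sum>j\<in>UNIV. (if j = i then x else - c j) * g j) = x * g i + (\<Sum>j\<in>UNIV - {i}. (if j = i then x else - c j) * g j)"
    by (subst sum.remove[of _ i]) auto
  also have "(\<Sum>j\<in>UNIV - {i}. (if j = i then x else - c j) * g j) = (\<Sum>j\<in>UNIV - {i}. - (c j * g j))"
    by (rule sum.cong) auto
  finally have "(\<Sum>j\<in>UNIV. (if j = i then x else - c j) * g j) = 0"
    by (simp add: c sum_negf)
  from syzygy_coefficient[OF N this, of i] show ?thesis by simp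
qed

text \<open>The exponents are lowered one index at a time. The mixed system \<open>?h\<close>, with
  exponent \<open>s\<close> at the current index, is still primary to the maximal ideal, so
  \<open>colon_parameter\<close> cancels \<open>g i ^ s\<close> against \<open>g i ^ Suc s\<close>
  and leaves a multiple of \<open>g i\<close>.\<close>

lemma colon_powers:
  fixes g :: "'n::finite \<Rightarrow> ('a::comm_ring_1, 'n) mfps"
  assumes N: "ideal_pow max_ideal N \<subseteq> ideal_gen (range g)"
    and "finite A"
    and x: "x * (\<Prod>i\<in>A. g i ^ s) \<in> ideal_gen (range (\<lambda>i. if i \<in> A then g i ^ Suc s else g i))"
  shows "x \<in> ideal_gen (range g)"
  using assms(2,3)
proof (induction A rule: finite_induct)
  case (insert i A)
  define e where "e j = (if j = i then s else if j \<in> A then Suc s else 1)" for j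
  let ?h = "\<lambda>j. g j ^ e j"
  let ?h' = "\<lambda>j. if j \<in> A then g j ^ Suc s else g j"
  obtain N' where N': "ideal_pow max_ideal N' \<subseteq> ideal_gen (range ?h)"
    using powers_primary[OF N] by blast
  from insert.prems obtain c where
    c: "x * (\<Prod>i\<in>insert i A. g i ^ s) = (\<Sum>j\<in>UNIV. c j * (if j \<in> insert i A then g j ^ Suc s else g j))"
    by (rule ideal_gen_rangeE)
  also have "\<dots> = c i * g i ^ Suc s + (\<Sum>j\<in>UNIV - {i}. c j * (if j \<in> insert i A then g j ^ Suc s else g j))"
    by (subst sum.remove[of _ i]) auto
  also have "(\<Sum>j\<in>UNIV - {i}. c j * (if j \<in> insert i A then g j ^ Suc s else g j)) = (\<Sum>j\<in>UNIV - {i}. c j * ?h j)"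
    by (rule sum.cong) (auto simp: e_def)
  finally have "(x * (\<Prod>i\<in>A. g i ^ s) - c i * g i) * ?h i = (\<Sum>j\<in>UNIV - {i}. c j * ?h j)"
    using insert.hyps by (simp add: e_def algebra_simps)
  also have "\<dots> \<in> ideal_gen (?h ` (UNIV - {i}))"
    by (intro ideal_sum ideal_mult_l is_ideal_gen ideal_gen_base) auto
  finally have "x * (\<Prod>i\<in>A. g i ^ s) - c i * g i \<in> ideal_gen (?h ` (UNIV - {i}))"
    by (rule colon_parameter[OF N'])
  moreover have "?h ` (UNIV - {i}) \<subseteq> range ?h'" by (auto simp: e_def)
  ultimately have *: "x * (\<Prod>i\<in>A. g i ^ s) - c i * g i \<in> ideal_gen (range ?h')"
    using ideal_gen_mono by blast
  have "g i \<in> range ?h'" using insert.hyps by (auto intro!: image_eqI[of _ _ i])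
  then have "c i * g i \<in> ideal_gen (range ?h')" by (intro ideal_mult_l is_ideal_gen ideal_gen_base)
  with * have "x * (\<Prod>i\<in>A. g i ^ s) \<in> ideal_gen (range ?h')"
    using ideal_cong[OF is_ideal_gen *] ideal_add[OF is_ideal_gen *] by fastforce
  then show ?case by (rule insert.IH)
qed simp

text \<open>Multiplication by \<open>mon g b\<close>, where \<open>a0 + b\<close> has all entries
  \<open>s\<close>, turns every other monomial of degree \<open>s\<close> and every monomial of
  degree \<open>Suc s\<close> into a multiple of some \<open>g i ^ Suc s\<close>. Only the term of
  \<open>a0\<close> survives, and \<open>colon_powers\<close> applies to its coefficient.\<close>

lemma quasi_regular:
  fixes g :: "'n::finite \<Rightarrow> ('a::comm_ring_1, 'n) mfps"
  assumes N: "ideal_pow max_ideal N \<subseteq> ideal_gen (range g)"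
    and c: "(\<Sum>a | deg a = s. c a * mon g a) \<in> ideal_pow (ideal_gen (range g)) (Suc s)"
    and a0: "deg a0 = s"
  shows "c a0 \<in> ideal_gen (range g)"
proof -
  let ?K = "ideal_gen (range (\<lambda>i. g i ^ Suc s))"
  define b :: "'n \<Rightarrow>\<^sub>0 nat" where "b = Abs_poly_mapping (\<lambda>i. s - Poly_Mapping.lookup a0 i)"
  have lb: "Poly_Mapping.lookup b i = s - Poly_Mapping.lookup a0 i" for i
    by (simp add: b_def)
  have a0b: "Poly_Mapping.lookup (a0 + b) i = s" for i
    using lookup_le_deg[of a0 i] a0 by (simp add: lookup_add lb)
  have K: "mon g a \<in> ?K" if "s < Poly_Mapping.lookup a i" for a i
    using that by (intro ideal_dvd[OF is_ideal_gen _ mon_dvd[of "Suc s" a i]] ideal_gen_base) auto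
  have *: "mon g b * mon g a \<in> ?K" if "deg a = s" "a \<noteq> a0" for a
  proof -
    have "\<exists>i. Poly_Mapping.lookup a i > Poly_Mapping.lookup a0 i"
    proof (rule ccontr)
      assume "\<not> ?thesis"
      then have le: "Poly_Mapping.lookup a i \<le> Poly_Mapping.lookup a0 i" for i by (auto simp: not_less)
      moreover from \<open>a \<noteq> a0\<close> obtain j where "Poly_Mapping.lookup a j \<noteq> Poly_Mapping.lookup a0 j"
        by (metis poly_mapping_eqI)
      ultimately have "deg a < deg a0"
        unfolding deg_def by (intro sum_strict_mono_ex1) (auto intro: le_neq_trans)
      then show False using that a0 by simp
    qed
    then obtain i where i: "Poly_Mapping.lookup a i > Poly_Mapping.lookup a0 i" ..
    have "s < Poly_Mapping.lookup (b + a) i"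
      using i lookup_le_deg[of a0 i] a0 by (simp add: lookup_add lb)
    then show ?thesis by (metis K mon_add)
  qed
  obtain d where d: "(\<Sum>a | deg a = s. c a * mon g a) = (\<Sum>a | deg a = Suc s. d a * mon g a)"
    using c by (rule ideal_pow_expand')
  have eq: "mon g b * (\<Sum>a | deg a = Suc s. d a * mon g a) = (\<Sum>a | deg a = Suc s. d a * (mon g b * mon g a))"
    unfolding sum_distrib_left by (rule sum.cong) (simp_all only: mult.left_commute)
  have "mon g b * (\<Sum>a | deg a = Suc s. d a * mon g a) \<in> ?K"
    unfolding eq
  proof (rule ideal_sum[OF is_ideal_gen], rule ideal_mult_l[OF is_ideal_gen])
    fix a :: "'n \<Rightarrow>\<^sub>0 nat" assume a: "a \<in> {a. deg a = Suc s}"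
    have "deg (a0 + b) = CARD('n) * s" unfolding deg_def a0b by simp
    then have "deg (b + a) = Suc (CARD('n) * s)" using a a0 by (simp add: deg_add)
    \<comment> \<open>The total degree is n s + 1, so the n entries cannot all be at most
      \<open>s\<close>.\<close>
    have "\<exists>i. Suc s \<le> Poly_Mapping.lookup (b + a) i"
    proof (rule ccontr)
      assume "\<not> ?thesis"
      then have "deg (b + a) \<le> CARD('n) * s"
        unfolding deg_def using sum_bounded_above[of UNIV "Poly_Mapping.lookup (b + a)" s]
        by (simp add: not_le less_Suc_eq_le)
      then show False using \<open>deg (b + a) = _\<close> by simp
    qed
    then show "mon g b * mon g a \<in> ?K" by (metis K mon_add Suc_le_eq)
  qed
  then have "mon g b * (\<Sum>a | deg a = s. c a * mon g a) \<in> ?K" unfolding d .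
  also have "(\<Sum>a | deg a = s. c a * mon g a) = c a0 * mon g a0 + (\<Sum>a\<in>{a. deg a = s} - {a0}. c a * mon g a)"
    using a0 by (subst sum.remove[of _ a0]) auto
  finally have "c a0 * mon g (a0 + b) + (\<Sum>a\<in>{a. deg a = s} - {a0}. c a * (mon g b * mon g a)) \<in> ?K"
    by (simp add: distrib_left sum_distrib_left mult_ac mon_add)
  moreover have "(\<Sum>a\<in>{a. deg a = s} - {a0}. c a * (mon g b * mon g a)) \<in> ?K"
    by (rule ideal_sum[OF is_ideal_gen], rule ideal_mult_l[OF is_ideal_gen], rule *) auto
  ultimately have "c a0 * mon g (a0 + b) \<in> ?K"
    using ideal_diff[OF is_ideal_gen] by fastforce
  also have "mon g (a0 + b) = (\<Prod>i\<in>UNIV. g i ^ s)" unfolding mon_def a0b ..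
  finally show ?thesis using colon_powers[OF N, of UNIV "c a0" s] by simp
qed

text \<open>Layer by layer: an element of J^s is a form of degree \<open>s\<close> in
  \<open>g\<close>, and its coefficients matter only modulo \<open>J\<close> when working modulo
  J^(s+1).\<close>

lemma spans_mod_pow:
  fixes g :: "'n::finite \<Rightarrow> ('a::field, 'n) mfps"
  defines "J \<equiv> ideal_gen (range g)"
  assumes b: "spans_mod J I b"
  shows "spans_mod (ideal_pow J s) (I \<times> {a. deg a < s}) (\<lambda>(i, a). b i * mon g a)"
proof (induction s)
  case (Suc s)
  have fin: "finite I" using b by (simp add: spans_mod_def)
  have D: "I \<times> {a. deg a < Suc s} = I \<times> {a :: 'n \<Rightarrow>\<^sub>0 nat. deg a < s} \<union> I \<times> {a. deg a = s}"
    by (auto simp: less_Suc_eq)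
  show ?case
    unfolding spans_mod_def
  proof (intro conjI allI)
    fix h
    from Suc obtain c where "h - lcomb c (\<lambda>(i, a). b i * mon g a) (I \<times> {a. deg a < s}) \<in> ideal_pow J s"
      by (auto simp: spans_mod_def)
    then obtain d where d: "h - lcomb c (\<lambda>(i, a). b i * mon g a) (I \<times> {a. deg a < s}) = (\<Sum>a | deg a = s. d a * mon g a)"
      unfolding J_def by (rule ideal_pow_expand')
    from b have "\<forall>a. \<exists>e. d a - lcomb e b I \<in> J" by (auto simp: spans_mod_def)
    then obtain e where e: "\<And>a. d a - lcomb (e a) b I \<in> J" by metis
    define c' where "c' = (\<lambda>(i, a). if deg a < s then c (i, a) else e a i)"
    have "lcomb c' (\<lambda>(i, a). b i * mon g a) (I \<times> {a. deg a < Suc s}) =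
        lcomb c' (\<lambda>(i, a). b i * mon g a) (I \<times> {a. deg a < s}) + lcomb c' (\<lambda>(i, a). b i * mon g a) (I \<times> {a. deg a = s})"
      unfolding D lcomb_def using fin by (intro sum.union_disjoint) auto
    also have "lcomb c' (\<lambda>(i, a). b i * mon g a) (I \<times> {a. deg a < s}) = lcomb c (\<lambda>(i, a). b i * mon g a) (I \<times> {a. deg a < s})"
      unfolding lcomb_def by (rule sum.cong) (auto simp: c'_def)
    also have "lcomb c' (\<lambda>(i, a). b i * mon g a) (I \<times> {a. deg a = s}) = (\<Sum>i\<in>I. \<Sum>a | deg a = s. mfps_const (e a i) * (b i * mon g a))"
      unfolding lcomb_def sum.cartesian_product by (rule sum.cong) (auto simp: c'_def)
    also have "\<dots> = (\<Sum>a | deg a = s. lcomb (e a) b I * mon g a)"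
      unfolding lcomb_def sum_distrib_right by (subst sum.swap) (simp add: mult.assoc)
    finally have "h - lcomb c' (\<lambda>(i, a). b i * mon g a) (I \<times> {a. deg a < Suc s}) =
        (\<Sum>a | deg a = s. (d a - lcomb (e a) b I) * mon g a)"
      using d by (simp add: algebra_simps sum_subtractf)
    also have "\<dots> \<in> ideal_pow J (Suc s)"
      unfolding ideal_pow.simps
    proof (intro ideal_sum is_ideal_mult ideal_mult_mem e)
      fix a :: "'n \<Rightarrow>\<^sub>0 nat" assume "a \<in> {a. deg a = s}"
      then show "mon g a \<in> ideal_pow J s"
        using mon_in_ideal_pow[of g J a] by (auto simp: J_def ideal_gen_base)
    qed
    finally show "\<exists>c. h - lcomb c (\<lambda>(i, a). b i * mon g a) (I \<times> {a. deg a < Suc s}) \<in> ideal_pow J (Suc s)"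
      by blast
  qed (use fin in simp)
qed (use b in \<open>auto simp: spans_mod_def\<close>)

text \<open>The lower layers vanish by induction; in the top layer quasi-regularity puts each
  coefficient into \<open>J\<close>, where independence of \<open>b\<close> applies.\<close>

lemma indep_mod_pow:
  fixes g :: "'n::finite \<Rightarrow> ('a::field, 'n) mfps"
  defines "J \<equiv> ideal_gen (range g)"
  assumes N: "ideal_pow max_ideal N \<subseteq> J" and b: "indep_mod J I b"
  shows "indep_mod (ideal_pow J s) (I \<times> {a. deg a < s}) (\<lambda>(i, a). b i * mon g a)"
proof (induction s)
  case (Suc s)
  have fin: "finite I" using b by (simp add: indep_mod_def)
  have D: "I \<times> {a. deg a < Suc s} = I \<times> {a :: 'n \<Rightarrow>\<^sub>0 nat. deg a < s} \<union> I \<times> {a. deg a = s}"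
    by (auto simp: less_Suc_eq)
  show ?case
    unfolding indep_mod_def
  proof (intro conjI allI impI)
    fix c assume c: "lcomb c (\<lambda>(i, a). b i * mon g a) (I \<times> {a. deg a < Suc s}) \<in> ideal_pow J (Suc s)"
    have split: "lcomb c (\<lambda>(i, a). b i * mon g a) (I \<times> {a. deg a < Suc s}) =
        lcomb c (\<lambda>(i, a). b i * mon g a) (I \<times> {a. deg a < s}) + lcomb c (\<lambda>(i, a). b i * mon g a) (I \<times> {a. deg a = s})"
      unfolding D lcomb_def using fin by (intro sum.union_disjoint) auto
    have "lcomb c (\<lambda>(i, a). b i * mon g a) (I \<times> {a. deg a = s}) = (\<Sum>i\<in>I. \<Sum>a | deg a = s. mfps_const (c (i, a)) * (b i * mon g a))"
      unfolding lcomb_def sum.cartesian_product by (rule sum.cong) auto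
    also have "\<dots> = (\<Sum>a | deg a = s. lcomb (\<lambda>i. c (i, a)) b I * mon g a)"
      unfolding lcomb_def sum_distrib_right by (subst sum.swap) (simp add: mult.assoc)
    finally have top: "lcomb c (\<lambda>(i, a). b i * mon g a) (I \<times> {a. deg a = s}) =
        (\<Sum>a | deg a = s. lcomb (\<lambda>i. c (i, a)) b I * mon g a)" .
    have "lcomb c (\<lambda>(i, a). b i * mon g a) (I \<times> {a. deg a = s}) \<in> ideal_pow J s"
      unfolding top
    proof (intro ideal_sum is_ideal_pow ideal_mult_l)
      fix a :: "'n \<Rightarrow>\<^sub>0 nat" assume "a \<in> {a. deg a = s}"
      then show "mon g a \<in> ideal_pow J s"
        using mon_in_ideal_pow[of g J a] by (auto simp: J_def ideal_gen_base)
    qed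
    moreover have "lcomb c (\<lambda>(i, a). b i * mon g a) (I \<times> {a. deg a < Suc s}) \<in> ideal_pow J s"
      using c ideal_pow_antimono[of s "Suc s" J] by auto
    ultimately have "lcomb c (\<lambda>(i, a). b i * mon g a) (I \<times> {a. deg a < s}) \<in> ideal_pow J s"
      unfolding split using ideal_diff[OF is_ideal_pow] by fastforce
    then have low: "\<forall>p\<in>I \<times> {a. deg a < s}. c p = 0" using Suc by (auto simp: indep_mod_def)
    then have "lcomb c (\<lambda>(i, a). b i * mon g a) (I \<times> {a. deg a < s}) = 0"
      by (auto simp: lcomb_def intro!: sum.neutral)
    then have "(\<Sum>a | deg a = s. lcomb (\<lambda>i. c (i, a)) b I * mon g a) \<in> ideal_pow J (Suc s)"
      using c unfolding split top by simp
    then have "lcomb (\<lambda>i. c (i, a)) b I \<in> J" if "deg a = s" for a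
      using quasi_regular[of N g "\<lambda>a. lcomb (\<lambda>i. c (i, a)) b I" s a] that N unfolding J_def by blast
    then have "\<forall>p\<in>I \<times> {a. deg a = s}. c p = 0" using b by (auto simp: indep_mod_def)
    with low show "\<forall>p\<in>I \<times> {a. deg a < Suc s}. c p = 0" unfolding D by blast
  qed (use fin in simp)
qed (use b in \<open>auto simp: indep_mod_def\<close>)

lemma cod_parameter_pow:
  fixes g :: "'n::finite \<Rightarrow> ('a::field, 'n) mfps"
  assumes N: "ideal_pow max_ideal N \<subseteq> ideal_gen (range g)" and fin: "fincod (ideal_gen (range g))"
  shows "fincod (ideal_pow (ideal_gen (range g)) s)"
    and "cod (ideal_pow (ideal_gen (range g)) s) = cod (ideal_gen (range g)) * card {a :: 'n \<Rightarrow>\<^sub>0 nat. deg a < s}"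
proof -
  let ?J = "ideal_gen (range g)"
  obtain b :: "nat \<Rightarrow> _" where b: "spans_mod ?J {..<cod ?J} b" "indep_mod ?J {..<cod ?J} b"
    using fincod_basis[OF is_ideal_gen fin] .
  show "fincod (ideal_pow ?J s)" using spans_mod_fincod(1)[OF spans_mod_pow[OF b(1)]] .
  show "cod (ideal_pow ?J s) = cod ?J * card {a :: 'n \<Rightarrow>\<^sub>0 nat. deg a < s}"
    using cod_eqI[OF is_ideal_pow indep_mod_pow[OF N b(2)] spans_mod_pow[OF b(1)]]
    by (simp add: card_cartesian_product)
qed

text \<open>By quasi-regularity the associated graded ring of \<open>J\<close> is a polynomial ring
  over R/J. Although R/J has zero divisors, a nonzero form with coefficients in the field is a
  nonzerodivisor there, because its nonzero coefficients are units.\<close>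

lemma form_cancel:
  fixes g :: "'n::finite \<Rightarrow> ('a::field, 'n) mfps"
  defines "J \<equiv> ideal_gen (range g)"
  assumes N: "ideal_pow max_ideal N \<subseteq> J" and \<beta>: "deg b0 = i" "\<beta> b0 \<noteq> 0"
    and x: "(\<Sum>b | deg b = i. mfps_const (\<beta> b) * mon g b) * x \<in> ideal_pow J (r + i)"
  shows "x \<in> ideal_pow J r"
  using x
proof (induction r)
  case (Suc r)
  have gJ: "g j \<in> J" for j by (simp add: J_def ideal_gen_base)
  have "x \<in> ideal_pow J r"
    using Suc.prems ideal_pow_antimono[of "r + i" "Suc r + i" J] by (intro Suc.IH) auto
  then obtain \<xi> where \<xi>: "x = (\<Sum>a | deg a = r. \<xi> a * mon g a)"
    unfolding J_def by (rule ideal_pow_expand')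
  show ?case
  proof (rule ccontr)
    assume nx: "x \<notin> ideal_pow J (Suc r)"
    define A where "A = {a. deg a = r \<and> \<xi> a \<notin> J}"
    define B where "B = {b. deg b = i \<and> \<beta> b \<noteq> 0}"
    have "A \<noteq> {}"
    proof
      assume "A = {}"
      then have "\<xi> a * mon g a \<in> ideal_pow J (Suc r)" if "deg a = r" for a
        using that mon_in_ideal_pow[of g J a, OF gJ] by (auto simp: A_def intro!: ideal_mult_mem)
      then have "x \<in> ideal_pow J (Suc r)" unfolding \<xi> by (intro ideal_sum is_ideal_pow) auto
      with nx show False by simp
    qed
    moreover have "B \<noteq> {}" using \<beta> by (auto simp: B_def)
    moreover have "finite A" "finite B"
      by (rule finite_subset[OF _ finite_deg[of r]], auto simp: A_def)
        (rule finite_subset[OF _ finite_deg[of i]], auto simp: B_def)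
    ultimately obtain a b where ab: "a \<in> A" "b \<in> B"
      "\<And>a' b'. a' \<in> A \<Longrightarrow> b' \<in> B \<Longrightarrow> a' + b' = a + b \<Longrightarrow> a' = a \<and> b' = b"
      using exponent_unique_sum[of A B] by metis
    let ?D = "{a. deg a = r} \<times> {b. deg b = i}"
    let ?F = "\<lambda>(a, b). mfps_const (\<beta> b) * \<xi> a"
    have "(\<Sum>b | deg b = i. mfps_const (\<beta> b) * mon g b) * x =
        (\<Sum>(a, b)\<in>?D. mfps_const (\<beta> b) * \<xi> a * mon g (a + b))"
      unfolding \<xi> sum_product
      by (subst sum.swap) (simp add: sum.cartesian_product mon_add mult_ac)
    also have "\<dots> = (\<Sum>c | deg c = r + i. \<Sum>p\<in>{p \<in> ?D. fst p + snd p = c}. (\<lambda>(a, b). mfps_const (\<beta> b) * \<xi> a * mon g (a + b)) p)"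
      by (rule sum.group[symmetric]) (auto simp: deg_add)
    also have "\<dots> = (\<Sum>c | deg c = r + i. (\<Sum>p\<in>{p \<in> ?D. fst p + snd p = c}. ?F p) * mon g c)"
      unfolding sum_distrib_right by (intro sum.cong) auto
    finally have "(\<Sum>c | deg c = r + i. (\<Sum>p\<in>{p \<in> ?D. fst p + snd p = c}. ?F p) * mon g c) \<in> ideal_pow J (Suc (r + i))"
      using Suc.prems by simp
    from quasi_regular[OF N[unfolded J_def] this[unfolded J_def], of "a + b"] ab(1,2)
    have "(\<Sum>p\<in>{p \<in> ?D. fst p + snd p = a + b}. ?F p) \<in> J"
      by (simp add: A_def B_def deg_add J_def)
    also have "(\<Sum>p\<in>{p \<in> ?D. fst p + snd p = a + b}. ?F p) =
        ?F (a, b) + (\<Sum>p\<in>{p \<in> ?D. fst p + snd p = a + b} - {(a, b)}. ?F p)"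
      using ab(1,2) by (intro sum.remove) (auto simp: A_def B_def)
    finally have 1: "?F (a, b) + (\<Sum>p\<in>{p \<in> ?D. fst p + snd p = a + b} - {(a, b)}. ?F p) \<in> J" .
    \<comment> \<open>\<open>a\<close> and \<open>b\<close> were chosen so that no other pair with
      both coefficients relevant has the same exponent sum; all remaining pairs contribute elements
      of \<open>J\<close>.\<close>
    have "(\<Sum>p\<in>{p \<in> ?D. fst p + snd p = a + b} - {(a, b)}. ?F p) \<in> J"
    proof (rule ideal_sum)
      fix p assume "p \<in> {p \<in> ?D. fst p + snd p = a + b} - {(a, b)}"
      then obtain a' b' where p: "p = (a', b')" "deg a' = r" "deg b' = i" "a' + b' = a + b" "\<not> (a' = a \<and> b' = b)"
        by (cases p) auto
      with ab(3)[of a' b'] have "a' \<notin> A \<or> b' \<notin> B" by blast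
      then have "\<xi> a' \<in> J \<or> \<beta> b' = 0" using p by (auto simp: A_def B_def)
      then show "?F p \<in> J" by (auto simp: p J_def ideal_zero intro: ideal_mult_l)
    qed (simp add: J_def)
    with 1 have 2: "mfps_const (\<beta> b) * \<xi> a \<in> J"
      using ideal_diff[of J] by (fastforce simp: J_def)
    have "mfps_const (inverse (\<beta> b)) * (mfps_const (\<beta> b) * \<xi> a) = \<xi> a"
      using ab(2) unfolding mult.assoc[symmetric] mfps_const_mult[symmetric] by (simp add: B_def)
    moreover have "mfps_const (inverse (\<beta> b)) * (mfps_const (\<beta> b) * \<xi> a) \<in> J"
      using 2 by (simp add: J_def ideal_mult_l)
    ultimately show False using ab(1) by (simp add: A_def)
  qed
qed simp

subsection \<open>Hilbert's basis theorem\<close>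

text \<open>Rings are subsets of one ambient ring, so that algebras can be built up generator by
  generator without changing the type.\<close>

definition subring :: "'a::comm_ring_1 set \<Rightarrow> bool" where
  "subring B \<longleftrightarrow> 1 \<in> B \<and> (\<forall>x\<in>B. \<forall>y\<in>B. x - y \<in> B \<and> x * y \<in> B)"

lemma subring_one: "subring B \<Longrightarrow> 1 \<in> B"
  and subring_diff: "subring B \<Longrightarrow> x \<in> B \<Longrightarrow> y \<in> B \<Longrightarrow> x - y \<in> B"
  and subring_mult: "subring B \<Longrightarrow> x \<in> B \<Longrightarrow> y \<in> B \<Longrightarrow> x * y \<in> B"
  by (auto simp: subring_def)

lemma subring_zero: "subring B \<Longrightarrow> 0 \<in> B"
  using subring_diff[OF _ subring_one subring_one] by simp

lemma subring_uminus: "subring B \<Longrightarrow> x \<in> B \<Longrightarrow> - x \<in> B"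
  using subring_diff[OF _ subring_zero] by fastforce

lemma subring_add: "subring B \<Longrightarrow> x \<in> B \<Longrightarrow> y \<in> B \<Longrightarrow> x + y \<in> B"
  using subring_diff[OF _ _ subring_uminus] by fastforce

lemma subring_sum: "subring B \<Longrightarrow> (\<And>i. i \<in> I \<Longrightarrow> f i \<in> B) \<Longrightarrow> sum f I \<in> B"
  by (induction I rule: infinite_finite_induct) (auto intro: subring_zero subring_add)

lemma subring_prod: "subring B \<Longrightarrow> (\<And>i. i \<in> I \<Longrightarrow> f i \<in> B) \<Longrightarrow> prod f I \<in> B"
  by (induction I rule: infinite_finite_induct) (auto intro: subring_one subring_mult)

lemma subring_power: "subring B \<Longrightarrow> x \<in> B \<Longrightarrow> x ^ k \<in> B"
  by (induction k) (auto intro: subring_one subring_mult)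

definition poly_over :: "'a::comm_ring_1 set \<Rightarrow> 'a poly set" where
  "poly_over B = {p. \<forall>i. coeff p i \<in> B}"

lemma poly_over_const: "subring B \<Longrightarrow> c \<in> B \<Longrightarrow> [:c:] \<in> poly_over B"
  by (auto simp: poly_over_def coeff_pCons subring_zero split: nat.split)

lemma poly_over_monom: "subring B \<Longrightarrow> c \<in> B \<Longrightarrow> monom c k \<in> poly_over B"
  by (simp add: poly_over_def subring_zero)

lemma subring_poly_over: "subring B \<Longrightarrow> subring (poly_over B)"
  unfolding subring_def[of "poly_over B"]
  by (auto simp: poly_over_def coeff_mult coeff_1 subring_zero subring_one
      intro!: subring_diff subring_sum subring_mult)

definition adjoin :: "'a::comm_ring_1 set \<Rightarrow> 'a \<Rightarrow> 'a set" where
  "adjoin B a = (\<lambda>p. poly p a) ` poly_over B"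

lemma subring_adjoin: 
  assumes "subring B" shows "subring (adjoin B a)"
proof -
  note P = subring_poly_over[OF assms]
  have "1 \<in> adjoin B a" unfolding adjoin_def
    by (rule image_eqI[of _ _ 1]) (simp_all add: subring_one[OF P])
  moreover have "x - y \<in> adjoin B a \<and> x * y \<in> adjoin B a" if xy: "x \<in> adjoin B a" "y \<in> adjoin B a" for x y
  proof -
    from xy obtain p q where "x = poly p a" "y = poly q a" "p \<in> poly_over B" "q \<in> poly_over B"
      by (auto simp: adjoin_def)
    then have "x - y = poly (p - q) a" "x * y = poly (p * q) a" "p - q \<in> poly_over B" "p * q \<in> poly_over B"
      using subring_diff[OF P, of p q] subring_mult[OF P, of p q] by simp_all
    then show ?thesis unfolding adjoin_def by blast
  qed
  ultimately show ?thesis by (auto simp: subring_def)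
qed

lemma adjoin_superset: "subring B \<Longrightarrow> B \<subseteq> adjoin B a"
  unfolding adjoin_def by (auto intro!: image_eqI[OF _ poly_over_const])

lemma adjoin_elem: "subring B \<Longrightarrow> a \<in> adjoin B a"
  unfolding adjoin_def by (rule image_eqI[OF _ poly_over_monom[of B 1 1]]) (simp_all add: poly_monom subring_one)

lemma poly_in_subring: "subring C \<Longrightarrow> p \<in> poly_over C \<Longrightarrow> a \<in> C \<Longrightarrow> poly p a \<in> C"
  unfolding poly_altdef by (intro subring_sum subring_mult subring_power) (auto simp: poly_over_def)

lemma adjoin_least: "subring C \<Longrightarrow> B \<subseteq> C \<Longrightarrow> a \<in> C \<Longrightarrow> adjoin B a \<subseteq> C"
  unfolding adjoin_def by (intro image_subsetI poly_in_subring) (auto simp: poly_over_def)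

text \<open>The chain condition for the ideals spanned by initial segments of a sequence. Applied to
  a sequence of approximate powers of \<open>f\<close> it directly yields an equation of integral
  dependence.\<close>

definition noetherian :: "'a::comm_ring_1 set \<Rightarrow> bool" where
  "noetherian B \<longleftrightarrow> (\<forall>h :: nat \<Rightarrow> 'a. range h \<subseteq> B \<longrightarrow>
     (\<exists>N c. (\<forall>j<N. c j \<in> B) \<and> h N = (\<Sum>j<N. c j * h j)))"

definition span_over :: "'a::comm_ring_1 set \<Rightarrow> (nat \<Rightarrow> 'a) \<Rightarrow> nat \<Rightarrow> 'a set" where
  "span_over B h N = {x. \<exists>c. (\<forall>j<N. c j \<in> B) \<and> x = (\<Sum>j<N. c j * h j)}"

lemma noetherian_iff: "noetherian B \<longleftrightarrow> (\<forall>h. range h \<subseteq> B \<longrightarrow> (\<exists>N. h N \<in> span_over B h N))"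
  by (auto simp: noetherian_def span_over_def)

lemma span_over_zero: "subring B \<Longrightarrow> 0 \<in> span_over B h N"
  by (auto simp: span_over_def subring_zero intro!: exI[of _ "\<lambda>_. 0"])

lemma span_over_add:
  assumes "subring B" "x \<in> span_over B h N" "y \<in> span_over B h N" shows "x + y \<in> span_over B h N"
proof -
  from assms obtain c d where "\<forall>j<N. c j \<in> B" "x = (\<Sum>j<N. c j * h j)" "\<forall>j<N. d j \<in> B" "y = (\<Sum>j<N. d j * h j)"
    by (auto simp: span_over_def)
  then show ?thesis
    unfolding span_over_def using assms(1)
    by (intro CollectI exI[of _ "\<lambda>j. c j + d j"]) (simp add: distrib_right sum.distrib subring_add)
qed

lemma span_over_mult:
  assumes "subring B" "b \<in> B" "x \<in> span_over B h N" shows "b * x \<in> span_over B h N"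
proof -
  from assms obtain c where "\<forall>j<N. c j \<in> B" "x = (\<Sum>j<N. c j * h j)"
    by (auto simp: span_over_def)
  then show ?thesis
    unfolding span_over_def using assms(1,2)
    by (intro CollectI exI[of _ "\<lambda>j. b * c j"]) (simp add: sum_distrib_left mult.assoc subring_mult)
qed

lemma span_over_sum:
  "subring B \<Longrightarrow> (\<And>i. i \<in> I \<Longrightarrow> f i \<in> span_over B h N) \<Longrightarrow> sum f I \<in> span_over B h N"
  by (induction I rule: infinite_finite_induct) (auto intro: span_over_zero span_over_add)

lemma span_over_base: "subring B \<Longrightarrow> j < N \<Longrightarrow> h j \<in> span_over B h N"
  unfolding span_over_def
  by (intro CollectI exI[of _ "\<lambda>i. if i = j then 1 else 0"])
    (auto simp: subring_zero subring_one if_distrib[of "\<lambda>c. c * _"] cong: if_cong)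

lemma span_over_subset:
  assumes "subring B" "\<And>j. j < N \<Longrightarrow> h j \<in> span_over B h' M"
  shows "span_over B h N \<subseteq> span_over B h' M"
proof
  fix x assume "x \<in> span_over B h N"
  then obtain c where "\<forall>j<N. c j \<in> B" "x = (\<Sum>j<N. c j * h j)" by (auto simp: span_over_def)
  then show "x \<in> span_over B h' M"
    using assms by (auto intro!: span_over_sum span_over_mult)
qed

lemma span_over_mono: "subring B \<Longrightarrow> N \<le> M \<Longrightarrow> span_over B h N \<subseteq> span_over B h M"
  by (intro span_over_subset span_over_base) auto

text \<open>Suppose no term of \<open>h\<close> is in the span of its predecessors. Polynomials of
  least degree are chosen successively outside the span of the earlier ones; a linear relation
  between their leading coefficients then produces a competitor of lower degree.\<close>

theorem hilbert_basis:
  fixes B :: "'a::comm_ring_1 set"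
  assumes B: "subring B" and noeth: "noetherian B"
  shows "noetherian (adjoin B a)"
  unfolding noetherian_iff
proof (intro allI impI, rule ccontr)
  fix h :: "nat \<Rightarrow> 'a"
  let ?C = "adjoin B a"
  assume h: "range h \<subseteq> ?C" and contra: "\<not> (\<exists>N. h N \<in> span_over ?C h N)"
  note C = subring_adjoin[OF B, of a] and P = subring_poly_over[OF B]
  define I where "I = (\<Union>N. span_over ?C h N)"
  have I_add: "x - y \<in> I" if "x \<in> I" "y \<in> I" for x y
  proof -
    from that obtain N M where "x \<in> span_over ?C h N" "y \<in> span_over ?C h M" by (auto simp: I_def)
    then have "x \<in> span_over ?C h (max N M)" "y \<in> span_over ?C h (max N M)"
      using span_over_mono[OF C, of _ "max N M" h] by (meson max.cobounded1 max.cobounded2 subsetD)+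
    then have "x + (- 1) * y \<in> span_over ?C h (max N M)"
      by (intro span_over_add span_over_mult C subring_uminus subring_one)
    then show ?thesis by (auto simp: I_def)
  qed
  have I_mult: "b * x \<in> I" if "b \<in> ?C" "x \<in> I" for b x
    using that span_over_mult[OF C] unfolding I_def by blast
  have I_zero: "0 \<in> I" using span_over_zero[OF C] by (auto simp: I_def)
  have I_sum: "sum f A \<in> I" if "\<And>i. i \<in> A \<Longrightarrow> f i \<in> I" for f and A :: "nat set"
    using that
  proof (induction A rule: infinite_finite_induct)
    case (insert i A)
    have "(-1) * sum f A \<in> I" using insert by (intro I_mult subring_uminus subring_one C) auto
    then have "f i - (-1) * sum f A \<in> I" using insert.prems[of i] by (intro I_add) auto
    then show ?case using insert.hyps by simp
  qed (simp_all add: I_zero)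
  \<comment> \<open>The conditions concern values at \<open>a\<close>, not polynomials, since
    \<open>a\<close> may be algebraic over \<open>B\<close>.\<close>
  define good where "good F i p \<longleftrightarrow> p \<in> poly_over B \<and> poly p a \<in> I \<and>
      poly p a \<notin> span_over ?C (\<lambda>j. poly (F j) a) i" for F :: "nat \<Rightarrow> 'a poly" and i p
  define Q where "Q F i p \<longleftrightarrow> good F i p \<and> (\<forall>q. good F i q \<longrightarrow> degree p \<le> degree q)" for F i p
  have "\<exists>F. \<forall>i. Q F i (F i)"
  proof (rule dependent_wellorder_choice)
    fix r and F G :: "nat \<Rightarrow> 'a poly" and i :: nat assume eq: "\<And>y. y < i \<Longrightarrow> F y = G y"
    have "span_over ?C (\<lambda>j. poly (F j) a) i = span_over ?C (\<lambda>j. poly (G j) a) i"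
      unfolding span_over_def using eq by (intro Collect_cong ex_cong1 conj_cong refl) simp
    then show "Q F i r = Q G i r" unfolding Q_def good_def by simp
  next
    fix i :: nat and F :: "nat \<Rightarrow> 'a poly" assume F: "\<And>y. y < i \<Longrightarrow> Q F y (F y)"
    have "\<exists>N. \<forall>j<k. poly (F j) a \<in> span_over ?C h N" if "k \<le> i" for k
      using that
    proof (induction k)
      case (Suc k)
      then obtain N where N: "\<forall>j<k. poly (F j) a \<in> span_over ?C h N" by auto
      have "poly (F k) a \<in> I" using F[of k] Suc.prems by (auto simp: Q_def good_def)
      then obtain M where M: "poly (F k) a \<in> span_over ?C h M" by (auto simp: I_def)
      have "\<forall>j<Suc k. poly (F j) a \<in> span_over ?C h (max N M)"
        using N M span_over_mono[OF C, of N "max N M" h] span_over_mono[OF C, of M "max N M" h]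
        by (auto simp: less_Suc_eq)
      then show ?case ..
    qed simp
    then obtain N where N: "\<And>j. j < i \<Longrightarrow> poly (F j) a \<in> span_over ?C h N" by blast
    have "span_over ?C (\<lambda>j. poly (F j) a) i \<subseteq> span_over ?C h N"
      by (rule span_over_subset[OF C N])
    then have 1: "h N \<notin> span_over ?C (\<lambda>j. poly (F j) a) i" using contra by blast
    have "h N \<in> ?C" using h by auto
    then obtain p where p: "p \<in> poly_over B" "h N = poly p a" by (auto simp: adjoin_def)
    have "h N \<in> I" using span_over_base[OF C, of N "Suc N" h] by (auto simp: I_def)
    with p 1 have "good F i p" by (simp add: good_def)
    then obtain q where "good F i q" "\<forall>r. good F i r \<longrightarrow> degree q \<le> degree r"
      using ex_has_least_nat[of "good F i" p degree] by blast
    then show "\<exists>r. Q F i r" unfolding Q_def by blast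
  qed
  then obtain F where F: "\<And>i. Q F i (F i)" by blast
  have mono: "degree (F j) \<le> degree (F i)" if "j \<le> i" for i j
  proof -
    have "good F j (F i)"
      using F[of i] span_over_mono[OF C that, of "\<lambda>j. poly (F j) a"] by (auto simp: Q_def good_def)
    then show ?thesis using F[of j] by (auto simp: Q_def)
  qed
  have FB: "F i \<in> poly_over B" for i using F by (simp add: Q_def good_def)
  have "range (\<lambda>i. lead_coeff (F i)) \<subseteq> B" using FB by (auto simp: poly_over_def)
  then obtain N b where b: "\<And>j. j < N \<Longrightarrow> b j \<in> B" "lead_coeff (F N) = (\<Sum>j<N. b j * lead_coeff (F j))"
    using noeth unfolding noetherian_def by blast
  \<comment> \<open>The earlier polynomials, shifted to the degree of \<open>F N\<close> and
    weighted so that their leading terms add up to that of \<open>F N\<close>.\<close>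
  define R where "R j = monom (b j) (degree (F N) - degree (F j)) * F j" for j
  define q where "q = F N - (\<Sum>j<N. R j)"
  have RB: "R j \<in> poly_over B" if "j < N" for j
    unfolding R_def using b(1)[OF that] FB by (intro subring_mult P poly_over_monom B)
  have "poly (R j) a = poly (monom (b j) (degree (F N) - degree (F j))) a * poly (F j) a" for j
    by (simp add: R_def)
  moreover have "poly (monom (b j) (degree (F N) - degree (F j))) a \<in> ?C" if "j < N" for j
    using b(1)[OF that] unfolding adjoin_def by (intro imageI poly_over_monom B)
  ultimately have Rs: "poly (R j) a \<in> span_over ?C (\<lambda>j. poly (F j) a) N" if "j < N" for j
    using that by (auto intro!: span_over_mult[OF C] span_over_base[OF C])
  have RI: "poly (R j) a \<in> I" if "j < N" for j
  proof -
    have "poly (F j) a \<in> I" using F by (simp add: Q_def good_def)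
    then show ?thesis using that \<open>\<And>j. poly (R j) a = _\<close> \<open>\<And>j. j < N \<Longrightarrow> _ \<in> ?C\<close> I_mult by metis
  qed
  have pq: "poly q a = poly (F N) a - (\<Sum>j<N. poly (R j) a)" by (simp add: q_def poly_sum)
  have sum_span: "(\<Sum>j<N. poly (R j) a) \<in> span_over ?C (\<lambda>j. poly (F j) a) N"
    using Rs by (intro span_over_sum C) auto
  have "good F N q"
    unfolding good_def
  proof (intro conjI)
    show "q \<in> poly_over B" unfolding q_def using RB FB by (intro subring_diff P subring_sum) auto
    show "poly q a \<in> I"
      unfolding pq using RI F[of N] by (intro I_add I_sum) (auto simp: Q_def good_def)
    show "poly q a \<notin> span_over ?C (\<lambda>j. poly (F j) a) N"
    proof
      assume "poly q a \<in> span_over ?C (\<lambda>j. poly (F j) a) N"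
      then have "poly q a + (\<Sum>j<N. poly (R j) a) \<in> span_over ?C (\<lambda>j. poly (F j) a) N"
        using sum_span by (intro span_over_add C)
      then show False using F[of N] unfolding pq by (simp add: Q_def good_def)
    qed
  qed
  then have "degree (F N) \<le> degree q" using F[of N] by (auto simp: Q_def)
  moreover have dR: "degree (R j) \<le> degree (F N)" if "j < N" for j
  proof -
    have "degree (R j) \<le> (degree (F N) - degree (F j)) + degree (F j)"
      unfolding R_def by (rule order.trans[OF degree_mult_le add_mono[OF degree_monom_le order.refl]])
    then show ?thesis using mono[of j N] that by simp
  qed
  then have "degree q \<le> degree (F N)"
    unfolding q_def by (intro degree_diff_le degree_sum_le) auto
  \<comment> \<open>By construction the coefficient of \<open>q\<close> in this degree is 0. Hence
    \<open>q = 0\<close>, but the value 0 lies in every span.\<close>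
  ultimately have dq: "degree q = degree (F N)" by simp
  have "coeff (R j) (degree (F N)) = b j * lead_coeff (F j)" if "j < N" for j
    using mono[of j N] that by (simp add: R_def coeff_monom_mult)
  then have "lead_coeff q = 0" unfolding dq by (simp add: q_def coeff_sum b(2))
  then have "q = 0" by simp
  then show False using \<open>good F N q\<close> span_over_zero[OF C] by (simp add: good_def)
qed

section \<open>Finitely generated algebras over a field and integral dependence\<close>

fun adjoin_list :: "'a::comm_ring_1 set \<Rightarrow> 'a list \<Rightarrow> 'a set" where
  "adjoin_list B [] = B"
| "adjoin_list B (a # as) = adjoin_list (adjoin B a) as"

lemma subring_adjoin_list: "subring B \<Longrightarrow> subring (adjoin_list B as)"
  by (induction as arbitrary: B) (auto intro: subring_adjoin)

lemma adjoin_list_superset: "subring B \<Longrightarrow> B \<subseteq> adjoin_list B as"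
  by (induction as arbitrary: B) (use subring_adjoin adjoin_superset in \<open>fastforce+\<close>)

lemma adjoin_list_elem: "subring B \<Longrightarrow> a \<in> set as \<Longrightarrow> a \<in> adjoin_list B as"
proof (induction as arbitrary: B)
  case (Cons x as)
  then show ?case
    using subring_adjoin[of B x] adjoin_elem[of B x] adjoin_list_superset[of "adjoin B x" as] by auto
qed simp

lemma adjoin_list_least: "subring C \<Longrightarrow> B \<subseteq> C \<Longrightarrow> set as \<subseteq> C \<Longrightarrow> adjoin_list B as \<subseteq> C"
  by (induction as arbitrary: B) (auto simp: adjoin_least)

lemma noetherian_adjoin_list: "subring B \<Longrightarrow> noetherian B \<Longrightarrow> noetherian (adjoin_list B as)"
  by (induction as arbitrary: B) (auto intro: subring_adjoin hilbert_basis)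

text \<open>Instantiated twice: for polynomials over the power series ring, and for
  k[Y_0, ..., Y_n].\<close>

locale coefficient_field =
  fixes \<kappa> :: "'k::field \<Rightarrow> 'a::comm_ring_1"
  assumes \<kappa>_one: "\<kappa> 1 = 1"
    and \<kappa>_diff: "\<kappa> (x - y) = \<kappa> x - \<kappa> y"
    and \<kappa>_mult: "\<kappa> (x * y) = \<kappa> x * \<kappa> y"
begin

lemma \<kappa>_zero: "\<kappa> 0 = 0"
  using \<kappa>_diff[of 0 0] by simp

lemma subring_range: "subring (range \<kappa>)"
  unfolding subring_def by (auto simp flip: \<kappa>_one \<kappa>_diff \<kappa>_mult)

lemma noetherian_range: "noetherian (range \<kappa>)"
  unfolding noetherian_def
proof (intro allI impI)
  fix h :: "nat \<Rightarrow> 'a" assume "range h \<subseteq> range \<kappa>"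
  then have "\<exists>c. h j = \<kappa> c" for j by auto
  then obtain c where c: "\<And>j. h j = \<kappa> (c j)" by metis
  show "\<exists>N d. (\<forall>j<N. d j \<in> range \<kappa>) \<and> h N = (\<Sum>j<N. d j * h j)"
  proof (cases "c 0 = 0")
    case True
    then show ?thesis by (intro exI[of _ 0]) (simp add: c \<kappa>_zero)
  next
    case False
    then have "h (Suc 0) = \<kappa> (c 1 / c 0) * h 0" by (simp add: c flip: \<kappa>_mult)
    then show ?thesis by (intro exI[of _ "Suc 0"] exI[of _ "\<lambda>_. \<kappa> (c 1 / c 0)"]) simp
  qed
qed

end

lemma prod_monom: "(\<Prod>i\<in>A. monom (c i) (k i)) = monom (\<Prod>i\<in>A. c i) (\<Sum>i\<in>A. k i)"
  for c :: "'i \<Rightarrow> 'a::comm_ring_1"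
  by (induction A rule: infinite_finite_induct) (simp_all add: mult_monom)

text \<open>In the Rees algebra of \<open>J\<close>, a bounded shift between the powers of \<open>T\<close> and those of \<open>J\<close> forces
  \<open>f \<in> T\<close> to satisfy an integral equation. To stay inside a finitely generated algebra, \<open>f ^ s\<close>
  is replaced by a polynomial approximation in a subring of the Rees algebra generated by the
  \<open>X\<^sub>i\<close> and the \<open>g\<^sub>i t\<close>.\<close>

lemma bounded_shift_integral:
  fixes g :: "'n::finite \<Rightarrow> ('a::field, 'n) mfps"
  defines "J \<equiv> ideal_gen (range g)"
  assumes N: "ideal_pow max_ideal N \<subseteq> J" and JT: "J \<subseteq> T" and f: "f \<in> T"
    and shift: "\<And>s. ideal_pow T (s + Suc c) \<subseteq> ideal_pow J s"
  shows "\<exists>L. f ^ Suc L \<in> ideal_mult J (ideal_pow T L)"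
proof -
  define \<kappa> :: "'a \<Rightarrow> ('a, 'n) mfps poly" where "\<kappa> x = [:mfps_const x:]" for x
  interpret coefficient_field \<kappa>
    by unfold_locales (simp_all add: \<kappa>_def mfps_const_diff mfps_const_mult)
  obtain xs :: "'n list" where xs: "set xs = UNIV" using finite_list[of "UNIV :: 'n set"] by auto
  define C where "C = adjoin_list (range \<kappa>) (map (\<lambda>i. [:mfps_var i:]) xs @ map (\<lambda>i. monom (g i) 1) xs)"
  have C: "subring C" unfolding C_def by (intro subring_adjoin_list subring_range)
  have noeth: "noetherian C" unfolding C_def by (intro noetherian_adjoin_list subring_range noetherian_range)
  have C\<kappa>: "\<kappa> x \<in> C" for x
    using adjoin_list_superset[OF subring_range] unfolding C_def by blast
  have CX: "[:mfps_var i:] \<in> C" and Cg: "monom (g i) 1 \<in> C" for i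
    unfolding C_def using xs by (auto intro!: adjoin_list_elem[OF subring_range])
  \<comment> \<open>The Rees algebra of \<open>J\<close> as a ring of polynomials in t: the
    coefficient of t^i lies in J^i.\<close>
  define Rees where "Rees = {p. \<forall>i. coeff p i \<in> ideal_pow J i}"
  have Rees: "subring Rees"
    unfolding subring_def
  proof (intro conjI ballI)
    show "1 \<in> Rees" by (simp add: Rees_def coeff_1 ideal_zero)
    fix p q assume pq: "p \<in> Rees" "q \<in> Rees"
    then show "p - q \<in> Rees" by (simp add: Rees_def ideal_diff)
    show "p * q \<in> Rees"
      unfolding Rees_def
    proof (intro CollectI allI)
      fix i
      have "coeff p k * coeff q (i - k) \<in> ideal_pow J i" if "k \<le> i" for k
        using pq that ideal_pow_mult_mem[of "coeff p k" J k "coeff q (i - k)" "i - k"] by (simp add: Rees_def)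
      then show "coeff (p * q) i \<in> ideal_pow J i"
        unfolding coeff_mult by (intro ideal_sum is_ideal_pow) simp
    qed
  qed
  have const: "[:x:] \<in> Rees" for x
    unfolding Rees_def by (auto simp: coeff_pCons ideal_zero split: nat.split)
  have gJ: "g i \<in> J" for i by (simp add: J_def ideal_gen_base)
  have "monom (g i) 1 \<in> Rees" for i
    using gJ ideal_pow_1[of J] by (auto simp: Rees_def ideal_zero J_def)
  then have CR: "C \<subseteq> Rees"
    unfolding C_def using const by (intro adjoin_list_least Rees) (auto simp: \<kappa>_def)
  have "\<exists>q. monom q s \<in> C \<and> f ^ (s + Suc c) - q \<in> ideal_pow J (s + Suc (Suc (Suc c)))" for s
  proof -
    \<comment> \<open>At this order of truncation the error of a coefficient lies in J^(c+3), which
      leaves room for the final estimate; what is kept is a polynomial in the variables.\<close>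
    let ?M = "N * Suc (Suc (Suc c))"
    have M: "ideal_pow max_ideal ?M \<subseteq> ideal_pow J (Suc (Suc (Suc c)))"
      using ideal_pow_mono[OF N, of "Suc (Suc (Suc c))"] by (simp only: ideal_pow_pow)
    have "f ^ (s + Suc c) \<in> ideal_pow J s"
      using power_in_ideal_pow[OF f] shift by blast
    then obtain d where d: "f ^ (s + Suc c) = (\<Sum>a | deg a = s. d a * mon g a)"
      unfolding J_def by (rule ideal_pow_expand')
    have "spans_mod max_ideal {()} (\<lambda>_. 1 :: ('a, 'n) mfps)"
      unfolding spans_mod_def lcomb_def using diff_const_in_max_ideal by (auto intro!: exI[of _ "\<lambda>_. mfps_nth _ 0"])
    from spans_mod_pow[of mfps_var, folded max_ideal_gen, OF this, of ?M]
    have "\<exists>e. d a - lcomb e (\<lambda>(i, b). 1 * mon mfps_var b) ({()} \<times> {a. deg a < ?M}) \<in> ideal_pow max_ideal ?M" for a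
      unfolding spans_mod_def by blast
    then obtain e where e: "\<And>a. d a - lcomb (e a) (\<lambda>(i, b). 1 * mon mfps_var b) ({()} \<times> {a. deg a < ?M}) \<in> ideal_pow max_ideal ?M"
      by metis
    define \<delta> where "\<delta> a = lcomb (e a) (\<lambda>(i, b). 1 * mon mfps_var b) ({()} \<times> {a. deg a < ?M})" for a
    have mX: "[:mon mfps_var b:] \<in> C" for b
    proof -
      have "[:mon mfps_var b :: ('a, 'n) mfps:] = (\<Prod>i\<in>UNIV. [:mfps_var i:] ^ Poly_Mapping.lookup b i)"
        unfolding mon_def by (simp add: poly_const_pow prod_to_poly)
      then show ?thesis using CX by (auto intro!: subring_prod[OF C] subring_power[OF C])
    qed
    have "[:\<delta> a:] \<in> C" for a
    proof -
      have "[:\<delta> a:] = (\<Sum>p\<in>{()} \<times> {a. deg a < ?M}. \<kappa> (e a p) * [:mon mfps_var (snd p):])"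
        unfolding \<delta>_def lcomb_def \<kappa>_def by (simp add: case_prod_unfold mult.commute flip: sum_to_poly)
      also have "\<dots> \<in> C" by (intro subring_sum subring_mult C C\<kappa> mX)
      finally show ?thesis .
    qed
    moreover have "monom (mon g a) s \<in> C" if "deg a = s" for a
    proof -
      have "monom (mon g a) (deg a) = (\<Prod>i\<in>UNIV. monom (g i) 1 ^ Poly_Mapping.lookup a i)"
        unfolding mon_def deg_def by (simp only: monom_power prod_monom mult_1)
      then show ?thesis using that Cg by (auto intro!: subring_prod[OF C] subring_power[OF C])
    qed
    ultimately have "(\<Sum>a | deg a = s. [:\<delta> a:] * monom (mon g a) s) \<in> C"
      by (intro subring_sum subring_mult C) auto
    also have "(\<Sum>a | deg a = s. [:\<delta> a:] * monom (mon g a) s) = monom (\<Sum>a | deg a = s. \<delta> a * mon g a) s"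
      by (simp add: monom_sum smult_monom)
    finally have 1: "monom (\<Sum>a | deg a = s. \<delta> a * mon g a) s \<in> C" .
    have "f ^ (s + Suc c) - (\<Sum>a | deg a = s. \<delta> a * mon g a) = (\<Sum>a | deg a = s. (d a - \<delta> a) * mon g a)"
      by (simp only: d sum_subtractf left_diff_distrib)
    also have "\<dots> \<in> ideal_pow J (s + Suc (Suc (Suc c)))"
    proof (rule ideal_sum[OF is_ideal_pow])
      fix a :: "'n \<Rightarrow>\<^sub>0 nat" assume a: "a \<in> {a. deg a = s}"
      have "d a - \<delta> a \<in> ideal_pow J (Suc (Suc (Suc c)))" using e[of a] M by (auto simp: \<delta>_def)
      moreover have "mon g a \<in> ideal_pow J s" using mon_in_ideal_pow[of g J a, OF gJ] a by simp
      ultimately show "(d a - \<delta> a) * mon g a \<in> ideal_pow J (s + Suc (Suc (Suc c)))"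
        using ideal_pow_mult_mem by (metis add.commute)
    qed
    finally show ?thesis using 1 by blast
  qed
  then obtain q where q: "\<And>s. monom (q s) s \<in> C" "\<And>s. f ^ (s + Suc c) - q s \<in> ideal_pow J (s + Suc (Suc (Suc c)))"
    by metis
  have "range (\<lambda>s. monom (q s) s) \<subseteq> C" using q(1) by auto
  \<comment> \<open>The sequence of the q_s t^s lies in the noetherian ring \<open>C\<close>;
    comparing coefficients of t^n gives the equation for \<open>q n\<close>.\<close>
  from noeth[unfolded noetherian_def, rule_format, OF this] obtain n \<beta> where \<beta>: "\<And>j. j < n \<Longrightarrow> \<beta> j \<in> C" "monom (q n) n = (\<Sum>j<n. \<beta> j * monom (q j) j)"
    by blast
  define \<gamma> where "\<gamma> j = coeff (\<beta> j) (n - j)" for j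
  have \<gamma>: "\<gamma> j \<in> ideal_pow J (n - j)" if "j < n" for j
    using \<beta>(1)[OF that] CR by (auto simp: \<gamma>_def Rees_def)
  have "q n = coeff (monom (q n) n) n" by simp
  also have "\<dots> = (\<Sum>j<n. \<gamma> j * q j)"
    unfolding \<beta>(2) coeff_sum by (rule sum.cong)
      (simp_all add: \<gamma>_def coeff_monom_mult mult.commute[of _ "monom _ _"] mult.commute[of "coeff _ _"])
  finally have qn: "q n = (\<Sum>j<n. \<gamma> j * q j)" .
  \<comment> \<open>The approximations \<open>q j\<close> are replaced by powers of
    \<open>f\<close>; the errors lie in high powers of \<open>J\<close> and are harmless.\<close>
  have fe: "f ^ (n + Suc c) = (f ^ (n + Suc c) - q n) + (\<Sum>j<n. \<gamma> j * f ^ (j + Suc c) - \<gamma> j * (f ^ (j + Suc c) - q j))"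
    by (simp add: qn algebra_simps)
  have big: "ideal_pow J (n + Suc (Suc (Suc c))) \<subseteq> ideal_mult J (ideal_pow T (n + c))"
    using ideal_mult_mono[of J J "ideal_pow J (n + Suc (Suc c))" "ideal_pow T (n + c)"]
      ideal_pow_mono[OF JT, of "n + Suc (Suc c)"] ideal_pow_antimono[of "n + c" "n + Suc (Suc c)" T] by auto
  have 1: "\<gamma> j * f ^ (j + Suc c) \<in> ideal_mult J (ideal_pow T (n + c))" if "j < n" for j
  proof -
    have "\<gamma> j \<in> ideal_mult J (ideal_pow T (n - Suc j))"
      using \<gamma>[OF that] ideal_mult_mono[OF order.refl ideal_pow_mono[OF JT, of "n - Suc j"], of J] that
      by (auto simp: Suc_diff_Suc simp flip: ideal_pow.simps)
    then have "\<gamma> j * f ^ (j + Suc c) \<in> ideal_mult (ideal_mult J (ideal_pow T (n - Suc j))) (ideal_pow T (j + Suc c))"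
      using power_in_ideal_pow[OF f] by (intro ideal_mult_mem)
    also have "\<dots> = ideal_mult J (ideal_pow T (n - Suc j + (j + Suc c)))"
      by (simp only: ideal_mult_assoc ideal_pow_add)
    also have "n - Suc j + (j + Suc c) = n + c" using that by simp
    finally show ?thesis .
  qed
  have 2: "\<gamma> j * (f ^ (j + Suc c) - q j) \<in> ideal_mult J (ideal_pow T (n + c))" if "j < n" for j
    using ideal_pow_mult_mem[OF \<gamma>[OF that] q(2)[of j]] big that by auto
  have "f ^ (n + Suc c) \<in> ideal_mult J (ideal_pow T (n + c))"
    by (subst fe) (intro ideal_add ideal_sum ideal_diff is_ideal_mult subsetD[OF big q(2)]; use 1 2 in simp)
  then show ?thesis by auto
qed

subsection \<open>The weak Nullstellensatz\<close>

text \<open>Instead of inverting the leading coefficient, the dividend is multiplied by one of its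
  powers: leading coefficients will be invertible only modulo a maximal ideal.\<close>

lemma pseudo_division:
  fixes B :: "'a::comm_ring_1 set"
  assumes B: "subring B" and "p \<in> poly_over B" and r: "r \<in> poly_over B"
  shows "\<exists>k s t. s \<in> poly_over B \<and> t \<in> poly_over B \<and> smult (lead_coeff r ^ k) p = r * s + t \<and>
    (t = 0 \<or> degree t < degree r) \<and> degree s \<le> degree p - degree r"
  using assms(2)
proof (induction "degree p" arbitrary: p rule: less_induct)
  case (less p)
  note P = subring_poly_over[OF B]
  let ?l = "lead_coeff r"
  show ?case
  proof (cases "p = 0 \<or> degree p < degree r")
    case True
    then show ?thesis
      using less.prems subring_zero[OF P] by (intro exI[of _ 0] exI[of _ "0 :: 'a poly"] exI[of _ p]) auto
  next
    case False
    define m where "m = monom (lead_coeff p) (degree p - degree r)"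
    define p1 where "p1 = [:?l:] * p - m * r"
    have mP: "m \<in> poly_over B"
      unfolding m_def using less.prems by (intro poly_over_monom B) (auto simp: poly_over_def)
    have lP: "[:?l:] \<in> poly_over B" using r by (intro poly_over_const B) (auto simp: poly_over_def)
    have p1P: "p1 \<in> poly_over B"
      unfolding p1_def using mP lP r less.prems by (intro subring_diff subring_mult P)
    have "degree m \<le> degree p - degree r" unfolding m_def by (rule degree_monom_le)
    then have "degree (m * r) \<le> degree p" using degree_mult_le[of m r] False by linarith
    then have dp1: "degree p1 \<le> degree p"
      unfolding p1_def by (intro degree_diff_le) (auto intro: order.trans[OF degree_smult_le])
    have "coeff p1 (degree p) = 0"
      using False by (simp add: p1_def m_def coeff_monom_mult mult.commute[of "lead_coeff p"])
    then have "p1 = 0 \<or> degree p1 < degree p"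
      using dp1 by (metis le_neq_implies_less leading_coeff_0_iff)
    then obtain k s t where st: "s \<in> poly_over B" "t \<in> poly_over B" "smult (?l ^ k) p1 = r * s + t"
      "t = 0 \<or> degree t < degree r" "degree s \<le> degree p - degree r"
    proof
      assume "p1 = 0"
      then show thesis using that[of 0 0 0] subring_zero[OF P] by auto
    next
      assume lt: "degree p1 < degree p"
      then obtain k s t where "s \<in> poly_over B" "t \<in> poly_over B" "smult (?l ^ k) p1 = r * s + t"
        "t = 0 \<or> degree t < degree r" "degree s \<le> degree p1 - degree r"
        using less.hyps[OF lt p1P] by blast
      moreover have "degree p1 - degree r \<le> degree p - degree r" using dp1 by (rule diff_le_mono)
      ultimately show thesis by (intro that) (auto intro: order.trans)
    qed
    have "smult (?l ^ Suc k) p = r * (s + [:?l ^ k:] * m) + t"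
    proof -
      have "smult (?l ^ Suc k) p = smult (?l ^ k) (p1 + m * r)" by (simp add: p1_def smult_add_right mult.commute)
      also have "\<dots> = r * s + t + smult (?l ^ k) (m * r)" by (simp add: smult_add_right st(3))
      finally show ?thesis by (simp add: algebra_simps)
    qed
    moreover have "s + [:?l ^ k:] * m \<in> poly_over B"
      using mP st(1) r by (intro subring_add subring_mult P poly_over_const B subring_power) (auto simp: poly_over_def)
    moreover have "degree (s + [:?l ^ k:] * m) \<le> degree p - degree r"
      using st(5) \<open>degree m \<le> _\<close> by (intro degree_add_le) (auto intro: order.trans[OF degree_smult_le])
    ultimately show ?thesis using st(2,4) by blast
  qed
qed

text \<open>Field theory is carried out modulo \<open>M\<close> without forming a quotient type:
  being nonzero reads as not lying in \<open>M\<close>.\<close>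

locale maximal_ideal_ctx =
  fixes M :: "'a::comm_ring_1 set"
  assumes M: "is_ideal M" and one: "1 \<notin> M" and inv: "x \<notin> M \<Longrightarrow> \<exists>y. x * y - 1 \<in> M"
begin

lemmas M_intros = ideal_diff[OF M] ideal_add[OF M] ideal_mult_l[OF M] ideal_mult_r[OF M]

lemma prime: "x * y \<in> M \<Longrightarrow> x \<in> M \<or> y \<in> M"
proof (rule disjCI, rule ccontr)
  assume xy: "x * y \<in> M" and "y \<notin> M" "x \<notin> M"
  then obtain z where "x * z - 1 \<in> M" using inv by blast
  then have "z * (x * y) - y * (x * z - 1) \<in> M" using xy by (blast intro: M_intros)
  also have "z * (x * y) - y * (x * z - 1) = y" by (simp add: algebra_simps)
  finally show False using \<open>y \<notin> M\<close> by simp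
qed

lemma prime_power: "x ^ k \<in> M \<Longrightarrow> x \<in> M"
  using one by (induction k) (auto dest: prime)

lemma poly_mod: "(\<And>i. coeff p i \<in> M) \<Longrightarrow> poly p a \<in> M"
  unfolding poly_altdef by (intro ideal_sum ideal_mult_r M)

text \<open>Units of a polynomial ring over a field are constant. Modulo \<open>M\<close> the
  degrees are the largest indices \<open>m\<close> and \<open>n\<close> with coefficient outside
  \<open>M\<close>, and the product of these two coefficients survives in degree m + n.\<close>

lemma poly_unit_mod:
  assumes "h * \<gamma> - 1 \<in> poly_over M" shows "coeff h (Suc i) \<in> M"
proof (rule ccontr)
  assume hi: "coeff h (Suc i) \<notin> M"
  have fin: "finite {i. coeff p i \<notin> M}" for p :: "'a poly"
    by (rule finite_subset[of _ "{..degree p}"]) (use ideal_zero[OF M] in \<open>auto intro!: le_degree\<close>)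
  define m where "m = Max {i. coeff h i \<notin> M}"
  have m: "coeff h m \<notin> M" "coeff h j \<in> M" if "m < j" for j
    using Max_in[OF fin, of h] Max_ge[OF fin, of j h] hi that unfolding m_def by auto
  have m0: "coeff h m \<notin> M" using Max_in[OF fin, of h] hi unfolding m_def by auto
  have "Suc i \<le> m" using Max_ge[OF fin, of "Suc i" h] hi unfolding m_def by simp
  have "\<exists>j. coeff \<gamma> j \<notin> M"
  proof (rule ccontr)
    assume "\<nexists>j. coeff \<gamma> j \<notin> M"
    then have "coeff (h * \<gamma>) 0 \<in> M" by (auto simp: coeff_mult intro!: ideal_mult_l M)
    moreover have "coeff (h * \<gamma> - 1) 0 \<in> M" using assms by (simp only: poly_over_def mem_Collect_eq)
    ultimately have "coeff (h * \<gamma>) 0 - coeff (h * \<gamma> - 1) 0 \<in> M" by (blast intro: M_intros)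
    then show False using one by simp
  qed
  then obtain l where l: "coeff \<gamma> l \<notin> M" ..
  define n where "n = Max {i. coeff \<gamma> i \<notin> M}"
  have n0: "coeff \<gamma> n \<notin> M" using Max_in[OF fin, of \<gamma>] l unfolding n_def by auto
  have n: "coeff \<gamma> j \<in> M" if "n < j" for j
    using Max_ge[OF fin, of j \<gamma>] that unfolding n_def by auto
  have "coeff (h * \<gamma>) (m + n) = coeff h m * coeff \<gamma> n + (\<Sum>k\<in>{..m + n} - {m}. coeff h k * coeff \<gamma> (m + n - k))"
    unfolding coeff_mult by (subst sum.remove[of _ m]) auto
  moreover have "(\<Sum>k\<in>{..m + n} - {m}. coeff h k * coeff \<gamma> (m + n - k)) \<in> M"
  proof (rule ideal_sum[OF M])
    fix k assume k: "k \<in> {..m + n} - {m}"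
    show "coeff h k * coeff \<gamma> (m + n - k) \<in> M"
    proof (cases "m < k")
      case True
      then show ?thesis by (intro ideal_mult_r[OF M] m(2))
    next
      case False
      then have "n < m + n - k" using k by auto
      then show ?thesis by (intro ideal_mult_l[OF M] n)
    qed
  qed
  moreover have "coeff (h * \<gamma>) (m + n) \<in> M"
  proof -
    have "coeff (h * \<gamma> - 1) (m + n) \<in> M" using assms by (simp only: poly_over_def mem_Collect_eq)
    then show ?thesis using \<open>Suc i \<le> m\<close> by (simp add: coeff_1)
  qed
  ultimately have "coeff h m * coeff \<gamma> n \<in> M"
    using ideal_diff[OF M, of "coeff (h * \<gamma>) (m + n)"] by fastforce
  then show False using prime m0 n0 by blast
qed

text \<open>Since \<open>M\<close> is contained in \<open>K\<close>, such a \<open>K\<close> is the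
  full preimage of a subfield of the residue field.\<close>

definition subfield_mod :: "'a set \<Rightarrow> bool" where
  "subfield_mod K \<longleftrightarrow> subring K \<and> M \<subseteq> K \<and> (\<forall>x\<in>K. x \<notin> M \<longrightarrow> (\<exists>y\<in>K. x * y - 1 \<in> M))"

definition finite_mod :: "'a set \<Rightarrow> 'a set \<Rightarrow> 'a set \<Rightarrow> bool" where
  "finite_mod K E A \<longleftrightarrow> finite E \<and> (\<forall>x\<in>A. \<exists>c. (\<forall>e\<in>E. c e \<in> K) \<and> x - (\<Sum>e\<in>E. c e * e) \<in> M)"

lemma finite_modE:
  assumes "finite_mod K E A" "x \<in> A"
  obtains c where "\<And>e. e \<in> E \<Longrightarrow> c e \<in> K" "x - (\<Sum>e\<in>E. c e * e) \<in> M"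
  using assms unfolding finite_mod_def by metis

text \<open>Dropping the leading coefficients that lie in \<open>M\<close> makes the formal degree
  equal to the degree modulo \<open>M\<close>.\<close>

lemma strip_leading:
  assumes B: "subring B" and q: "q \<in> poly_over B" "coeff q i \<notin> M"
  obtains q' where "q' \<in> poly_over B" "degree q' \<le> degree q" "lead_coeff q' \<notin> M" "poly q a - poly q' a \<in> M"
proof -
  have fin: "finite {i. coeff q i \<notin> M}"
    by (rule finite_subset[of _ "{..degree q}"]) (use ideal_zero[OF M] in \<open>auto intro!: le_degree\<close>)
  define m where "m = Max {i. coeff q i \<notin> M}"
  have m0: "coeff q m \<notin> M" using Max_in[OF fin] q unfolding m_def by auto
  have m: "coeff q j \<in> M" if "m < j" for j
    using Max_ge[OF fin, of j] that unfolding m_def by auto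
  define q' where "q' = (\<Sum>i\<le>m. monom (coeff q i) i)"
  have cq': "coeff q' i = (if i \<le> m then coeff q i else 0)" for i
    by (simp add: q'_def coeff_sum if_distrib[of "\<lambda>c. c = _"] cong: if_cong)
  have "coeff q' m \<noteq> 0" using m0 ideal_zero[OF M] by (auto simp: cq')
  then have dq': "degree q' = m"
    by (intro antisym degree_le le_degree) (auto simp: cq')
  have "poly (q - q') a \<in> M"
    by (rule poly_mod) (auto simp: cq' ideal_zero[OF M] m)
  moreover have "m \<le> degree q" using m0 ideal_zero[OF M] by (metis le_degree)
  ultimately show thesis
    using that[of q'] q(1) m0 by (auto simp: dq' cq' poly_over_def subring_zero[OF B])
qed

text \<open>\<open>p\<close> plays the role of the minimal polynomial of \<open>a\<close>. Its
  powers below the degree of \<open>p\<close> span K[a]; an element \<open>y\<close> is inverted by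
  taking a polynomial of least degree whose value is a nonzero multiple of \<open>y\<close> and
  dividing \<open>p\<close> by it.\<close>

lemma algebraic_adjoin:
  assumes K: "subfield_mod K"
    and q: "q \<in> poly_over K" "coeff q i \<notin> M" "poly q a \<in> M"
  shows "subfield_mod (adjoin K a)" and "\<exists>E. finite_mod K E (adjoin K a)"
proof -
  let ?C = "adjoin K a"
  have subK: "subring K" and MK: "M \<subseteq> K" using K by (auto simp: subfield_mod_def)
  note P = subring_poly_over[OF subK] and C = subring_adjoin[OF subK, of a]
  define PS where "PS p \<longleftrightarrow> p \<in> poly_over K \<and> lead_coeff p \<notin> M \<and> poly p a \<in> M" for p
  obtain q' where "q' \<in> poly_over K" "lead_coeff q' \<notin> M" "poly q a - poly q' a \<in> M"
    using strip_leading[OF subK q(1,2)] by blast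
  then have "PS q'" using ideal_cong[OF M] q(3) by (auto simp: PS_def)
  then obtain p where p: "PS p" and pmin: "\<And>r. PS r \<Longrightarrow> degree p \<le> degree r"
    using ex_has_least_nat[of PS q' degree] by blast
  have pK: "p \<in> poly_over K" and lp: "lead_coeff p \<notin> M" and pa: "poly p a \<in> M"
    using p by (auto simp: PS_def)
  have invK: "\<exists>y\<in>K. x * y - 1 \<in> M" if "x \<in> K" "x \<notin> M" for x using K that by (auto simp: subfield_mod_def)
  have powK: "\<exists>y\<in>K. lead_coeff r ^ k * y - 1 \<in> M" if "r \<in> poly_over K" "lead_coeff r \<notin> M" for r k
    using that prime_power by (intro invK subring_power subK) (auto simp: poly_over_def)
  show "subfield_mod ?C"
    unfolding subfield_mod_def
  proof (intro conjI ballI impI C)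
    show "M \<subseteq> ?C" using MK adjoin_superset[OF subK] by blast
    fix y assume y: "y \<in> ?C" "y \<notin> M"
    \<comment> \<open>The polynomials whose value at \<open>a\<close> is nonzero modulo
      \<open>M\<close> and lies in the ideal generated by \<open>y\<close>.\<close>
    define RS where "RS r \<longleftrightarrow> r \<in> poly_over K \<and> lead_coeff r \<notin> M \<and> poly r a \<notin> M \<and> (\<exists>h\<in>?C. poly r a - h * y \<in> M)" for r
    have strip: "\<exists>r'. RS r' \<and> degree r' \<le> degree r"
      if r: "r \<in> poly_over K" "poly r a \<notin> M" and h: "h \<in> ?C" "poly r a - h * y \<in> M" for r h
    proof -
      obtain j where "coeff r j \<notin> M" using r(2) poly_mod by blast
      then obtain r' where r': "r' \<in> poly_over K" "degree r' \<le> degree r" "lead_coeff r' \<notin> M" "poly r a - poly r' a \<in> M"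
        using strip_leading[OF subK r(1)] by blast
      have "(poly r a - h * y) - (poly r a - poly r' a) \<in> M" using h(2) r'(4) by (blast intro: M_intros)
      then have "poly r' a - h * y \<in> M" by simp
      moreover have "poly r' a \<notin> M" using ideal_cong[OF M r'(4)] r(2) by blast
      ultimately have "RS r'" unfolding RS_def using r' h(1) by blast
      then show ?thesis using r' by blast
    qed
    obtain r0 where "r0 \<in> poly_over K" "y = poly r0 a" using y by (auto simp: adjoin_def)
    then obtain r1 where "RS r1" using strip[of r0 1] y subring_one[OF C] ideal_zero[OF M] by auto
    then obtain r where r: "RS r" and rmin: "\<And>s. RS s \<Longrightarrow> degree r \<le> degree s"
      using ex_has_least_nat[of RS r1 degree] by blast
    then obtain h where rK: "r \<in> poly_over K" and lr: "lead_coeff r \<notin> M" and ra: "poly r a \<notin> M"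
      and h: "h \<in> ?C" "poly r a - h * y \<in> M" by (auto simp: RS_def)
    have "degree r < degree p"
    proof (rule ccontr)
      assume "\<not> degree r < degree p"
      obtain k s t where st: "s \<in> poly_over K" "t \<in> poly_over K" "smult (lead_coeff p ^ k) r = p * s + t"
        "t = 0 \<or> degree t < degree p"
        using pseudo_division[OF subK rK pK] by blast
      have ta: "lead_coeff p ^ k * poly r a = poly p a * poly s a + poly t a"
        using arg_cong[OF st(3), of "\<lambda>p. poly p a"] by simp
      have "lead_coeff p ^ k \<in> K" using pK by (intro subring_power subK) (auto simp: poly_over_def)
      then have lC: "lead_coeff p ^ k \<in> ?C" using adjoin_superset[OF subK] by blast
      have "lead_coeff p ^ k * poly r a \<notin> M" using lp ra prime prime_power by blast
      then have "poly t a \<notin> M" unfolding ta using pa by (auto intro: ideal_add ideal_mult_r M)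
      moreover have "poly t a - (lead_coeff p ^ k * h) * y \<in> M"
      proof -
        have "lead_coeff p ^ k * (poly r a - h * y) - poly p a * poly s a \<in> M"
          using pa h by (blast intro: M_intros)
        then show ?thesis using ta by (simp add: algebra_simps)
      qed
      ultimately obtain t' where "RS t'" "degree t' \<le> degree t"
        using strip[OF st(2)] lC h(1) subring_mult[OF C] by blast
      moreover have "t \<noteq> 0" using \<open>poly t a \<notin> M\<close> ideal_zero[OF M] by auto
      ultimately show False using rmin[of t'] st(4) \<open>\<not> degree r < degree p\<close> by simp
    qed
    obtain k s t where st: "s \<in> poly_over K" "t \<in> poly_over K" "smult (lead_coeff r ^ k) p = r * s + t"
        "t = 0 \<or> degree t < degree r" "degree s \<le> degree p - degree r"
      using pseudo_division[OF subK pK rK] by blast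
    have ta: "lead_coeff r ^ k * poly p a = poly r a * poly s a + poly t a"
      using arg_cong[OF st(3), of "\<lambda>p. poly p a"] by simp
    have sC: "poly s a \<in> ?C" using st(1) by (auto simp: adjoin_def)
    \<comment> \<open>The remainder again has its value in the ideal generated by \<open>y\<close>;
      if nonzero, it would contradict the minimality of \<open>r\<close>.\<close>
    have tM: "poly t a \<in> M"
    proof (rule ccontr)
      assume nt: "poly t a \<notin> M"
      have "lead_coeff r ^ k * poly p a - poly s a * (poly r a - h * y) \<in> M"
        using pa h by (blast intro: M_intros)
      then have "poly t a - (- poly s a * h) * y \<in> M" using ta by (simp add: algebra_simps)
      moreover have "- poly s a * h \<in> ?C" using sC h by (intro subring_mult subring_uminus C)
      ultimately obtain t' where "RS t'" "degree t' \<le> degree t" using strip[OF st(2) nt] by blast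
      moreover have "t \<noteq> 0" using nt ideal_zero[OF M] by auto
      ultimately show False using rmin[of t'] st(4) by simp
    qed
    have "poly r a * poly s a = lead_coeff r ^ k * poly p a - poly t a" using ta by simp
    also have "\<dots> \<in> M" using pa tM by (blast intro: M_intros)
    finally have sM: "poly s a \<in> M" using prime ra by blast
    \<comment> \<open>Otherwise \<open>s\<close>, which vanishes at \<open>a\<close>, would have
      degree below that of \<open>p\<close>. A constant \<open>r\<close> outside \<open>M\<close> is
      invertible, and so is \<open>y\<close>.\<close>
    have "degree r = 0"
    proof (rule ccontr)
      assume "degree r \<noteq> 0"
      have "\<exists>j. coeff s j \<notin> M"
      proof (rule ccontr)
        assume "\<nexists>j. coeff s j \<notin> M"
        then have "coeff (r * s) (degree p) \<in> M" by (auto simp: coeff_mult intro!: ideal_sum ideal_mult_l M)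
        moreover have "coeff t (degree p) = 0" using st(4) \<open>degree r < degree p\<close> by (auto intro: coeff_eq_0)
        ultimately have "lead_coeff r ^ k * lead_coeff p \<in> M"
          using arg_cong[OF st(3), of "\<lambda>q. coeff q (degree p)"] by simp
        then show False using lr lp prime prime_power by blast
      qed
      then obtain s' where s': "s' \<in> poly_over K" "degree s' \<le> degree s" "lead_coeff s' \<notin> M" "poly s a - poly s' a \<in> M"
        using strip_leading[OF subK st(1)] by blast
      then have "PS s'" using ideal_cong[OF M s'(4)] sM by (simp add: PS_def)
      then have "degree p \<le> degree s'" by (rule pmin)
      then show False using s'(2) st(5) \<open>degree r \<noteq> 0\<close> \<open>degree r < degree p\<close> by linarith
    qed
    then obtain b where rb: "r = [:b:]" by (rule degree_eq_zeroE)
    have bK: "b \<in> K" "b \<notin> M" using rK lr rb by (auto simp: poly_over_def dest: spec[of _ 0])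
    then obtain b' where b': "b' \<in> K" "b * b' - 1 \<in> M" using invK by blast
    have "b' \<in> ?C" using b' adjoin_superset[OF subK] by blast
    have "(b * b' - 1) - b' * (poly r a - h * y) \<in> M" using b' h by (blast intro: M_intros)
    then have "y * (b' * h) - 1 \<in> M" by (simp add: rb algebra_simps)
    then show "\<exists>z\<in>?C. y * z - 1 \<in> M" using \<open>b' \<in> ?C\<close> h(1) subring_mult[OF C] by blast
  qed
  have "finite_mod K ((\<lambda>i. a ^ i) ` {..<degree p}) ?C"
    unfolding finite_mod_def
  proof (intro conjI ballI)
    fix x assume "x \<in> ?C"
    then obtain r where r: "r \<in> poly_over K" "x = poly r a" by (auto simp: adjoin_def)
    obtain k s t where st: "t \<in> poly_over K" "smult (lead_coeff p ^ k) r = p * s + t"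
        "t = 0 \<or> degree t < degree p"
      using pseudo_division[OF subK r(1) pK] by blast
    have ta: "lead_coeff p ^ k * x = poly p a * poly s a + poly t a"
      using arg_cong[OF st(2), of "\<lambda>p. poly p a"] r by simp
    obtain l where l: "l \<in> K" "lead_coeff p ^ k * l - 1 \<in> M" using powK[OF pK lp] by blast
    have "l * (poly p a * poly s a) - x * (lead_coeff p ^ k * l - 1) \<in> M"
      using pa l by (blast intro: M_intros)
    also have "l * (poly p a * poly s a) - x * (lead_coeff p ^ k * l - 1) =
        x - l * poly t a + l * (poly p a * poly s a + poly t a - lead_coeff p ^ k * x)"
      by (simp add: algebra_simps)
    finally have x: "x - l * poly t a \<in> M" by (simp add: ta)
    show "\<exists>c. (\<forall>e\<in>(\<lambda>i. a ^ i) ` {..<degree p}. c e \<in> K) \<and> x - (\<Sum>e\<in>(\<lambda>i. a ^ i) ` {..<degree p}. c e * e) \<in> M"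
    proof (intro exI conjI ballI)
      \<comment> \<open>Different powers of \<open>a\<close> may coincide as elements, so the
        coefficients of equal powers are added up.\<close>
      let ?c = "\<lambda>e. \<Sum>i\<in>{i. i < degree p \<and> a ^ i = e}. l * coeff t i"
      show "?c e \<in> K" for e
        using l st(1) by (intro subring_sum subring_mult subK) (auto simp: poly_over_def)
      have "poly t a = (\<Sum>i<degree p. coeff t i * a ^ i)"
      proof (cases "t = 0")
        case False
        then have "degree t < degree p" using st(3) by simp
        then show ?thesis
          unfolding poly_altdef by (intro sum.mono_neutral_left) (auto simp: coeff_eq_0)
      qed simp
      then have "l * poly t a = (\<Sum>i<degree p. l * coeff t i * a ^ i)" by (simp add: sum_distrib_left mult.assoc)
      also have "\<dots> = (\<Sum>e\<in>(\<lambda>i. a ^ i) ` {..<degree p}. \<Sum>i\<in>{i \<in> {..<degree p}. a ^ i = e}. l * coeff t i * a ^ i)"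
        by (rule sum.group[symmetric]) auto
      also have "\<dots> = (\<Sum>e\<in>(\<lambda>i. a ^ i) ` {..<degree p}. ?c e * e)"
        unfolding sum_distrib_right by (intro sum.cong refl) auto
      finally show "x - (\<Sum>e\<in>(\<lambda>i. a ^ i) ` {..<degree p}. ?c e * e) \<in> M" using x by simp
    qed
  qed simp
  then show "\<exists>E. finite_mod K E ?C" ..
qed

lemma finite_mod_trans:
  assumes K: "subring K" and 1: "finite_mod K E C" and 2: "finite_mod C F UNIV"
  shows "\<exists>G. finite_mod K G UNIV"
proof -
  have fin: "finite E" "finite F" using 1 2 by (auto simp: finite_mod_def)
  let ?G = "(\<lambda>(e, f). e * f) ` (E \<times> F)"
  have "finite_mod K ?G UNIV"
    unfolding finite_mod_def
  proof (intro conjI ballI)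
    fix x
    obtain c where c: "\<And>f. f \<in> F \<Longrightarrow> c f \<in> C" "x - (\<Sum>f\<in>F. c f * f) \<in> M"
      using finite_modE[OF 2] by blast
    have "\<forall>f. \<exists>d. f \<in> F \<longrightarrow> (\<forall>e\<in>E. d e \<in> K) \<and> c f - (\<Sum>e\<in>E. d e * e) \<in> M"
      using 1 c(1) by (auto simp: finite_mod_def)
    then obtain d where d: "\<And>f e. f \<in> F \<Longrightarrow> e \<in> E \<Longrightarrow> d f e \<in> K" "\<And>f. f \<in> F \<Longrightarrow> c f - (\<Sum>e\<in>E. d f e * e) \<in> M"
      by metis
    let ?b = "\<lambda>g. \<Sum>p\<in>{p \<in> E \<times> F. (case p of (e, f) \<Rightarrow> e * f) = g}. d (snd p) (fst p)"
    have "(\<Sum>f\<in>F. (c f - (\<Sum>e\<in>E. d f e * e)) * f) \<in> M" using d(2) by (intro ideal_sum ideal_mult_r M)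
    then have "(x - (\<Sum>f\<in>F. c f * f)) + (\<Sum>f\<in>F. (c f - (\<Sum>e\<in>E. d f e * e)) * f) \<in> M"
      using c(2) by (blast intro: M_intros)
    then have *: "x - (\<Sum>f\<in>F. (\<Sum>e\<in>E. d f e * e) * f) \<in> M" by (simp add: left_diff_distrib sum_subtractf)
    have "(\<Sum>f\<in>F. (\<Sum>e\<in>E. d f e * e) * f) = (\<Sum>p\<in>E \<times> F. d (snd p) (fst p) * (case p of (e, f) \<Rightarrow> e * f))"
      unfolding sum_distrib_right
      by (subst sum.swap) (simp add: sum.cartesian_product case_prod_unfold mult.assoc)
    also have "\<dots> = (\<Sum>g\<in>?G. \<Sum>p\<in>{p \<in> E \<times> F. (case p of (e, f) \<Rightarrow> e * f) = g}. d (snd p) (fst p) * (case p of (e, f) \<Rightarrow> e * f))"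
      using fin by (intro sum.group[symmetric]) auto
    also have "\<dots> = (\<Sum>g\<in>?G. ?b g * g)"
      unfolding sum_distrib_right by (intro sum.cong refl) auto
    finally have "x - (\<Sum>g\<in>?G. ?b g * g) \<in> M" using * by simp
    moreover have "?b g \<in> K" for g using d(1) by (intro subring_sum K) auto
    ultimately show "\<exists>c. (\<forall>g\<in>?G. c g \<in> K) \<and> x - (\<Sum>g\<in>?G. c g * g) \<in> M" by (intro exI[of _ ?b]) blast
  qed (use fin in auto)
  then show ?thesis ..
qed

text \<open>If \<open>a\<close> is transcendental over \<open>K\<close>, then with \<open>s\<close> a common denominator of the structure
  constants every nonzero element of \<open>K[a]\<close> would divide a power of \<open>s\<close>, but \<open>1 + a s\<close>
  does not.\<close>

lemma transcendental_adjoin: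
  assumes K: "subfield_mod K"
    and tr: "\<And>q i. q \<in> poly_over K \<Longrightarrow> poly q a \<in> M \<Longrightarrow> coeff q i \<in> M"
    and gen: "adjoin_list (adjoin K a) as = UNIV"
    and IH: "\<And>L. subfield_mod L \<Longrightarrow> adjoin_list L as = UNIV \<Longrightarrow> \<exists>E. finite_mod L E UNIV"
  shows False
proof -
  let ?C = "adjoin K a"
  have subK: "subring K" and MK: "M \<subseteq> K" using K by (auto simp: subfield_mod_def)
  note P = subring_poly_over[OF subK] and C = subring_adjoin[OF subK, of a]
  have MC: "M \<subseteq> ?C" using MK adjoin_superset[OF subK] by blast
  \<comment> \<open>The preimage of the fraction field of K[a] inside the residue field modulo
    \<open>M\<close>; the remaining generators are handled over it by the induction
    hypothesis.\<close>
  define L where "L = {x. \<exists>d\<in>?C. d \<notin> M \<and> d * x \<in> ?C}"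
  have CL: "?C \<subseteq> L" unfolding L_def using subring_one[OF C] one by (auto intro!: bexI[of _ 1])
  have "subfield_mod L"
    unfolding subfield_mod_def
  proof (intro conjI ballI impI)
    show "subring L"
      unfolding subring_def
    proof (intro conjI ballI)
      show "1 \<in> L" using CL subring_one[OF C] by blast
      fix x y assume "x \<in> L" "y \<in> L"
      then obtain d e where d: "d \<in> ?C" "d \<notin> M" "d * x \<in> ?C" "e \<in> ?C" "e \<notin> M" "e * y \<in> ?C"
        by (auto simp: L_def)
      have de: "d * e \<in> ?C" "d * e \<notin> M" using d prime subring_mult[OF C] by auto
      have "e * (d * x) - d * (e * y) \<in> ?C" "(d * x) * (e * y) \<in> ?C"
        by (rule subring_diff[OF C subring_mult[OF C d(4,3)] subring_mult[OF C d(1,6)]])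
          (rule subring_mult[OF C d(3,6)])
      then have "(d * e) * (x - y) \<in> ?C" "(d * e) * (x * y) \<in> ?C" by (simp_all add: algebra_simps)
      then show "x - y \<in> L" "x * y \<in> L" unfolding L_def using de by blast+
    qed
    show "M \<subseteq> L" using MC CL by blast
    fix x assume x: "x \<in> L" "x \<notin> M"
    then obtain d where d: "d \<in> ?C" "d \<notin> M" "d * x \<in> ?C" by (auto simp: L_def)
    obtain y where y: "x * y - 1 \<in> M" using inv x(2) by blast
    then have "d * (x * y - 1) \<in> ?C" using MC ideal_mult_l[OF M] by blast
    then have "d * (x * y - 1) + d \<in> ?C" using d by (intro subring_add C)
    then have "(d * x) * y \<in> ?C" by (simp add: algebra_simps)
    moreover have "d * x \<notin> M" using d x prime by blast
    ultimately have "y \<in> L" using d by (auto simp: L_def)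
    then show "\<exists>y\<in>L. x * y - 1 \<in> M" using y by blast
  qed
  note L = this
  have subL: "subring L" using L by (simp add: subfield_mod_def)
  have "adjoin_list ?C as \<subseteq> adjoin_list L as"
    using CL adjoin_list_superset[OF subL, of as] adjoin_list_elem[OF subL, of _ as]
    by (intro adjoin_list_least subring_adjoin_list subL) auto
  then have "adjoin_list L as = UNIV" using gen by auto
  from IH[OF L this] obtain E0 where "finite_mod L E0 UNIV" by blast
  \<comment> \<open>A spanning set of least size, hence a basis over \<open>L\<close> modulo
    \<open>M\<close>.\<close>
  then obtain E where E: "finite_mod L E UNIV" and Emin: "\<And>F. finite_mod L F UNIV \<Longrightarrow> card E \<le> card F"
    using ex_has_least_nat[of "\<lambda>E. finite_mod L E UNIV" E0 card] by blast
  have finE: "finite E" using E by (simp add: finite_mod_def)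
  have indep: "c e0 \<in> M" if c: "\<And>e. e \<in> E \<Longrightarrow> c e \<in> L" "(\<Sum>e\<in>E. c e * e) \<in> M" and e0: "e0 \<in> E" for c e0
  proof (rule ccontr)
    assume "c e0 \<notin> M"
    then obtain y where y: "y \<in> L" "c e0 * y - 1 \<in> M" using L c(1)[OF e0] by (auto simp: subfield_mod_def)
    have "finite_mod L (E - {e0}) UNIV"
      unfolding finite_mod_def
    proof (intro conjI ballI)
      fix x
      obtain b where b: "\<And>e. e \<in> E \<Longrightarrow> b e \<in> L" "x - (\<Sum>e\<in>E. b e * e) \<in> M"
        using finite_modE[OF E] by blast
      have "(x - (\<Sum>e\<in>E. b e * e)) + b e0 * y * (\<Sum>e\<in>E. c e * e) - (b e0 * e0) * (c e0 * y - 1) \<in> M"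
        using b c y by (blast intro: M_intros)
      also have "(x - (\<Sum>e\<in>E. b e * e)) + b e0 * y * (\<Sum>e\<in>E. c e * e) - (b e0 * e0) * (c e0 * y - 1)
          = x - (\<Sum>e\<in>E - {e0}. (b e - b e0 * y * c e) * e)"
        using e0 finE by (simp add: sum.remove[of E e0] algebra_simps sum_subtractf sum_distrib_left)
      finally show "\<exists>c. (\<forall>e\<in>E - {e0}. c e \<in> L) \<and> x - (\<Sum>e\<in>E - {e0}. c e * e) \<in> M"
        using b(1) c(1) y e0
        by (intro exI[of _ "\<lambda>e. b e - b e0 * y * c e"]) (auto intro!: subring_diff subring_mult subL)
    qed (use finE in simp)
    then show False using Emin[of "E - {e0}"] e0 finE by (metis card_Diff1_less not_le)
  qed
  have "E \<noteq> {}" using E one by (auto simp: finite_mod_def dest: spec[of _ 1])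
  then obtain e0 where e0: "e0 \<in> E" by blast
  \<comment> \<open>The lattice spanned by the basis \<open>E\<close> over K[a], up to elements of
    \<open>M\<close>. Every element enters it after multiplication by a denominator.\<close>
  define V where "V = {x. \<exists>c. (\<forall>e\<in>E. c e \<in> ?C) \<and> x - (\<Sum>e\<in>E. c e * e) \<in> M}"
  have VI: "x \<in> V" if "\<And>e. e \<in> E \<Longrightarrow> c e \<in> ?C" "x - (\<Sum>e\<in>E. c e * e) \<in> M" for x c
    using that unfolding V_def by blast
  have V_mult: "d * x \<in> V" if "d \<in> ?C" "x \<in> V" for d x
  proof -
    from that obtain c where c: "\<forall>e\<in>E. c e \<in> ?C" "x - (\<Sum>e\<in>E. c e * e) \<in> M" by (auto simp: V_def)
    from c(2) have "d * (x - (\<Sum>e\<in>E. c e * e)) \<in> M" by (rule ideal_mult_l[OF M])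
    then have "d * x - (\<Sum>e\<in>E. (d * c e) * e) \<in> M" by (simp add: right_diff_distrib sum_distrib_left mult.assoc)
    moreover have "d * c e \<in> ?C" if "e \<in> E" for e using c(1) \<open>d \<in> ?C\<close> that subring_mult[OF C] by blast
    ultimately show ?thesis using VI[of "\<lambda>e. d * c e"] by blast
  qed
  have V_diff: "x - y \<in> V" if "x \<in> V" "y \<in> V" for x y
  proof -
    from that obtain c d where c: "\<forall>e\<in>E. c e \<in> ?C" "x - (\<Sum>e\<in>E. c e * e) \<in> M"
      "\<forall>e\<in>E. d e \<in> ?C" "y - (\<Sum>e\<in>E. d e * e) \<in> M" by (auto simp: V_def)
    have "(x - (\<Sum>e\<in>E. c e * e)) - (y - (\<Sum>e\<in>E. d e * e)) \<in> M" using c by (blast intro: M_intros)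
    then have "(x - y) - (\<Sum>e\<in>E. (c e - d e) * e) \<in> M" by (simp add: left_diff_distrib sum_subtractf algebra_simps)
    moreover have "c e - d e \<in> ?C" if "e \<in> E" for e using c that subring_diff[OF C] by blast
    ultimately show ?thesis using VI[of "\<lambda>e. c e - d e"] by blast
  qed
  have MV: "M \<subseteq> V" unfolding V_def using subring_zero[OF C] by (auto intro!: exI[of _ "\<lambda>_. 0"])
  have V_add: "x + y \<in> V" if "x \<in> V" "y \<in> V" for x y
    using V_diff[OF that(1) V_diff[OF subsetD[OF MV ideal_zero[OF M]] that(2)]] by simp
  have V_sum: "sum F A \<in> V" if "finite A" "\<And>i. i \<in> A \<Longrightarrow> F i \<in> V" for F and A :: "'a set"
    using that MV ideal_zero[OF M] V_add by (induction A rule: finite_induct) auto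
  have EV: "e \<in> V" if "e \<in> E" for e
    unfolding V_def using that finE subring_zero[OF C] subring_one[OF C] ideal_zero[OF M]
    by (intro CollectI exI[of _ "\<lambda>e'. if e' = e then 1 else 0"])
      (auto simp: if_distrib[of "\<lambda>c. c * _"] cong: if_cong)
  have denom: "\<exists>d\<in>?C. d \<notin> M \<and> d * x \<in> V" for x
  proof -
    obtain c where c: "\<And>e. e \<in> E \<Longrightarrow> c e \<in> L" "x - (\<Sum>e\<in>E. c e * e) \<in> M"
      using finite_modE[OF E] by blast
    have "\<forall>e\<in>E. \<exists>d. d \<in> ?C \<and> d \<notin> M \<and> d * c e \<in> ?C" using c(1) by (auto simp: L_def)
    then obtain d where d: "\<And>e. e \<in> E \<Longrightarrow> d e \<in> ?C" "\<And>e. e \<in> E \<Longrightarrow> d e \<notin> M" "\<And>e. e \<in> E \<Longrightarrow> d e * c e \<in> ?C"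
      by metis
    let ?d = "\<Prod>e\<in>E. d e"
    have "?d \<in> ?C" using d(1) by (intro subring_prod C)
    moreover have "?d \<notin> M"
      using finE d(2) by (induction E rule: finite_induct) (use one prime in auto)
    moreover have "?d * x \<in> V"
    proof -
      have "?d * (x - (\<Sum>e\<in>E. c e * e)) \<in> M" using c(2) by (rule ideal_mult_l[OF M])
      then have 1: "?d * x - (\<Sum>e\<in>E. (?d * c e) * e) \<in> M"
        by (simp add: right_diff_distrib sum_distrib_left mult.assoc)
      have "?d * c e \<in> ?C" if "e \<in> E" for e
      proof -
        have "?d * c e = (d e * c e) * (\<Prod>e\<in>E - {e}. d e)"
          using that finE by (simp add: prod.remove[of E e] mult_ac)
        also have "\<dots> \<in> ?C" by (rule subring_mult[OF C d(3)[OF that] subring_prod[OF C d(1)]]) simp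
        finally show ?thesis .
      qed
      with 1 show ?thesis using VI[of "\<lambda>e. ?d * c e"] by blast
    qed
    ultimately show ?thesis by blast
  qed
  have "\<exists>s\<in>?C. s \<notin> M \<and> (\<forall>x\<in>X. s * x \<in> V)" if "finite X" for X
    using that
  proof (induction X rule: finite_induct)
    case empty
    then show ?case using subring_one[OF C] one by auto
  next
    case (insert x X)
    then obtain s where s: "s \<in> ?C" "s \<notin> M" "\<forall>x\<in>X. s * x \<in> V" by blast
    obtain d where d: "d \<in> ?C" "d \<notin> M" "d * x \<in> V" using denom by blast
    have "s * d * y \<in> V" if "y \<in> insert x X" for y
    proof (cases "y = x")
      case True
      then show ?thesis using V_mult[OF s(1) d(3)] by (simp add: mult.assoc)
    next
      case False
      then have "s * y \<in> V" using s(3) that by auto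
      then have "d * (s * y) \<in> V" by (rule V_mult[OF d(1)])
      then show ?thesis by (simp add: mult_ac)
    qed
    moreover have "s * d \<in> ?C" "s * d \<notin> M" using s d prime subring_mult[OF C] by auto
    ultimately show ?case by blast
  qed
  \<comment> \<open>A common denominator for all products of a generator with a basis
    element.\<close>
  from this[of "(\<lambda>(x, e). x * e) ` (set as \<times> E)"] finE
  obtain s where s: "s \<in> ?C" "s \<notin> M" "\<And>x e. x \<in> set as \<Longrightarrow> e \<in> E \<Longrightarrow> s * (x * e) \<in> V" by auto
  \<comment> \<open>The elements that map the lattice into itself up to a power of \<open>s\<close>.
    They form a ring containing all generators, so this is everything.\<close>
  define W where "W = {x. \<exists>j. \<forall>v\<in>V. s ^ j * x * v \<in> V}"
  have WI: "x \<in> W" if "\<And>e. e \<in> E \<Longrightarrow> s ^ j * x * e \<in> V" for x j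
  proof -
    have "s ^ j * x * v \<in> V" if "v \<in> V" for v
    proof -
      from that obtain c where c: "\<forall>e\<in>E. c e \<in> ?C" "v - (\<Sum>e\<in>E. c e * e) \<in> M" by (auto simp: V_def)
      have "s ^ j * x * (v - (\<Sum>e\<in>E. c e * e)) \<in> V" using c(2) MV ideal_mult_l[OF M] by blast
      moreover have "(\<Sum>e\<in>E. c e * (s ^ j * x * e)) \<in> V"
        by (rule V_sum[OF finE V_mult]) (use c(1) \<open>\<And>e. e \<in> E \<Longrightarrow> s ^ j * x * e \<in> V\<close> in auto)
      ultimately have "s ^ j * x * (v - (\<Sum>e\<in>E. c e * e)) + (\<Sum>e\<in>E. c e * (s ^ j * x * e)) \<in> V" by (rule V_add)
      then show ?thesis by (simp add: right_diff_distrib sum_distrib_left mult_ac)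
    qed
    then show ?thesis by (auto simp: W_def)
  qed
  have sj: "s ^ j \<in> ?C" for j using s(1) by (intro subring_power C)
  have W: "subring W"
    unfolding subring_def
  proof (intro conjI ballI)
    show "1 \<in> W" by (auto simp: W_def intro!: exI[of _ 0])
    fix x y assume "x \<in> W" "y \<in> W"
    then obtain j k where jk: "\<And>v. v \<in> V \<Longrightarrow> s ^ j * x * v \<in> V" "\<And>v. v \<in> V \<Longrightarrow> s ^ k * y * v \<in> V"
      by (auto simp: W_def)
    have "s ^ (j + k) * (x - y) * v \<in> V" if "v \<in> V" for v
    proof -
      have "s ^ k * (s ^ j * x * v) - s ^ j * (s ^ k * y * v) \<in> V"
        by (rule V_diff[OF V_mult[OF sj jk(1)[OF that]] V_mult[OF sj jk(2)[OF that]]])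
      then show ?thesis by (simp add: power_add algebra_simps)
    qed
    then show "x - y \<in> W" by (auto simp: W_def)
    have "s ^ (j + k) * (x * y) * v \<in> V" if "v \<in> V" for v
      using jk(1)[OF jk(2)[OF that]] by (simp add: power_add mult_ac)
    then show "x * y \<in> W" by (auto simp: W_def)
  qed
  have "adjoin_list ?C as \<subseteq> W"
  proof (rule adjoin_list_least[OF W])
    show "?C \<subseteq> W" using V_mult by (auto simp: W_def intro!: exI[of _ 0])
    show "set as \<subseteq> W" using s(3) by (auto intro!: WI[of 1] simp: mult.assoc)
  qed
  then have WU: "x \<in> W" for x using gen by auto
  obtain \<sigma> where \<sigma>: "\<sigma> \<in> poly_over K" "s = poly \<sigma> a" using s(1) by (auto simp: adjoin_def)
  \<comment> \<open>The polynomial 1 + X \<sigma>, where \<sigma> represents \<open>s\<close>: it is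
    coprime to \<sigma>, so its inverse cannot have a power of \<open>s\<close> as
    denominator.\<close>
  define h where "h = 1 + monom 1 1 * \<sigma>"
  have hK: "h \<in> poly_over K"
    unfolding h_def using \<sigma> by (intro subring_add subring_one subring_mult P poly_over_monom subK subring_one)
  have "coeff h 0 = 1" by (simp add: h_def coeff_monom_mult)
  then have "poly h a \<notin> M" using tr[OF hK, of 0] one by auto
  then obtain z where z: "poly h a * z - 1 \<in> M" using inv by blast
  obtain j where "s ^ j * z * e0 \<in> V" using WU[of z] EV[OF e0] by (auto simp: W_def)
  then obtain c where c: "\<And>e. e \<in> E \<Longrightarrow> c e \<in> ?C" "s ^ j * z * e0 - (\<Sum>e\<in>E. c e * e) \<in> M" by (auto simp: V_def)
  have hC: "poly h a \<in> ?C" using hK by (auto simp: adjoin_def)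
  have "s ^ j * e0 * (poly h a * z - 1) - poly h a * (s ^ j * z * e0 - (\<Sum>e\<in>E. c e * e)) \<in> M"
    using z c by (blast intro: M_intros)
  also have "s ^ j * e0 * (poly h a * z - 1) - poly h a * (s ^ j * z * e0 - (\<Sum>e\<in>E. c e * e))
      = (\<Sum>e\<in>E. (poly h a * c e - (if e = e0 then s ^ j else 0)) * e)"
    using e0 finE by (simp add: algebra_simps sum_subtractf sum_distrib_left if_distrib[of "\<lambda>c. _ * c"] cong: if_cong)
  \<comment> \<open>Comparing coordinates at \<open>e0\<close> gives h c = s^j modulo
    \<open>M\<close>; by transcendence this lifts to an identity of polynomials modulo
    \<open>M\<close>.\<close>
  finally have "poly h a * c e0 - (if e0 = e0 then s ^ j else 0) \<in> M"
  proof (rule indep[rotated])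
    fix e assume "e \<in> E"
    then show "poly h a * c e - (if e = e0 then s ^ j else 0) \<in> L"
      using c(1) hC sj subring_zero[OF C] by (intro subsetD[OF CL] subring_diff subring_mult C) auto
  qed (rule e0)
  then have hc: "poly h a * c e0 - s ^ j \<in> M" by simp
  obtain \<beta> where \<beta>: "\<beta> \<in> poly_over K" "c e0 = poly \<beta> a" using c(1)[OF e0] by (auto simp: adjoin_def)
  have "coeff (h * \<beta> - \<sigma> ^ j) i \<in> M" for i
    using hc hK \<sigma> \<beta> by (intro tr subring_diff subring_mult subring_power P) simp_all
  then have 1: "h * \<beta> - \<sigma> ^ j \<in> poly_over M" by (simp add: poly_over_def)
  define X where "X = (monom 1 1 :: 'a poly)"
  \<comment> \<open>Modulo \<open>h\<close> the product X \<sigma> is -1, so (X \<sigma>)^j is a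
    sign. As \<open>h\<close> also divides \<sigma>^j modulo \<open>M\<close>, it is a unit modulo
    \<open>M\<close>.\<close>
  have "X * \<sigma> - (- 1) dvd (X * \<sigma>) ^ j - (- 1) ^ j"
    by (cases j) (simp_all only: power_0 diff_self dvd_0_right diff_power_eq_sum dvd_triv_left)
  then obtain \<delta> where \<delta>: "(X * \<sigma>) ^ j - (- 1) ^ j = h * \<delta>"
    unfolding h_def X_def by (auto elim!: dvdE simp: add.commute)
  have "(- 1) ^ j * (- 1) ^ j = (1 :: 'a poly)" by (simp flip: power_mult_distrib)
  have "h * ((- 1) ^ j * (X ^ j * \<beta> - \<delta>)) - 1 = (- 1) ^ j * X ^ j * (h * \<beta> - \<sigma> ^ j)"
  proof -
    have "h * ((- 1) ^ j * (X ^ j * \<beta> - \<delta>)) = (- 1) ^ j * (X ^ j * (h * \<beta>) - h * \<delta>)"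
      by (simp add: algebra_simps)
    also have "\<dots> = (- 1) ^ j * (X ^ j * (h * \<beta>) - X ^ j * \<sigma> ^ j) + (- 1) ^ j * (- 1) ^ j"
      unfolding \<delta>[symmetric] by (simp add: algebra_simps power_mult_distrib)
    finally show ?thesis using \<open>(- 1) ^ j * (- 1) ^ j = 1\<close> by (simp add: algebra_simps)
  qed
  moreover have "coeff ((- 1) ^ j * X ^ j * (h * \<beta> - \<sigma> ^ j)) i \<in> M" for i
    using 1 unfolding coeff_mult by (intro ideal_sum ideal_mult_l M) (simp add: poly_over_def)
  ultimately have "h * ((- 1) ^ j * (X ^ j * \<beta> - \<delta>)) - 1 \<in> poly_over M" by (simp add: poly_over_def)
  \<comment> \<open>A unit is constant modulo \<open>M\<close>; hence \<sigma> vanishes modulo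
    \<open>M\<close>, contrary to the choice of \<open>s\<close>.\<close>
  then have "coeff h (Suc i) \<in> M" for i by (rule poly_unit_mod)
  then have "coeff \<sigma> i \<in> M" for i by (simp add: h_def coeff_monom_mult)
  then have "s \<in> M" unfolding \<sigma>(2) by (rule poly_mod)
  then show False using s(2) by simp
qed

text \<open>Zariski's lemma, by induction on the generators: an algebraic generator gives a finite
  step, and a transcendental one is impossible.\<close>

theorem zariski:
  "subfield_mod K \<Longrightarrow> adjoin_list K as = UNIV \<Longrightarrow> \<exists>E. finite_mod K E UNIV"
proof (induction as arbitrary: K)
  case Nil
  have "finite_mod UNIV {1} UNIV"
    unfolding finite_mod_def
  proof (intro conjI ballI)
    fix x :: 'a
    show "\<exists>c. (\<forall>e\<in>{1}. c e \<in> UNIV) \<and> x - (\<Sum>e\<in>{1}. c e * e) \<in> M"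
      by (rule exI[of _ "\<lambda>_. x"]) (simp add: ideal_zero[OF M])
  qed simp
  with Nil show ?case by auto
next
  case (Cons a as)
  show ?case
  proof (cases "\<exists>q\<in>poly_over K. poly q a \<in> M \<and> (\<exists>i. coeff q i \<notin> M)")
    case True
    then obtain q i where q: "q \<in> poly_over K" "coeff q i \<notin> M" "poly q a \<in> M" by blast
    obtain F where "finite_mod (adjoin K a) F UNIV"
      using Cons.IH[OF algebraic_adjoin(1)[OF Cons.prems(1) q]] Cons.prems(2) by auto
    moreover obtain E where "finite_mod K E (adjoin K a)" using algebraic_adjoin(2)[OF Cons.prems(1) q] by blast
    ultimately show ?thesis using Cons.prems(1) by (intro finite_mod_trans) (auto simp: subfield_mod_def)
  next
    case False
    then have "\<And>q i. q \<in> poly_over K \<Longrightarrow> poly q a \<in> M \<Longrightarrow> coeff q i \<in> M" by blast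
    with transcendental_adjoin[OF Cons.prems(1) this _ Cons.IH] Cons.prems(2) show ?thesis by auto
  qed
qed

end

section \<open>From Zariski's lemma to points over an algebraically closed field\<close>

lemma ex_maximal_ideal:
  assumes "is_ideal I" "1 \<notin> I"
  obtains M where "I \<subseteq> M" "maximal_ideal_ctx M"
proof -
  define S where "S = {J. is_ideal J \<and> I \<subseteq> J \<and> 1 \<notin> J}"
  have "\<exists>M\<in>S. \<forall>X\<in>S. M \<subseteq> X \<longrightarrow> X = M"
  proof (rule subset_Zorn_nonempty)
    show "S \<noteq> {}" using assms by (auto simp: S_def)
    fix Ch assume ne: "Ch \<noteq> {}" and ch: "subset.chain S Ch"
    have CS: "J \<in> S" if "J \<in> Ch" for J using ch that by (auto simp: subset.chain_def)
    have "is_ideal (\<Union>Ch)"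
    proof (rule is_idealI)
      show "0 \<in> \<Union>Ch" using ne CS ideal_zero by (auto simp: S_def)
    next
      fix x y assume "x \<in> \<Union>Ch" "y \<in> \<Union>Ch"
      then obtain J J' where J: "J \<in> Ch" "J' \<in> Ch" "x \<in> J" "y \<in> J'" by auto
      then have "J \<subseteq> J' \<or> J' \<subseteq> J" using ch by (auto simp: subset.chain_def)
      then show "x + y \<in> \<Union>Ch"
      proof
        assume "J \<subseteq> J'"
        then have "x + y \<in> J'" using J CS[of J'] by (intro ideal_add) (auto simp: S_def)
        then show ?thesis using J by blast
      next
        assume "J' \<subseteq> J"
        then have "x + y \<in> J" using J CS[of J] by (intro ideal_add) (auto simp: S_def)
        then show ?thesis using J by blast
      qed
    next
      fix c x assume "x \<in> \<Union>Ch"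
      then obtain J where J: "J \<in> Ch" "x \<in> J" by auto
      then have "c * x \<in> J" using CS[of J] by (intro ideal_mult_l) (auto simp: S_def)
      then show "c * x \<in> \<Union>Ch" using J by blast
    qed
    moreover have "I \<subseteq> \<Union>Ch" using ne CS by (fastforce simp: S_def)
    moreover have "1 \<notin> \<Union>Ch" using CS by (auto simp: S_def)
    ultimately show "\<Union>Ch \<in> S" by (simp add: S_def)
  qed
  then obtain M where M: "M \<in> S" "\<And>X. X \<in> S \<Longrightarrow> M \<subseteq> X \<Longrightarrow> X = M" by blast
  have idM: "is_ideal M" using M by (simp add: S_def)
  have "\<exists>y. x * y - 1 \<in> M" if x: "x \<notin> M" for x
  proof -
    let ?X = "ideal_plus M (ideal_gen {x})"
    have "is_ideal ?X" using idM by (simp add: is_ideal_plus)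
    moreover have "M \<subseteq> ?X" using ideal_plus_l[of "ideal_gen {x}" _ M] by auto
    moreover have "x \<in> ?X" using idM by (intro ideal_plus_r ideal_gen_base) auto
    ultimately have "1 \<in> ?X" using M x by (auto simp: S_def)
    then obtain m c where mc: "1 = m + c * x" "m \<in> M" by (metis ideal_plusE ideal_gen_singleE)
    have "x * c - 1 = - m" by (subst mc(1)) (simp add: mult.commute)
    then show ?thesis using ideal_uminus[OF idM mc(2)] by metis
  qed
  with M idM have "maximal_ideal_ctx M" by unfold_locales (auto simp: S_def)
  with M show thesis by (intro that[of M]) (auto simp: S_def)
qed

text \<open>The sums of constants and elements of \<open>M\<close> form a subfield modulo
  \<open>M\<close>, over which the whole ring is finite by \<open>zariski\<close>. Hence every
  element is algebraic over the field, and algebraic closedness makes it constant modulo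
  \<open>M\<close>.\<close>

theorem (in coefficient_field) weak_nullstellensatz:
  assumes alg_closed: "\<And>p :: 'k poly. degree p > 0 \<Longrightarrow> \<exists>z. poly p z = 0"
    and gen: "adjoin_list (range \<kappa>) as = UNIV"
    and I: "is_ideal I" "1 \<notin> I"
  obtains M where "is_ideal M" "I \<subseteq> M" "1 \<notin> M" "\<And>x. \<exists>c. x - \<kappa> c \<in> M"
proof -
  obtain M where IM: "I \<subseteq> M" and Mc: "maximal_ideal_ctx M" using ex_maximal_ideal[OF I] .
  interpret maximal_ideal_ctx M by (rule Mc)
  define K where "K = {x. \<exists>c. x - \<kappa> c \<in> M}"
  have \<kappa>_add: "\<kappa> (x + y) = \<kappa> x + \<kappa> y" for x y using \<kappa>_diff[of "x + y" y] by simp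
  have \<kappa>_sum: "\<kappa> (sum f A) = (\<Sum>i\<in>A. \<kappa> (f i))" for f :: "nat \<Rightarrow> 'k" and A
    by (induction A rule: infinite_finite_induct) (simp_all add: \<kappa>_zero \<kappa>_add)
  have KI: "x \<in> K" if "x - \<kappa> c \<in> M" for x c using that by (auto simp: K_def)
  have "subfield_mod K"
    unfolding subfield_mod_def
  proof (intro conjI ballI impI)
    show "subring K"
      unfolding subring_def
    proof (intro conjI ballI)
      show "1 \<in> K" using ideal_zero[OF M] by (intro KI[of _ 1]) (simp add: \<kappa>_one)
      fix x y assume "x \<in> K" "y \<in> K"
      then obtain c d where cd: "x - \<kappa> c \<in> M" "y - \<kappa> d \<in> M" by (auto simp: K_def)
      have "(x - \<kappa> c) - (y - \<kappa> d) \<in> M" "y * (x - \<kappa> c) + \<kappa> c * (y - \<kappa> d) \<in> M"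
        using cd by (blast intro: M_intros)+
      then show "x - y \<in> K" "x * y \<in> K"
        by (auto intro!: KI[of "x - y" "c - d"] KI[of "x * y" "c * d"] simp: \<kappa>_diff \<kappa>_mult algebra_simps)
    qed
    show "M \<subseteq> K" using KI[of _ 0] by (auto simp: \<kappa>_zero)
    fix x assume x: "x \<in> K" "x \<notin> M"
    then obtain c where c: "x - \<kappa> c \<in> M" by (auto simp: K_def)
    have "c \<noteq> 0" using c x by (auto simp: \<kappa>_zero)
    then have "x * \<kappa> (inverse c) - 1 = \<kappa> (inverse c) * (x - \<kappa> c)"
      by (simp add: algebra_simps \<kappa>_one flip: \<kappa>_mult)
    also have "\<dots> \<in> M" using c by (rule ideal_mult_l[OF M])
    finally show "\<exists>y\<in>K. x * y - 1 \<in> M"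
      by (intro bexI[of _ "\<kappa> (inverse c)"] KI[of _ "inverse c"]) (simp_all add: ideal_zero[OF M])
  qed
  note K = this
  have subK: "subring K" using K by (simp add: subfield_mod_def)
  have "\<kappa> x \<in> K" for x by (rule KI[of _ x]) (simp add: ideal_zero[OF M])
  then have "range \<kappa> \<subseteq> K" by auto
  then have "adjoin_list (range \<kappa>) as \<subseteq> adjoin_list K as"
    using adjoin_list_superset[OF subK, of as] adjoin_list_elem[OF subK, of _ as]
    by (intro adjoin_list_least subring_adjoin_list subK) auto
  then have "adjoin_list K as = UNIV" using gen by auto
  from zariski[OF K this] obtain E where E: "finite_mod K E UNIV" by blast
  have finE: "finite E" using E by (simp add: finite_mod_def)
  have "\<exists>c. y - \<kappa> c \<in> M" for y
  proof -
    have "\<exists>d. x - (\<Sum>e\<in>E. \<kappa> (d e) * e) \<in> M" for x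
    proof -
      obtain c where c: "\<And>e. e \<in> E \<Longrightarrow> c e \<in> K" "x - (\<Sum>e\<in>E. c e * e) \<in> M"
        using finite_modE[OF E] by blast
      from c(1) have "\<forall>e. \<exists>d. e \<in> E \<longrightarrow> c e - \<kappa> d \<in> M" by (auto simp: K_def)
      then obtain d where d: "\<And>e. e \<in> E \<Longrightarrow> c e - \<kappa> (d e) \<in> M" by metis
      have "(x - (\<Sum>e\<in>E. c e * e)) + (\<Sum>e\<in>E. (c e - \<kappa> (d e)) * e) \<in> M"
        using c(2) d by (intro ideal_add ideal_sum ideal_mult_r M)
      then show ?thesis by (auto simp: left_diff_distrib sum_subtractf)
    qed
    then have "\<forall>i. \<exists>d. y ^ i - (\<Sum>e\<in>E. \<kappa> (d e) * e) \<in> M" by blast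
    then obtain A where A: "\<And>i. y ^ i - (\<Sum>e\<in>E. \<kappa> (A i e) * e) \<in> M" by metis
    \<comment> \<open>There is one more power of \<open>y\<close> than there are elements of
      \<open>E\<close>, so the powers are linearly dependent modulo \<open>M\<close>.\<close>
    obtain c where c: "\<exists>i\<in>{..card E}. c i \<noteq> 0" "\<And>e. e \<in> E \<Longrightarrow> (\<Sum>i\<in>{..card E}. c i * A i e) = 0"
      using homogeneous_system[OF finE, of "{..card E}" A] by auto
    define ev where "ev p = poly (map_poly \<kappa> p) y" for p
    have cm: "coeff (map_poly \<kappa> p) i = \<kappa> (coeff p i)" for p i by (simp add: coeff_map_poly \<kappa>_zero)
    have ev_mult: "ev (p * q) = ev p * ev q" for p q
    proof -
      have "map_poly \<kappa> (p * q) = map_poly \<kappa> p * map_poly \<kappa> q"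
        by (rule poly_eqI) (simp add: cm coeff_mult \<kappa>_sum \<kappa>_mult)
      then show ?thesis by (simp add: ev_def)
    qed
    have ev_lin: "ev [:- r, 1:] = y - \<kappa> r" for r
      using \<kappa>_diff[of 0 r] by (simp add: ev_def map_poly_pCons \<kappa>_zero \<kappa>_one)
    have ev_const: "ev [:x:] = \<kappa> x" for x by (simp add: ev_def map_poly_pCons \<kappa>_zero)
    define p where "p = (\<Sum>i\<le>card E. monom (c i) i)"
    have cp: "coeff p i = (if i \<le> card E then c i else 0)" for i
      by (simp add: p_def coeff_sum if_distrib[of "\<lambda>c. c = _"] cong: if_cong)
    have "map_poly \<kappa> p = (\<Sum>i\<le>card E. monom (\<kappa> (c i)) i)"
      by (rule poly_eqI) (simp add: cm cp coeff_sum \<kappa>_zero cong: if_cong)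
    then have "ev p = (\<Sum>i\<le>card E. \<kappa> (c i) * y ^ i)" by (simp add: ev_def poly_sum poly_monom)
    also have "\<dots> = (\<Sum>i\<le>card E. \<kappa> (c i) * (y ^ i - (\<Sum>e\<in>E. \<kappa> (A i e) * e)))
        + (\<Sum>e\<in>E. \<kappa> (\<Sum>i\<le>card E. c i * A i e) * e)"
    proof -
      have "(\<Sum>e\<in>E. \<kappa> (\<Sum>i\<le>card E. c i * A i e) * e) = (\<Sum>i\<le>card E. \<kappa> (c i) * (\<Sum>e\<in>E. \<kappa> (A i e) * e))"
        unfolding \<kappa>_sum sum_distrib_right \<kappa>_mult sum_distrib_left
        by (subst sum.swap) (simp add: mult.assoc)
      then show ?thesis by (simp add: right_diff_distrib sum_subtractf)
    qed
    also have "\<dots> \<in> M" using A c(2) by (simp add: \<kappa>_zero) (intro ideal_sum ideal_mult_l M)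
    finally have "ev p \<in> M" .
    moreover have "p \<noteq> 0" using c(1) cp by (metis atMost_iff coeff_0)
    \<comment> \<open>Linear factors of an annihilating polynomial are split off until one of them
      vanishes at \<open>y\<close> modulo the prime ideal \<open>M\<close>.\<close>
    moreover have "\<exists>c. y - \<kappa> c \<in> M" if "ev p \<in> M" "p \<noteq> 0" for p
      using that
    proof (induction "degree p" arbitrary: p)
      case 0
      then obtain b where b: "p = [:b:]" by (metis degree_eq_zeroE)
      then have "\<kappa> b \<in> M" "b \<noteq> 0" using 0 by (auto simp: ev_const)
      then have "\<kappa> (inverse b) * \<kappa> b \<in> M" by (blast intro: M_intros)
      then show ?case using one \<open>b \<noteq> 0\<close> by (simp add: \<kappa>_one flip: \<kappa>_mult)
    next
      case (Suc n)
      then obtain r where "poly p r = 0" using alg_closed[of p] by auto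
      then obtain q where q: "p = [:- r, 1:] * q" by (metis dvdE poly_eq_0_iff_dvd)
      then have "(y - \<kappa> r) * ev q \<in> M" using Suc.prems(1) by (simp only: ev_mult ev_lin)
      then consider "y - \<kappa> r \<in> M" | "ev q \<in> M" using prime by blast
      then show ?case
      proof cases
        case 2
        have "q \<noteq> 0" using q Suc.prems by auto
        then have "n = degree q" using q Suc.hyps(2) by (simp add: degree_mult_eq del: mult_pCons_left)
        then show ?thesis using Suc.hyps(1) 2 \<open>q \<noteq> 0\<close> by blast
      qed blast
    qed
    ultimately show ?thesis by blast
  qed
  with M IM one show thesis by (intro that)
qed

subsection \<open>Primary ideals and reductions\<close>

lemma ideal_pow_finite_gen:
  fixes v :: "'i::finite \<Rightarrow> 'a::comm_ring_1"
  shows "ideal_pow (ideal_gen (range v)) s = ideal_gen (mon v ` {a. deg a = s})"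
proof
  show "ideal_gen (mon v ` {a. deg a = s}) \<subseteq> ideal_pow (ideal_gen (range v)) s"
    using mon_in_ideal_pow[of v "ideal_gen (range v)"]
    by (intro ideal_gen_least is_ideal_pow) (auto intro: ideal_gen_base)
  show "ideal_pow (ideal_gen (range v)) s \<subseteq> ideal_gen (mon v ` {a. deg a = s})"
  proof
    fix x assume "x \<in> ideal_pow (ideal_gen (range v)) s"
    then obtain c where "x = (\<Sum>a | deg a = s. c a * mon v a)" by (rule ideal_pow_expand')
    moreover have "\<dots> \<in> ideal_gen (mon v ` {a. deg a = s})"
      by (rule ideal_sum[OF is_ideal_gen], rule ideal_mult_l[OF is_ideal_gen], rule ideal_gen_base) auto
    ultimately show "x \<in> ideal_gen (mon v ` {a. deg a = s})" by simp
  qed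
qed

lemma spans_mod_max: "spans_mod max_ideal {()} (\<lambda>_. 1 :: ('a::field, 'n) mfps)"
  unfolding spans_mod_def lcomb_def using diff_const_in_max_ideal by (auto intro!: exI[of _ "\<lambda>_. mfps_nth _ 0"])

lemma indep_mod_max: "indep_mod max_ideal {()} (\<lambda>_. 1 :: ('a::field, 'n) mfps)"
  unfolding indep_mod_def lcomb_def by (auto simp: max_ideal_def mfps_nth_const)

lemma cod_max_pow:
  "fincod (ideal_pow (max_ideal :: ('a::field, 'n::finite) mfps set) s)"
  "cod (ideal_pow (max_ideal :: ('a, 'n) mfps set) s) = card {a :: 'n \<Rightarrow>\<^sub>0 nat. deg a < s}"
proof -
  let ?m = "max_ideal :: ('a, 'n) mfps set"
  have 1: "ideal_pow ?m 1 \<subseteq> ideal_gen (range mfps_var)"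
    unfolding max_ideal_gen[symmetric] by (simp add: ideal_pow_1)
  have fin: "fincod (ideal_gen (range (mfps_var :: 'n \<Rightarrow> ('a, 'n) mfps)))"
    unfolding max_ideal_gen[symmetric] by (rule spans_mod_fincod(1)[OF spans_mod_max])
  have "cod ?m = 1" using cod_eqI[OF is_ideal_max_ideal indep_mod_max spans_mod_max] by simp
  then show "fincod (ideal_pow ?m s)" "cod (ideal_pow ?m s) = card {a :: 'n \<Rightarrow>\<^sub>0 nat. deg a < s}"
    using cod_parameter_pow[OF 1 fin, of s] by (simp_all add: max_ideal_gen)
qed

lemma primary_fincod: "ideal_pow max_ideal N \<subseteq> I \<Longrightarrow> fincod I"
  for I :: "('a::field, 'n::finite) mfps set"
  using fincod_mono cod_max_pow(1) by blast

text \<open>The ideals I + m^s have codimension at most that of \<open>I\<close>, so they become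
  stationary; at that point Nakayama's lemma gives that m^s is contained in
  \<open>I\<close>.\<close>

lemma fincod_primary:
  fixes I :: "('a::field, 'n::finite) mfps set"
  assumes I: "is_ideal I" and fin: "fincod I"
  shows "\<exists>N. ideal_pow max_ideal N \<subseteq> I"
proof -
  let ?m = "max_ideal :: ('a, 'n) mfps set"
  define S where "S s = ideal_plus I (ideal_pow ?m s)" for s
  have S: "is_ideal (S s)" "I \<subseteq> S s" for s
    using I by (auto simp: S_def is_ideal_plus intro: ideal_plus_l)
  have "\<exists>s. S (Suc s) = S s"
  proof (rule ccontr)
    assume "\<nexists>s. S (Suc s) = S s"
    moreover have "S (Suc s) \<subseteq> S s" for s
      unfolding S_def by (intro ideal_plus_mono order.refl ideal_pow_antimono) simp
    ultimately have "S (Suc s) \<subset> S s" for s by blast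
    then have lt: "cod (S s) < cod (S (Suc s))" for s
      using S fincod_mono[OF S(2) fin] by (intro cod_strict) auto
    have "s \<le> cod (S s)" for s
      by (induction s) (use lt in \<open>auto simp: Suc_le_eq intro: le_less_trans\<close>)
    moreover have "cod (S s) \<le> cod I" for s using cod_mono[OF I S(2) fin] .
    ultimately show False by (metis Suc_n_not_le_n order.trans)
  qed
  then obtain s where s: "S (Suc s) = S s" ..
  have "ideal_pow ?m s \<subseteq> ideal_plus I (ideal_mult ?m (ideal_pow ?m s))"
    using s I ideal_plus_r[of I _ "ideal_pow ?m s"] by (auto simp: S_def)
  moreover have gen: "ideal_pow ?m s = ideal_gen (mon mfps_var ` {a. deg a = s})"
    unfolding max_ideal_gen by (rule ideal_pow_finite_gen)
  ultimately have "ideal_pow ?m s \<subseteq> I"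
    using nakayama[of "mon mfps_var ` {a. deg a = s}" I] I by (simp only: finite_imageI finite_deg)
  then show ?thesis ..
qed

lemma ideal_plus_gen_range:
  "ideal_plus (ideal_gen {f}) (ideal_gen (range g)) = ideal_gen (range (case_option f g))"
proof
  show "ideal_plus (ideal_gen {f}) (ideal_gen (range g)) \<subseteq> ideal_gen (range (case_option f g))"
    by (intro ideal_plus_least ideal_gen_mono is_ideal_gen) (auto intro: image_eqI[of _ _ None] image_eqI[of _ _ "Some _"])
  have "f \<in> ideal_plus (ideal_gen {f}) (ideal_gen (range g))"
    by (intro ideal_plus_l is_ideal_gen ideal_gen_base) simp
  moreover have "g i \<in> ideal_plus (ideal_gen {f}) (ideal_gen (range g))" for i
    by (intro ideal_plus_r is_ideal_gen ideal_gen_base) simp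
  ultimately show "ideal_gen (range (case_option f g)) \<subseteq> ideal_plus (ideal_gen {f}) (ideal_gen (range g))"
    by (intro ideal_gen_least is_ideal_plus is_ideal_gen) (auto split: option.splits)
qed

text \<open>T^(l+1) is generated by \<open>f ^ Suc l\<close> modulo J T^l, so the congruence for
  this one element extends to all of T^(l+1), and Nakayama removes the term with the maximal
  ideal.\<close>

lemma reduction_from_power:
  fixes g :: "'n::finite \<Rightarrow> ('a::field, 'n) mfps"
  defines "J \<equiv> ideal_gen (range g)"
  assumes T: "T = ideal_plus (ideal_gen {f}) J"
    and f: "f ^ Suc l \<in> ideal_plus (ideal_mult J (ideal_pow T l)) (ideal_mult max_ideal (ideal_pow T (Suc l)))"
  shows "ideal_pow T (Suc l) \<subseteq> ideal_mult J (ideal_pow T l)"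
proof -
  have J: "is_ideal J" by (simp add: J_def)
  have gen: "T = ideal_gen (range (case_option f g))" unfolding T J_def by (rule ideal_plus_gen_range)
  have "ideal_pow T (Suc l) = ideal_plus (ideal_gen {f ^ Suc l}) (ideal_mult J (ideal_pow T l))"
    by (rule ideal_pow_plus_single[OF T J])
  also have "\<dots> \<subseteq> ideal_plus (ideal_mult J (ideal_pow T l)) (ideal_mult max_ideal (ideal_pow T (Suc l)))"
    using f by (intro ideal_plus_least ideal_gen_least is_ideal_plus is_ideal_mult) (auto intro: ideal_plus_l)
  finally have "ideal_pow T (Suc l) \<subseteq> ideal_plus (ideal_mult J (ideal_pow T l)) (ideal_mult max_ideal (ideal_pow T (Suc l)))" .
  moreover have "ideal_pow T (Suc l) = ideal_gen (mon (case_option f g) ` {a. deg a = Suc l})"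
    unfolding gen by (rule ideal_pow_finite_gen)
  ultimately show ?thesis
    using nakayama[of "mon (case_option f g) ` {a. deg a = Suc l}" "ideal_mult J (ideal_pow T l)"] by simp
qed

text \<open>The inclusion is iterated, each step trading one factor \<open>T\<close> for
  \<open>J\<close>; the surplus T^l is discarded at the end.\<close>

lemma reduction_shift:
  assumes red: "ideal_pow T (Suc l) \<subseteq> ideal_mult J (ideal_pow T l)" and J: "is_ideal J"
  shows "ideal_pow T (s + l) \<subseteq> ideal_pow J s"
proof -
  have "ideal_pow T (s + l) \<subseteq> ideal_mult (ideal_pow J s) (ideal_pow T l)"
  proof (induction s)
    case (Suc s)
    have "ideal_pow T (Suc s + l) \<subseteq> ideal_mult T (ideal_mult (ideal_pow J s) (ideal_pow T l))"
      using ideal_mult_mono[OF order.refl Suc, of T] by simp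
    also have "\<dots> = ideal_mult (ideal_pow J s) (ideal_pow T (Suc l))"
      by (simp add: ideal_mult_left_commute)
    also have "\<dots> \<subseteq> ideal_mult (ideal_pow J s) (ideal_mult J (ideal_pow T l))"
      by (rule ideal_mult_mono[OF order.refl red])
    also have "\<dots> = ideal_mult (ideal_pow J (Suc s)) (ideal_pow T l)"
      by (simp add: ideal_mult_left_commute ideal_mult_assoc)
    finally show ?case .
  qed simp
  also have "\<dots> \<subseteq> ideal_pow J s" by (rule ideal_mult_subset_l) simp
  finally show ?thesis .
qed

subsection \<open>Counting exponents and multiplicities\<close>

text \<open>The type argument carries the number n of variables. The value is the length of R/m^s
  (\<open>cod_max_pow\<close>).\<close>

definition ndeg :: "'n::finite itself \<Rightarrow> nat \<Rightarrow> nat" where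
  "ndeg _ s = card {a :: 'n \<Rightarrow>\<^sub>0 nat. deg a < s}"

lemma ex_map_eq: "distinct xs \<Longrightarrow> length xs = length ys \<Longrightarrow> \<exists>h. map h xs = ys"
proof (induction xs arbitrary: ys)
  case (Cons x xs)
  then obtain y ys' where ys: "ys = y # ys'" by (metis length_Suc_conv list.size(4) add_Suc_right)
  then obtain h where "map h xs = ys'" using Cons by auto
  then have "map (h(x := y)) (x # xs) = ys" using Cons.prems ys by auto
  then show ?case by blast
qed simp

lemma ndeg_binomial: "ndeg TYPE('n::finite) s = (s + CARD('n) - 1) choose CARD('n)"
proof (cases s)
  case 0
  have "CARD('n) > 0" by simp
  then show ?thesis using 0 by (simp add: ndeg_def binomial_eq_0)
next
  case (Suc r)
  obtain xs :: "'n list" where xs: "set xs = UNIV" "distinct xs"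
    using finite_distinct_list[of "UNIV :: 'n set"] by auto
  then have len: "length xs = CARD('n)" by (metis distinct_card)
  have deg: "sum_list (map (Poly_Mapping.lookup a) xs) = deg a" for a
    unfolding deg_def using xs by (simp add: sum_list_distinct_conv_sum_set)
  \<comment> \<open>A slack entry turns exponents of degree at most \<open>r\<close> into lists of n
    + 1 numbers with sum exactly \<open>r\<close>.\<close>
  define F where "F a = (r - deg a) # map (Poly_Mapping.lookup a) xs" for a
  have "bij_betw F {a. deg a < s} {l. length l = Suc (CARD('n)) \<and> sum_list l = r}"
    unfolding bij_betw_def
  proof
    show "inj_on F {a. deg a < s}"
      using xs by (auto simp: inj_on_def F_def intro: poly_mapping_eqI)
    show "F ` {a. deg a < s} = {l. length l = Suc (CARD('n)) \<and> sum_list l = r}"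
    proof (intro equalityI subsetI)
      fix l assume "l \<in> F ` {a. deg a < s}"
      then show "l \<in> {l. length l = Suc (CARD('n)) \<and> sum_list l = r}"
        using Suc by (auto simp: F_def deg len)
    next
      fix l assume "l \<in> {l. length l = Suc (CARD('n)) \<and> sum_list l = r}"
      then obtain y ys where l: "l = y # ys" "length ys = CARD('n)" "y + sum_list ys = r"
        by (auto simp: length_Suc_conv)
      then obtain h where h: "map h xs = ys" using ex_map_eq[of xs ys] xs len by auto
      define a where "a = Abs_poly_mapping h"
      have la: "Poly_Mapping.lookup a = h" by (simp add: a_def)
      then have "deg a = sum_list ys" using deg[of a] h by simp
      then have "l = F a" "deg a < s" using l h la Suc by (auto simp: F_def)
      then show "l \<in> F ` {a. deg a < s}" by blast
    qed
  qed
  then have "ndeg TYPE('n) s = card {l. length l = Suc (CARD('n)) \<and> sum_list l = r}"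
    unfolding ndeg_def by (rule bij_betw_same_card)
  also have "\<dots> = (r + CARD('n)) choose r" using card_length_sum_list[of "Suc CARD('n)" r] by simp
  also have "\<dots> = (r + CARD('n)) choose CARD('n)" using binomial_symmetric[of r "r + CARD('n)"] by simp
  finally show ?thesis using Suc by simp
qed

lemma ndeg_limit: "(\<lambda>s. fact CARD('n) * real (ndeg TYPE('n::finite) s) / real s ^ CARD('n)) \<longlonglongrightarrow> 1"
proof -
  let ?n = "CARD('n)"
  have "(\<lambda>s. \<Prod>i<?n. 1 + real i / real s) \<longlonglongrightarrow> (\<Prod>i<?n. 1 + 0)"
    by (intro tendsto_prod tendsto_add tendsto_const real_tendsto_divide_at_top[OF tendsto_const] filterlim_real_sequentially)
  moreover have "(\<Prod>i<?n. 1 + real i / real s) = fact ?n * real (ndeg TYPE('n) s) / real s ^ ?n" if "s > 0" for s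
  proof -
    have pos: "?n > 0" by simp
    have "real (ndeg TYPE('n) s) = real (s + ?n - 1) gchoose ?n"
      by (simp only: ndeg_binomial binomial_gbinomial)
    also have "\<dots> = pochhammer (real s) ?n / fact ?n"
    proof -
      obtain m where "?n = Suc m" using pos by (metis gr0_conv_Suc)
      then have "real (s + ?n - 1) - real ?n + 1 = real s" by simp
      then show ?thesis by (simp only: gbinomial_pochhammer')
    qed
    also have "pochhammer (real s) ?n = (\<Prod>i<?n. real s * (1 + real i / real s))"
      unfolding pochhammer_prod atLeast0LessThan using that by (intro prod.cong) (auto simp: field_simps)
    also have "\<dots> = real s ^ ?n * (\<Prod>i<?n. 1 + real i / real s)" by (simp add: prod.distrib)
    finally show ?thesis using that by simp
  qed
  then have "eventually (\<lambda>s. (\<Prod>i<?n. 1 + real i / real s) = fact ?n * real (ndeg TYPE('n) s) / real s ^ ?n) sequentially"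
    by (rule eventually_mono[OF eventually_gt_at_top[of "0 :: nat"]])
  ultimately show ?thesis by (simp add: tendsto_cong)
qed

definition hs_seq :: "('a::field, 'n::finite) mfps set \<Rightarrow> nat \<Rightarrow> real" where
  "hs_seq I s = fact CARD('n) * real (cod (ideal_pow I s)) / real s ^ CARD('n)"

lemma hs_multiplicity_limit:
  fixes T :: "('a::field, 'n::finite) mfps set"
  assumes T: "ideal_pow max_ideal N \<subseteq> T" and lim: "hs_seq T \<longlonglongrightarrow> e"
  shows "hs_multiplicity T = e"
proof -
  have prim: "ideal_pow max_ideal (N * s) \<subseteq> ideal_pow T s" for s
    using ideal_pow_mono[OF T, of s] by (simp add: ideal_pow_pow)
  have "quot_length (ideal_pow T s) = enat (cod (ideal_pow T s))" for s
    using quot_length_eq[OF is_ideal_pow primary_fincod[OF prim] prim] .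
  then have "hs_multiplicity T = lim (hs_seq T)"
    unfolding hs_multiplicity_def hs_seq_def[abs_def] by simp
  then show ?thesis using lim by (simp add: limI)
qed

text \<open>J^(s+l) is contained in T^(s+l), which is contained in J^s; both outer ideals have
  codimension \<open>cod J\<close> times a count of exponents. Hence the limit exists and equals
  \<open>cod J\<close>. The shift with s = 1 shows that \<open>J\<close> is primary.\<close>

lemma hs_seq_reduction:
  fixes g :: "'n::finite \<Rightarrow> ('a::field, 'n) mfps"
  defines "J \<equiv> ideal_gen (range g)"
  assumes T: "ideal_pow max_ideal N \<subseteq> T" and JT: "J \<subseteq> T"
    and shift: "\<And>s. ideal_pow T (s + l) \<subseteq> ideal_pow J s"
  shows "\<exists>N'. ideal_pow max_ideal N' \<subseteq> J" and "hs_seq T \<longlonglongrightarrow> real (cod J)"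
proof -
  let ?n = "CARD('n)" and ?N = "ndeg TYPE('n)"
  have prim: "ideal_pow max_ideal (N * s) \<subseteq> ideal_pow T s" for s
    using ideal_pow_mono[OF T, of s] by (simp add: ideal_pow_pow)
  have J: "ideal_pow max_ideal (N * Suc l) \<subseteq> J"
    using order.trans[OF prim[of "Suc l"]] shift[of 1] ideal_pow_1[of J] by (simp add: J_def)
  then show "\<exists>N'. ideal_pow max_ideal N' \<subseteq> J" ..
  have codJ: "cod (ideal_pow J s) = cod J * ?N s" "fincod (ideal_pow J s)" for s
    using cod_parameter_pow[of _ g s] J primary_fincod[OF J] unfolding J_def ndeg_def by blast+
  have up: "cod (ideal_pow T s) \<le> cod J * ?N s" for s
    using cod_mono[OF is_ideal_pow ideal_pow_mono[OF JT] codJ(2), of s] by (simp add: codJ)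
  have low: "cod J * ?N s \<le> cod (ideal_pow T (s + l))" for s
    using cod_mono[OF is_ideal_pow shift primary_fincod[OF prim], of s] by (simp add: codJ)
  have b: "(\<lambda>s. fact ?n * real (?N s) / real s ^ ?n) \<longlonglongrightarrow> 1" by (rule ndeg_limit)
  have "(\<lambda>s. hs_seq T (s + l)) \<longlonglongrightarrow> real (cod J)"
  proof (rule tendsto_sandwich)
    let ?lo = "\<lambda>s. real (cod J) * (fact ?n * real (?N s) / real s ^ ?n * (real s / real (s + l)) ^ ?n)"
    let ?hi = "\<lambda>s. real (cod J) * (fact ?n * real (?N (s + l)) / real (s + l) ^ ?n)"
    show "\<forall>\<^sub>F s in sequentially. hs_seq T (s + l) \<le> ?hi s"
    proof (rule always_eventually, rule allI)
      fix s
      have "real (cod (ideal_pow T (s + l))) \<le> real (cod J) * real (?N (s + l))"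
        using up[of "s + l"] by (metis of_nat_le_iff of_nat_mult)
      then have "hs_seq T (s + l) \<le> fact ?n * (real (cod J) * real (?N (s + l))) / real (s + l) ^ ?n"
        unfolding hs_seq_def by (intro divide_right_mono mult_left_mono) auto
      then show "hs_seq T (s + l) \<le> ?hi s" by (simp add: mult_ac)
    qed
    show "\<forall>\<^sub>F s in sequentially. ?lo s \<le> hs_seq T (s + l)"
      using eventually_gt_at_top[of "0 :: nat"]
    proof eventually_elim
      case (elim s)
      have "real (cod J) * real (?N s) \<le> real (cod (ideal_pow T (s + l)))"
        using low[of s] by (metis of_nat_le_iff of_nat_mult)
      then have "fact ?n * (real (cod J) * real (?N s)) / real (s + l) ^ ?n \<le> hs_seq T (s + l)"
        unfolding hs_seq_def by (intro divide_right_mono mult_left_mono) auto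
      moreover have "?lo s = fact ?n * (real (cod J) * real (?N s)) / real (s + l) ^ ?n"
        using elim by (simp add: power_divide)
      ultimately show ?case by simp
    qed
    show "?hi \<longlonglongrightarrow> real (cod J)"
      using tendsto_mult_left[OF LIMSEQ_ignore_initial_segment[OF b, of l], of "real (cod J)"] by simp
    have "(\<lambda>s. 1 / (1 + real l / real s)) \<longlonglongrightarrow> 1 / (1 + 0)"
      by (intro tendsto_divide tendsto_add tendsto_const real_tendsto_divide_at_top[OF tendsto_const] filterlim_real_sequentially) simp
    moreover have "\<forall>\<^sub>F s in sequentially. 1 / (1 + real l / real s) = real s / real (s + l)"
      using eventually_gt_at_top[of "0 :: nat"] by eventually_elim (simp add: field_simps)
    ultimately have "(\<lambda>s. real s / real (s + l)) \<longlonglongrightarrow> 1" by (simp add: tendsto_cong)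
    then have "(\<lambda>s. (real s / real (s + l)) ^ ?n) \<longlonglongrightarrow> 1 ^ ?n" by (rule tendsto_power)
    then have "?lo \<longlonglongrightarrow> real (cod J) * (1 * 1 ^ ?n)" using b by (intro tendsto_mult tendsto_const)
    then show "?lo \<longlonglongrightarrow> real (cod J)" by simp
  qed
  then show "hs_seq T \<longlonglongrightarrow> real (cod J)" by (rule LIMSEQ_offset)
qed

subsection \<open>Parameter ideals of minimal colength\<close>

lemma form_in_pow:
  fixes g :: "'n::finite \<Rightarrow> 'a::comm_ring_1"
  assumes "\<And>i. g i \<in> J" "is_ideal J"
  shows "(\<Sum>b | deg b = i. c b * mon g b) \<in> ideal_pow J i"
proof (rule ideal_sum[OF is_ideal_pow], rule ideal_mult_l[OF is_ideal_pow])
  fix b :: "'n \<Rightarrow>\<^sub>0 nat" assume "b \<in> {b. deg b = i}"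
  then show "mon g b \<in> ideal_pow J i" using mon_in_ideal_pow[of g J b] assms by simp
qed

text \<open>\<open>i\<close> is the least degree in \<open>g\<close> occurring in a dependency, and
  j = s - i - 1. A term of larger degree in \<open>g\<close> has at least i + 1 factors from
  \<open>J\<close> and j further ones from \<open>T\<close>, so only the part of degree
  \<open>i\<close> is isolated.\<close>

lemma indep_or_relation:
  fixes g :: "'n::finite \<Rightarrow> ('a::field, 'n) mfps"
  defines "J \<equiv> ideal_gen (range g)"
  assumes T: "T = ideal_plus (ideal_gen {f}) J"
    and dep: "\<not> indep_mod (ideal_pow J s) {a. deg a < s} (\<lambda>a. f ^ (s - deg a) * mon g a)"
  obtains i j \<beta> b0 where "deg b0 = i" "\<beta> b0 \<noteq> 0"
    "(\<Sum>b | deg b = i. mfps_const (\<beta> b) * mon g b) * f ^ Suc j \<in> ideal_mult (ideal_pow J (Suc i)) (ideal_pow T j)"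
proof -
  have J: "is_ideal J" by (simp add: J_def)
  have gJ: "g i \<in> J" for i by (simp add: J_def ideal_gen_base)
  have f: "f \<in> T" and JT: "J \<subseteq> T"
    using T J by (auto intro: ideal_plus_l ideal_plus_r ideal_gen_base)
  let ?x = "\<lambda>a. f ^ (s - deg a) * mon g a"
  from dep obtain c a0 where c: "lcomb c ?x {a. deg a < s} \<in> ideal_pow J s" and a0: "deg a0 < s" "c a0 \<noteq> 0"
    by (auto simp: indep_mod_def)
  define i where "i = (LEAST i. \<exists>a. deg a = i \<and> c a \<noteq> 0)"
  have "\<exists>a. deg a = i \<and> c a \<noteq> 0" unfolding i_def by (rule LeastI_ex) (use a0 in blast)
  then obtain b0 where b0: "deg b0 = i" "c b0 \<noteq> 0" by blast
  have imin: "i \<le> deg a" if "c a \<noteq> 0" for a unfolding i_def using that by (intro Least_le) blast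
  have "i < s" using imin[OF a0(2)] a0(1) by simp
  then obtain j where j: "s = Suc (i + j)" by (metis less_imp_Suc_add)
  let ?R = "ideal_mult (ideal_pow J (Suc i)) (ideal_pow T j)"
  have "ideal_pow J s \<subseteq> ?R"
  proof -
    have "ideal_pow J s = ideal_mult (ideal_pow J (Suc i)) (ideal_pow J j)"
      unfolding j using ideal_pow_add[of J "Suc i" j] by simp
    then show ?thesis using ideal_mult_mono[OF order.refl ideal_pow_mono[OF JT]] by blast
  qed
  with c have 1: "lcomb c ?x {a. deg a < s} \<in> ?R" by blast
  have "lcomb c ?x {a. deg a < s} = lcomb c ?x {a. deg a = i} + lcomb c ?x {a. i < deg a \<and> deg a < s}"
  proof -
    have "{a :: 'n \<Rightarrow>\<^sub>0 nat. deg a < s} = {a. deg a < i} \<union> ({a. deg a = i} \<union> {a. i < deg a \<and> deg a < s})"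
      using \<open>i < s\<close> by auto
    moreover have "lcomb c ?x ({a. deg a < i} \<union> ({a. deg a = i} \<union> {a. i < deg a \<and> deg a < s})) =
        lcomb c ?x {a. deg a < i} + lcomb c ?x ({a. deg a = i} \<union> {a. i < deg a \<and> deg a < s})"
      unfolding lcomb_def by (rule sum.union_disjoint) (auto intro: finite_subset[OF _ finite_deg_less[of s]])
    moreover have "lcomb c ?x ({a. deg a = i} \<union> {a. i < deg a \<and> deg a < s}) =
        lcomb c ?x {a. deg a = i} + lcomb c ?x {a. i < deg a \<and> deg a < s}"
      unfolding lcomb_def by (rule sum.union_disjoint) (auto intro: finite_subset[OF _ finite_deg_less[of s]])
    moreover have "lcomb c ?x {a. deg a < i} = 0"
    proof -
      have "c a = 0" if "deg a < i" for a using imin[of a] that by auto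
      then show ?thesis by (simp add: lcomb_def)
    qed
    ultimately show ?thesis by simp
  qed
  moreover have "lcomb c ?x {a. i < deg a \<and> deg a < s} \<in> ?R"
  proof (rule lcomb_in_ideal[OF is_ideal_mult])
    fix a :: "'n \<Rightarrow>\<^sub>0 nat" assume "a \<in> {a. i < deg a \<and> deg a < s}"
    then have a: "i < deg a" "deg a < s" by auto
    then have d: "deg a = Suc i + (deg a - Suc i)" by simp
    have "mon g a \<in> ideal_pow J (deg a)" by (rule mon_in_ideal_pow[OF gJ])
    then have "mon g a \<in> ideal_mult (ideal_pow J (Suc i)) (ideal_pow J (deg a - Suc i))"
      using d ideal_pow_add[of J "Suc i" "deg a - Suc i"] by simp
    then have "mon g a \<in> ideal_mult (ideal_pow J (Suc i)) (ideal_pow T (deg a - Suc i))"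
      using ideal_mult_mono[OF order.refl ideal_pow_mono[OF JT]] by blast
    then have "mon g a * f ^ (s - deg a) \<in> ideal_mult (ideal_mult (ideal_pow J (Suc i)) (ideal_pow T (deg a - Suc i))) (ideal_pow T (s - deg a))"
      by (rule ideal_mult_mem[OF _ power_in_ideal_pow[OF f]])
    also have "\<dots> = ideal_mult (ideal_pow J (Suc i)) (ideal_pow T ((deg a - Suc i) + (s - deg a)))"
      by (simp only: ideal_mult_assoc ideal_pow_add)
    also have "(deg a - Suc i) + (s - deg a) = j" using a j by simp
    finally show "f ^ (s - deg a) * mon g a \<in> ?R" by (simp add: mult.commute)
  qed
  ultimately have "lcomb c ?x {a. deg a = i} \<in> ?R"
    using ideal_diff[OF is_ideal_mult 1] by fastforce
  also have "lcomb c ?x {a. deg a = i} = (\<Sum>b | deg b = i. mfps_const (c b) * mon g b) * f ^ Suc j"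
    unfolding lcomb_def sum_distrib_right by (rule sum.cong) (auto simp: j mult_ac)
  finally show thesis using that[of b0 i c j] b0 by simp
qed

lemma form_cancel_power:
  fixes g :: "'n::finite \<Rightarrow> ('a::field, 'n) mfps"
  defines "J \<equiv> ideal_gen (range g)"
  assumes N: "ideal_pow max_ideal N \<subseteq> J" and \<beta>: "deg b0 = i" "\<beta> b0 \<noteq> 0"
    and x: "(\<Sum>b | deg b = i. mfps_const (\<beta> b) * mon g b) ^ s * x \<in> ideal_pow J (r + s * i)"
  shows "x \<in> ideal_pow J r"
  using x
proof (induction s arbitrary: x)
  case (Suc s)
  let ?b = "\<Sum>b | deg b = i. mfps_const (\<beta> b) * mon g b"
  have "?b ^ s * (?b * x) \<in> ideal_pow J ((r + i) + s * i)" using Suc.prems by (simp add: algebra_simps)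
  have "?b * (?b ^ s * x) \<in> ideal_pow J ((r + s * i) + i)" using Suc.prems by (simp add: algebra_simps)
  then have "?b ^ s * x \<in> ideal_pow J (r + s * i)"
    using form_cancel[where \<beta> = \<beta> and ?b0.0 = b0, OF N[unfolded J_def] \<beta>] unfolding J_def by blast
  then show ?case by (rule Suc.IH)
qed simp

text \<open>The form multiplies T^(j+1) into J^(i+1) T^j: the relation treats the power of
  \<open>f\<close>, and the rest of T^(j+1) already has a factor in \<open>J\<close>. After s rounds
  b^s T^(s+j) lies in J^(s(i+1)), and cancelling b^s, of degree s i, leaves J^s.\<close>

lemma relation_shift:
  fixes g :: "'n::finite \<Rightarrow> ('a::field, 'n) mfps"
  defines "J \<equiv> ideal_gen (range g)"
  assumes T: "T = ideal_plus (ideal_gen {f}) J" and N: "ideal_pow max_ideal N \<subseteq> J"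
    and \<beta>: "deg b0 = i" "\<beta> b0 \<noteq> 0"
    and rel: "(\<Sum>b | deg b = i. mfps_const (\<beta> b) * mon g b) * f ^ Suc j \<in> ideal_mult (ideal_pow J (Suc i)) (ideal_pow T j)"
  shows "ideal_pow T (s + j) \<subseteq> ideal_pow J s"
proof -
  let ?b = "\<Sum>b | deg b = i. mfps_const (\<beta> b) * mon g b"
  have J: "is_ideal J" by (simp add: J_def)
  have bJ: "?b \<in> ideal_pow J i"
    by (rule form_in_pow) (auto simp: J_def ideal_gen_base)
  have step: "?b * x \<in> ideal_mult (ideal_pow J (Suc i)) (ideal_pow T j)" if "x \<in> ideal_pow T (Suc j)" for x
  proof -
    from that obtain c y where x: "x = c * f ^ Suc j + y" "y \<in> ideal_mult J (ideal_pow T j)"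
      unfolding ideal_pow_plus_single[OF T J] by (metis ideal_plusE ideal_gen_singleE)
    have "?b * y \<in> ideal_mult (ideal_pow J i) (ideal_mult J (ideal_pow T j))"
      using bJ x(2) by (rule ideal_mult_mem)
    also have "\<dots> = ideal_mult (ideal_pow J (Suc i)) (ideal_pow T j)"
      by (simp add: ideal_mult_left_commute ideal_mult_assoc)
    finally have "c * (?b * f ^ Suc j) + ?b * y \<in> ideal_mult (ideal_pow J (Suc i)) (ideal_pow T j)"
      by (rule ideal_add[OF is_ideal_mult ideal_mult_l[OF is_ideal_mult rel]])
    then show ?thesis by (simp add: x(1) algebra_simps)
  qed
  have "ideal_mult (ideal_gen {?b}) (ideal_pow T (Suc j)) \<subseteq> ideal_mult (ideal_pow J (Suc i)) (ideal_pow T j)"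
  proof (rule ideal_mult_least)
    fix x y assume "x \<in> ideal_gen {?b}" "y \<in> ideal_pow T (Suc j)"
    then obtain c where "x = c * ?b" using ideal_gen_singleE by blast
    then have "x * y = c * (?b * y)" by (simp only: mult.assoc)
    then show "x * y \<in> ideal_mult (ideal_pow J (Suc i)) (ideal_pow T j)"
      by (simp only: ideal_mult_l[OF is_ideal_mult step[OF \<open>y \<in> _\<close>]])
  qed simp
  note step' = this
  have "ideal_mult (ideal_pow (ideal_gen {?b}) s) (ideal_pow T (s + j)) \<subseteq> ideal_mult (ideal_pow J (s * Suc i)) (ideal_pow T j)" for s
  proof (induction s)
    case (Suc s)
    have "ideal_mult (ideal_pow (ideal_gen {?b}) (Suc s)) (ideal_pow T (Suc s + j)) =
        ideal_mult (ideal_mult (ideal_gen {?b}) T) (ideal_mult (ideal_pow (ideal_gen {?b}) s) (ideal_pow T (s + j)))"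
      by (simp add: ideal_mult_assoc ideal_mult_left_commute)
    also have "\<dots> \<subseteq> ideal_mult (ideal_mult (ideal_gen {?b}) T) (ideal_mult (ideal_pow J (s * Suc i)) (ideal_pow T j))"
      by (rule ideal_mult_mono[OF order.refl Suc])
    also have "\<dots> = ideal_mult (ideal_pow J (s * Suc i)) (ideal_mult (ideal_gen {?b}) (ideal_pow T (Suc j)))"
      by (simp add: ideal_mult_assoc ideal_mult_left_commute)
    also have "\<dots> \<subseteq> ideal_mult (ideal_pow J (s * Suc i)) (ideal_mult (ideal_pow J (Suc i)) (ideal_pow T j))"
      by (rule ideal_mult_mono[OF order.refl step'])
    also have "\<dots> = ideal_mult (ideal_pow J (s * Suc i + Suc i)) (ideal_pow T j)"
      by (simp only: ideal_pow_add ideal_mult_assoc)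
    also have "s * Suc i + Suc i = Suc s * Suc i" by simp
    finally show ?case .
  qed simp
  note bT = this
  show ?thesis
  proof
    fix x assume "x \<in> ideal_pow T (s + j)"
    then have "?b ^ s * x \<in> ideal_mult (ideal_pow (ideal_gen {?b}) s) (ideal_pow T (s + j))"
      by (intro ideal_mult_mem power_in_ideal_pow ideal_gen_base) auto
    then have "?b ^ s * x \<in> ideal_pow J (s * Suc i)"
      using bT[of s] ideal_mult_subset_l[OF is_ideal_pow, of J "s * Suc i" "ideal_pow T j"] by blast
    then have "?b ^ s * x \<in> ideal_pow J (s + s * i)" by simp
    then show "x \<in> ideal_pow J s"
      using form_cancel_power[where \<beta> = \<beta> and ?b0.0 = b0, OF N[unfolded J_def] \<beta>] unfolding J_def by blast
  qed
qed

text \<open>A special case of Rees' theorem: if the monomials \<open>f\<^sup>j g\<^sup>a\<close> with \<open>j \<ge> 1\<close> and \<open>j + |a| = s\<close> were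
  independent modulo \<open>J\<^sup>s\<close> for all \<open>s\<close>, the multiplicity of \<open>T\<close> would drop by at least 1.\<close>

lemma equal_multiplicity_integral:
  fixes g :: "'n::finite \<Rightarrow> ('a::field, 'n) mfps"
  defines "J \<equiv> ideal_gen (range g)"
  assumes T: "T = ideal_plus (ideal_gen {f}) J" and N: "ideal_pow max_ideal N \<subseteq> J"
    and lim: "hs_seq T \<longlonglongrightarrow> real (cod J)"
  shows "\<exists>L. f ^ Suc L \<in> ideal_mult J (ideal_pow T L)"
proof -
  let ?n = "CARD('n)" and ?N = "ndeg TYPE('n)"
  have J: "is_ideal J" by (simp add: J_def)
  have f: "f \<in> T" and JT: "J \<subseteq> T" and idT: "is_ideal T"
    using T J by (auto intro: ideal_plus_l ideal_plus_r ideal_gen_base is_ideal_plus)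
  have "\<exists>s. \<not> indep_mod (ideal_pow J s) {a. deg a < s} (\<lambda>a. f ^ (s - deg a) * mon g a)"
  proof (rule ccontr)
    assume "\<nexists>s. \<not> indep_mod (ideal_pow J s) {a. deg a < s} (\<lambda>a. f ^ (s - deg a) * mon g a)"
    then have indep: "indep_mod (ideal_pow J s) {a. deg a < s} (\<lambda>a. f ^ (s - deg a) * mon g a)" for s by blast
    have codJ: "cod (ideal_pow J s) = cod J * ?N s" "fincod (ideal_pow J s)" for s
      using cod_parameter_pow[of _ g s] N primary_fincod[OF N] unfolding J_def ndeg_def by blast+
    \<comment> \<open>The independent family lies in T^s and has \<open>?N s\<close> members, so it
      bounds the dimension of T^s / J^s from below.\<close>
    have le: "cod (ideal_pow T s) + ?N s \<le> cod J * ?N s" for s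
      unfolding ndeg_def codJ(1)[unfolded ndeg_def, symmetric]
    proof (rule cod_add_indep[OF is_ideal_pow is_ideal_pow ideal_pow_mono[OF JT] codJ(2) _ indep])
      fix a :: "'n \<Rightarrow>\<^sub>0 nat" assume "a \<in> {a. deg a < s}"
      then have a: "deg a < s" by simp
      have "g i \<in> T" for i using JT by (auto simp: J_def ideal_gen_base)
      then have "mon g a \<in> ideal_pow T (deg a)" by (rule mon_in_ideal_pow)
      then have "f ^ (s - deg a) * mon g a \<in> ideal_pow T (s - deg a + deg a)"
        by (intro ideal_pow_mult_mem power_in_ideal_pow f)
      then show "f ^ (s - deg a) * mon g a \<in> ideal_pow T s" using a by simp
    qed
    have "hs_seq T s \<le> (real (cod J) - 1) * (fact ?n * real (?N s) / real s ^ ?n)" for s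
    proof -
      have "real (cod (ideal_pow T s) + ?N s) \<le> real (cod J * ?N s)" using le by (simp only: of_nat_le_iff)
      then have "real (cod (ideal_pow T s)) \<le> (real (cod J) - 1) * real (?N s)" by (simp add: algebra_simps)
      then have "hs_seq T s \<le> fact ?n * ((real (cod J) - 1) * real (?N s)) / real s ^ ?n"
        unfolding hs_seq_def by (intro divide_right_mono mult_left_mono) auto
      then show ?thesis by (simp add: mult_ac)
    qed
    moreover have "(\<lambda>s. (real (cod J) - 1) * (fact ?n * real (?N s) / real s ^ ?n)) \<longlonglongrightarrow> (real (cod J) - 1) * 1"
      by (intro tendsto_mult tendsto_const ndeg_limit)
    ultimately have "real (cod J) \<le> (real (cod J) - 1) * 1" using lim by (intro LIMSEQ_le) auto
    then show False by simp
  qed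
  then obtain s where s: "\<not> indep_mod (ideal_pow J s) {a. deg a < s} (\<lambda>a. f ^ (s - deg a) * mon g a)" ..
  obtain i j \<beta> b0 where rel: "deg b0 = i" "\<beta> b0 \<noteq> 0"
    "(\<Sum>b | deg b = i. mfps_const (\<beta> b) * mon g b) * f ^ Suc j \<in> ideal_mult (ideal_pow J (Suc i)) (ideal_pow T j)"
    by (rule indep_or_relation[OF T[unfolded J_def] s[unfolded J_def], folded J_def])
  have sh: "ideal_pow T (s + j) \<subseteq> ideal_pow J s" for s
    using relation_shift[where \<beta> = \<beta> and ?b0.0 = b0, OF T[unfolded J_def] N[unfolded J_def] rel[unfolded J_def]]
    unfolding J_def .
  have "ideal_pow T (s + Suc j) \<subseteq> ideal_pow J s" for s
  proof -
    have "ideal_pow T (s + Suc j) \<subseteq> ideal_pow T (s + j)" by (rule ideal_pow_antimono) simp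
    then show ?thesis using sh[of s] by (rule order.trans)
  qed
  then show ?thesis
    using bounded_shift_integral[OF N[unfolded J_def] JT[unfolded J_def] f] unfolding J_def by blast
qed

subsection \<open>Generic reductions\<close>

lemma base_expansion_inj:
  fixes d e :: "nat \<Rightarrow> nat"
  assumes "\<And>k. k < n \<Longrightarrow> d k < B" "\<And>k. k < n \<Longrightarrow> e k < B"
    and "(\<Sum>k<n. d k * B ^ k) = (\<Sum>k<n. e k * B ^ k)"
  shows "k < n \<Longrightarrow> d k = e k"
  using assms
proof (induction n arbitrary: d e k)
  case (Suc n)
  have split: "(\<Sum>k<Suc n. d k * B ^ k) = d 0 + B * (\<Sum>k<n. d (Suc k) * B ^ k)" for d :: "nat \<Rightarrow> nat"
    by (simp add: sum.lessThan_Suc_shift sum_distrib_left mult_ac del: sum.lessThan_Suc)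
  have eq: "d 0 + B * (\<Sum>k<n. d (Suc k) * B ^ k) = e 0 + B * (\<Sum>k<n. e (Suc k) * B ^ k)"
    using Suc.prems(4) by (simp only: split)
  have lt: "d 0 < B" "e 0 < B" using Suc.prems by auto
  have "d 0 = (d 0 + B * (\<Sum>k<n. d (Suc k) * B ^ k)) mod B" using lt by simp
  also have "\<dots> = e 0" unfolding eq using lt by simp
  finally have 0: "d 0 = e 0" .
  then have "(\<Sum>k<n. d (Suc k) * B ^ k) = (\<Sum>k<n. e (Suc k) * B ^ k)" using eq lt by simp
  then have "d (Suc j) = e (Suc j)" if "j < n" for j
    using Suc.IH[of j "\<lambda>k. d (Suc k)" "\<lambda>k. e (Suc k)"] Suc.prems that by auto
  with 0 Suc.prems(1) show ?case by (cases k) auto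
qed simp

text \<open>Kronecker substitution: the i-th variable becomes z^(B^(h i)) with \<open>B\<close>
  above all entries, so different exponents keep different degrees and the resulting polynomial in z
  is nonzero.\<close>

lemma nonvanishing_point:
  fixes c :: "('n::finite \<Rightarrow>\<^sub>0 nat) \<Rightarrow> 'k::alg_closed_field"
  assumes A: "finite A" and a0: "a0 \<in> A" "c a0 \<noteq> 0"
  obtains y where "(\<Sum>a\<in>A. c a * mon y a) \<noteq> 0"
proof -
  obtain h where h: "bij_betw h (UNIV :: 'n set) {..<CARD('n)}"
    using ex_bij_betw_finite_nat[of "UNIV :: 'n set"] by (auto simp: atLeast0LessThan)
  define B where "B = Suc (Max (deg ` A))"
  have B: "Poly_Mapping.lookup a i < B" if "a \<in> A" for a i
  proof -
    have "deg a \<le> Max (deg ` A)" using A that by (intro Max_ge) auto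
    then show ?thesis using lookup_le_deg[of a i] by (simp add: B_def)
  qed
  define w where "w a = (\<Sum>i\<in>UNIV. Poly_Mapping.lookup a i * B ^ h i)" for a
  have w: "w a = (\<Sum>k<CARD('n). Poly_Mapping.lookup a (inv_into UNIV h k) * B ^ k)" for a
  proof -
    have "inj h" using h by (simp add: bij_betw_def)
    then show ?thesis
      unfolding w_def by (simp add: sum.reindex_bij_betw[OF h, symmetric])
  qed
  have inj: "a = b" if "a \<in> A" "b \<in> A" "w a = w b" for a b
  proof (rule poly_mapping_eqI)
    fix i
    have "Poly_Mapping.lookup a (inv_into UNIV h (h i)) = Poly_Mapping.lookup b (inv_into UNIV h (h i))"
    proof (rule base_expansion_inj[where n = "CARD('n)" and B = B and k = "h i"])
      show "h i < CARD('n)" using bij_betwE[OF h] by auto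
      show "(\<Sum>k<CARD('n). Poly_Mapping.lookup a (inv_into UNIV h k) * B ^ k) =
          (\<Sum>k<CARD('n). Poly_Mapping.lookup b (inv_into UNIV h k) * B ^ k)"
        using that(3) unfolding w .
    qed (rule B[OF that(1)], rule B[OF that(2)])
    then show "Poly_Mapping.lookup a i = Poly_Mapping.lookup b i" using h by (simp add: bij_betw_def)
  qed
  define P where "P = (\<Sum>a\<in>A. monom (c a) (w a))"
  have "coeff P (w a0) = (\<Sum>a\<in>A. if a = a0 then c a else 0)"
    unfolding P_def coeff_sum by (rule sum.cong) (use inj a0 in auto)
  then have "P \<noteq> 0" using a0 A by auto
  \<comment> \<open>If \<open>P\<close> vanished everywhere, \<open>P + 1\<close> would have no root
    and would thus be constant, which forces \<open>P = 0\<close>.\<close>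
  have "\<exists>z. poly P z \<noteq> 0"
  proof (rule ccontr)
    assume z: "\<nexists>z. poly P z \<noteq> 0"
    then have "\<nexists>z. poly (P + 1) z = 0" by simp
    then have "\<not> 0 < degree (P + 1)" using alg_closed_imp_poly_has_root by blast
    then obtain d where "P + 1 = [:d:]" by (auto elim: degree_eq_zeroE)
    then have P: "P = [:d:] - 1" by (simp add: eq_diff_eq)
    moreover from P have "d = 1" using z by auto
    ultimately show False using \<open>P \<noteq> 0\<close> by (simp add: one_pCons)
  qed
  then obtain z where z: "poly P z \<noteq> 0" ..
  have "mon (\<lambda>i. z ^ B ^ h i) a = z ^ w a" for a
    unfolding mon_def w_def by (simp add: power_sum mult.commute flip: power_mult)
  then have "(\<Sum>a\<in>A. c a * mon (\<lambda>i. z ^ B ^ h i) a) = poly P z"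
    by (simp add: P_def poly_sum poly_monom)
  with z show thesis by (intro that[of "\<lambda>i. z ^ B ^ h i"]) simp
qed

lemma ndeg_mono: "s \<le> t \<Longrightarrow> ndeg TYPE('n::finite) s \<le> ndeg TYPE('n) t"
  unfolding ndeg_def by (intro card_mono) auto

text \<open>If all these families were independent, the length of \<open>R / T\<^sup>s\<close> would grow like \<open>s\<^sup>n\<^sup>+\<^sup>1\<close>.\<close>

lemma ex_fiber_relation:
  fixes D :: "'n::finite \<Rightarrow> ('a::field, 'n) mfps"
  assumes T: "is_ideal T" "T \<subseteq> max_ideal" "ideal_pow max_ideal N \<subseteq> T" and f: "f \<in> T" and D: "\<And>i. D i \<in> T"
  shows "\<exists>s. \<not> indep_mod (ideal_mult max_ideal (ideal_pow T s)) {a. deg a < Suc s} (\<lambda>a. f ^ (s - deg a) * mon D a)"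
proof (rule ccontr)
  let ?N = "ndeg TYPE('n)" and ?n = "CARD('n)"
  assume "\<not> ?thesis"
  then have indep: "indep_mod (ideal_mult max_ideal (ideal_pow T s)) {a. deg a < Suc s} (\<lambda>a. f ^ (s - deg a) * mon D a)" for s
    by blast
  \<comment> \<open>The successor keeps the factor 2 M positive, as the subsequence argument below
    requires.\<close>
  define M where "M = Suc N"
  have M: "ideal_pow max_ideal M \<subseteq> T" using order.trans[OF ideal_pow_antimono T(3), of M] by (simp add: M_def)
  have prim: "ideal_pow max_ideal (M * s) \<subseteq> ideal_pow T s" for s
    using ideal_pow_mono[OF M, of s] by (simp add: ideal_pow_pow)
  have mT: "ideal_pow T (Suc s) \<subseteq> ideal_mult max_ideal (ideal_pow T s)" for s
    using T(2) by (simp add: ideal_mult_mono)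
  have step: "cod (ideal_pow T s) + ?N (Suc s) \<le> cod (ideal_pow T (Suc s))" for s
  proof -
    have fin: "fincod (ideal_pow T (Suc s))" by (rule primary_fincod[OF prim])
    have "cod (ideal_pow T s) + ?N (Suc s) \<le> cod (ideal_mult max_ideal (ideal_pow T s))"
      unfolding ndeg_def
    proof (rule cod_add_indep[OF is_ideal_mult is_ideal_pow ideal_mult_subset_r[OF is_ideal_pow] fincod_mono[OF mT fin] _ indep])
      fix a :: "'n \<Rightarrow>\<^sub>0 nat" assume a: "a \<in> {a. deg a < Suc s}"
      have "f ^ (s - deg a) * mon D a \<in> ideal_pow T (s - deg a + deg a)"
        by (intro ideal_pow_mult_mem power_in_ideal_pow f mon_in_ideal_pow D)
      then show "f ^ (s - deg a) * mon D a \<in> ideal_pow T s" using a by simp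
    qed
    also have "\<dots> \<le> cod (ideal_pow T (Suc s))" by (rule cod_mono[OF is_ideal_pow mT fin])
    finally show ?thesis .
  qed
  have "k * ?N t \<le> cod (ideal_pow T (t + k))" for t k
  proof (induction k)
    case (Suc k)
    have "?N t \<le> ?N (Suc (t + k))" by (rule ndeg_mono) simp
    then show ?case using Suc step[of "t + k"] by simp
  qed simp
  \<comment> \<open>The previous bound with k = t: summing about t layers of size t^n exhibits
    growth of order n + 1.\<close>
  then have "t * ?N t \<le> cod (ideal_pow T (2 * t))" for t by (metis mult_2)
  moreover have "cod (ideal_pow T s) \<le> ?N (M * s)" for s
    using cod_mono[OF is_ideal_pow prim cod_max_pow(1)] by (simp add: cod_max_pow(2) ndeg_def)
  ultimately have le: "t * ?N t \<le> ?N (2 * M * t)" for t by (metis mult.assoc mult.left_commute order.trans)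
  define b where "b s = fact ?n * real (?N s) / real s ^ ?n" for s
  have b: "b \<longlonglongrightarrow> 1" unfolding b_def[abs_def] by (rule ndeg_limit)
  have "filterlim (\<lambda>t. 2 * M * t) sequentially sequentially"
    by (intro filterlim_subseq strict_monoI mult_less_mono2) (simp_all add: M_def)
  then have b2: "(\<lambda>t. b (2 * M * t)) \<longlonglongrightarrow> 1" using b by (rule filterlim_compose[rotated])
  \<comment> \<open>The first two conditions turn \<open>le\<close> into t / 2 <= 2 (2M)^n, which
    the third contradicts.\<close>
  have "\<forall>\<^sub>F t in sequentially. b t > 1 / 2 \<and> b (2 * M * t) < 2 \<and> t > 4 * (2 * M) ^ ?n"
    by (intro eventually_conj order_tendstoD[OF b] order_tendstoD[OF b2] eventually_gt_at_top) simp_all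
  then obtain t where t: "b t > 1 / 2" "b (2 * M * t) < 2" "t > 4 * (2 * M) ^ ?n"
    using eventually_happens' sequentially_bot by blast
  have pos: "real t > 0" using t(3) by simp
  have b_mult: "b s * real s ^ ?n = fact ?n * real (?N s)" if "s > 0" for s using that by (simp add: b_def)
  have "real t * b t * real t ^ ?n = fact ?n * real (t * ?N t)" 
  proof -
    have "real t * b t * real t ^ ?n = real t * (fact ?n * real (?N t))"
      using pos by (simp only: mult.assoc b_mult[of t] of_nat_0_less_iff)
    then show ?thesis by simp
  qed
  also have "\<dots> \<le> fact ?n * real (?N (2 * M * t))" by (intro mult_left_mono of_nat_mono le) simp
  also have "\<dots> = b (2 * M * t) * real (2 * M * t) ^ ?n" using pos by (intro b_mult[symmetric]) (simp add: M_def)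
  also have "\<dots> = b (2 * M * t) * real (2 * M) ^ ?n * real t ^ ?n" by (simp add: power_mult_distrib)
  finally have "real t * b t \<le> b (2 * M * t) * real (2 * M) ^ ?n" using pos by simp
  also have "\<dots> \<le> 2 * real (2 * M) ^ ?n" using t(2) by (intro mult_right_mono) auto
  finally have "real t * b t \<le> 2 * real (2 * M) ^ ?n" .
  moreover have "real t * (1 / 2) \<le> real t * b t" using t(1) pos by (intro mult_left_mono) auto
  ultimately have "real t \<le> 4 * real (2 * M) ^ ?n" by simp
  moreover have "real t > real (4 * (2 * M) ^ ?n)" using t(3) by (simp only: of_nat_less_iff)
  ultimately show False by simp
qed

text \<open>The preimage in R of the degree-d part of the ideal generated by \<open>J\<close> in the
  fiber cone of \<open>T\<close>. Degree 0 gets the zero ideal, since there the congruence of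
  \<open>mon_fiber_cong\<close> is an equality.\<close>

definition fiber_ideal :: "('a::comm_ring_1, 'n) mfps set \<Rightarrow> ('a, 'n) mfps set \<Rightarrow> nat \<Rightarrow> ('a, 'n) mfps set" where
  "fiber_ideal J T d = (case d of 0 \<Rightarrow> {0}
     | Suc l \<Rightarrow> ideal_plus (ideal_mult J (ideal_pow T l)) (ideal_mult max_ideal (ideal_pow T (Suc l))))"

lemma is_ideal_fiber [simp]: "is_ideal (fiber_ideal J T d)"
  by (cases d) (simp_all add: fiber_ideal_def is_ideal_plus)

lemma fiber_ideal_mult:
  assumes x: "x \<in> T" and z: "z \<in> fiber_ideal J T d" shows "x * z \<in> fiber_ideal J T (Suc d)"
proof (cases d)
  case 0
  then have "z = 0" using z by (simp add: fiber_ideal_def)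
  then show ?thesis by (simp add: ideal_zero)
next
  case (Suc l)
  with z obtain p q where pq: "z = p + q" "p \<in> ideal_mult J (ideal_pow T l)" "q \<in> ideal_mult max_ideal (ideal_pow T (Suc l))"
    by (auto simp: fiber_ideal_def simp del: ideal_pow.simps elim: ideal_plusE)
  have "x * p \<in> ideal_mult J (ideal_pow T (Suc l))" "x * q \<in> ideal_mult max_ideal (ideal_pow T (Suc (Suc l)))"
    using ideal_mult_mem[OF x pq(2)] ideal_mult_mem[OF x pq(3)] by (simp_all add: ideal_mult_left_commute)
  then show ?thesis unfolding pq(1) Suc distrib_left fiber_ideal_def nat.case by (rule ideal_plusI)
qed

lemma fiber_ideal_power_mult:
  "f \<in> T \<Longrightarrow> z \<in> fiber_ideal J T d \<Longrightarrow> f ^ k * z \<in> fiber_ideal J T (d + k)"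
proof (induction k)
  case (Suc k)
  then have "f * (f ^ k * z) \<in> fiber_ideal J T (Suc (d + k))" by (intro fiber_ideal_mult)
  then show ?case by (simp add: mult.assoc)
qed simp

text \<open>In the fiber cone modulo \<open>J\<close> each \<open>D i\<close> equals
  \<open>y i\<close> times \<open>f\<close>, so a monomial in \<open>D\<close> becomes its value at
  \<open>y\<close> times a power of \<open>f\<close>.\<close>

lemma mon_fiber_cong:
  fixes D g :: "'n::finite \<Rightarrow> ('a::comm_ring_1, 'n) mfps"
  assumes f: "f \<in> T" and D: "\<And>i. D i \<in> T" and g: "\<And>i. g i \<in> J"
    and cong: "\<And>i. D i - mfps_const (y i) * f - g i \<in> ideal_mult max_ideal T"
  shows "mon D a - mfps_const (mon y a) * f ^ deg a \<in> fiber_ideal J T (deg a)"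
proof (induction "deg a" arbitrary: a)
  case 0
  then have "a = 0" by simp
  then show ?case using ideal_zero[OF is_ideal_fiber] by simp
next
  case (Suc d)
  obtain b i where b: "a = b + Poly_Mapping.single i 1" "deg b = d" using Suc.hyps(2) by (metis deg_SucE)
  let ?z = "mfps_const (mon y b) * f ^ d"
  have z: "?z \<in> ideal_pow T d" by (intro ideal_mult_l is_ideal_pow power_in_ideal_pow f)
  have "D i * (mon D b - ?z) \<in> fiber_ideal J T (Suc d)"
    using fiber_ideal_mult[OF D Suc.hyps(1)[of b]] b(2) by simp
  moreover have "g i * ?z + (D i - mfps_const (y i) * f - g i) * ?z \<in> fiber_ideal J T (Suc d)"
    unfolding fiber_ideal_def nat.case
  proof (rule ideal_plusI)
    show "g i * ?z \<in> ideal_mult J (ideal_pow T d)" using g z by (rule ideal_mult_mem)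
    show "(D i - mfps_const (y i) * f - g i) * ?z \<in> ideal_mult max_ideal (ideal_pow T (Suc d))"
      using ideal_mult_mem[OF cong z] by (simp add: ideal_mult_assoc)
  qed
  ultimately have "D i * (mon D b - ?z) + (g i * ?z + (D i - mfps_const (y i) * f - g i) * ?z) \<in> fiber_ideal J T (Suc d)"
    by (rule ideal_add[OF is_ideal_fiber])
  also have "D i * (mon D b - ?z) + (g i * ?z + (D i - mfps_const (y i) * f - g i) * ?z) =
      mon D a - mfps_const (mon y a) * f ^ deg a"
    using b(2) by (simp add: b(1) mon_add deg_add mfps_const_mult algebra_simps)
  finally show ?case using Suc.hyps(2) by simp
qed

subsection \<open>The Tjurina ideal\<close>

text \<open>By the Leibniz rule the derivatives of a multiple of h lie in the Tjurina ideal of h.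
  The reverse inclusion is the same fact for the inverse unit, applied to u f.\<close>

lemma tjurina_ideal_unit:
  fixes f :: "('a::field, 'n::finite) mfps"
  assumes u: "u dvd 1"
  shows "tjurina_ideal f = ideal_plus (ideal_gen {f}) (jacobian_ideal (u * f))"
proof -
  have T: "tjurina_ideal h = ideal_plus (ideal_gen {h}) (jacobian_ideal h)" for h :: "('a, 'n) mfps"
    by (simp add: tjurina_ideal_def ideal_plus_def)
  have J: "is_ideal (jacobian_ideal h)" for h :: "('a, 'n) mfps" by (simp add: jacobian_ideal_def)
  have le: "jacobian_ideal (w * h) \<subseteq> ideal_plus (ideal_gen {h}) (jacobian_ideal h)" for w h :: "('a, 'n) mfps"
    unfolding jacobian_ideal_def[of "w * h"]
  proof (rule ideal_gen_least)
    show "range (\<lambda>i. mfps_deriv i (w * h)) \<subseteq> ideal_plus (ideal_gen {h}) (jacobian_ideal h)"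
    proof clarify
      fix i
      have "mfps_deriv i w * h \<in> ideal_gen {h}" by (intro ideal_mult_l is_ideal_gen ideal_gen_base) simp
      moreover have "w * mfps_deriv i h \<in> jacobian_ideal h"
        unfolding jacobian_ideal_def by (intro ideal_mult_l is_ideal_gen ideal_gen_base) simp
      ultimately show "mfps_deriv i (w * h) \<in> ideal_plus (ideal_gen {h}) (jacobian_ideal h)"
        unfolding mfps_deriv_mult by (rule ideal_plusI)
    qed
  qed (simp add: is_ideal_plus J)
  obtain w where w: "1 = u * w" using u by (rule dvdE)
  then have f: "w * (u * f) = f" by (metis mult.assoc mult.commute mult.left_neutral)
  have uf: "ideal_gen {u * f} \<subseteq> ideal_gen {f}"
    by (intro ideal_gen_least is_ideal_gen) (auto intro: ideal_mult_l ideal_gen_base)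
  show ?thesis
    unfolding T
  proof
    have "jacobian_ideal f \<subseteq> ideal_plus (ideal_gen {u * f}) (jacobian_ideal (u * f))"
      using le[of w "u * f"] by (simp only: f)
    also have "\<dots> \<subseteq> ideal_plus (ideal_gen {f}) (jacobian_ideal (u * f))"
      using uf by (intro ideal_plus_mono order.refl)
    finally show "ideal_plus (ideal_gen {f}) (jacobian_ideal f) \<subseteq> ideal_plus (ideal_gen {f}) (jacobian_ideal (u * f))"
      using ideal_plus_l[OF J] by (intro ideal_plus_least is_ideal_plus is_ideal_gen J) auto
    show "ideal_plus (ideal_gen {f}) (jacobian_ideal (u * f)) \<subseteq> ideal_plus (ideal_gen {f}) (jacobian_ideal f)"
      using le[of u f] ideal_plus_l[OF J] by (intro ideal_plus_least is_ideal_plus is_ideal_gen J) auto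
  qed
qed

lemma is_ideal_tjurina [simp]: "is_ideal (tjurina_ideal f)"
  for f :: "('a::field, 'n::finite) mfps"
  using tjurina_ideal_unit[of 1 f] by (simp add: is_ideal_plus jacobian_ideal_def)

lemma tjurina_ideal_gen: "tjurina_ideal f = ideal_gen (range (tjurina_gens f))"
  for f :: "('a::field, 'n::finite) mfps"
proof -
  have "tjurina_gens f = case_option f (\<lambda>i. mfps_deriv i f)"
    by (auto simp: tjurina_gens_def fun_eq_iff split: option.splits)
  then show ?thesis
    using tjurina_ideal_unit[of 1 f] ideal_plus_gen_range[of f "\<lambda>i. mfps_deriv i f"] by (simp add: jacobian_ideal_def)
qed

lemma tjurina_gens_in: "tjurina_gens f j \<in> tjurina_ideal f" for f :: "('a::field, 'n::finite) mfps"
  unfolding tjurina_ideal_gen by (rule ideal_gen_base) simp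

lemma f_in_tjurina: "f \<in> tjurina_ideal f" and deriv_in_tjurina: "mfps_deriv i f \<in> tjurina_ideal f"
  for f :: "('a::field, 'n::finite) mfps"
  using tjurina_gens_in[of f None] tjurina_gens_in[of f "Some i"] by (simp_all add: tjurina_gens_def)

lemma jacobian_subset_tjurina: "u dvd 1 \<Longrightarrow> jacobian_ideal (u * f) \<subseteq> tjurina_ideal f"
  for f :: "('a::field, 'n::finite) mfps"
  unfolding tjurina_ideal_unit by (auto intro: ideal_plus_r)

lemma deriv_nth_0: "mfps_nth (mfps_deriv i h) 0 = mfps_nth h (Poly_Mapping.single i 1)"
  by (simp add: mfps_deriv_def)

text \<open>The simplest unit with value 1 and gradient \<open>c\<close> at the origin; by
  \<open>deriv_linear_unit\<close> these data determine the derivatives of the product with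
  \<open>f\<close> modulo m T.\<close>

definition linear_unit :: "('n::finite \<Rightarrow> 'a) \<Rightarrow> ('a::field, 'n) mfps" where
  "linear_unit c = 1 + (\<Sum>i\<in>UNIV. mfps_const (c i) * mfps_var i)"

lemma single_eq_iff: "Poly_Mapping.single i (1 :: nat) = Poly_Mapping.single j 1 \<longleftrightarrow> i = j"
  by (metis lookup_single_eq lookup_single_not_eq zero_neq_one)

lemma single_neq_0: "Poly_Mapping.single i (1 :: nat) \<noteq> 0"
  by (metis lookup_single_eq lookup_zero zero_neq_one)

lemma linear_unit_nth:
  "mfps_nth (linear_unit c) 0 = 1" "mfps_nth (linear_unit c) (Poly_Mapping.single i 1) = c i"
  by (simp_all add: single_neq_0[unfolded One_nat_def] single_neq_0[unfolded One_nat_def, symmetric] linear_unit_def mfps_nth_sum mfps_nth_one mfps_const_eq_monom mfps_nth_monom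
      single_eq_iff[unfolded One_nat_def] if_distrib[of "\<lambda>x. _ * x"] cong: if_cong)

lemma linear_unit_dvd: "linear_unit c dvd 1"
  unfolding mfps_unit_iff by (simp add: linear_unit_nth)

lemma deriv_linear_unit:
  fixes f :: "('a::field, 'n::finite) mfps"
  shows "mfps_deriv i (linear_unit c * f) - (mfps_deriv i f + mfps_const (c i) * f)
    \<in> ideal_mult max_ideal (tjurina_ideal f)"
proof -
  have "mfps_deriv i (linear_unit c) - mfps_const (c i) \<in> max_ideal"
    by (simp add: max_ideal_def deriv_nth_0[unfolded One_nat_def] linear_unit_nth[unfolded One_nat_def] mfps_nth_const)
  then have 1: "(mfps_deriv i (linear_unit c) - mfps_const (c i)) * f \<in> ideal_mult max_ideal (tjurina_ideal f)"
    using f_in_tjurina by (rule ideal_mult_mem)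
  have "linear_unit c - 1 \<in> max_ideal"
    by (simp add: max_ideal_def linear_unit_nth mfps_nth_one)
  then have "(linear_unit c - 1) * mfps_deriv i f \<in> ideal_mult max_ideal (tjurina_ideal f)"
    using deriv_in_tjurina by (rule ideal_mult_mem)
  from ideal_add[OF is_ideal_mult 1 this] show ?thesis
    by (simp add: mfps_deriv_mult algebra_simps)
qed

text \<open>A relation between the generators in the fiber cone, with \<open>f\<close> set to 1, is
  a nonzero polynomial in the derivatives. At a point \<open>y\<close> where it does not vanish,
  substituting \<open>y i\<close> times \<open>f\<close> for the derivatives turns the relation into
  a nonzero scalar times f^s.\<close>

lemma generic_reduction:
  fixes f :: "('k::alg_closed_field, 'n::finite) mfps"
  defines "T \<equiv> tjurina_ideal f"
  assumes T: "T \<subseteq> max_ideal" "ideal_pow max_ideal N \<subseteq> T"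
  obtains c l where "f ^ Suc l \<in> ideal_plus (ideal_mult (jacobian_ideal (linear_unit c * f)) (ideal_pow T l))
    (ideal_mult max_ideal (ideal_pow T (Suc l)))"
proof -
  let ?D = "\<lambda>i. mfps_deriv i f"
  have f: "f \<in> T" and D: "?D i \<in> T" for i by (simp_all add: T_def f_in_tjurina deriv_in_tjurina)
  have idT: "is_ideal T" by (simp add: T_def)
  obtain s where "\<not> indep_mod (ideal_mult max_ideal (ideal_pow T s)) {a. deg a < Suc s} (\<lambda>a. f ^ (s - deg a) * mon ?D a)"
    using ex_fiber_relation[OF idT T f D] ..
  then obtain e a0 where e: "lcomb e (\<lambda>a. f ^ (s - deg a) * mon ?D a) {a. deg a < Suc s} \<in> ideal_mult max_ideal (ideal_pow T s)"
    and a0: "deg a0 < Suc s" "e a0 \<noteq> 0"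
    by (auto simp: indep_mod_def)
  obtain y where y: "(\<Sum>a | deg a < Suc s. e a * mon y a) \<noteq> 0"
    using nonvanishing_point[of "{a. deg a < Suc s}" a0 e] a0 by auto
  \<comment> \<open>The generators of the new Jacobian ideal are D_i + c_i f modulo m T, so dividing
    by them sets D_i equal to -c_i f.\<close>
  define c where "c i = - y i" for i
  let ?J = "jacobian_ideal (linear_unit c * f)"
  let ?F = "fiber_ideal ?J T"
  have cong: "?D i - mfps_const (y i) * f - mfps_deriv i (linear_unit c * f) \<in> ideal_mult max_ideal T" for i
    using ideal_uminus[OF is_ideal_mult deriv_linear_unit[of i c f]]
    by (simp add: T_def c_def mfps_const_uminus algebra_simps)
  have gJ: "mfps_deriv i (linear_unit c * f) \<in> ?J" for i
    unfolding jacobian_ideal_def by (rule ideal_gen_base) simp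
  have sub: "mfps_const (e a) * (f ^ (s - deg a) * mon ?D a) - mfps_const (e a * mon y a) * f ^ s \<in> ?F s"
    if "deg a < Suc s" for a
  proof -
    have "f ^ (s - deg a) * (mon ?D a - mfps_const (mon y a) * f ^ deg a) \<in> ?F (deg a + (s - deg a))"
      by (rule fiber_ideal_power_mult[OF f mon_fiber_cong[OF f D gJ cong]])
    then have "mfps_const (e a) * (f ^ (s - deg a) * (mon ?D a - mfps_const (mon y a) * f ^ deg a)) \<in> ?F s"
      using that by (intro ideal_mult_l[OF is_ideal_fiber, of _ _ _ _ "mfps_const (e a)"]) simp
    moreover have "f ^ (s - deg a) * f ^ deg a = f ^ s" using that by (simp flip: power_add)
    then have "mfps_const (e a) * (f ^ (s - deg a) * (mon ?D a - mfps_const (mon y a) * f ^ deg a)) =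
        mfps_const (e a) * (f ^ (s - deg a) * mon ?D a) - mfps_const (e a * mon y a) * f ^ s"
      by (simp add: right_diff_distrib mfps_const_mult mult.left_commute mult.assoc)
    ultimately show ?thesis by simp
  qed
  let ?q = "\<Sum>a | deg a < Suc s. e a * mon y a"
  have "lcomb e (\<lambda>a. f ^ (s - deg a) * mon ?D a) {a. deg a < Suc s} - mfps_const ?q * f ^ s \<in> ?F s"
    unfolding lcomb_def mfps_const_sum sum_distrib_right sum_subtractf[symmetric]
    by (rule ideal_sum[OF is_ideal_fiber]) (simp add: sub)
  note L = this
  have "lcomb e (\<lambda>a. f ^ (s - deg a) * mon ?D a) {a. deg a < Suc s}
      - (lcomb e (\<lambda>a. f ^ (s - deg a) * mon ?D a) {a. deg a < Suc s} - mfps_const ?q * f ^ s)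
      \<in> ideal_plus (?F s) (ideal_mult max_ideal (ideal_pow T s))"
    by (rule ideal_diff[OF is_ideal_plus[OF is_ideal_fiber is_ideal_mult]
          ideal_plus_r[OF is_ideal_fiber e] ideal_plus_l[OF is_ideal_mult L]])
  then have "mfps_const (inverse ?q) * (mfps_const ?q * f ^ s) \<in> ideal_plus (?F s) (ideal_mult max_ideal (ideal_pow T s))"
    by (intro ideal_mult_l[of _ _ "mfps_const (inverse ?q)"] is_ideal_plus is_ideal_fiber is_ideal_mult) simp
  also have "mfps_const (inverse ?q) * (mfps_const ?q * f ^ s) = f ^ s"
    using y unfolding mult.assoc[symmetric] mfps_const_mult[symmetric] by simp
  finally have fs: "f ^ s \<in> ideal_plus (?F s) (ideal_mult max_ideal (ideal_pow T s))" .
  show thesis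
  proof (cases s)
    \<comment> \<open>In degree 0 \<open>fiber_ideal\<close> is zero, so the relation would put 1
      into the maximal ideal.\<close>
    case 0
    have "1 \<in> ideal_mult max_ideal (ideal_pow T 0)" using fs 0 by (auto simp: fiber_ideal_def ideal_plus_def)
    then have "1 \<in> (max_ideal :: ('k, 'n) mfps set)" by simp
    then show thesis by (simp add: max_ideal_def mfps_nth_one)
  next
    case (Suc l)
    have "ideal_plus (?F s) (ideal_mult max_ideal (ideal_pow T s)) \<subseteq> ?F s"
      unfolding Suc fiber_ideal_def nat.case
      by (intro ideal_plus_least is_ideal_plus is_ideal_mult order.refl) (auto intro: ideal_plus_r)
    then have "f ^ Suc l \<in> ?F (Suc l)" using fs Suc by auto
    then show thesis using that unfolding fiber_ideal_def nat.case by blast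
  qed
qed

subsection \<open>Null-forms\<close>

lemma poly_mapping_sum_singles:
  "\<phi> = (\<Sum>a\<in>Poly_Mapping.keys \<phi>. Poly_Mapping.single a (Poly_Mapping.lookup \<phi> a))"
proof (rule poly_mapping_eqI)
  fix b
  have "Poly_Mapping.lookup (\<Sum>a\<in>Poly_Mapping.keys \<phi>. Poly_Mapping.single a (Poly_Mapping.lookup \<phi> a)) b
      = (\<Sum>a\<in>Poly_Mapping.keys \<phi>. if a = b then Poly_Mapping.lookup \<phi> b else 0)"
    unfolding lookup_sum by (rule sum.cong) (auto simp: lookup_single when_def)
  then show "Poly_Mapping.lookup \<phi> b =
      Poly_Mapping.lookup (\<Sum>a\<in>Poly_Mapping.keys \<phi>. Poly_Mapping.single a (Poly_Mapping.lookup \<phi> a)) b"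
    by (auto simp: in_keys_iff)
qed

lemma poly_mapping_mult_singles:
  "\<phi> * \<psi> = (\<Sum>a\<in>Poly_Mapping.keys \<phi>. \<Sum>b\<in>Poly_Mapping.keys \<psi>.
     Poly_Mapping.single (a + b) (Poly_Mapping.lookup \<phi> a * Poly_Mapping.lookup \<psi> b))"
  for \<phi> \<psi> :: "('c::comm_monoid_add) \<Rightarrow>\<^sub>0 ('b::comm_ring_1)"
proof -
  have "\<phi> * \<psi> = (\<Sum>a\<in>Poly_Mapping.keys \<phi>. Poly_Mapping.single a (Poly_Mapping.lookup \<phi> a)) *
      (\<Sum>b\<in>Poly_Mapping.keys \<psi>. Poly_Mapping.single b (Poly_Mapping.lookup \<psi> b))"
    using poly_mapping_sum_singles[of \<phi>] poly_mapping_sum_singles[of \<psi>] by simp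
  then show ?thesis by (simp add: sum_product mult_single)
qed

lemma poly_eval_superset:
  assumes "finite A" "Poly_Mapping.keys \<phi> \<subseteq> A"
  shows "poly_eval \<phi> v = (\<Sum>a\<in>A. Poly_Mapping.lookup \<phi> a * mon v a)"
  unfolding poly_eval_def mon_def using assms by (intro sum.mono_neutral_left) (auto simp: in_keys_iff)

lemma poly_eval_add: "poly_eval (\<phi> + \<psi>) v = poly_eval \<phi> v + poly_eval \<psi> v"
proof -
  let ?A = "Poly_Mapping.keys \<phi> \<union> Poly_Mapping.keys \<psi>"
  have "Poly_Mapping.keys (\<phi> + \<psi>) \<subseteq> ?A" by (rule Poly_Mapping.keys_add)
  then show ?thesis
    using poly_eval_superset[of ?A \<phi> v] poly_eval_superset[of ?A \<psi> v] poly_eval_superset[of ?A "\<phi> + \<psi>" v]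
    by (simp add: lookup_add distrib_right sum.distrib)
qed

lemma poly_eval_single: "poly_eval (Poly_Mapping.single a x) v = x * mon v a"
  using poly_eval_superset[of "{a}" "Poly_Mapping.single a x" v] by simp

lemma poly_eval_zero [simp]: "poly_eval 0 v = 0"
  by (simp add: poly_eval_def)

lemma poly_eval_sum: "poly_eval (sum f A) v = (\<Sum>i\<in>A. poly_eval (f i) v)"
  by (induction A rule: infinite_finite_induct) (simp_all add: poly_eval_add)

lemma poly_eval_mult: "poly_eval (\<phi> * \<psi>) v = poly_eval \<phi> v * poly_eval \<psi> v"
proof -
  have "poly_eval (\<phi> * \<psi>) v = (\<Sum>a\<in>Poly_Mapping.keys \<phi>. \<Sum>b\<in>Poly_Mapping.keys \<psi>.
      Poly_Mapping.lookup \<phi> a * Poly_Mapping.lookup \<psi> b * mon v (a + b))"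
    by (simp only: poly_mapping_mult_singles poly_eval_sum poly_eval_single)
  also have "\<dots> = poly_eval \<phi> v * poly_eval \<psi> v"
    unfolding poly_eval_superset[OF finite_keys order.refl, of \<phi>] poly_eval_superset[OF finite_keys order.refl, of \<psi>]
      sum_product by (intro sum.cong refl) (simp add: mon_add mult_ac)
  finally show ?thesis .
qed

lemma homogeneous_iff: "homogeneous s F \<longleftrightarrow> (\<forall>a. Poly_Mapping.lookup F a \<noteq> 0 \<longrightarrow> deg a = s)"
  by (auto simp: homogeneous_def deg_def in_keys_iff)

lemma poly_eval_homogeneous:
  assumes "homogeneous s F"
  shows "poly_eval F v = (\<Sum>a | deg a = s. Poly_Mapping.lookup F a * mon v a)"
  using assms by (intro poly_eval_superset) (auto simp: homogeneous_iff in_keys_iff)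

lemma mon_scale: "mon (\<lambda>i. c * v i) a = c ^ deg a * mon v a"
  by (simp add: mon_def deg_def power_mult_distrib prod.distrib power_sum)

lemma poly_eval_homogeneous_scale:
  assumes "homogeneous s F" shows "poly_eval F (\<lambda>i. c * v i) = c ^ s * poly_eval F v"
  unfolding poly_eval_homogeneous[OF assms] mon_scale sum_distrib_left
  by (rule sum.cong) (auto simp: mult_ac)

lemma null_ideal_vanish:
  assumes "\<And>s \<phi>. null_form f s \<phi> \<Longrightarrow> poly_eval \<phi> v = 0" and "\<phi> \<in> null_ideal f"
  shows "poly_eval \<phi> v = 0"
proof -
  have "is_ideal {\<phi>. poly_eval \<phi> v = 0}"
    by (rule is_idealI) (simp_all add: poly_eval_add poly_eval_mult)
  then have "null_ideal f \<subseteq> {\<phi>. poly_eval \<phi> v = 0}"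
    unfolding null_ideal_def using assms(1) by (intro ideal_gen_least) auto
  then show ?thesis using assms(2) by blast
qed

text \<open>The value at the generators of the homogenization of \<phi> in degree \<open>D\<close>,
  with Y_0 filling up the degree. Y_0 also remains a variable of \<phi>; it is identified with 1
  only because \<open>pvar None - 1\<close> has value 0 and so lies in the ideal
  \<open>affine_null_ideal\<close>.\<close>

definition form_value :: "('a::field, 'n::finite) mfps \<Rightarrow> nat \<Rightarrow> (('n option \<Rightarrow>\<^sub>0 nat) \<Rightarrow>\<^sub>0 'a) \<Rightarrow> ('a, 'n) mfps" where
  "form_value f D \<phi> = (\<Sum>a | deg a \<le> D. mfps_const (Poly_Mapping.lookup \<phi> a) * mon (tjurina_gens f) a * f ^ (D - deg a))"

definition deg_bounded :: "nat \<Rightarrow> (('i::finite \<Rightarrow>\<^sub>0 nat) \<Rightarrow>\<^sub>0 'a::zero) set" where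
  "deg_bounded D = {\<phi>. \<forall>a. Poly_Mapping.lookup \<phi> a \<noteq> 0 \<longrightarrow> deg a \<le> D}"

lemma form_value_add: "form_value f D (\<phi> + \<psi>) = form_value f D \<phi> + form_value f D \<psi>"
  and form_value_diff: "form_value f D (\<phi> - \<psi>) = form_value f D \<phi> - form_value f D \<psi>"
  by (simp_all add: form_value_def lookup_add lookup_minus mfps_const_add mfps_const_diff distrib_right
      left_diff_distrib sum.distrib sum_subtractf)

lemma form_value_zero [simp]: "form_value f D 0 = 0"
  by (simp add: form_value_def)

lemma form_value_sum: "form_value f D (sum F A) = (\<Sum>i\<in>A. form_value f D (F i))"
  by (induction A rule: infinite_finite_induct) (simp_all add: form_value_add)

lemma form_value_single:
  assumes "deg a \<le> D"
  shows "form_value f D (Poly_Mapping.single a x) = mfps_const x * mon (tjurina_gens f) a * f ^ (D - deg a)"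
proof -
  have "form_value f D (Poly_Mapping.single a x) = (\<Sum>b | deg b \<le> D. if b = a then mfps_const x * mon (tjurina_gens f) a * f ^ (D - deg a) else 0)"
    unfolding form_value_def by (rule sum.cong) (auto simp: lookup_single when_def)
  then show ?thesis using assms by (simp add: finite_deg_le)
qed

lemma form_value_keys:
  assumes "\<phi> \<in> deg_bounded D"
  shows "form_value f D \<phi> = (\<Sum>a\<in>Poly_Mapping.keys \<phi>. mfps_const (Poly_Mapping.lookup \<phi> a) * mon (tjurina_gens f) a * f ^ (D - deg a))"
  unfolding form_value_def using assms finite_deg_le
  by (intro sum.mono_neutral_right) (auto simp: deg_bounded_def in_keys_iff)

lemma form_value_mult:
  assumes "\<phi> \<in> deg_bounded D" "\<psi> \<in> deg_bounded E"
  shows "form_value f (D + E) (\<phi> * \<psi>) = form_value f D \<phi> * form_value f E \<psi>"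
proof -
  have "form_value f (D + E) (\<phi> * \<psi>) = (\<Sum>a\<in>Poly_Mapping.keys \<phi>. \<Sum>b\<in>Poly_Mapping.keys \<psi>.
      (mfps_const (Poly_Mapping.lookup \<phi> a) * mon (tjurina_gens f) a * f ^ (D - deg a)) *
      (mfps_const (Poly_Mapping.lookup \<psi> b) * mon (tjurina_gens f) b * f ^ (E - deg b)))"
    unfolding poly_mapping_mult_singles form_value_sum
  proof (intro sum.cong refl)
    fix a b assume "a \<in> Poly_Mapping.keys \<phi>" "b \<in> Poly_Mapping.keys \<psi>"
    then have le: "deg a \<le> D" "deg b \<le> E" using assms by (auto simp: deg_bounded_def in_keys_iff)
    then have "D + E - deg (a + b) = (D - deg a) + (E - deg b)" by (simp add: deg_add)
    then have "f ^ (D + E - deg (a + b)) = f ^ (D - deg a) * f ^ (E - deg b)" by (simp only: power_add)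
    then show "form_value f (D + E) (Poly_Mapping.single (a + b) (Poly_Mapping.lookup \<phi> a * Poly_Mapping.lookup \<psi> b)) =
      (mfps_const (Poly_Mapping.lookup \<phi> a) * mon (tjurina_gens f) a * f ^ (D - deg a)) *
      (mfps_const (Poly_Mapping.lookup \<psi> b) * mon (tjurina_gens f) b * f ^ (E - deg b))"
      using le by (subst form_value_single) (simp_all add: deg_add mfps_const_mult mon_add mult_ac)
  qed
  then show ?thesis using assms by (simp add: form_value_keys sum_product)
qed

lemma form_value_Suc:
  assumes "\<phi> \<in> deg_bounded D" shows "form_value f (D + k) \<phi> = f ^ k * form_value f D \<phi>"
proof -
  have "\<phi> \<in> deg_bounded (D + k)" using assms by (auto simp: deg_bounded_def intro: trans_le_add1)
  moreover have "f ^ (D + k - deg a) = f ^ k * f ^ (D - deg a)" if "a \<in> Poly_Mapping.keys \<phi>" for a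
  proof -
    have "deg a \<le> D" using that assms by (auto simp: deg_bounded_def in_keys_iff)
    then have "D + k - deg a = k + (D - deg a)" by simp
    then show ?thesis by (simp only: power_add)
  qed
  ultimately show ?thesis
    using assms by (simp add: form_value_keys sum_distrib_left mult_ac)
qed

lemma form_value_in_pow:
  fixes f :: "('a::field, 'n::finite) mfps"
  shows "form_value f D \<phi> \<in> ideal_pow (tjurina_ideal f) D"
  unfolding form_value_def
proof (rule ideal_sum[OF is_ideal_pow])
  fix a :: "'n option \<Rightarrow>\<^sub>0 nat" assume a: "a \<in> {a. deg a \<le> D}"
  have "mon (tjurina_gens f) a * f ^ (D - deg a) \<in> ideal_pow (tjurina_ideal f) (deg a + (D - deg a))"
    by (intro ideal_pow_mult_mem mon_in_ideal_pow tjurina_gens_in power_in_ideal_pow f_in_tjurina)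
  then have "mfps_const (Poly_Mapping.lookup \<phi> a) * (mon (tjurina_gens f) a * f ^ (D - deg a)) \<in> ideal_pow (tjurina_ideal f) D"
    using a by (intro ideal_mult_l[OF is_ideal_pow, of _ _ _ "mfps_const _"]) simp
  then show "mfps_const (Poly_Mapping.lookup \<phi> a) * mon (tjurina_gens f) a * f ^ (D - deg a) \<in> ideal_pow (tjurina_ideal f) D"
    by (simp only: mult.assoc)
qed

lemma deg_bounded_exists: "\<exists>D. \<phi> \<in> deg_bounded D"
proof
  show "\<phi> \<in> deg_bounded (Max (insert 0 (deg ` Poly_Mapping.keys \<phi>)))"
    by (auto simp: deg_bounded_def in_keys_iff intro!: Max_ge)
qed

lemma deg_bounded_mono: "D \<le> E \<Longrightarrow> \<phi> \<in> deg_bounded D \<Longrightarrow> \<phi> \<in> deg_bounded E"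
  by (auto simp: deg_bounded_def intro: order.trans)

lemma deg_bounded_add: "\<phi> \<in> deg_bounded D \<Longrightarrow> \<psi> \<in> deg_bounded D \<Longrightarrow> \<phi> + \<psi> \<in> deg_bounded D"
  for \<phi> \<psi> :: "('i::finite \<Rightarrow>\<^sub>0 nat) \<Rightarrow>\<^sub>0 'a::comm_ring_1"
  unfolding deg_bounded_def by (auto simp: lookup_add) (metis add.right_neutral)

lemma deg_bounded_diff: "\<phi> \<in> deg_bounded D \<Longrightarrow> \<psi> \<in> deg_bounded D \<Longrightarrow> \<phi> - \<psi> \<in> deg_bounded D"
  for \<phi> \<psi> :: "('i::finite \<Rightarrow>\<^sub>0 nat) \<Rightarrow>\<^sub>0 'a::comm_ring_1"
  unfolding deg_bounded_def by (auto simp: lookup_minus) (metis diff_zero)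

lemma deg_bounded_zero: "0 \<in> deg_bounded D"
  by (simp add: deg_bounded_def)

lemma deg_bounded_sum: "(\<And>i. i \<in> A \<Longrightarrow> F i \<in> deg_bounded D) \<Longrightarrow> sum F A \<in> deg_bounded D"
  for F :: "'j \<Rightarrow> ('i::finite \<Rightarrow>\<^sub>0 nat) \<Rightarrow>\<^sub>0 'a::comm_ring_1"
  by (induction A rule: infinite_finite_induct) (auto intro: deg_bounded_add simp: deg_bounded_zero)

lemma deg_bounded_single: "deg a \<le> D \<Longrightarrow> Poly_Mapping.single a x \<in> deg_bounded D"
  by (auto simp: deg_bounded_def lookup_single when_def)

lemma deg_bounded_mult: "\<phi> \<in> deg_bounded D \<Longrightarrow> \<psi> \<in> deg_bounded E \<Longrightarrow> \<phi> * \<psi> \<in> deg_bounded (D + E)"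
  for \<phi> \<psi> :: "('i::finite \<Rightarrow>\<^sub>0 nat) \<Rightarrow>\<^sub>0 'a::comm_ring_1"
  unfolding poly_mapping_mult_singles
  by (intro deg_bounded_sum deg_bounded_single)
    (auto simp: deg_bounded_def in_keys_iff deg_add intro: add_mono)

text \<open>The dehomogenization at \<open>Y\<^sub>0 = 1\<close>: the set of all polynomials whose homogenization is a null-form
  up to a power of \<open>Y\<^sub>0\<close>.\<close>

definition affine_null_ideal :: "('a::field, 'n::finite) mfps \<Rightarrow> (('n option \<Rightarrow>\<^sub>0 nat) \<Rightarrow>\<^sub>0 'a) set" where
  "affine_null_ideal f = {\<phi>. \<exists>D. \<phi> \<in> deg_bounded D \<and>
     form_value f D \<phi> \<in> ideal_mult max_ideal (ideal_pow (tjurina_ideal f) D)}"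

text \<open>Values in different degrees are compared by multiplying with powers of \<open>f\<close>,
  which preserves membership in m T^D.\<close>

lemma is_ideal_affine_null:
  fixes f :: "('a::field, 'n::finite) mfps"
  shows "is_ideal (affine_null_ideal f)"
proof -
  let ?T = "tjurina_ideal f"
  have up: "form_value f (D + k) \<phi> \<in> ideal_mult max_ideal (ideal_pow ?T (D + k))"
    if "\<phi> \<in> deg_bounded D" "form_value f D \<phi> \<in> ideal_mult max_ideal (ideal_pow ?T D)" for \<phi> D k
  proof -
    have "f ^ k * form_value f D \<phi> \<in> ideal_mult (ideal_pow ?T k) (ideal_mult max_ideal (ideal_pow ?T D))"
      by (intro ideal_mult_mem power_in_ideal_pow f_in_tjurina that)
    also have "\<dots> = ideal_mult max_ideal (ideal_pow ?T (D + k))"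
      by (simp only: ideal_mult_left_commute[of "ideal_pow ?T k"] add.commute[of D] ideal_pow_add)
    finally show ?thesis by (simp only: form_value_Suc[OF that(1)])
  qed
  show ?thesis
  proof (rule is_idealI)
    show "0 \<in> affine_null_ideal f"
      by (auto simp: affine_null_ideal_def deg_bounded_def ideal_zero intro!: exI[of _ 0])
  next
    fix \<phi> \<psi> assume "\<phi> \<in> affine_null_ideal f" "\<psi> \<in> affine_null_ideal f"
    then obtain D E where D: "\<phi> \<in> deg_bounded D" "form_value f D \<phi> \<in> ideal_mult max_ideal (ideal_pow ?T D)"
      and E: "\<psi> \<in> deg_bounded E" "form_value f E \<psi> \<in> ideal_mult max_ideal (ideal_pow ?T E)"
      unfolding affine_null_ideal_def by blast
    have "form_value f (D + E) \<phi> + form_value f (E + D) \<psi> \<in> ideal_mult max_ideal (ideal_pow ?T (D + E))"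
      using up[OF D, of E] up[OF E, of D] unfolding add.commute[of E D] by (rule ideal_add[OF is_ideal_mult])
    then have "form_value f (D + E) (\<phi> + \<psi>) \<in> ideal_mult max_ideal (ideal_pow ?T (D + E))"
      unfolding add.commute[of E D] by (simp only: form_value_add)
    moreover have "\<phi> + \<psi> \<in> deg_bounded (D + E)"
      by (intro deg_bounded_add deg_bounded_mono[OF _ D(1)] deg_bounded_mono[OF _ E(1)]) simp_all
    ultimately show "\<phi> + \<psi> \<in> affine_null_ideal f" unfolding affine_null_ideal_def by blast
  next
    fix r \<phi> :: "('n option \<Rightarrow>\<^sub>0 nat) \<Rightarrow>\<^sub>0 'a" assume "\<phi> \<in> affine_null_ideal f"
    then obtain D where D: "\<phi> \<in> deg_bounded D" "form_value f D \<phi> \<in> ideal_mult max_ideal (ideal_pow ?T D)"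
      unfolding affine_null_ideal_def by blast
    obtain E where E: "r \<in> deg_bounded E" using deg_bounded_exists by blast
    have "form_value f E r * form_value f D \<phi> \<in> ideal_mult (ideal_pow ?T E) (ideal_mult max_ideal (ideal_pow ?T D))"
      by (intro ideal_mult_mem form_value_in_pow D)
    also have "\<dots> = ideal_mult max_ideal (ideal_pow ?T (E + D))"
      by (simp only: ideal_mult_left_commute[of "ideal_pow ?T E"] ideal_pow_add)
    finally have "form_value f (E + D) (r * \<phi>) \<in> ideal_mult max_ideal (ideal_pow ?T (E + D))"
      by (simp only: form_value_mult[OF E D(1)])
    then show "r * \<phi> \<in> affine_null_ideal f"
      unfolding affine_null_ideal_def using deg_bounded_mult[OF E D(1)] by blast
  qed
qed

text \<open>The lift \<open>F\<close> may be replaced by the one with constant coefficients: their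
  difference has coefficients in m and contributes to m T^s.\<close>

lemma null_form_value:
  assumes "null_form f s \<phi>"
  shows "(\<Sum>a | deg a = s. mfps_const (Poly_Mapping.lookup \<phi> a) * mon (tjurina_gens f) a)
    \<in> ideal_mult max_ideal (ideal_pow (tjurina_ideal f) s)"
proof -
  let ?T = "tjurina_ideal f" and ?v = "tjurina_gens f"
  from assms obtain F where F: "homogeneous s F"
    "\<And>a. Poly_Mapping.lookup F a - mfps_const (Poly_Mapping.lookup \<phi> a) \<in> max_ideal"
    "poly_eval F ?v \<in> ideal_mult max_ideal (ideal_pow ?T s)"
    unfolding null_form_def by blast
  have "(\<Sum>a | deg a = s. (Poly_Mapping.lookup F a - mfps_const (Poly_Mapping.lookup \<phi> a)) * mon ?v a)
      \<in> ideal_mult max_ideal (ideal_pow ?T s)"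
  proof (rule ideal_sum[OF is_ideal_mult], rule ideal_mult_mem[OF F(2)])
    fix a :: "'b option \<Rightarrow>\<^sub>0 nat" assume "a \<in> {a. deg a = s}"
    then show "mon ?v a \<in> ideal_pow ?T s" using mon_in_ideal_pow[of ?v ?T a, OF tjurina_gens_in] by simp
  qed
  with F(3) have "poly_eval F ?v - (\<Sum>a | deg a = s. (Poly_Mapping.lookup F a - mfps_const (Poly_Mapping.lookup \<phi> a)) * mon ?v a)
      \<in> ideal_mult max_ideal (ideal_pow ?T s)"
    by (rule ideal_diff[OF is_ideal_mult])
  then show ?thesis
    unfolding poly_eval_homogeneous[OF F(1)] by (simp add: left_diff_distrib sum_subtractf)
qed

lemma null_form_affine:
  fixes f :: "('a::field, 'n::finite) mfps"
  assumes "null_form f s \<phi>" shows "\<phi> \<in> affine_null_ideal f"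
proof -
  have hom: "homogeneous s \<phi>" using assms by (simp add: null_form_def)
  then have "form_value f s \<phi> = (\<Sum>a | deg a = s. mfps_const (Poly_Mapping.lookup \<phi> a) * mon (tjurina_gens f) a)"
    unfolding form_value_def
  proof (intro sum.mono_neutral_cong_right finite_deg_le ballI)
    fix a :: "'n option \<Rightarrow>\<^sub>0 nat" assume "a \<in> {a. deg a \<le> s} - {a. deg a = s}"
    then have "Poly_Mapping.lookup \<phi> a = 0" using hom by (auto simp: homogeneous_iff)
    then show "mfps_const (Poly_Mapping.lookup \<phi> a) * mon (tjurina_gens f) a * f ^ (s - deg a) = 0" by simp
  qed auto
  moreover have "\<phi> \<in> deg_bounded s" using hom by (auto simp: homogeneous_iff deg_bounded_def)
  ultimately show ?thesis using null_form_value[OF assms] unfolding affine_null_ideal_def by auto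
qed

abbreviation pvar :: "'i \<Rightarrow> ('i \<Rightarrow>\<^sub>0 nat) \<Rightarrow>\<^sub>0 'a::comm_ring_1" where
  "pvar i \<equiv> Poly_Mapping.single (Poly_Mapping.single i 1) 1"

lemma mon_pvar: "mon pvar a = Poly_Mapping.single a (1 :: 'a::comm_ring_1)"
proof (induction "deg a" arbitrary: a)
  case 0
  then show ?case by simp
next
  case (Suc d)
  then obtain b i where b: "a = b + Poly_Mapping.single i 1" "deg b = d" by (metis deg_SucE)
  then show ?case using Suc.hyps(1)[of b] by (simp add: mon_add mult_single)
qed

text \<open>If 1 belonged to the affine ideal, some f^D would lie in m T^D. So the ideal is proper
  and the Nullstellensatz gives \<open>M\<close> with residue field k, whose coordinates are
  \<open>p\<close>. Both are returned: \<open>M\<close> serves congruences, \<open>p\<close>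
  evaluation.\<close>

lemma affine_null_point:
  fixes f :: "('k::alg_closed_field, 'n::finite) mfps"
  assumes ne: "\<And>l. l \<ge> 1 \<Longrightarrow> f ^ l \<notin> ideal_mult max_ideal (ideal_pow (tjurina_ideal f) l)"
  obtains M p where "is_ideal M" "1 \<notin> M" "affine_null_ideal f \<subseteq> M" "p None = 1"
    "\<And>j. pvar j - Poly_Mapping.single 0 (p j) \<in> M" "\<And>\<phi>. \<phi> \<in> M \<Longrightarrow> poly_eval \<phi> p = 0"
proof -
  define \<kappa> :: "'k \<Rightarrow> ('n option \<Rightarrow>\<^sub>0 nat) \<Rightarrow>\<^sub>0 'k" where "\<kappa> = Poly_Mapping.single 0"
  interpret coefficient_field \<kappa>
    by unfold_locales (simp_all add: \<kappa>_def single_diff mult_single)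
  obtain xs :: "'n option list" where xs: "set xs = UNIV" using finite_list[of "UNIV :: 'n option set"] by auto
  let ?C = "adjoin_list (range \<kappa>) (map pvar xs)"
  note C = subring_adjoin_list[OF subring_range, of "map pvar xs"]
  have \<kappa>C: "\<kappa> x \<in> ?C" for x using adjoin_list_superset[OF subring_range] by blast
  have YC: "pvar i \<in> ?C" for i using xs by (intro adjoin_list_elem[OF subring_range]) auto
  have single: "Poly_Mapping.single a x = \<kappa> x * mon pvar a" for a x
    unfolding \<kappa>_def mon_pvar mult_single by simp
  have expand: "\<phi> = (\<Sum>a\<in>Poly_Mapping.keys \<phi>. \<kappa> (Poly_Mapping.lookup \<phi> a) * mon pvar a)" for \<phi>
    unfolding single[symmetric] by (rule poly_mapping_sum_singles)
  have "mon pvar a \<in> ?C" for a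
    unfolding mon_def by (intro subring_prod subring_power C YC)
  then have "(\<Sum>a\<in>Poly_Mapping.keys \<phi>. \<kappa> (Poly_Mapping.lookup \<phi> a) * mon pvar a) \<in> ?C" for \<phi>
    by (intro subring_sum subring_mult C \<kappa>C)
  then have "\<phi> \<in> ?C" for \<phi>
    by (rule ssubst[where P = "\<lambda>x. x \<in> ?C", OF expand[of \<phi>]])
  then have gen: "?C = UNIV" by auto
  have alg: "\<exists>z. poly p z = 0" if "0 < degree p" for p :: "'k poly"
    using alg_closed_imp_poly_has_root[OF that] by blast
  have "1 \<notin> affine_null_ideal f"
  proof
    assume "1 \<in> affine_null_ideal f"
    then obtain D where D: "form_value f D 1 \<in> ideal_mult max_ideal (ideal_pow (tjurina_ideal f) D)"
      unfolding affine_null_ideal_def by blast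
    have "form_value f D 1 = f ^ D" using form_value_single[of 0 D f 1] by simp
    with D have fD: "f ^ D \<in> ideal_mult max_ideal (ideal_pow (tjurina_ideal f) D)" by simp
    show False
    proof (cases D)
      case 0
      then have "1 \<in> (max_ideal :: ('k, 'n) mfps set)" using fD by simp
      then show False by (simp add: max_ideal_def mfps_nth_one)
    next
      case (Suc d)
      then show False using ne[of D] fD by simp
    qed
  qed
  then obtain M where M: "is_ideal M" "affine_null_ideal f \<subseteq> M" "1 \<notin> M" "\<And>x. \<exists>c. x - \<kappa> c \<in> M"
    using weak_nullstellensatz[OF alg gen is_ideal_affine_null] by blast
  have \<kappa>M: "c = 0" if "\<kappa> c \<in> M" for c
  proof (rule ccontr)
    assume "c \<noteq> 0"
    then have "\<kappa> (inverse c) * \<kappa> c = 1" by (simp flip: \<kappa>_mult add: \<kappa>_one)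
    then show False using ideal_mult_l[OF M(1) that] M(3) by metis
  qed
  have "\<forall>j. \<exists>c. pvar j - \<kappa> c \<in> M" using M(4) by blast
  then obtain p where "\<forall>j. pvar j - \<kappa> (p j) \<in> M" by (rule choice[THEN exE])
  then have p: "\<And>j. pvar j - \<kappa> (p j) \<in> M" by blast
  \<comment> \<open>Both terms have value \<open>f\<close> in degree 1. This is what places the
    point in the chart Y_0 = 1.\<close>
  have "pvar None - 1 \<in> affine_null_ideal f"
    unfolding affine_null_ideal_def
  proof (intro CollectI exI conjI)
    have "(1 :: ('n option \<Rightarrow>\<^sub>0 nat) \<Rightarrow>\<^sub>0 'k) \<in> deg_bounded 1"
      using deg_bounded_single[of "0 :: 'n option \<Rightarrow>\<^sub>0 nat" 1 "1 :: 'k"] by simp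
    then show "(pvar None - 1 :: ('n option \<Rightarrow>\<^sub>0 nat) \<Rightarrow>\<^sub>0 'k) \<in> deg_bounded 1"
      by (intro deg_bounded_diff deg_bounded_single) simp_all
    have "form_value f 1 (pvar None) = f"
      by (subst form_value_single) (simp_all add: tjurina_gens_def)
    moreover have "form_value f 1 1 = f" using form_value_single[of 0 1 f 1] by simp
    ultimately show "form_value f 1 (pvar None - 1) \<in> ideal_mult max_ideal (ideal_pow (tjurina_ideal f) 1)"
      unfolding form_value_diff by (simp add: ideal_zero)
  qed
  then have "(pvar None - 1) - (pvar None - \<kappa> (p None)) \<in> M"
    by (rule ideal_diff[OF M(1) subsetD[OF M(2)] p])
  then have "\<kappa> (p None - 1) \<in> M" by (simp add: \<kappa>_diff \<kappa>_one)
  then have p0: "p None = 1" using \<kappa>M by fastforce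
  have "mon pvar a - \<kappa> (mon p a) \<in> M" for a
  proof (induction "deg a" arbitrary: a)
    case 0
    then show ?case by (simp add: \<kappa>_one ideal_zero[OF M(1)])
  next
    case (Suc d)
    then obtain b i where b: "a = b + Poly_Mapping.single i 1" "deg b = d" by (metis deg_SucE)
    have "mon pvar b * (pvar i - \<kappa> (p i)) + \<kappa> (p i) * (mon pvar b - \<kappa> (mon p b)) \<in> M"
      using p Suc.hyps(1)[of b] b(2) by (intro ideal_add[OF M(1)] ideal_mult_l[OF M(1)]) auto
    then show ?case by (simp add: b(1) mon_add \<kappa>_mult algebra_simps)
  qed
  note mon = this
  have eval: "\<phi> - \<kappa> (poly_eval \<phi> p) \<in> M" for \<phi>
  proof -
    have \<kappa>_sum: "\<kappa> (sum g A) = (\<Sum>i\<in>A. \<kappa> (g i))" for g and A :: "('n option \<Rightarrow>\<^sub>0 nat) set"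
      by (induction A rule: infinite_finite_induct) (simp_all add: \<kappa>_def single_add)
    have "(\<Sum>a\<in>Poly_Mapping.keys \<phi>. \<kappa> (Poly_Mapping.lookup \<phi> a) * (mon pvar a - \<kappa> (mon p a))) \<in> M"
      by (rule ideal_sum[OF M(1)], rule ideal_mult_l[OF M(1)], rule mon)
    moreover have "(\<Sum>a\<in>Poly_Mapping.keys \<phi>. \<kappa> (Poly_Mapping.lookup \<phi> a) * mon pvar a) = \<phi>"
      by (rule expand[symmetric])
    moreover have "(\<Sum>a\<in>Poly_Mapping.keys \<phi>. \<kappa> (Poly_Mapping.lookup \<phi> a) * \<kappa> (mon p a)) = \<kappa> (poly_eval \<phi> p)"
      by (simp add: poly_eval_superset[OF finite_keys order.refl] \<kappa>_sum \<kappa>_mult)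
    ultimately show ?thesis by (simp add: right_diff_distrib sum_subtractf)
  qed
  have "poly_eval \<phi> p = 0" if "\<phi> \<in> M" for \<phi>
    using ideal_diff[OF M(1) that eval[of \<phi>]] by (intro \<kappa>M) simp
  then show thesis using that[of M p] M p0 p by (simp add: \<kappa>_def)
qed

lemma ideal_mult_gen_expand:
  fixes g :: "'n::finite \<Rightarrow> 'a::comm_ring_1"
  assumes K: "is_ideal K" and "x \<in> ideal_mult (ideal_gen (range g)) K"
  obtains z where "\<And>i. z i \<in> K" "x = (\<Sum>i\<in>UNIV. g i * z i)"
proof -
  let ?S = "{x. \<exists>z. (\<forall>i. z i \<in> K) \<and> x = (\<Sum>i\<in>UNIV. g i * z i)}"
  have "ideal_mult (ideal_gen (range g)) K \<subseteq> ?S"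
  proof (rule ideal_mult_least)
    fix x y assume "x \<in> ideal_gen (range g)" and y: "y \<in> K"
    then obtain c where c: "x = (\<Sum>i\<in>UNIV. c i * g i)" by (metis ideal_gen_rangeE)
    have "x * y = (\<Sum>i\<in>UNIV. g i * (c i * y))"
      unfolding c sum_distrib_right by (rule sum.cong) (auto simp: mult_ac)
    then show "x * y \<in> ?S" using y K by (intro CollectI exI[of _ "\<lambda>i. c i * y"]) (auto intro: ideal_mult_l)
  next
    show "is_ideal ?S"
    proof (rule is_idealI)
      show "0 \<in> ?S" using K by (intro CollectI exI[of _ "\<lambda>_. 0"]) (simp add: ideal_zero)
    next
      fix x y assume "x \<in> ?S" "y \<in> ?S"
      then obtain z w where "\<forall>i. z i \<in> K" "x = (\<Sum>i\<in>UNIV. g i * z i)" "\<forall>i. w i \<in> K" "y = (\<Sum>i\<in>UNIV. g i * w i)"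
        by blast
      then show "x + y \<in> ?S"
        using K by (intro CollectI exI[of _ "\<lambda>i. z i + w i"]) (simp add: ideal_add distrib_left sum.distrib)
    next
      fix c x assume "x \<in> ?S"
      then obtain z where "\<forall>i. z i \<in> K" "x = (\<Sum>i\<in>UNIV. g i * z i)" by blast
      then show "c * x \<in> ?S"
        using K by (intro CollectI exI[of _ "\<lambda>i. c * z i"])
          (simp add: ideal_mult_l sum_distrib_left mult.left_commute)
    qed
  qed
  then show thesis using assms(2) that by blast
qed

text \<open>For this choice of the unit the generators of the Jacobian ideal are represented by the
  forms Y_i - p_i Y_0, which vanish at the point. If \<open>J\<close> were a reduction, Y_0^(l+1)
  would be a combination of these forms modulo the affine null ideal and hence lie in
  \<open>M\<close>, although Y_0 is 1 modulo \<open>M\<close>.\<close>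

lemma point_not_reduction:
  fixes f :: "('k::field, 'n::finite) mfps"
  defines "T \<equiv> tjurina_ideal f"
  assumes M: "is_ideal M" "1 \<notin> M" "affine_null_ideal f \<subseteq> M"
    and p: "p None = 1" "\<And>j. pvar j - Poly_Mapping.single 0 (p j) \<in> M"
  shows "f ^ Suc l \<notin> ideal_plus (ideal_mult (jacobian_ideal (linear_unit (\<lambda>i. - p (Some i)) * f)) (ideal_pow T l))
    (ideal_mult max_ideal (ideal_pow T (Suc l)))"
proof
  let ?c = "\<lambda>i. - p (Some i)" and ?v = "tjurina_gens f"
  let ?g = "\<lambda>i. mfps_deriv i (linear_unit ?c * f)"
  let ?mT = "\<lambda>s. ideal_mult max_ideal (ideal_pow T s)"
  assume "f ^ Suc l \<in> ideal_plus (ideal_mult (jacobian_ideal (linear_unit ?c * f)) (ideal_pow T l)) (?mT (Suc l))"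
  then obtain x w where xw: "f ^ Suc l = x + w" "x \<in> ideal_mult (ideal_gen (range ?g)) (ideal_pow T l)" "w \<in> ?mT (Suc l)"
    unfolding jacobian_ideal_def by (rule ideal_plusE)
  obtain z where z: "\<And>i. z i \<in> ideal_pow T l" "x = (\<Sum>i\<in>UNIV. ?g i * z i)"
    using ideal_mult_gen_expand[OF is_ideal_pow xw(2)] by blast
  \<comment> \<open>Modulo m T^l an element of T^l is the value of a form with coefficients in k,
    namely the constant terms of its coefficients.\<close>
  have "\<exists>\<zeta>. \<zeta> \<in> deg_bounded l \<and> z i - form_value f l \<zeta> \<in> ?mT l" for i
  proof -
    obtain \<rho> where \<rho>: "z i = (\<Sum>a | deg a = l. \<rho> a * mon ?v a)"
      using z(1)[of i] unfolding T_def tjurina_ideal_gen by (rule ideal_pow_expand')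
    define \<zeta> where "\<zeta> = (\<Sum>a | deg a = l. Poly_Mapping.single a (mfps_nth (\<rho> a) 0))"
    have "form_value f l \<zeta> = (\<Sum>a | deg a = l. mfps_const (mfps_nth (\<rho> a) 0) * mon ?v a)"
      unfolding \<zeta>_def form_value_sum by (rule sum.cong) (auto simp: form_value_single)
    then have "z i - form_value f l \<zeta> = (\<Sum>a | deg a = l. (\<rho> a - mfps_const (mfps_nth (\<rho> a) 0)) * mon ?v a)"
      by (simp add: \<rho> left_diff_distrib sum_subtractf)
    also have "\<dots> \<in> ?mT l"
    proof (rule ideal_sum[OF is_ideal_mult], rule ideal_mult_mem[OF diff_const_in_max_ideal])
      fix a :: "'n option \<Rightarrow>\<^sub>0 nat" assume "a \<in> {a. deg a = l}"
      then show "mon ?v a \<in> ideal_pow T l" using mon_in_ideal_pow[of ?v T a] tjurina_gens_in[of f] by (auto simp: T_def)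
    qed
    finally have "z i - form_value f l \<zeta> \<in> ?mT l" .
    moreover have "\<zeta> \<in> deg_bounded l" unfolding \<zeta>_def by (intro deg_bounded_sum deg_bounded_single) simp
    ultimately show ?thesis by blast
  qed
  then obtain \<zeta> where \<zeta>: "\<And>i. \<zeta> i \<in> deg_bounded l" "\<And>i. z i - form_value f l (\<zeta> i) \<in> ?mT l" by metis
  define h :: "'n \<Rightarrow> ('n option \<Rightarrow>\<^sub>0 nat) \<Rightarrow>\<^sub>0 'k"
    where "h i = pvar (Some i) + Poly_Mapping.single (Poly_Mapping.single None 1) (?c i)" for i
  define \<phi> where "\<phi> = Poly_Mapping.single (Poly_Mapping.single None (Suc l)) 1 - (\<Sum>i\<in>UNIV. h i * \<zeta> i)"
  have h1: "h i \<in> deg_bounded 1" for i unfolding h_def by (intro deg_bounded_add deg_bounded_single) simp_all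
  have hv: "form_value f 1 (h i) = mfps_deriv i f + mfps_const (?c i) * f" for i
    unfolding h_def form_value_add by (simp add: form_value_single tjurina_gens_def)
  have hT: "form_value f 1 (h i) \<in> T" for i
    unfolding hv T_def by (intro ideal_add ideal_mult_l is_ideal_tjurina deriv_in_tjurina f_in_tjurina)
  have "form_value f (Suc l) \<phi> = f ^ Suc l - (\<Sum>i\<in>UNIV. form_value f 1 (h i) * form_value f l (\<zeta> i))"
    unfolding \<phi>_def form_value_diff form_value_sum
    using form_value_mult[OF h1 \<zeta>(1), of f] by (simp add: form_value_single tjurina_gens_def)
  \<comment> \<open>Each product is replaced by its representing forms one factor at a time; both
    errors lie in m T^(l+1).\<close>
  also have "\<dots> = w + (\<Sum>i\<in>UNIV. (?g i - form_value f 1 (h i)) * z i + form_value f 1 (h i) * (z i - form_value f l (\<zeta> i)))"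
    unfolding xw(1) z(2) by (simp add: algebra_simps sum.distrib sum_subtractf)
  also have "\<dots> \<in> ?mT (Suc l)"
  proof (rule ideal_add[OF is_ideal_mult xw(3) ideal_sum[OF is_ideal_mult ideal_add[OF is_ideal_mult]]])
    fix i
    have "?g i - form_value f 1 (h i) \<in> ideal_mult max_ideal T"
      unfolding hv T_def by (rule deriv_linear_unit)
    from ideal_mult_mem[OF this z(1)] show "(?g i - form_value f 1 (h i)) * z i \<in> ?mT (Suc l)"
      by (simp add: ideal_mult_assoc)
    from ideal_mult_mem[OF hT \<zeta>(2)] show "form_value f 1 (h i) * (z i - form_value f l (\<zeta> i)) \<in> ?mT (Suc l)"
      by (simp add: ideal_mult_left_commute)
  qed
  finally have val: "form_value f (Suc l) \<phi> \<in> ?mT (Suc l)" .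
  have "h i * \<zeta> i \<in> deg_bounded (Suc l)" for i using deg_bounded_mult[OF h1 \<zeta>(1)] by simp
  then have "\<phi> \<in> deg_bounded (Suc l)"
    unfolding \<phi>_def by (intro deg_bounded_diff deg_bounded_single deg_bounded_sum) simp_all
  then have \<phi>M: "\<phi> \<in> M" using val M(3) unfolding affine_null_ideal_def T_def by blast
  have Y0: "pvar None - 1 \<in> M" using p(2)[of None] p(1) by simp
  have "h i \<in> M" for i
  proof -
    have "(pvar (Some i) - Poly_Mapping.single 0 (p (Some i))) + Poly_Mapping.single 0 (?c i) * (pvar None - 1) \<in> M"
      by (rule ideal_add[OF M(1) p(2) ideal_mult_l[OF M(1) Y0]])
    also have "(pvar (Some i) - Poly_Mapping.single 0 (p (Some i))) + Poly_Mapping.single 0 (?c i) * (pvar None - 1) = h i"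
      by (simp add: h_def right_diff_distrib mult_single single_uminus)
    finally show ?thesis .
  qed
  then have "(\<Sum>i\<in>UNIV. h i * \<zeta> i) \<in> M" by (intro ideal_sum[OF M(1)] ideal_mult_r[OF M(1)])
  then have "\<phi> + (\<Sum>i\<in>UNIV. h i * \<zeta> i) \<in> M" by (rule ideal_add[OF M(1) \<phi>M])
  then have "Poly_Mapping.single (Poly_Mapping.single None (Suc l)) 1 \<in> M" by (simp add: \<phi>_def)
  then have "pvar None ^ Suc l \<in> M"
    using mon_pvar[where a = "Poly_Mapping.single (None :: 'n option) (Suc l)" and 'a = 'k] by (simp only: mon_single)
  moreover have "1 - pvar None ^ Suc l \<in> M"
  proof -
    have "pvar None - 1 dvd pvar None ^ Suc l - 1 ^ Suc l"
      unfolding diff_power_eq_sum by (rule dvd_triv_left)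
    then have "pvar None ^ Suc l - 1 \<in> M" using ideal_dvd[OF M(1) Y0] by simp
    from ideal_uminus[OF M(1) this] show ?thesis by simp
  qed
  ultimately have "pvar None ^ Suc l + (1 - pvar None ^ Suc l) \<in> M" by (rule ideal_add[OF M(1)])
  then show False using M(2) by simp
qed

subsection \<open>The three conditions\<close>

lemma zero_set_Y0: "p \<in> zero_set {Y0} \<longleftrightarrow> p \<in> proj_space \<and> (\<forall>v\<in>p. v None = 0)"
  by (simp add: zero_set_def Y0_def poly_eval_single)

lemma proj_space_class:
  assumes "v \<noteq> (\<lambda>_. 0)"
  shows "proj_rel `` {v} \<in> proj_space" "v \<in> proj_rel `` {v}"
    "w \<in> proj_rel `` {v} \<Longrightarrow> \<exists>c. c \<noteq> 0 \<and> w = (\<lambda>i. c * v i)"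
proof -
  show "proj_rel `` {v} \<in> proj_space" unfolding proj_space_def by (rule quotientI) (use assms in simp)
  show "v \<in> proj_rel `` {v}" using assms by (auto simp: proj_rel_def intro!: exI[of _ 1])
  show "w \<in> proj_rel `` {v} \<Longrightarrow> \<exists>c. c \<noteq> 0 \<and> w = (\<lambda>i. c * v i)" by (auto simp: proj_rel_def)
qed

text \<open>Otherwise the point of \<open>affine_null_point\<close> is a common zero of the
  null-forms with Y_0 = 1, off the hyperplane.\<close>

lemma fiber_nilpotent_if_zero_set:
  fixes f :: "('k::alg_closed_field, 'n::finite) mfps"
  assumes Z: "zero_set (null_ideal f) \<subseteq> zero_set {Y0}"
  shows "\<exists>l\<ge>1. f ^ l \<in> ideal_mult max_ideal (ideal_pow (tjurina_ideal f) l)"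
proof (rule ccontr)
  assume "\<not> ?thesis"
  then obtain M p where M: "affine_null_ideal f \<subseteq> M" "p None = 1" "\<And>\<phi>. \<phi> \<in> M \<Longrightarrow> poly_eval \<phi> p = 0"
    using affine_null_point[of f] by metis
  have p: "p \<noteq> (\<lambda>_. 0)" using M(2) by (metis zero_neq_one)
  have "poly_eval \<phi> w = 0" if \<phi>: "\<phi> \<in> null_ideal f" and w: "w \<in> proj_rel `` {p}" for \<phi> w
  proof (rule null_ideal_vanish[OF _ \<phi>])
    fix s \<phi> assume nf: "null_form f s \<phi>"
    obtain c where c: "w = (\<lambda>i. c * p i)" using proj_space_class(3)[OF p w] by blast
    have "homogeneous s \<phi>" using nf by (simp add: null_form_def)
    moreover have "poly_eval \<phi> p = 0" using M null_form_affine[OF nf] by blast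
    ultimately show "poly_eval \<phi> w = 0" unfolding c by (simp add: poly_eval_homogeneous_scale)
  qed
  then have "proj_rel `` {p} \<in> zero_set (null_ideal f)"
    using proj_space_class(1)[OF p] by (simp add: zero_set_def)
  then have "proj_rel `` {p} \<in> zero_set {Y0}" using Z by blast
  then have "p None = 0" using proj_space_class(2)[OF p] unfolding zero_set_Y0 by blast
  then show False using M(2) by simp
qed

text \<open>The hypothesis says exactly that Y_0^l is a null-form.\<close>

lemma zero_set_subset_Y0:
  fixes f :: "('k::alg_closed_field, 'n::finite) mfps"
  assumes f: "f ^ l \<in> ideal_mult max_ideal (ideal_pow (tjurina_ideal f) l)"
  shows "zero_set (null_ideal f) \<subseteq> zero_set {Y0}"
proof
  fix p assume p: "p \<in> zero_set (null_ideal f)"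
  define \<phi> :: "('n option \<Rightarrow>\<^sub>0 nat) \<Rightarrow>\<^sub>0 'k" where "\<phi> = Poly_Mapping.single (Poly_Mapping.single None l) 1"
  define F :: "('n option \<Rightarrow>\<^sub>0 nat) \<Rightarrow>\<^sub>0 ('k, 'n) mfps" where "F = Poly_Mapping.single (Poly_Mapping.single None l) 1"
  have "homogeneous l \<phi>" "homogeneous l F"
    by (auto simp: homogeneous_iff \<phi>_def F_def lookup_single when_def)
  moreover have "Poly_Mapping.lookup F a - mfps_const (Poly_Mapping.lookup \<phi> a) \<in> max_ideal" for a
    by (simp add: F_def \<phi>_def lookup_single when_def ideal_zero)
  moreover have "poly_eval F (tjurina_gens f) \<in> ideal_mult max_ideal (ideal_pow (tjurina_ideal f) l)"
    using f by (simp add: F_def poly_eval_single tjurina_gens_def)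
  ultimately have "null_form f l \<phi>" unfolding null_form_def by blast
  then have "\<phi> \<in> null_ideal f" unfolding null_ideal_def by (intro ideal_gen_base) auto
  then have "v None = 0" if "v \<in> p" for v
    using p that by (auto simp: zero_set_def \<phi>_def poly_eval_single)
  moreover have "p \<in> proj_space" using p by (simp add: zero_set_def)
  ultimately show "p \<in> zero_set {Y0}" unfolding zero_set_Y0 by blast
qed

section \<open>Null-forms restricted to the hyperplane Y_0 = 0\<close>

definition lift_exp :: "('n::finite \<Rightarrow>\<^sub>0 nat) \<Rightarrow> 'n option \<Rightarrow>\<^sub>0 nat" where
  "lift_exp b = Abs_poly_mapping (case_option 0 (Poly_Mapping.lookup b))"

lemma lookup_lift_exp: "Poly_Mapping.lookup (lift_exp b) = case_option 0 (Poly_Mapping.lookup b)"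
  by (simp add: lift_exp_def)

lemma deg_lift_exp: "deg (lift_exp b) = deg b"
  by (simp add: deg_def lookup_lift_exp UNIV_option_conv sum.reindex)

lemma mon_lift_exp: "mon v (lift_exp b) = mon (\<lambda>i. v (Some i)) b"
  by (simp add: mon_def lookup_lift_exp UNIV_option_conv prod.reindex)

lemma ex_lift_exp:
  assumes "Poly_Mapping.lookup a None = 0" obtains b where "a = lift_exp b"
proof
  show "a = lift_exp (Abs_poly_mapping (\<lambda>i. Poly_Mapping.lookup a (Some i)))"
    using assms by (intro poly_mapping_eqI) (auto simp: lookup_lift_exp split: option.splits)
qed

lemma inj_lift_exp: "inj lift_exp"
proof (rule injI, rule poly_mapping_eqI)
  fix a b :: "'a \<Rightarrow>\<^sub>0 nat" and i assume "lift_exp a = lift_exp b"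
  then have "Poly_Mapping.lookup (lift_exp a) (Some i) = Poly_Mapping.lookup (lift_exp b) (Some i)" by simp
  then show "Poly_Mapping.lookup a i = Poly_Mapping.lookup b i" by (simp add: lookup_lift_exp)
qed

text \<open>Split the value of \<phi> into \<open>x\<close>, the part free of Y_0, and
  \<open>z\<close>, a multiple of \<open>f\<close>. In the fiber cone their sum is 0 and
  \<open>z\<close> is nilpotent, so \<open>x\<close> is nilpotent too. Passing from powers of
  \<open>T\<close> to powers of the reduction \<open>J\<close>, a high power of the form
  \<open>x\<close> lands one step too deep, which \<open>form_cancel_power\<close> forbids.\<close>

lemma null_form_coeff_zero:
  fixes f :: "('k::field, 'n::finite) mfps"
  defines "T \<equiv> tjurina_ideal f"
  assumes T: "T \<subseteq> max_ideal" and prim: "ideal_pow max_ideal N \<subseteq> T"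
    and f: "f ^ l \<in> ideal_mult max_ideal (ideal_pow T l)" "l \<ge> 1"
    and nf: "null_form f s \<phi>" and b0: "deg b0 = s"
  shows "Poly_Mapping.lookup \<phi> (lift_exp b0) = 0"
proof (rule ccontr)
  assume nz: "Poly_Mapping.lookup \<phi> (lift_exp b0) \<noteq> 0"
  let ?mT = "\<lambda>s. ideal_mult max_ideal (ideal_pow T s)" and ?v = "tjurina_gens f"
  let ?D = "\<lambda>i. mfps_deriv i f"
  define J where "J = ideal_gen (range ?D)"
  define \<beta> where "\<beta> b = Poly_Mapping.lookup \<phi> (lift_exp b)" for b
  define x where "x = (\<Sum>b | deg b = s. mfps_const (\<beta> b) * mon ?D b)"
  define z where "z = (\<Sum>a\<in>{a. deg a = s} - lift_exp ` {b. deg b = s}. mfps_const (Poly_Mapping.lookup \<phi> a) * mon ?v a)"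
  have fT: "f \<in> T" and idT: "is_ideal T" by (simp_all add: T_def f_in_tjurina)
  have "(\<Sum>a | deg a = s. mfps_const (Poly_Mapping.lookup \<phi> a) * mon ?v a) =
      z + (\<Sum>a\<in>lift_exp ` {b. deg b = s}. mfps_const (Poly_Mapping.lookup \<phi> a) * mon ?v a)"
    unfolding z_def by (rule sum.subset_diff) (auto simp: deg_lift_exp)
  also have "(\<Sum>a\<in>lift_exp ` {b. deg b = s}. mfps_const (Poly_Mapping.lookup \<phi> a) * mon ?v a) = x"
    unfolding x_def \<beta>_def
    by (subst sum.reindex) (auto intro: inj_on_subset[OF inj_lift_exp] simp: mon_lift_exp tjurina_gens_def)
  finally have xz: "z + x \<in> ?mT s" using null_form_value[OF nf] by (simp add: T_def)
  have vT: "?v i \<in> T" for i by (simp add: T_def tjurina_gens_in)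
  have zl: "z \<in> ideal_pow T s \<and> z ^ l \<in> ?mT (s * l)"
  proof -
    \<comment> \<open>For s = 0 the truncated \<open>s - 1\<close> makes the last condition void, so
      y = 0 is recorded separately.\<close>
    have "\<exists>y. z = f * y \<and> (s = 0 \<longrightarrow> y = 0) \<and> y \<in> ideal_pow T (s - 1)"
    proof -
      have "\<exists>y. mfps_const (Poly_Mapping.lookup \<phi> a) * mon ?v a = f * y \<and> (s = 0 \<longrightarrow> y = 0) \<and> y \<in> ideal_pow T (s - 1)"
        if "a \<in> {a. deg a = s} - lift_exp ` {b. deg b = s}" for a
      proof -
        have "Poly_Mapping.lookup a None > 0"
        proof (rule ccontr)
          assume "\<not> Poly_Mapping.lookup a None > 0"
          then obtain b where "a = lift_exp b" using ex_lift_exp[of a] by auto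
          then show False using that by (auto simp: deg_lift_exp)
        qed
        then obtain b where b: "a = b + Poly_Mapping.single None 1" by (rule exponent_split)
        have s: "s = Suc (deg b)" using that b by (simp add: deg_add)
        have "mfps_const (Poly_Mapping.lookup \<phi> a) * mon ?v b \<in> ideal_pow T (deg b)"
          by (rule ideal_mult_l[OF is_ideal_pow mon_in_ideal_pow[OF vT]])
        moreover have "mfps_const (Poly_Mapping.lookup \<phi> a) * mon ?v a = f * (mfps_const (Poly_Mapping.lookup \<phi> a) * mon ?v b)"
          by (simp add: b mon_add tjurina_gens_def mult_ac)
        ultimately show ?thesis using s by auto
      qed
      then obtain y where y: "\<And>a. a \<in> {a. deg a = s} - lift_exp ` {b. deg b = s} \<Longrightarrow>
          mfps_const (Poly_Mapping.lookup \<phi> a) * mon ?v a = f * y a \<and> (s = 0 \<longrightarrow> y a = 0) \<and> y a \<in> ideal_pow T (s - 1)"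
        by metis
      have "z = f * (\<Sum>a\<in>{a. deg a = s} - lift_exp ` {b. deg b = s}. y a)"
        unfolding z_def sum_distrib_left using y by (intro sum.cong) auto
      moreover have "s = 0 \<longrightarrow> (\<Sum>a\<in>{a. deg a = s} - lift_exp ` {b. deg b = s}. y a) = 0"
        by (intro impI sum.neutral ballI) (use y in blast)
      moreover have "(\<Sum>a\<in>{a. deg a = s} - lift_exp ` {b. deg b = s}. y a) \<in> ideal_pow T (s - 1)"
        by (rule ideal_sum[OF is_ideal_pow]) (use y in blast)
      ultimately show ?thesis by blast
    qed
    then obtain y where y: "z = f * y" "s = 0 \<longrightarrow> y = 0" "y \<in> ideal_pow T (s - 1)" by blast
    show ?thesis
    proof (cases s)
      case 0
      then show ?thesis using y f(2) by (simp add: ideal_zero power_0_left)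
    next
      case (Suc r)
      then have "z \<in> ideal_pow T s" using ideal_mult_mem[OF fT y(3)] y(1) by simp
      moreover have "f ^ l * y ^ l \<in> ideal_mult (?mT l) (ideal_pow (ideal_pow T r) l)"
        using y(3) Suc by (intro ideal_mult_mem f power_in_ideal_pow) simp
      moreover have "ideal_mult (?mT l) (ideal_pow (ideal_pow T r) l) = ?mT (s * l)"
        by (simp add: Suc ideal_mult_assoc ideal_pow_pow ideal_pow_add)
      ultimately show ?thesis by (simp add: y(1) power_mult_distrib)
    qed
  qed
  have DT: "?D i \<in> T" for i by (simp add: T_def deriv_in_tjurina)
  have xT: "x \<in> ideal_pow T s" unfolding x_def by (rule form_in_pow[OF DT idT])
  have xl: "x ^ l \<in> ?mT (s * l)"
  proof -
    obtain k where k: "l = Suc k" using f(2) by (cases l) auto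
    have nz': "- z \<in> ideal_pow T s" using zl by (simp add: ideal_uminus)
    \<comment> \<open>The cofactor in the factorization of x^l - (-z)^l by x + z.\<close>
    have "(\<Sum>p<Suc k. x ^ p * (- z) ^ (k - p)) \<in> ideal_pow T (s * k)"
    proof (rule ideal_sum[OF is_ideal_pow])
      fix p assume "p \<in> {..<Suc k}"
      then have "s * k = s * p + s * (k - p)" by (simp flip: add_mult_distrib2)
      moreover have "x ^ p * (- z) ^ (k - p) \<in> ideal_pow T (s * p + s * (k - p))"
        using power_in_ideal_pow[OF xT] power_in_ideal_pow[OF nz'] by (intro ideal_pow_mult_mem) (simp_all add: ideal_pow_pow)
      ultimately show "x ^ p * (- z) ^ (k - p) \<in> ideal_pow T (s * k)" by simp
    qed
    with xz have "(z + x) * (\<Sum>p<Suc k. x ^ p * (- z) ^ (k - p)) \<in> ideal_mult (?mT s) (ideal_pow T (s * k))"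
      by (rule ideal_mult_mem)
    also have "\<dots> = ?mT (s * l)" by (simp add: k ideal_mult_assoc ideal_pow_add)
    also have "(z + x) * (\<Sum>p<Suc k. x ^ p * (- z) ^ (k - p)) = x ^ l - (- z) ^ l"
      unfolding k diff_power_eq_sum by (simp add: add.commute)
    finally have "x ^ l - (- z) ^ l \<in> ?mT (s * l)" .
    moreover have "(- z) ^ l \<in> ?mT (s * l)"
    proof -
      have "(- z) ^ l = (- 1) ^ l * z ^ l" by (rule power_minus)
      then show ?thesis using zl by (simp add: ideal_mult_l)
    qed
    ultimately show ?thesis using ideal_cong[OF is_ideal_mult] by blast
  qed
  have TJ: "T = ideal_plus (ideal_gen {f}) J"
    using tjurina_ideal_unit[of 1 f] by (simp add: T_def J_def jacobian_ideal_def)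
  obtain k where k: "l = Suc k" using f(2) by (cases l) auto
  have "f ^ Suc k \<in> ideal_plus (ideal_mult J (ideal_pow T k)) (ideal_mult max_ideal (ideal_pow T (Suc k)))"
    using f(1) unfolding k by (intro ideal_plus_r is_ideal_mult)
  then have red: "ideal_pow T (Suc k) \<subseteq> ideal_mult J (ideal_pow T k)"
    using reduction_from_power[of T f ?D] TJ unfolding J_def by blast
  have JT: "J \<subseteq> T" unfolding J_def using DT by (intro ideal_gen_least idT) auto
  have shift: "ideal_pow T (t + k) \<subseteq> ideal_pow J t" for t
    using reduction_shift[OF red] by (simp add: J_def)
  obtain N' where N': "ideal_pow max_ideal N' \<subseteq> J"
    using hs_seq_reduction(1)[OF prim JT[unfolded J_def] shift[unfolded J_def]] unfolding J_def by blast
  \<comment> \<open>Passing from \<open>T\<close> to \<open>J\<close> costs at most k powers; k + 1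
    additional factors from \<open>J\<close> compensate for this with one to spare.\<close>
  have absorb: "ideal_mult (ideal_pow J (Suc k)) (ideal_pow T t) \<subseteq> ideal_pow J (Suc t)" for t
  proof (cases "t \<ge> k")
    case True
    have "ideal_pow T t \<subseteq> ideal_pow J (t - k)" using shift[of "t - k"] True by simp
    then have "ideal_mult (ideal_pow J (Suc k)) (ideal_pow T t) \<subseteq> ideal_mult (ideal_pow J (Suc k)) (ideal_pow J (t - k))"
      by (rule ideal_mult_mono[OF order.refl])
    also have "\<dots> = ideal_pow J (Suc k + (t - k))" by (simp only: ideal_pow_add)
    finally show ?thesis using True by simp
  next
    case False
    have "ideal_mult (ideal_pow J (Suc k)) (ideal_pow T t) \<subseteq> ideal_pow J (Suc k)" by (rule ideal_mult_subset_l) simp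
    also have "\<dots> \<subseteq> ideal_pow J (Suc t)" using False by (intro ideal_pow_antimono) simp
    finally show ?thesis .
  qed
  \<comment> \<open>This many factors of the maximal ideal supply the k + 1 factors from
    \<open>J\<close> needed for \<open>absorb\<close>.\<close>
  let ?K = "N' * Suc k"
  have "(x ^ l) ^ ?K \<in> ideal_pow (?mT (s * l)) ?K" using xl by (rule power_in_ideal_pow)
  also have "\<dots> = ideal_mult (ideal_pow max_ideal ?K) (ideal_pow T (s * l * ?K))"
    by (simp only: ideal_pow_mult ideal_pow_pow)
  also have "\<dots> \<subseteq> ideal_mult (ideal_pow J (Suc k)) (ideal_pow T (s * l * ?K))"
    using ideal_pow_mono[OF N', of "Suc k"] by (intro ideal_mult_mono order.refl) (simp only: ideal_pow_pow)
  also have "\<dots> \<subseteq> ideal_pow J (Suc (s * l * ?K))" by (rule absorb)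
  finally have "x ^ (l * ?K) * 1 \<in> ideal_pow J (1 + (l * ?K) * s)" by (simp add: power_mult mult_ac)
  then have "1 \<in> ideal_pow J 1"
    using form_cancel_power[where \<beta> = \<beta> and ?b0.0 = b0 and g = ?D, OF N'[unfolded J_def] b0] nz
    unfolding x_def J_def \<beta>_def by blast
  then have "1 \<in> J" using ideal_pow_1[of J] by (simp add: J_def)
  then have "1 \<in> (max_ideal :: ('k, 'n) mfps set)" using JT T by blast
  then show False by (simp add: max_ideal_def mfps_nth_one)
qed

lemma Y0_subset_zero_set:
  fixes f :: "('k::alg_closed_field, 'n::finite) mfps"
  assumes van: "\<And>s \<phi> v. null_form f s \<phi> \<Longrightarrow> v None = 0 \<Longrightarrow> poly_eval \<phi> v = 0"
  shows "zero_set {Y0} \<subseteq> zero_set (null_ideal f)"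
proof
  fix p :: "('n option \<Rightarrow> 'k) set" assume "p \<in> zero_set {Y0}"
  then have p: "p \<in> proj_space" "\<And>v. v \<in> p \<Longrightarrow> v None = 0" by (auto simp: zero_set_Y0)
  have "poly_eval \<phi> v = 0" if \<phi>: "\<phi> \<in> null_ideal f" and v: "v \<in> p" for \<phi> v
  proof (rule null_ideal_vanish[OF _ \<phi>])
    show "poly_eval \<psi> v = 0" if "null_form f s \<psi>" for s \<psi>
      using that p(2)[OF v] by (rule van)
  qed
  then show "p \<in> zero_set (null_ideal f)" using p(1) by (simp add: zero_set_def)
qed

text \<open>At a point with Y_0 = 0 the monomials containing Y_0 vanish, and all other coefficients
  are 0 by \<open>null_form_coeff_zero\<close>.\<close>

lemma null_form_vanish:
  fixes f :: "('k::field, 'n::finite) mfps"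
  assumes "tjurina_ideal f \<subseteq> max_ideal" "ideal_pow max_ideal N \<subseteq> tjurina_ideal f"
    and "f ^ l \<in> ideal_mult max_ideal (ideal_pow (tjurina_ideal f) l)" "l \<ge> 1"
    and nf: "null_form f s \<phi>" and v: "v None = 0"
  shows "poly_eval \<phi> v = 0"
proof -
  have hom: "homogeneous s \<phi>" using nf by (simp add: null_form_def)
  show ?thesis
    unfolding poly_eval_homogeneous[OF hom]
  proof (rule sum.neutral, rule ballI)
    fix a :: "'n option \<Rightarrow>\<^sub>0 nat" assume a: "a \<in> {a. deg a = s}"
    show "Poly_Mapping.lookup \<phi> a * mon v a = 0"
    proof (cases "Poly_Mapping.lookup a None = 0")
      case True
      then obtain b where "a = lift_exp b" by (rule ex_lift_exp)
      then show ?thesis using null_form_coeff_zero[OF assms(1-5), of b] a by (simp add: deg_lift_exp)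
    next
      case False
      then obtain b where "a = b + Poly_Mapping.single None 1" using exponent_split[of a None] by auto
      then show ?thesis using v by (simp add: mon_add)
    qed
  qed
qed

text \<open>Null-forms vanish at the point \<open>y\<close> of constant terms of the generators,
  which satisfies Y_0 = 0 because f(0) = 0. For n = 1 every solution of Y_0 = 0 is a multiple of
  \<open>y\<close>.\<close>

lemma null_form_vanish_smooth:
  fixes f :: "('k::field, 'n::finite) mfps"
  assumes f: "f \<in> max_ideal" and n: "CARD('n) = 1" and T: "tjurina_ideal f = UNIV"
    and nz: "mfps_nth (mfps_deriv i f) 0 \<noteq> 0"
    and nf: "null_form f s \<phi>" and v: "v None = 0"
  shows "poly_eval \<phi> v = 0"
proof -
  have hom: "homogeneous s \<phi>" using nf by (simp add: null_form_def)
  define y where "y j = mfps_nth (tjurina_gens f j) 0" for j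
  have mon0: "mfps_nth (mon (tjurina_gens f) a) 0 = mon y a" for a
  proof -
    have pw: "mfps_nth (h ^ k) 0 = mfps_nth h 0 ^ k" for h :: "('k, 'n) mfps" and k
      by (induction k) (simp_all add: mfps_nth_one mfps_nth_mult_0)
    have pr: "mfps_nth (prod h A) 0 = (\<Prod>j\<in>A. mfps_nth (h j) 0)" for h :: "'n option \<Rightarrow> ('k, 'n) mfps" and A
      by (induction A rule: infinite_finite_induct) (simp_all add: mfps_nth_one mfps_nth_mult_0)
    show ?thesis by (simp add: mon_def y_def pw pr)
  qed
  have "(\<Sum>a | deg a = s. mfps_const (Poly_Mapping.lookup \<phi> a) * mon (tjurina_gens f) a) \<in> max_ideal"
    using null_form_value[OF nf] ideal_mult_subset_l[OF is_ideal_max_ideal] by blast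
  then have "poly_eval \<phi> y = 0"
    unfolding poly_eval_homogeneous[OF hom] by (simp add: max_ideal_def mfps_nth_sum mfps_const_eq_monom mon0)
  have "v = (\<lambda>j. (v (Some i) / y (Some i)) * y j)"
  proof
    fix j
    have U: "(UNIV :: 'n set) = {i}" using n by (metis UNIV_I card_1_singletonE singletonD)
    show "v j = (v (Some i) / y (Some i)) * y j"
    proof (cases j)
      case None
      then show ?thesis using v f by (simp add: y_def tjurina_gens_def max_ideal_def)
    next
      case (Some i')
      then have "i' = i" using U by blast
      then show ?thesis using Some nz by (simp add: y_def tjurina_gens_def)
    qed
  qed
  then have "poly_eval \<phi> v = (v (Some i) / y (Some i)) ^ s * poly_eval \<phi> y"
    using poly_eval_homogeneous_scale[OF hom] by metis
  then show ?thesis using \<open>poly_eval \<phi> y = 0\<close> by simp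
qed

section \<open>The smooth case and the equivalence with the Milnor numbers\<close>

lemma not_in_square:
  fixes f :: "('k::field, 'n::finite) mfps"
  assumes "f \<in> max_ideal" "f \<notin> ideal_pow max_ideal 2"
  obtains i where "mfps_nth (mfps_deriv i f) 0 \<noteq> 0"
proof -
  from assms(2) obtain a where a: "deg a < 2" "mfps_nth f a \<noteq> 0"
    unfolding max_ideal_pow by (auto simp: order_ideal_def)
  have "a \<noteq> 0" using a(2) assms(1) by (auto simp: max_ideal_def)
  then have "deg a \<noteq> 0" by simp
  then have "deg a = Suc 0" using a(1) by linarith
  then obtain b i where "a = b + Poly_Mapping.single i 1" "deg b = 0" by (metis deg_SucE)
  then have "mfps_nth (mfps_deriv i f) 0 = mfps_nth f a" by (simp add: deriv_nth_0)
  then have "mfps_nth (mfps_deriv i f) 0 \<noteq> 0" using a(2) by simp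
  then show thesis by (rule that)
qed

lemma tjurina_subset_max:
  fixes f :: "('k::field, 'n::finite) mfps"
  assumes "f \<in> ideal_pow max_ideal 2"
  shows "tjurina_ideal f \<subseteq> max_ideal"
proof -
  have f: "mfps_nth f a = 0" if "deg a < 2" for a
    using assms that unfolding max_ideal_pow by (simp add: order_ideal_def)
  have "tjurina_gens f j \<in> max_ideal" for j
    using f[of 0] f[of "Poly_Mapping.single _ 1"]
    by (cases j) (simp_all add: tjurina_gens_def max_ideal_def deriv_nth_0)
  then show ?thesis unfolding tjurina_ideal_gen by (intro ideal_gen_least) auto
qed

lemma milnor_number_eq:
  "milnor_number h = (if fincod (jacobian_ideal h) then enat (cod (jacobian_ideal h)) else \<infinity>)"
  for h :: "('a::field, 'n) mfps"
  unfolding milnor_number_def by (rule quot_dim_eq) (simp add: jacobian_ideal_def)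

text \<open>As f(0) = 0, the gradient of u f at the origin is u(0) times that of f; so a partial
  derivative is a unit for every \<open>u\<close>, and both invariants are 0.\<close>

lemma smooth_case:
  fixes f :: "('k::alg_closed_field, 'n::finite) mfps"
  assumes f: "f \<in> max_ideal" "f \<notin> ideal_pow max_ideal 2"
  shows "u dvd 1 \<Longrightarrow> ereal_of_enat (milnor_number (u * f)) = ereal (milnor_tilde f)"
    and "tjurina_ideal f = UNIV"
proof -
  obtain i where i: "mfps_nth (mfps_deriv i f) 0 \<noteq> 0" using not_in_square[OF f] .
  then show "tjurina_ideal f = UNIV"
    by (intro ideal_eq_UNIV[OF is_ideal_tjurina deriv_in_tjurina]) (simp add: mfps_unit_iff)
  assume u: "u dvd 1"
  have "mfps_nth (mfps_deriv i (u * f)) 0 \<noteq> 0"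
    using u i f by (simp add: mfps_deriv_mult mfps_nth_mult_0 mfps_unit_iff max_ideal_def)
  moreover have "mfps_deriv i (u * f) \<in> jacobian_ideal (u * f)"
    unfolding jacobian_ideal_def by (rule ideal_gen_base) simp
  ultimately have "jacobian_ideal (u * f) = UNIV"
    by (intro ideal_eq_UNIV[of _ "mfps_deriv i (u * f)"]) (simp_all add: mfps_unit_iff jacobian_ideal_def)
  then show "ereal_of_enat (milnor_number (u * f)) = ereal (milnor_tilde f)"
    using f by (simp add: milnor_number_eq milnor_tilde_def)
qed

text \<open>The hypothesis on \<open>f ^ l\<close> does not involve \<open>u\<close>, so
  \<open>reduction_from_power\<close> applies to all Jacobian ideals J(uf) at once.\<close>

lemma milnor_if_fiber_nilpotent:
  fixes f :: "('k::alg_closed_field, 'n::finite) mfps"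
  defines "T \<equiv> tjurina_ideal f"
  assumes f2: "f \<in> ideal_pow max_ideal 2" and prim: "ideal_pow max_ideal N \<subseteq> T"
    and f: "f ^ l \<in> ideal_mult max_ideal (ideal_pow T l)" "l \<ge> 1" and u: "u dvd 1"
  shows "ereal_of_enat (milnor_number (u * f)) = ereal (milnor_tilde f)"
proof -
  let ?g = "\<lambda>i. mfps_deriv i (u * f)" and ?J = "jacobian_ideal (u * f)"
  obtain k where k: "l = Suc k" using f(2) by (cases l) auto
  have J: "?J = ideal_gen (range ?g)" by (simp add: jacobian_ideal_def)
  have TJ: "T = ideal_plus (ideal_gen {f}) (ideal_gen (range ?g))"
    unfolding T_def J[symmetric] by (rule tjurina_ideal_unit[OF u])
  have "f ^ Suc k \<in> ideal_plus (ideal_mult (ideal_gen (range ?g)) (ideal_pow T k)) (ideal_mult max_ideal (ideal_pow T (Suc k)))"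
    using f(1) unfolding k by (intro ideal_plus_r is_ideal_mult)
  note red = reduction_from_power[OF TJ this]
  have shift: "ideal_pow T (s + k) \<subseteq> ideal_pow (ideal_gen (range ?g)) s" for s
    by (rule reduction_shift[OF red is_ideal_gen])
  have JT: "ideal_gen (range ?g) \<subseteq> T" using jacobian_subset_tjurina[OF u, of f] unfolding T_def J .
  obtain N' where N': "ideal_pow max_ideal N' \<subseteq> ?J"
    using hs_seq_reduction(1)[OF prim JT shift] unfolding J by blast
  have "hs_multiplicity T = real (cod ?J)"
    using hs_multiplicity_limit[OF prim hs_seq_reduction(2)[OF prim JT shift]] by (simp add: J)
  then show ?thesis
    using f2 primary_fincod[OF N'] by (simp add: milnor_number_eq milnor_tilde_def T_def)
qed

text \<open>Two units are compared. A generic \<open>c\<close> ensures that the limit defining the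
  multiplicity exists and equals a codimension. The unit \<open>c'\<close> belonging to a common
  zero of the null-forms would by hypothesis have the same codimension, and the resulting integral
  equation contradicts \<open>point_not_reduction\<close>.\<close>

lemma fiber_nilpotent_if_milnor:
  fixes f :: "('k::alg_closed_field, 'n::finite) mfps"
  defines "T \<equiv> tjurina_ideal f"
  assumes f2: "f \<in> ideal_pow max_ideal 2" and prim: "ideal_pow max_ideal N \<subseteq> T"
    and mil: "\<And>u. u dvd 1 \<Longrightarrow> ereal_of_enat (milnor_number (u * f)) = ereal (milnor_tilde f)"
  shows "\<exists>l\<ge>1. f ^ l \<in> ideal_mult max_ideal (ideal_pow T l)"
proof (rule ccontr)
  assume "\<not> ?thesis"
  then have ne: "f ^ l \<notin> ideal_mult max_ideal (ideal_pow T l)" if "l \<ge> 1" for l using that by blast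
  have Tm: "T \<subseteq> max_ideal" unfolding T_def by (rule tjurina_subset_max[OF f2])
  have tilde: "milnor_tilde f = hs_multiplicity T" using f2 by (simp add: milnor_tilde_def T_def)
  define g where "g c i = mfps_deriv i (linear_unit c * f)" for c i
  have J: "jacobian_ideal (linear_unit c * f) = ideal_gen (range (g c))" for c
    by (simp add: jacobian_ideal_def g_def)
  have TJ: "T = ideal_plus (ideal_gen {f}) (ideal_gen (range (g c)))" for c
    unfolding T_def J[symmetric] by (rule tjurina_ideal_unit[OF linear_unit_dvd])
  have JT: "ideal_gen (range (g c)) \<subseteq> T" for c
    unfolding T_def J[symmetric] by (rule jacobian_subset_tjurina[OF linear_unit_dvd])
  obtain c l where cl: "f ^ Suc l \<in> ideal_plus (ideal_mult (jacobian_ideal (linear_unit c * f)) (ideal_pow T l))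
      (ideal_mult max_ideal (ideal_pow T (Suc l)))"
    by (rule generic_reduction[OF Tm[unfolded T_def] prim[unfolded T_def], folded T_def])
  have shift: "ideal_pow T (s + l) \<subseteq> ideal_pow (ideal_gen (range (g c))) s" for s
    by (rule reduction_shift[OF reduction_from_power[OF TJ cl[unfolded J]] is_ideal_gen])
  have lim: "hs_seq T \<longlonglongrightarrow> real (cod (ideal_gen (range (g c))))"
    by (rule hs_seq_reduction(2)[OF prim JT shift])
  obtain M p where M: "is_ideal M" "1 \<notin> M" "affine_null_ideal f \<subseteq> M" "p None = 1"
    "\<And>j. pvar j - Poly_Mapping.single 0 (p j) \<in> M" "\<And>\<phi>. \<phi> \<in> M \<Longrightarrow> poly_eval \<phi> p = 0"
    by (rule affine_null_point[OF ne[unfolded T_def]], assumption, rule that)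
  define c' where "c' i = - p (Some i)" for i
  have "ereal_of_enat (milnor_number (linear_unit c' * f)) = ereal (real (cod (ideal_gen (range (g c)))))"
    using mil[OF linear_unit_dvd] hs_multiplicity_limit[OF prim lim] tilde by simp
  \<comment> \<open>The hypothesis also yields finiteness: an infinite Milnor number could not equal
    a real number.\<close>
  then have fin: "fincod (ideal_gen (range (g c')))" and cod: "cod (ideal_gen (range (g c'))) = cod (ideal_gen (range (g c)))"
    by (auto simp: milnor_number_eq J split: if_splits)
  obtain N' where N': "ideal_pow max_ideal N' \<subseteq> ideal_gen (range (g c'))"
    using fincod_primary[OF is_ideal_gen fin] by blast
  obtain L where "f ^ Suc L \<in> ideal_mult (ideal_gen (range (g c'))) (ideal_pow T L)"
    using equal_multiplicity_integral[OF TJ N'] lim by (auto simp: cod)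
  then have "f ^ Suc L \<in> ideal_plus (ideal_mult (jacobian_ideal (linear_unit c' * f)) (ideal_pow T L))
      (ideal_mult max_ideal (ideal_pow T (Suc L)))"
    unfolding J by (intro ideal_plus_l is_ideal_mult)
  then show False
    using point_not_reduction[OF M(1-5)] unfolding T_def c'_def by blast
qed

text \<open>\<open>ereal\<close> is the common home of the possibly infinite Milnor number and the
  real multiplicity. The last clause is conditional because for f outside m^2 statement (iii) holds,
  while the null-forms cut out the single point (0 : gradient of f at the origin); this is all of
  Z(Y_0) only for n = 1.\<close>

theorem theorem3p6:
  fixes f :: "('k::alg_closed_field, 'n::finite) mfps"
  assumes "f \<in> max_ideal"
    and "tjurina_number f < \<infinity>"
  shows "let i = (\<forall>u. u dvd 1 \<longrightarrow> ereal_of_enat (milnor_number (u * f)) = ereal (milnor_tilde f));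
             ii = (zero_set (null_ideal f) = zero_set {Y0});
             iii = (\<exists>l\<ge>1. f ^ l \<in> ideal_mult max_ideal (ideal_pow (tjurina_ideal f) l))
         in (i \<longleftrightarrow> iii) \<and> (ii \<longrightarrow> iii) \<and>
            (f \<in> ideal_pow max_ideal 2 \<or> CARD('n) = 1 \<longrightarrow> (iii \<longrightarrow> ii))"
proof -
  let ?T = "tjurina_ideal f"
  let ?i = "\<forall>u. u dvd 1 \<longrightarrow> ereal_of_enat (milnor_number (u * f)) = ereal (milnor_tilde f)"
  let ?iii = "\<exists>l\<ge>1. f ^ l \<in> ideal_mult max_ideal (ideal_pow ?T l)"
  have "fincod ?T"
    using assms(2) quot_dim_eq[OF is_ideal_tjurina, of f] by (simp add: tjurina_number_def split: if_splits)
  then obtain N where N: "ideal_pow max_ideal N \<subseteq> ?T" using fincod_primary[OF is_ideal_tjurina] by blast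
  have "?i \<longleftrightarrow> ?iii"
  proof (cases "f \<in> ideal_pow max_ideal 2")
    case True
    then show ?thesis
      using milnor_if_fiber_nilpotent[OF True N] fiber_nilpotent_if_milnor[OF True N] by blast
  next
    case False
    have "f ^ 1 \<in> ideal_mult max_ideal (ideal_pow ?T 1)"
      using assms(1) smooth_case(2)[OF assms(1) False] by (simp add: ideal_pow_UNIV)
    then show ?thesis using smooth_case(1)[OF assms(1) False] by blast
  qed
  moreover have "?iii" if "zero_set (null_ideal f) = zero_set {Y0}"
    using fiber_nilpotent_if_zero_set[of f] that by simp
  moreover have "zero_set (null_ideal f) = zero_set {Y0}"
    if c: "f \<in> ideal_pow max_ideal 2 \<or> CARD('n) = 1" and "?iii"
  proof -
    from \<open>?iii\<close> obtain l where l: "l \<ge> 1" "f ^ l \<in> ideal_mult max_ideal (ideal_pow ?T l)" by blast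
    have "poly_eval \<phi> v = 0" if "null_form f s \<phi>" "v None = 0" for s \<phi> v
    proof (cases "f \<in> ideal_pow max_ideal 2")
      case True
      show ?thesis by (rule null_form_vanish[where v = v, OF tjurina_subset_max[OF True] N l(2,1) that])
    next
      case False
      then obtain i where "mfps_nth (mfps_deriv i f) 0 \<noteq> 0" using not_in_square[OF assms(1)] by blast
      moreover have "CARD('n) = 1" using c False by blast
      ultimately show ?thesis
        using null_form_vanish_smooth[where v = v, OF assms(1) _ smooth_case(2)[OF assms(1) False] _ that] by blast
    qed
    then have "zero_set {Y0} \<subseteq> zero_set (null_ideal f)" by (rule Y0_subset_zero_set)
    then show ?thesis using zero_set_subset_Y0[OF l(2)] by (rule equalityI[rotated])
  qed
  ultimately show ?thesis unfolding Let_def by blast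
qed

end
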